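(* Let $(\Omega,\mathcal B,\mathbb P)$ be a probability space, $\mathbf T:\Omega\to\Omega$ an ergodic transformation, and $\mathbf F:\Omega\to\mathrm{Sym}_W(\mathbb R)$ a measurable function with $\mathbb E\log_+\|\mathbf F\|<\infty$. Let $\Phi_{n,\omega}(z)$ be the associated matrix Schrödinger cocycle with Lyapunov exponents $\gamma_j(z)$ (see context). Fix a Lagrangian subspace $F\subset\mathbb R^{2W}$ and let $\pi_F:\mathbb R^{2W}\to F$ be the orthogonal projection. Then almost* surely $$\limsup_{n\to\infty}\frac1n\log s_W(\Phi_{n,\omega}(z)\pi_F^* )\ge\gamma_W(z)$$ for all $z\in\mathbb C$ outside a set of zero logarithmic capacity.
   Context: Setting. $W\ge1$ is an integer and $\mathrm{Sym}_W(\mathbb R)$ is the space of real symmetric $W\times W$ matrices. Put $V_{n,\omega}=\mathbf F(\mathbf T^n\omega)$, $n\ge0$, and for $z\in\mathbb C$ let $$T_{n,\omega}(z)=\begin{pmatrix} z\mathbf 1-V_{n,\omega} & -\mathbf 1\\ \mathbf 1&0\end{pmatrix},\qquad \Phi_{n,\omega}(z)=T_{n,\omega}(z)T_{n-1,\omega}(z)\cdots T_{1,\omega}(z)$$ ($2W\times 2W$ matrices). $s_j(\cdot)$ denotes the $j$-th largest singular value. The Lyapunov exponents are $\gamma_j(z)=\lim_{n\to\infty}\frac1n\mathbb E\log s_j(\Phi_{n,\omega}(z))$, $1\le j\le 2W$ (these are finite). Lagrangian subspaces. A subspace $F\subset\mathbb R^{2W}$ of dimension $W$ is Lagrangian if $F=(JF)^\perp$,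 where $J=\begin{pmatrix}0&-\mathbf 1\\ \mathbf 1&0\end{pmatrix}$. The adjoint $\pi_F^*:F\to\mathbb R^{2W}$ is the inclusion (complexified when $z$ is not real), so $\Phi_{n,\omega}(z)\pi_F^*$ is the restriction of $\Phi_{n,\omega}(z)$ to $F$, an operator with $W$ singular values, of which $s_W$ is the smallest. Terminology. A property holds "almost* surely" if it holds for $\mathbb P$-almost every $\omega$ under the general assumptions ($\mathbf T$ ergodic, $\mathbf F$ measurable, $\mathbb E\log_+\|\mathbf F\|<\infty$) and, moreover, for all $\omega\in\Omega$ in the uniquely ergodic case, i.e. when $\Omega$ is a compact metrisable topological space, $\mathbf T$ is continuous and uniquely ergodic, and $\mathbf F:\Omega\to\mathrm{Sym}_W(\mathbb R)$ is continuous. *)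

theory Defs
  imports "HOL-Probability.Probability"
begin

section \<open>Singular values\<close>

definition cinner :: "complex ^ 'n \<Rightarrow> complex ^ 'n \<Rightarrow> complex" where
  "cinner x y = (\<Sum>i\<in>UNIV. x $ i * cnj (y $ i))"

definition conj_transpose :: "complex ^ 'n ^ 'm \<Rightarrow> complex ^ 'm ^ 'n" where
  "conj_transpose A = (\<chi> i j. cnj (A $ j $ i))"

text \<open>
  Let \<open>B\<close> be the restriction of \<open>A\<close> to the complex subspace \<open>U\<close>, an operator from \<open>U\<close> to
  \<open>complex ^ 'm\<close>. By the defining property of the adjoint, the space below is the eigenspace
  of the operator \<open>B\<^sup>* B\<close> on \<open>U\<close> for the eigenvalue \<open>\<sigma>\<^sup>2\<close>.
\<close>

definition singular_space :: "(complex ^ 'n) set \<Rightarrow> complex ^ 'n ^ 'm \<Rightarrow> real \<Rightarrow> (complex ^ 'n) set" where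
  "singular_space U A \<sigma> =
     {v \<in> U. \<forall>w\<in>U. cinner (A *v v) (A *v w) = of_real (\<sigma>\<^sup>2) * cinner v w}"

definition singular_multiplicity :: "(complex ^ 'n) set \<Rightarrow> complex ^ 'n ^ 'm \<Rightarrow> real \<Rightarrow> nat" where
  "singular_multiplicity U A \<sigma> = vec.dim (singular_space U A \<sigma>)"

definition singular_values_on :: "(complex ^ 'n) set \<Rightarrow> complex ^ 'n ^ 'm \<Rightarrow> real multiset" where
  "singular_values_on U A =
     (\<Sum>\<sigma> | 0 \<le> \<sigma> \<and> singular_multiplicity U A \<sigma> > 0.
        replicate_mset (singular_multiplicity U A \<sigma>) \<sigma>)"

text \<open>The index \<open>j\<close> counts from \<open>1\<close>, as in \<open>s\<^sub>1 \<ge> s\<^sub>2 \<ge> \<dots>\<close>.\<close>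

definition sv_on :: "(complex ^ 'n) set \<Rightarrow> nat \<Rightarrow> complex ^ 'n ^ 'm \<Rightarrow> real" where
  "sv_on U j A = rev (sorted_list_of_multiset (singular_values_on U A)) ! (j - 1)"

abbreviation sv :: "nat \<Rightarrow> complex ^ 'n ^ 'm \<Rightarrow> real" where
  "sv \<equiv> sv_on UNIV"

lemma cinner_diff_left: "cinner (x - y) w = cinner x w - cinner y w"
  by (simp add: cinner_def algebra_simps sum_subtractf)

lemma cinner_scale_left: "cinner (c *s x) y = c * cinner x y"
  by (simp add: cinner_def sum_distrib_left mult.assoc)

lemma cinner_self: "cinner x x = of_real ((norm x)\<^sup>2)"
proof -
  have "(norm x)\<^sup>2 = (\<Sum>i\<in>UNIV. (cmod (x $ i))\<^sup>2)"
    by (simp add: norm_vec_def L2_set_def sum_nonneg)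
  then show ?thesis
    by (simp add: cinner_def complex_norm_square[symmetric] flip: of_real_power)
qed

lemma cinner_mult_right:
  fixes A :: "complex ^ 'n ^ 'm"
  shows "cinner v (A *v w) = cinner (conj_transpose A *v v) w"
proof -
  have "cinner v (A *v w) = (\<Sum>i\<in>UNIV. \<Sum>j\<in>UNIV. v $ i * cnj (A $ i $ j) * cnj (w $ j))"
    by (simp add: cinner_def matrix_vector_mult_def sum_distrib_left mult.assoc)
  also have "\<dots> = (\<Sum>j\<in>UNIV. \<Sum>i\<in>UNIV. v $ i * cnj (A $ i $ j) * cnj (w $ j))"
    by (rule sum.swap)
  also have "\<dots> = cinner (conj_transpose A *v v) w"
    by (simp add: cinner_def matrix_vector_mult_def conj_transpose_def sum_distrib_right
        sum_distrib_left mult_ac)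
  finally show ?thesis .
qed

lemma singular_space_UNIV:
  fixes A :: "complex ^ 'n ^ 'm"
  shows "singular_space UNIV A \<sigma> =
    {v. (conj_transpose A ** A) *v v = of_real (\<sigma>\<^sup>2) *s v}"
proof -
  have "(\<forall>w. cinner (A *v v) (A *v w) = of_real (\<sigma>\<^sup>2) * cinner v w) \<longleftrightarrow>
        (conj_transpose A ** A) *v v = of_real (\<sigma>\<^sup>2) *s v" (is "?L \<longleftrightarrow> ?R") for v
  proof -
    let ?d = "(conj_transpose A ** A) *v v - of_real (\<sigma>\<^sup>2) *s v"
    have *: "cinner ?d w = cinner (A *v v) (A *v w) - of_real (\<sigma>\<^sup>2) * cinner v w" for w
      by (simp add: cinner_diff_left cinner_scale_left cinner_mult_right
          matrix_vector_mul_assoc)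
    show ?thesis
    proof
      assume ?L
      then have "cinner ?d ?d = 0"
        by (simp only: *) simp
      then have "?d = 0"
        by (simp add: cinner_self)
      then show ?R
        by simp
    next
      assume ?R
      then have "cinner ?d w = 0" for w
        by (simp add: cinner_def)
      then show ?L
        unfolding * by simp
    qed
  qed
  then show ?thesis
    by (simp add: singular_space_def)
qed


section \<open>Lagrangian subspaces of \<open>\<real>\<^sup>2\<^sup>W\<close>, with \<open>W = CARD('w)\<close>\<close>

definition block_matrix ::
  "'b::zero ^ 'w ^ 'w \<Rightarrow> 'b ^ 'w ^ 'w \<Rightarrow> 'b ^ 'w ^ 'w \<Rightarrow> 'b ^ 'w ^ 'w \<Rightarrow> 'b ^ ('w::finite + 'w) ^ ('w + 'w)" where
  "block_matrix A B C D = (\<chi> i j. case i of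
       Inl a \<Rightarrow> (case j of Inl b \<Rightarrow> A $ a $ b | Inr b \<Rightarrow> B $ a $ b)
     | Inr a \<Rightarrow> (case j of Inl b \<Rightarrow> C $ a $ b | Inr b \<Rightarrow> D $ a $ b))"

definition symplectic_J :: "real ^ ('w::finite + 'w) ^ ('w + 'w)" where
  "symplectic_J = block_matrix 0 (- mat 1) (mat 1) 0"

definition lagrangian :: "(real ^ ('w::finite + 'w)) set \<Rightarrow> bool" where
  "lagrangian L \<longleftrightarrow> subspace L \<and> dim L = CARD('w) \<and>
     L = orthogonal_comp ((\<lambda>x. symplectic_J *v x) ` L)"

text \<open>The subspace \<open>L + \<i> L\<close>. Restricting a real matrix to it instead of to \<open>L\<close> does not change
  the singular values, so it can be used for real spectral parameters as well.\<close>

definition complexification :: "(real ^ 'n) set \<Rightarrow> (complex ^ 'n) set" where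
  "complexification L = {v. (\<chi> i. Re (v $ i)) \<in> L \<and> (\<chi> i. Im (v $ i)) \<in> L}"


section \<open>The cocycle and its Lyapunov exponents\<close>

definition transfer_matrix ::
  "('a \<Rightarrow> 'a) \<Rightarrow> ('a \<Rightarrow> real ^ 'w ^ 'w) \<Rightarrow> complex \<Rightarrow> nat \<Rightarrow> 'a \<Rightarrow> complex ^ ('w::finite + 'w) ^ ('w + 'w)" where
  "transfer_matrix T F z n \<omega> =
     block_matrix (mat z - (\<chi> i j. of_real (F ((T ^^ n) \<omega>) $ i $ j))) (- mat 1) (mat 1) 0"

primrec cocycle ::
  "('a \<Rightarrow> 'a) \<Rightarrow> ('a \<Rightarrow> real ^ 'w ^ 'w) \<Rightarrow> complex \<Rightarrow> nat \<Rightarrow> 'a \<Rightarrow> complex ^ ('w::finite + 'w) ^ ('w + 'w)" where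
  "cocycle T F z 0 \<omega> = mat 1"
| "cocycle T F z (Suc n) \<omega> = transfer_matrix T F z (Suc n) \<omega> ** cocycle T F z n \<omega>"

definition lyapunov_exponent ::
  "'a measure \<Rightarrow> ('a \<Rightarrow> 'a) \<Rightarrow> ('a \<Rightarrow> real ^ 'w ^ 'w) \<Rightarrow> nat \<Rightarrow> complex \<Rightarrow> real" where
  "lyapunov_exponent M T F j z =
     lim (\<lambda>n. (1 / real n) * (\<integral>\<omega>. ln (sv j (cocycle T F z n \<omega>)) \<partial>M))"


section \<open>Ergodicity and ``almost* surely''\<close>

definition measure_preserving_map :: "'a measure \<Rightarrow> ('a \<Rightarrow> 'a) \<Rightarrow> bool" where
  "measure_preserving_map M T \<longleftrightarrow> T \<in> measurable M M \<and> distr M M T = M"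

definition ergodic_map :: "'a measure \<Rightarrow> ('a \<Rightarrow> 'a) \<Rightarrow> bool" where
  "ergodic_map M T \<longleftrightarrow> measure_preserving_map M T \<and>
     (\<forall>A\<in>sets M. T -` A \<inter> space M = A \<longrightarrow> measure M A = 0 \<or> measure M A = 1)"

definition borel_of_topology :: "'a topology \<Rightarrow> 'a measure" where
  "borel_of_topology X = sigma (topspace X) {U. openin X U}"

definition uniquely_ergodic_map :: "'a topology \<Rightarrow> ('a \<Rightarrow> 'a) \<Rightarrow> bool" where
  "uniquely_ergodic_map X T \<longleftrightarrow>
     (\<exists>!\<mu>. prob_space \<mu> \<and> space \<mu> = topspace X \<and> sets \<mu> = sets (borel_of_topology X) \<and>
        measure_preserving_map \<mu> T)"

definition uniquely_ergodic_case ::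
  "'a measure \<Rightarrow> ('a \<Rightarrow> 'a) \<Rightarrow> ('a \<Rightarrow> 'b::topological_space) \<Rightarrow> bool" where
  "uniquely_ergodic_case M T F \<longleftrightarrow>
     (\<exists>X. topspace X = space M \<and> sets (borel_of_topology X) = sets M \<and>
        compact_space X \<and> metrizable_space X \<and>
        continuous_map X X T \<and> uniquely_ergodic_map X T \<and>
        continuous_map X euclidean F)"

definition almost_star_surely ::
  "'a measure \<Rightarrow> ('a \<Rightarrow> 'a) \<Rightarrow> ('a \<Rightarrow> 'b::topological_space) \<Rightarrow> ('a \<Rightarrow> bool) \<Rightarrow> bool" where
  "almost_star_surely M T F P \<longleftrightarrow>
     (AE \<omega> in M. P \<omega>) \<and> (uniquely_ergodic_case M T F \<longrightarrow> (\<forall>\<omega>\<in>space M. P \<omega>))"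

definition log_plus :: "real \<Rightarrow> real" where
  "log_plus x = ln (max 1 x)"


section \<open>Logarithmic capacity\<close>

text \<open>
  The energy \<open>\<integral>\<integral> log (1 / \<bar>x - y\<bar>) d\<mu>(x) d\<mu>(y)\<close>, with kernel \<open>\<infinity>\<close> on the diagonal, as the
  difference of the integrals of the positive and the negative part of the kernel. The
  conversions \<^const>\<open>e2ennreal\<close> and \<^const>\<open>ennreal\<close> send negative values to \<open>0\<close>, so they take the
  positive part; the second integrand vanishes on the diagonal because \<open>ln 0 = 0\<close>. The
  second integral is finite for the compactly supported measures used below.
\<close>

definition log_kernel :: "complex \<Rightarrow> complex \<Rightarrow> ereal" where
  "log_kernel x y = (if x = y then \<infinity> else ereal (ln (1 / dist x y)))"

definition log_energy :: "complex measure \<Rightarrow> ereal" where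
  "log_energy \<mu> =
     enn2ereal (\<integral>\<^sup>+x. \<integral>\<^sup>+y. e2ennreal (log_kernel x y) \<partial>\<mu> \<partial>\<mu>) -
     enn2ereal (\<integral>\<^sup>+x. \<integral>\<^sup>+y. ennreal (ln (dist x y)) \<partial>\<mu> \<partial>\<mu>)"

definition compactly_supported_probs :: "complex set \<Rightarrow> complex measure set" where
  "compactly_supported_probs E =
     {\<mu>. prob_space \<mu> \<and> sets \<mu> = sets borel \<and> (\<exists>K. compact K \<and> K \<subseteq> E \<and> emeasure \<mu> K = 1)}"

definition log_capacity :: "complex set \<Rightarrow> ennreal" where
  "log_capacity E = (SUP \<mu>\<in>compactly_supported_probs E.
     if log_energy \<mu> = \<infinity> then 0 else ennreal (exp (- real_of_ereal (log_energy \<mu>))))"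

end

theory Submission
  imports Defs "HOL-Computational_Algebra.Fundamental_Theorem_Algebra"
begin

text \<open>
  Let \<open>N\<^sub>k(A)\<close> be the sum of the absolute values of the \<open>k\<close>-minors of \<open>A\<close>. It is submultiplicative and
  comparable to \<open>s\<^sub>1 \<cdots> s\<^sub>k\<close>, so \<open>G\<^sub>k(z) = lim (1/n) E log N\<^sub>k(\<Phi>\<^sub>n(z))\<close> is \<open>\<gamma>\<^sub>1 + \<dots> + \<gamma>\<^sub>k\<close>, and
  \<open>limsup (1/n) log N\<^sub>k(\<Phi>\<^sub>n(z)) \<le> G\<^sub>k(z)\<close> holds almost* surely for all \<open>z\<close> at once: the ergodic theorem is
  only applied to countably many observables, obtained from rational \<open>z\<close> by perturbation. In the
  uniquely ergodic case its upper half holds at every point, because a weak limit of time averages is an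
  invariant measure.

  Let \<open>Q\<^sub>n(z)\<close> be the determinant of the upper half of \<open>\<Phi>\<^sub>n(z)\<close> restricted to \<open>F\<close>, a polynomial in \<open>z\<close>.
  Then \<open>s\<^sub>W(\<Phi>\<^sub>n \<pi>\<^sub>F\<^sup>*) \<ge> c \<bar>Q\<^sub>n\<bar> / N\<^sub>W\<^sub>-\<^sub>1(\<Phi>\<^sub>n)\<close>, so it suffices that \<open>limsup (1/n) log \<bar>Q\<^sub>n(z)\<bar> \<ge> G\<^sub>W(z)\<close>.
  For \<open>Im z > 0\<close> the Wronskian identity bounds \<open>\<bar>Q\<^sub>n(z)\<bar>\<close> from below by the Dirichlet determinant, the
  latter by \<open>N\<^sub>W(\<Phi>\<^sub>n(z))\<close>, and makes \<open>log \<bar>det\<bar>\<close> of the Dirichlet block almost superadditive; this gives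
  \<open>liminf (1/n) log \<bar>Q\<^sub>n(x + i \<epsilon>)\<bar> \<ge> max (G\<^sub>W(x + i \<epsilon>)) (G\<^sub>W(x))\<close>. If the bound failed on a set of real \<open>x\<close> of
  positive capacity, this set would carry a measure with small local logarithmic potential; integrating
  \<open>(1/n) log \<bar>Q\<^sub>n\<bar>\<close>, a potential of the zeros, against it and moving the points by \<open>i \<epsilon>\<close> changes
  the integral too little to be compatible with the last inequality.
\<close>

section \<open>The ergodic theorem\<close>

text \<open>Two demands shape the proof. In the uniquely ergodic case every point counts, so each
  observable must be a continuous function of finitely many values of the potential with an
  integrable majorant. Minors, being polynomials in the entries, allow this. Only upper bounds on
  time averages are derived; lower ones come from observables of opposite sign. Secondly, the bound
  is wanted at the real point x itself, and the return from \<open>x + i \<epsilon>\<close> does not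
  go through continuity of \<open>G\<^sub>W\<close>. Conjugation by the Cayley matrix turns the
  Wronskian into a difference of squared norms that does not decrease even for real z; the corner
  determinant of the conjugated product is a polynomial without zeros in the upper half-plane, so
  its modulus grows when the point moves up. Hence \<open>N\<^sub>W(\<Phi>\<^sub>n(x)) \<le> C
  N\<^sub>W(\<Phi>\<^sub>n(x + i \<epsilon>))\<close> with C independent of n, x, \<epsilon> and the
  potential. The other constants may depend on \<epsilon> and on the first potential, never on n,
  and vanish after division by n.\<close>

definition birkhoff_le :: "'a measure \<Rightarrow> ('a \<Rightarrow> 'a) \<Rightarrow> ('a \<Rightarrow> real) \<Rightarrow> 'a \<Rightarrow> bool" where
  "birkhoff_le M T f \<omega> \<longleftrightarrow>
     (\<forall>\<delta>>0. \<forall>\<^sub>F n in sequentially. (\<Sum>j<n. f ((T ^^ j) \<omega>)) \<le> real n * (integral\<^sup>L M f + \<delta>))"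

section \<open>Time averages almost everywhere, by a maximal function\<close>

lemma measure_preserving_integrable:
  assumes "measure_preserving_map M T" "integrable M (f :: 'a \<Rightarrow> real)"
  shows "integrable M (\<lambda>\<omega>. f (T \<omega>))" "integral\<^sup>L M (\<lambda>\<omega>. f (T \<omega>)) = integral\<^sup>L M f"
proof -
  have T: "T \<in> measurable M M" "distr M M T = M"
    using assms(1) by (auto simp: measure_preserving_map_def)
  have f: "f \<in> borel_measurable M"
    using assms(2) by simp
  show "integrable M (\<lambda>\<omega>. f (T \<omega>))"
    using integrable_distr_eq[OF T(1) f] assms(2) T(2) by simp
  show "integral\<^sup>L M (\<lambda>\<omega>. f (T \<omega>)) = integral\<^sup>L M f"
    using integral_distr[OF T(1) f] T(2) by simp
qed

text \<open>The maximum of 0 and the partial sums of \<open>g\<close> along the orbit up to length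
  \<open>N\<close>; the recursive form displays how it changes under \<open>T\<close>.\<close>

primrec max_sum :: "('a \<Rightarrow> 'a) \<Rightarrow> ('a \<Rightarrow> real) \<Rightarrow> nat \<Rightarrow> 'a \<Rightarrow> real" where
  "max_sum T g 0 \<omega> = 0"
| "max_sum T g (Suc N) \<omega> = max 0 (g \<omega> + max_sum T g N (T \<omega>))"

lemma max_sum_nonneg: "max_sum T g N \<omega> \<ge> 0"
  by (cases N) auto

lemma max_sum_Suc_ge: "max_sum T g N \<omega> \<le> max_sum T g (Suc N) \<omega>"
proof (induction N arbitrary: \<omega>)
  case (Suc N)
  from Suc[of "T \<omega>"] show ?case
    by auto
qed auto

lemma max_sum_mono: "N \<le> N' \<Longrightarrow> max_sum T g N \<omega> \<le> max_sum T g N' \<omega>"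
  by (rule lift_Suc_mono_le[where f = "\<lambda>N. max_sum T g N \<omega>"]) (rule max_sum_Suc_ge)

lemma sum_le_max_sum: "(\<Sum>j<k. g ((T ^^ j) \<omega>)) \<le> max_sum T g k \<omega>"
proof (induction k arbitrary: \<omega>)
  case (Suc k)
  have "(\<Sum>j<Suc k. g ((T ^^ j) \<omega>)) = g \<omega> + (\<Sum>j<k. g ((T ^^ j) (T \<omega>)))"
    by (subst sum.lessThan_Suc_shift) (simp add: funpow_swap1)
  then show ?case
    using Suc[of "T \<omega>"] by simp
qed auto

lemma integrable_max_sum:
  assumes "measure_preserving_map M T" "integrable M g"
  shows "integrable M (max_sum T g N)"
proof (induction N)
  case (Suc N)
  have "integrable M (\<lambda>\<omega>. max 0 (g \<omega> + max_sum T g N (T \<omega>)))"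
    using assms(2) measure_preserving_integrable(1)[OF assms(1) Suc] by auto
  then show ?case
    by simp
qed auto

text \<open>The increments of \<open>max_sum\<close> along \<open>T\<close> have nonnegative integral and converge to \<open>g\<close>
  wherever \<open>max_sum\<close> is unbounded; so the invariant set of unboundedness cannot have full
  measure.\<close>

lemma AE_max_sum_bounded:
  assumes "prob_space M" and erg: "ergodic_map M T" and g: "integrable M g" and neg: "integral\<^sup>L M g < 0"
  shows "AE \<omega> in M. \<exists>K. \<forall>N. max_sum T g N \<omega> \<le> K"
proof -
  interpret prob_space M by fact
  have mp: "measure_preserving_map M T"
    using erg by (simp add: ergodic_map_def)
  then have T[measurable]: "T \<in> measurable M M"
    by (simp add: measure_preserving_map_def)
  note int = integrable_max_sum[OF mp g]
  have [measurable]: "max_sum T g N \<in> borel_measurable M" for N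
    using int by simp
  define B where "B = {\<omega> \<in> space M. \<forall>K :: nat. \<exists>N. max_sum T g N \<omega> > real K}"
  have B: "B \<in> sets M"
    unfolding B_def by measurable
  have shift: "(\<forall>K :: nat. \<exists>N. max_sum T g N (T \<omega>) > real K) \<longleftrightarrow> (\<forall>K :: nat. \<exists>N. max_sum T g N \<omega> > real K)" for \<omega>
  proof (intro iffI allI)
    fix K :: nat
    assume a: "\<forall>K :: nat. \<exists>N. max_sum T g N (T \<omega>) > real K"
    obtain K' :: nat where "real K' > real K - g \<omega>"
      using reals_Archimedean2 by blast
    moreover obtain N where "max_sum T g N (T \<omega>) > real K'"
      using a by blast
    ultimately have "max_sum T g (Suc N) \<omega> > real K"
      by simp
    then show "\<exists>N. max_sum T g N \<omega> > real K" ..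
  next
    fix K :: nat
    assume a: "\<forall>K :: nat. \<exists>N. max_sum T g N \<omega> > real K"
    obtain K' :: nat where K': "real K' > real K + \<bar>g \<omega>\<bar>"
      using reals_Archimedean2 by blast
    obtain N where N: "max_sum T g N \<omega> > real K'"
      using a by blast
    then have "max_sum T g (Suc N) \<omega> > real K'"
      by (rule less_le_trans[OF _ max_sum_Suc_ge])
    then have "max_sum T g N (T \<omega>) > real K"
      using K' by (simp add: less_max_iff_disj)
    then show "\<exists>N. max_sum T g N (T \<omega>) > real K" ..
  qed
  have inv: "T -` B \<inter> space M = B"
    using shift measurable_space[OF T] by (auto simp: B_def)
  then have "prob B = 0 \<or> prob B = 1"
    using erg B by (auto simp: ergodic_map_def)
  moreover have "prob B \<noteq> 1"
  proof
    assume "prob B = 1"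
    then have AEB: "AE \<omega> in M. \<omega> \<in> B"
      using B prob_eq_1 by blast
    define h where "h N \<omega> = max_sum T g (Suc N) \<omega> - max_sum T g N (T \<omega>)" for N \<omega>
    have h: "h N \<omega> = max (- max_sum T g N (T \<omega>)) (g \<omega>)" for N \<omega>
      by (simp add: h_def max_def)
    have "(\<lambda>N. integral\<^sup>L M (h N)) \<longlonglongrightarrow> integral\<^sup>L M g"
    proof (rule integral_dominated_convergence[where w = "\<lambda>\<omega>. \<bar>g \<omega>\<bar>"])
      show "AE \<omega> in M. (\<lambda>N. h N \<omega>) \<longlonglongrightarrow> g \<omega>"
        using AEB
      proof eventually_elim
        fix \<omega> assume "\<omega> \<in> B"
        then have *: "\<forall>K :: nat. \<exists>N. max_sum T g N (T \<omega>) > real K"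
          unfolding shift by (simp add: B_def)
        obtain K :: nat where K: "real K > - g \<omega>"
          using reals_Archimedean2 by blast
        obtain N where N: "max_sum T g N (T \<omega>) > real K"
          using * by blast
        have "h n \<omega> = g \<omega>" if "n \<ge> N" for n
          using max_sum_mono[OF that, of T g "T \<omega>"] N K by (simp add: h)
        then have "\<forall>\<^sub>F n in sequentially. h n \<omega> = g \<omega>"
          by (auto simp: eventually_sequentially)
        then show "(\<lambda>N. h N \<omega>) \<longlonglongrightarrow> g \<omega>"
          by (rule tendsto_eventually)
      qed
      show "AE \<omega> in M. norm (h N \<omega>) \<le> \<bar>g \<omega>\<bar>" for N
        using max_sum_nonneg[of T g N] by (auto simp: h max_def)
      show "h N \<in> borel_measurable M" for N
        unfolding h_def by measurable
    qed (use g in auto)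
    moreover have "integral\<^sup>L M (h N) \<ge> 0" for N
    proof -
      have "integral\<^sup>L M (h N) = integral\<^sup>L M (max_sum T g (Suc N)) - integral\<^sup>L M (\<lambda>\<omega>. max_sum T g N (T \<omega>))"
        unfolding h_def by (rule Bochner_Integration.integral_diff[OF int measure_preserving_integrable(1)[OF mp int]])
      also have "integral\<^sup>L M (\<lambda>\<omega>. max_sum T g N (T \<omega>)) = integral\<^sup>L M (max_sum T g N)"
        by (rule measure_preserving_integrable(2)[OF mp int])
      moreover have "integral\<^sup>L M (max_sum T g N) \<le> integral\<^sup>L M (max_sum T g (Suc N))"
        by (intro integral_mono int) (rule max_sum_Suc_ge)
      ultimately show ?thesis
        by linarith
    qed
    ultimately have "integral\<^sup>L M g \<ge> 0"
      by (intro tendsto_lowerbound[of _ "integral\<^sup>L M g" sequentially]) auto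
    then show False
      using neg by simp
  qed
  ultimately have "AE \<omega> in M. \<omega> \<notin> B"
    using B prob_eq_0 by blast
  then show ?thesis
    using AE_space
  proof eventually_elim
    fix \<omega> assume "\<omega> \<notin> B" "\<omega> \<in> space M"
    then obtain K :: nat where "\<forall>N. \<not> max_sum T g N \<omega> > real K"
      by (auto simp: B_def)
    then show "\<exists>K. \<forall>N. max_sum T g N \<omega> \<le> K"
      by (auto simp: not_less)
  qed
qed

text \<open>Subtracting slightly more than the mean makes the integral negative, so the centred
  partial sums are bounded above almost everywhere and contribute at most \<open>o(n)\<close>. The
  excess runs through the countably many values \<open>1 / Suc i\<close>.\<close>

lemma AE_birkhoff_le:
  assumes M: "prob_space M" and erg: "ergodic_map M T" and f: "integrable M f"
  shows "AE \<omega> in M. birkhoff_le M T f \<omega>"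
proof -
  interpret prob_space M by fact
  have *: "AE \<omega> in M. \<exists>K. \<forall>N. max_sum T (\<lambda>\<omega>. f \<omega> - (integral\<^sup>L M f + 1 / real (Suc i))) N \<omega> \<le> K" for i
    by (rule AE_max_sum_bounded[OF M erg]) (use f in \<open>auto simp: prob_space\<close>)
  then have "AE \<omega> in M. \<forall>i. \<exists>K. \<forall>N. max_sum T (\<lambda>\<omega>. f \<omega> - (integral\<^sup>L M f + 1 / real (Suc i))) N \<omega> \<le> K"
    by (simp add: AE_all_countable)
  then show ?thesis
  proof eventually_elim
    fix \<omega> assume b: "\<forall>i. \<exists>K. \<forall>N. max_sum T (\<lambda>\<omega>. f \<omega> - (integral\<^sup>L M f + 1 / real (Suc i))) N \<omega> \<le> K"
    show "birkhoff_le M T f \<omega>"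
      unfolding birkhoff_le_def
    proof (intro allI impI)
      fix \<delta> :: real assume "\<delta> > 0"
      then obtain i where i: "1 / real (Suc i) < \<delta> / 2"
        using reals_Archimedean[of "\<delta> / 2"] by (auto simp: inverse_eq_divide)
      define c where "c = integral\<^sup>L M f + 1 / real (Suc i)"
      obtain K where K: "\<And>N. max_sum T (\<lambda>\<omega>. f \<omega> - c) N \<omega> \<le> K"
        using b unfolding c_def by blast
      obtain N :: nat where N: "real N > K / (\<delta> / 2)"
        using reals_Archimedean2 by blast
      have "(\<Sum>j<n. f ((T ^^ j) \<omega>)) \<le> real n * (integral\<^sup>L M f + \<delta>)" if "n \<ge> N" for n
      proof -
        have "(\<Sum>j<n. f ((T ^^ j) \<omega>)) - real n * c \<le> K"
          using sum_le_max_sum[of "\<lambda>\<omega>. f \<omega> - c" T \<omega> n] K[of n] by (simp add: sum_subtractf)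
        also have "K \<le> real N * (\<delta> / 2)"
          using N \<open>\<delta> > 0\<close> by (simp add: field_simps)
        also have "\<dots> \<le> real n * (\<delta> / 2)"
          using that \<open>\<delta> > 0\<close> by (intro mult_right_mono) auto
        finally have "(\<Sum>j<n. f ((T ^^ j) \<omega>)) \<le> real n * (c + \<delta> / 2)"
          by (simp add: algebra_simps)
        also have "\<dots> \<le> real n * (integral\<^sup>L M f + \<delta>)"
          using i by (intro mult_left_mono) (auto simp: c_def)
        finally show ?thesis .
      qed
      then show "\<forall>\<^sub>F n in sequentially. (\<Sum>j<n. f ((T ^^ j) \<omega>)) \<le> real n * (integral\<^sup>L M f + \<delta>)"
        by (auto simp: eventually_sequentially)
    qed
  qed
qed

subsection \<open>The measure of a positive functional\<close>

text \<open>A normalised positive linear functional on the continuous functions of a compact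
  metrizable space; \<open>\<Lambda> f\<close> only depends on the restriction of \<open>f\<close> to the space.\<close>

locale positive_functional =
  fixes X :: "'a topology" and \<Lambda> :: "('a \<Rightarrow> real) \<Rightarrow> real"
  assumes compact: "compact_space X" and metr: "metrizable_space X"
    and add: "\<And>f g. continuous_map X euclideanreal f \<Longrightarrow> continuous_map X euclideanreal g \<Longrightarrow>
      \<Lambda> (\<lambda>x. f x + g x) = \<Lambda> f + \<Lambda> g"
    and scale: "\<And>f c. continuous_map X euclideanreal f \<Longrightarrow> \<Lambda> (\<lambda>x. c * f x) = c * \<Lambda> f"
    and mono: "\<And>f g. continuous_map X euclideanreal f \<Longrightarrow> continuous_map X euclideanreal g \<Longrightarrow>
      (\<And>x. x \<in> topspace X \<Longrightarrow> f x \<le> g x) \<Longrightarrow> \<Lambda> f \<le> \<Lambda> g"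
    and one: "\<Lambda> (\<lambda>x. 1) = 1"
begin

definition subord :: "('a \<Rightarrow> real) \<Rightarrow> 'a set \<Rightarrow> bool" where
  "subord f U \<longleftrightarrow> continuous_map X euclideanreal f \<and> (\<forall>x\<in>topspace X. 0 \<le> f x \<and> f x \<le> 1) \<and>
    (\<forall>x\<in>topspace X. x \<notin> U \<longrightarrow> f x = 0)"

text \<open>The value that the Riesz measure is to take on open sets; \<open>outer\<close> extends
  it from above, and Caratheodory's theorem makes a measure of it.\<close>

definition ucontent :: "'a set \<Rightarrow> ennreal" where
  "ucontent U = (SUP f\<in>{f. subord f U}. ennreal (\<Lambda> f))"

definition outer :: "'a set \<Rightarrow> ennreal" where
  "outer E = (INF U\<in>{U. openin X U \<and> E \<subseteq> U}. ucontent U)"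

lemma const: "\<Lambda> (\<lambda>x. c) = c"
  using scale[of "\<lambda>x. 1" c] one by simp

lemma subord_le_ucontent: "subord f U \<Longrightarrow> ennreal (\<Lambda> f) \<le> ucontent U"
  unfolding ucontent_def by (intro SUP_upper) auto

lemma subord_mono: "subord f U \<Longrightarrow> U \<subseteq> V \<Longrightarrow> subord f V"
  unfolding subord_def by blast

lemma subord_nonneg: "subord f U \<Longrightarrow> 0 \<le> \<Lambda> f"
  using mono[of "\<lambda>x. 0" f] const[of 0] by (simp add: subord_def)

lemma subord_le_1: "subord f U \<Longrightarrow> \<Lambda> f \<le> 1"
  using mono[of f "\<lambda>x. 1"] one by (simp add: subord_def)

lemma ucontent_mono: "U \<subseteq> V \<Longrightarrow> ucontent U \<le> ucontent V"
  unfolding ucontent_def by (intro SUP_subset_mono) (auto intro: subord_mono)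

lemma ucontent_le_1: "ucontent U \<le> 1"
  unfolding ucontent_def by (intro SUP_least) (use subord_le_1 in \<open>simp add: ennreal_le_1\<close>)

lemma subord_zero: "subord (\<lambda>x. 0) U"
  by (simp add: subord_def)

lemma ucontent_empty: "ucontent {} = 0"
proof -
  have "\<Lambda> f \<le> 0" if "subord f {}" for f
    using mono[of f "\<lambda>x. 0"] const[of 0] that by (simp add: subord_def)
  then show ?thesis
    unfolding ucontent_def by (intro antisym SUP_least) (auto simp: ennreal_neg)
qed

lemma ucontent_space: "ucontent (topspace X) = 1"
proof (rule antisym[OF ucontent_le_1])
  have "subord (\<lambda>x. 1) (topspace X)"
    by (simp add: subord_def)
  from subord_le_ucontent[OF this] show "1 \<le> ucontent (topspace X)"
    by (simp add: one)
qed

lemma outer_open: "openin X U \<Longrightarrow> outer U = ucontent U"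
  unfolding outer_def by (intro antisym INF_lower INF_greatest) (auto intro: ucontent_mono)

lemma outer_mono: "E \<subseteq> F \<Longrightarrow> outer E \<le> outer F"
  unfolding outer_def by (intro INF_superset_mono) auto

text \<open>Lowering \<open>f\<close> by \<open>e > 0\<close> costs at most \<open>e\<close> under
  \<open>\<Lambda>\<close>, and the result vanishes off the closed set \<open>{f \<ge> e}\<close>,
  which is contained in \<open>U\<close> when \<open>f\<close> is subordinate to \<open>U\<close>.
  The approximation arguments below rest on this gap.\<close>

definition cutoff :: "real \<Rightarrow> ('a \<Rightarrow> real) \<Rightarrow> 'a \<Rightarrow> real" where
  "cutoff e f x = max 0 (f x - e)"

lemma cutoff_continuous: "continuous_map X euclideanreal f \<Longrightarrow> continuous_map X euclideanreal (cutoff e f)"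
  unfolding cutoff_def[abs_def] by (intro continuous_intros)

lemma subord_cutoff: "subord f U \<Longrightarrow> 0 \<le> e \<Longrightarrow> subord (cutoff e f) U"
  using cutoff_continuous[of f e] unfolding subord_def by (auto simp: cutoff_def)

lemma le_cutoff: "subord f U \<Longrightarrow> \<Lambda> f \<le> \<Lambda> (cutoff e f) + e"
proof -
  assume f: "subord f U"
  have "\<Lambda> f \<le> \<Lambda> (\<lambda>x. cutoff e f x + e)"
    using f by (intro mono continuous_map_add cutoff_continuous) (auto simp: subord_def cutoff_def)
  also have "\<dots> = \<Lambda> (cutoff e f) + e"
    using f add[of "cutoff e f" "\<lambda>x. e"] cutoff_continuous by (simp add: const subord_def)
  finally show ?thesis .
qed

lemma closedin_ge: "continuous_map X euclideanreal f \<Longrightarrow> closedin X {x \<in> topspace X. e \<le> f x}"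
  using closedin_continuous_map_preimage[of X euclideanreal f "{e..}"] by simp

lemma normal: "normal_space X"
  using compact metr by (simp add: compact_Hausdorff_or_regular_imp_normal_space metrizable_imp_Hausdorff_space)

text \<open>A Urysohn function \<open>h\<close>, equal to 1 on the part of
  \<open>{f \<ge> e}\<close> outside \<open>V\<close> and to 0 outside \<open>U\<close>, splits the
  cutoff of \<open>f\<close> into its products with \<open>h\<close> and \<open>1 - h\<close>, which
  are subordinate to \<open>U\<close> and to \<open>V\<close>.\<close>

lemma ucontent_Un_le:
  assumes U: "openin X U" and V: "openin X V"
  shows "ucontent (U \<union> V) \<le> ucontent U + ucontent V"
proof -
  have "ennreal (\<Lambda> f) \<le> ucontent U + ucontent V" if f: "subord f (U \<union> V)" for f
  proof (rule ennreal_le_epsilon)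
    fix e :: real assume e: "e > 0"
    define K where "K = {x \<in> topspace X. e \<le> f x}"
    have cf: "continuous_map X euclideanreal f"
      using f by (simp add: subord_def)
    have K: "closedin X (K - V)"
      unfolding K_def using V cf by (intro closedin_diff closedin_ge)
    moreover have "closedin X (topspace X - U)"
      using U by blast
    moreover have "disjnt (K - V) (topspace X - U)"
      using f e by (force simp: disjnt_def K_def subord_def)
    ultimately obtain h where h: "continuous_map X (top_of_set {0..1}) h" "h ` (topspace X - U) \<subseteq> {0::real}" "h ` (K - V) \<subseteq> {1}"
      using Urysohn_lemma[OF normal, of "topspace X - U" "K - V" 0 1] by (auto simp: disjnt_sym)
    have ch: "continuous_map X euclideanreal h" and h01: "\<And>x. x \<in> topspace X \<Longrightarrow> 0 \<le> h x \<and> h x \<le> 1"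
      using h(1) by (auto simp: continuous_map_in_subtopology)
    let ?c = "cutoff e f"
    have c: "continuous_map X euclideanreal ?c" "\<And>x. x \<in> topspace X \<Longrightarrow> 0 \<le> ?c x \<and> ?c x \<le> 1"
      using subord_cutoff[OF f, of e] e by (auto simp: subord_def)
    have 1: "subord (\<lambda>x. ?c x * h x) U"
      unfolding subord_def using c ch h01 h(2)
      by (auto intro!: continuous_map_real_mult mult_le_one)
    have z: "?c x * (1 - h x) = 0" if "x \<in> topspace X" "x \<notin> V" for x
      using that h(3) by (cases "e \<le> f x") (auto simp: cutoff_def K_def image_subset_iff)
    have c2: "continuous_map X euclideanreal (\<lambda>x. ?c x * (1 - h x))"
      by (intro continuous_map_real_mult continuous_map_diff c ch) auto
    have 2: "subord (\<lambda>x. ?c x * (1 - h x)) V"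
      unfolding subord_def using c c2 h01 z by (auto intro!: mult_le_one)
    have "\<Lambda> ?c = \<Lambda> (\<lambda>x. ?c x * h x + ?c x * (1 - h x))"
      by (rule arg_cong[where f = \<Lambda>]) (simp add: fun_eq_iff algebra_simps)
    also have "\<dots> = \<Lambda> (\<lambda>x. ?c x * h x) + \<Lambda> (\<lambda>x. ?c x * (1 - h x))"
      using 1 c2 by (intro add) (auto simp: subord_def)
    finally have "ennreal (\<Lambda> f) \<le> ennreal (\<Lambda> (\<lambda>x. ?c x * h x) + \<Lambda> (\<lambda>x. ?c x * (1 - h x)) + e)"
      using le_cutoff[OF f, of e] by (intro ennreal_leI) simp
    also have "\<dots> = ennreal (\<Lambda> (\<lambda>x. ?c x * h x)) + ennreal (\<Lambda> (\<lambda>x. ?c x * (1 - h x))) + ennreal e"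
      using subord_nonneg[OF 1] subord_nonneg[OF 2] e by (simp add: ennreal_plus)
    also have "\<dots> \<le> ucontent U + ucontent V + ennreal e"
      by (intro add_mono subord_le_ucontent 1 2 order_refl)
    finally show "ennreal (\<Lambda> f) \<le> ucontent U + ucontent V + ennreal e" .
  qed
  then show ?thesis
    unfolding ucontent_def[of "U \<union> V"] by (intro SUP_least) auto
qed

lemma ucontent_finite_UN_le:
  assumes "finite I" "\<And>i. i \<in> I \<Longrightarrow> openin X (U i)"
  shows "ucontent (\<Union>i\<in>I. U i) \<le> (\<Sum>i\<in>I. ucontent (U i))"
  using assms
proof (induction I rule: finite_induct)
  case (insert i I)
  have "ucontent (U i \<union> (\<Union>i\<in>I. U i)) \<le> ucontent (U i) + ucontent (\<Union>i\<in>I. U i)"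
    using insert by (intro ucontent_Un_le openin_Union) auto
  also have "\<dots> \<le> ucontent (U i) + (\<Sum>i\<in>I. ucontent (U i))"
    using insert by (intro add_mono) auto
  finally show ?case
    using insert by simp
qed (simp add: ucontent_empty)

text \<open>The closed set \<open>{f \<ge> e}\<close> is compact, hence covered by finitely many
  \<open>U i\<close>; finite subadditivity then applies to the cutoff.\<close>

lemma ucontent_UN_le:
  assumes U: "\<And>i :: nat. openin X (U i)"
  shows "ucontent (\<Union>i. U i) \<le> (\<Sum>i. ucontent (U i))"
proof -
  have "ennreal (\<Lambda> f) \<le> (\<Sum>i. ucontent (U i))" if f: "subord f (\<Union>i. U i)" for f
  proof (rule ennreal_le_epsilon)
    fix e :: real assume e: "e > 0"
    define K where "K = {x \<in> topspace X. e \<le> f x}"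
    have cf: "continuous_map X euclideanreal f"
      using f by (simp add: subord_def)
    have "compactin X K"
      unfolding K_def by (intro closedin_compact_space[OF compact] closedin_ge cf)
    moreover have "K \<subseteq> \<Union> (range U)"
      using f e by (force simp: K_def subord_def)
    ultimately obtain \<F> where F: "finite \<F>" "\<F> \<subseteq> range U" "K \<subseteq> \<Union> \<F>"
      using U unfolding compactin_def by (metis image_iff)
    then obtain I where I: "finite I" "\<F> = U ` I"
      by (meson finite_subset_image)
    have "subord (cutoff e f) (\<Union>i\<in>I. U i)"
      unfolding subord_def
    proof (intro conjI ballI impI)
      fix x assume "x \<in> topspace X" "x \<notin> (\<Union>i\<in>I. U i)"
      then have "\<not> e \<le> f x"
        using F(3) I(2) by (auto simp: K_def)
      then show "cutoff e f x = 0"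
        by (simp add: cutoff_def)
    qed (use subord_cutoff[OF f, of e] e in \<open>auto simp: subord_def\<close>)
    note c = this
    have "ennreal (\<Lambda> f) \<le> ennreal (\<Lambda> (cutoff e f) + e)"
      using le_cutoff[OF f, of e] by (intro ennreal_leI)
    also have "\<dots> = ennreal (\<Lambda> (cutoff e f)) + ennreal e"
      using subord_nonneg[OF c] e by (simp add: ennreal_plus)
    also have "\<dots> \<le> (\<Sum>i\<in>I. ucontent (U i)) + ennreal e"
      using subord_le_ucontent[OF c] ucontent_finite_UN_le[OF I(1) U] by (intro add_mono order_refl) (rule order_trans)
    also have "\<dots> \<le> (\<Sum>i. ucontent (U i)) + ennreal e"
      by (intro add_mono order_refl sum_le_suminf I(1)) auto
    finally show "ennreal (\<Lambda> f) \<le> (\<Sum>i. ucontent (U i)) + ennreal e" .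
  qed
  then show ?thesis
    unfolding ucontent_def[of "\<Union>i. U i"] by (intro SUP_least) auto
qed

lemma outer_approx:
  assumes "E \<subseteq> topspace X" "e > (0::real)"
  shows "\<exists>U. openin X U \<and> E \<subseteq> U \<and> ucontent U \<le> outer E + ennreal e"
proof -
  have "outer E \<le> ucontent (topspace X)"
    unfolding outer_def using assms(1) by (intro INF_lower) auto
  then have "outer E \<le> 1"
    by (rule order_trans[OF _ ucontent_le_1])
  then have "outer E < top"
    by (rule le_less_trans) simp
  then have "outer E < outer E + ennreal e"
    using assms(2) by (simp add: ennreal_add_left_cancel_less[of _ 0, simplified])
  then obtain U where "U \<in> {U. openin X U \<and> E \<subseteq> U}" "ucontent U < outer E + ennreal e"
    unfolding outer_def[of E] by (subst (asm) (1) INF_less_iff) blast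
  then show ?thesis
    by (auto intro: less_imp_le)
qed

lemma outer_measure_space: "outer_measure_space (Pow (topspace X)) outer"
  unfolding outer_measure_space_def
proof (intro conjI)
  show "positive (Pow (topspace X)) outer"
    by (simp add: positive_def outer_open ucontent_empty)
  show "increasing (Pow (topspace X)) outer"
    by (auto simp: increasing_def intro: outer_mono)
  show "countably_subadditive (Pow (topspace X)) outer"
    unfolding countably_subadditive_def
  proof (intro allI impI)
    fix A :: "nat \<Rightarrow> 'a set"
    assume A: "range A \<subseteq> Pow (topspace X)"
    show "outer (\<Union>i. A i) \<le> (\<Sum>i. outer (A i))"
    proof (rule ennreal_le_epsilon)
      fix e :: real assume e: "e > 0"
      have "\<exists>U. openin X U \<and> A i \<subseteq> U \<and> ucontent U \<le> outer (A i) + ennreal (e * (1 / 2) ^ Suc i)" for i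
        using A e by (intro outer_approx) auto
      then obtain U where U: "\<And>i. openin X (U i)" "\<And>i. A i \<subseteq> U i"
        "\<And>i. ucontent (U i) \<le> outer (A i) + ennreal (e * (1 / 2) ^ Suc i)"
        by metis
      have "outer (\<Union>i. A i) \<le> outer (\<Union>i. U i)"
        using U(2) by (intro outer_mono) blast
      also have "\<dots> = ucontent (\<Union>i. U i)"
        using U(1) by (intro outer_open openin_Union) auto
      also have "\<dots> \<le> (\<Sum>i. ucontent (U i))"
        by (rule ucontent_UN_le[OF U(1)])
      also have "\<dots> \<le> (\<Sum>i. outer (A i) + ennreal (e * (1 / 2) ^ Suc i))"
        by (intro suminf_le U(3)) auto
      also have "\<dots> = (\<Sum>i. outer (A i)) + (\<Sum>i. ennreal (e * (1 / 2) ^ Suc i))"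
        by (subst suminf_add) auto
      also have "(\<Sum>i. ennreal (e * (1 / 2) ^ Suc i)) = ennreal e"
      proof (rule suminf_ennreal_eq)
        show "(\<lambda>i. e * (1 / 2) ^ Suc i) sums e"
          using sums_mult[OF power_half_series, of e] by simp
      qed (use e in auto)
      finally show "outer (\<Union>i. A i) \<le> (\<Sum>i. outer (A i)) + ennreal e" .
    qed
  qed
qed

text \<open>Caratheodory's condition for the open set \<open>U\<close>, tested on an open set. If
  \<open>f\<close> is subordinate to \<open>V \<inter> U\<close>, then \<open>V\<close> minus
  \<open>{f \<ge> e}\<close> is open and contains \<open>V - U\<close>. A function subordinate to it
  vanishes wherever the cutoff of \<open>f\<close> does not, so the two can be added without
  exceeding 1.\<close>

lemma ucontent_split:
  assumes U: "openin X U" and V: "openin X V"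
  shows "outer (V \<inter> U) + outer (V - U) \<le> ucontent V"
proof -
  have VU: "openin X (V \<inter> U)"
    using U V by blast
  have *: "ennreal (\<Lambda> f) + outer (V - U) \<le> ucontent V" if f: "subord f (V \<inter> U)" for f
  proof (rule ennreal_le_epsilon)
    fix e :: real assume e: "e > 0"
    define K where "K = {x \<in> topspace X. e \<le> f x}"
    have cf: "continuous_map X euclideanreal f"
      using f by (simp add: subord_def)
    define W where "W = V - K"
    have W: "openin X W"
      unfolding W_def K_def by (intro openin_diff V closedin_ge cf)
    have "V - U \<subseteq> W"
      using f e openin_subset[OF V] by (force simp: W_def K_def subord_def)
    then have oW: "outer (V - U) \<le> ucontent W"
      using outer_mono outer_open[OF W] by metis
    have c: "subord (cutoff e f) (V \<inter> U)"
      using subord_cutoff[OF f] e by simp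
    have "ennreal (\<Lambda> (cutoff e f)) + ennreal (\<Lambda> g) \<le> ucontent V" if g: "subord g W" for g
    proof -
      have "subord (\<lambda>x. cutoff e f x + g x) V"
        unfolding subord_def
      proof (intro conjI ballI impI)
        show "continuous_map X euclideanreal (\<lambda>x. cutoff e f x + g x)"
          using g cutoff_continuous[OF cf] by (intro continuous_map_add) (auto simp: subord_def)
        fix x assume x: "x \<in> topspace X"
        show "0 \<le> cutoff e f x + g x"
          using g x by (simp add: subord_def cutoff_def)
        show "cutoff e f x + g x \<le> 1"
          using g c x by (cases "e \<le> f x") (auto simp: subord_def W_def K_def cutoff_def)
        show "cutoff e f x + g x = 0" if "x \<notin> V"
          using g c x that by (auto simp: subord_def W_def)
      qed
      from subord_le_ucontent[OF this] show ?thesis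
        using g add[of "cutoff e f" g] cutoff_continuous[OF cf] subord_nonneg[OF c] subord_nonneg[OF g]
        by (simp add: subord_def ennreal_plus)
    qed
    then have le: "ennreal (\<Lambda> (cutoff e f)) + ucontent W \<le> ucontent V"
      unfolding ucontent_def[of W]
      by (subst ennreal_SUP_add_right) (auto intro!: SUP_least subord_zero)
    have "ennreal (\<Lambda> f) \<le> ennreal (\<Lambda> (cutoff e f)) + ennreal e"
      using le_cutoff[OF f, of e] subord_nonneg[OF c] e by (simp add: ennreal_plus[symmetric] ennreal_leI del: ennreal_plus)
    then have "ennreal (\<Lambda> f) + outer (V - U) \<le> (ennreal (\<Lambda> (cutoff e f)) + ennreal e) + ucontent W"
      using oW by (intro add_mono)
    also have "\<dots> = (ennreal (\<Lambda> (cutoff e f)) + ucontent W) + ennreal e"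
      by (simp only: ac_simps)
    also have "\<dots> \<le> ucontent V + ennreal e"
      by (intro add_mono le order_refl)
    finally show "ennreal (\<Lambda> f) + outer (V - U) \<le> ucontent V + ennreal e" .
  qed
  show ?thesis
    unfolding outer_open[OF VU] ucontent_def[of "V \<inter> U"]
    by (subst ennreal_SUP_add_left[symmetric]) (auto intro!: SUP_least subord_zero *)
qed

definition riesz_measure :: "'a measure" where
  "riesz_measure = measure_of (topspace X) {U. openin X U} outer"

lemma openin_lambda_system:
  assumes U: "openin X U"
  shows "U \<in> lambda_system (topspace X) (Pow (topspace X)) outer"
proof -
  interpret sigma_algebra "topspace X" "Pow (topspace X)"
    by (rule sigma_algebra_Pow)
  have "outer (E \<inter> U) + outer (E - U) = outer E" if E: "E \<subseteq> topspace X" for E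
  proof (rule antisym)
    show "outer (E \<inter> U) + outer (E - U) \<le> outer E"
      unfolding outer_def[of E]
    proof (rule INF_greatest, safe)
      fix V assume V: "openin X V" "E \<subseteq> V"
      have "outer (E \<inter> U) + outer (E - U) \<le> outer (V \<inter> U) + outer (V - U)"
        using V by (intro add_mono outer_mono) auto
      also have "\<dots> \<le> ucontent V"
        by (rule ucontent_split[OF U V(1)])
      finally show "outer (E \<inter> U) + outer (E - U) \<le> ucontent V" .
    qed
    have "countably_subadditive (Pow (topspace X)) outer" "positive (Pow (topspace X)) outer"
      using outer_measure_space by (auto simp: outer_measure_space_def)
    then have "subadditive (Pow (topspace X)) outer"
      by (intro ring_of_sets.countably_subadditive_subadditive[OF ring_of_sets_axioms])
    moreover have "E \<inter> U \<in> Pow (topspace X)" "E - U \<in> Pow (topspace X)"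
      using E by auto
    ultimately have "outer ((E \<inter> U) \<union> (E - U)) \<le> outer (E \<inter> U) + outer (E - U)"
      by (intro subadditiveD) auto
    then show "outer E \<le> outer (E \<inter> U) + outer (E - U)"
      by (simp add: Int_Diff_Un)
  qed
  then show ?thesis
    using openin_subset[OF U] by (auto simp: lambda_system_eq)
qed

lemma
  shows space_riesz_measure: "space riesz_measure = topspace X"
    and sets_riesz_measure: "sets riesz_measure = sets (borel_of_topology X)"
    and emeasure_riesz_measure: "openin X U \<Longrightarrow> emeasure riesz_measure U = ucontent U"
    and prob_space_riesz_measure: "prob_space riesz_measure"
proof -
  have sub: "{U. openin X U} \<subseteq> Pow (topspace X)"
    using openin_subset by auto
  show sp: "space riesz_measure = topspace X"
    unfolding riesz_measure_def using sub by (rule space_measure_of)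
  show "sets riesz_measure = sets (borel_of_topology X)"
    unfolding riesz_measure_def borel_of_topology_def using sub by simp
  interpret sigma_algebra "topspace X" "Pow (topspace X)"
    by (rule sigma_algebra_Pow)
  have ms: "measure_space (topspace X) (lambda_system (topspace X) (Pow (topspace X)) outer) outer"
    by (rule caratheodory_lemma[OF outer_measure_space])
  then have "sigma_algebra (topspace X) (lambda_system (topspace X) (Pow (topspace X)) outer)"
    by (simp add: measure_space_def)
  then have ss: "sigma_sets (topspace X) {U. openin X U} \<subseteq> lambda_system (topspace X) (Pow (topspace X)) outer"
    by (rule sigma_algebra.sigma_sets_subset) (auto intro: openin_lambda_system)
  have sR: "sets riesz_measure = sigma_sets (topspace X) {U. openin X U}"
    unfolding riesz_measure_def using sub by (rule sets_measure_of)
  have ms': "measure_space (topspace X) (sigma_sets (topspace X) {U. openin X U}) outer"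
    by (rule measure_down[OF ms sigma_algebra_sigma_sets[OF sub] ss])
  then have em: "emeasure riesz_measure E = outer E" if "E \<in> sigma_sets (topspace X) {U. openin X U}" for E
    using that sub ms'
    by (intro emeasure_measure_of[OF riesz_measure_def]) (simp_all add: measure_space_def sR)
  show op: "emeasure riesz_measure U = ucontent U" if "openin X U" for U
    using that by (subst em) (auto simp: outer_open)
  show "prob_space riesz_measure"
    by (rule prob_spaceI) (simp add: sp op ucontent_space)
qed

lemma sets_riesz_measure_eq: "sets riesz_measure = sigma_sets (topspace X) {U. openin X U}"
  unfolding riesz_measure_def using openin_subset by (intro sets_measure_of) auto

lemma openin_sets_riesz: "openin X U \<Longrightarrow> U \<in> sets riesz_measure"
  unfolding sets_riesz_measure_eq by (intro sigma_sets.Basic) simp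

lemma borel_measurable_riesz:
  assumes "continuous_map X euclideanreal f"
  shows "f \<in> borel_measurable riesz_measure"
proof (rule borel_measurableI)
  fix S :: "real set" assume "open S"
  then have "openin X {x \<in> topspace X. f x \<in> S}"
    using assms by (simp add: continuous_map_def)
  moreover have "f -` S \<inter> space riesz_measure = {x \<in> topspace X. f x \<in> S}"
    by (auto simp: space_riesz_measure)
  ultimately show "f -` S \<inter> space riesz_measure \<in> sets riesz_measure"
    by (simp only: openin_sets_riesz)
qed

text \<open>Layer cake: \<open>N f\<close> is the sum of the truncations of \<open>N f - i\<close> to \<open>[0, 1]\<close>.\<close>

lemma sum_truncation:
  fixes y :: real
  assumes "0 \<le> y" "y \<le> real N"
  shows "(\<Sum>i<N. min 1 (max 0 (y - real i))) = y"
  using assms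
proof (induction N)
  case (Suc N)
  show ?case
  proof (cases "y \<le> real N")
    case True
    then show ?thesis
      using Suc by simp
  next
    case False
    have "(\<Sum>i<N. min 1 (max 0 (y - real i))) = (\<Sum>i<N. 1)"
      using False by (intro sum.cong) auto
    then show ?thesis
      using False Suc.prems by simp
  qed
qed auto

text \<open>With \<open>U i = {N f > i}\<close>, the truncation \<open>t i\<close> is subordinate to
  \<open>U i\<close> and dominates the indicator of \<open>U (Suc i)\<close>. Comparing the two sums
  costs a shift by one index, that is one summand of size at most 1, which becomes negligible after
  division by \<open>N\<close>.\<close>

lemma functional_le_integral:
  assumes f: "continuous_map X euclideanreal f" and f01: "\<And>x. x \<in> topspace X \<Longrightarrow> 0 \<le> f x \<and> f x \<le> 1"
  shows "\<Lambda> f \<le> integral\<^sup>L riesz_measure f"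
proof -
  interpret R: prob_space riesz_measure
    by (rule prob_space_riesz_measure)
  have "\<Lambda> f \<le> integral\<^sup>L riesz_measure f + 1 / real N" if N: "N > 0" for N :: nat
  proof -
    define t where "t i x = min 1 (max 0 (real N * f x - real i))" for i x
    have ct: "continuous_map X euclideanreal (t i)" for i
      unfolding t_def[abs_def] by (intro continuous_intros f)
    have t01: "0 \<le> t i x" "t i x \<le> 1" for i x
      by (auto simp: t_def)
    have int: "integrable riesz_measure (t i)" for i
      using t01 by (intro R.integrable_const_bound[of _ 1] borel_measurable_riesz ct) auto
    have intf: "integrable riesz_measure f"
      using f01 by (intro R.integrable_const_bound[of _ 1] borel_measurable_riesz f) (auto simp: space_riesz_measure)
    define U where "U i = {x \<in> topspace X. real N * f x > real i}" for i
    have U: "openin X (U i)" for i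
    proof -
      have "continuous_map X euclideanreal (\<lambda>x. real N * f x)"
        by (intro continuous_intros f)
      from openin_continuous_map_preimage[OF this, of "{real i<..}"] show ?thesis
        by (simp add: U_def)
    qed
    have Us: "U i \<in> sets riesz_measure" for i
      by (rule openin_sets_riesz[OF U])
    have le: "\<Lambda> (t i) \<le> R.prob (U i)" for i
    proof -
      have "subord (t i) (U i)"
        unfolding subord_def using ct t01 by (auto simp: t_def U_def)
      from subord_le_ucontent[OF this] have "ennreal (\<Lambda> (t i)) \<le> ennreal (R.prob (U i))"
        by (simp add: emeasure_riesz_measure[OF U, symmetric] R.emeasure_eq_measure)
      then show ?thesis
        by simp
    qed
    have ge: "R.prob (U (Suc i)) \<le> integral\<^sup>L riesz_measure (t i)" for i
    proof -
      have "R.prob (U (Suc i)) = integral\<^sup>L riesz_measure (indicator (U (Suc i)))"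
        using Us by simp
      also have "\<dots> \<le> integral\<^sup>L riesz_measure (t i)"
      proof (rule integral_mono[OF _ int])
        show "integrable riesz_measure (indicator (U (Suc i)) :: 'a \<Rightarrow> real)"
          using Us by (intro integrable_real_indicator) (simp_all add: R.emeasure_eq_measure)
        show "indicator (U (Suc i)) x \<le> t i x" for x
          using t01(1)[of i x] by (cases "x \<in> U (Suc i)") (auto simp: U_def t_def)
      qed
      finally show ?thesis .
    qed
    have sum_t: "(\<Sum>i<N. t i x) = real N * f x" if "x \<in> topspace X" for x
      unfolding t_def using f01[OF that] N by (intro sum_truncation) (auto simp: mult_le_cancel_left1)
    have csum: "continuous_map X euclideanreal (\<lambda>x. \<Sum>i<n. t i x)" for n
      by (intro continuous_map_sum ct) auto
    have L: "\<Lambda> (\<lambda>x. \<Sum>i<n. t i x) = (\<Sum>i<n. \<Lambda> (t i))" for n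
    proof (induction n)
      case (Suc n)
      then show ?case
        using add[OF csum[of n] ct[of n]] by simp
    qed (use const[of 0] in simp)
    have "real N * \<Lambda> f = \<Lambda> (\<lambda>x. real N * f x)"
      by (simp add: scale f)
    also have "\<dots> \<le> \<Lambda> (\<lambda>x. \<Sum>i<N. t i x)"
      by (intro mono csum continuous_intros f) (simp add: sum_t)
    also have "\<dots> \<le> (\<Sum>i<N. R.prob (U i))"
      unfolding L by (intro sum_mono le)
    also have "\<dots> \<le> (\<Sum>i<Suc N. R.prob (U i))"
      by simp
    also have "\<dots> = R.prob (U 0) + (\<Sum>i<N. R.prob (U (Suc i)))"
      by (rule sum.lessThan_Suc_shift)
    also have "\<dots> \<le> 1 + (\<Sum>i<N. integral\<^sup>L riesz_measure (t i))"
      by (intro add_mono sum_mono ge) simp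
    also have "(\<Sum>i<N. integral\<^sup>L riesz_measure (t i)) = integral\<^sup>L riesz_measure (\<lambda>x. \<Sum>i<N. t i x)"
      by (intro Bochner_Integration.integral_sum[symmetric] int)
    also have "\<dots> = integral\<^sup>L riesz_measure (\<lambda>x. real N * f x)"
      by (intro Bochner_Integration.integral_cong refl sum_t) (simp add: space_riesz_measure)
    also have "\<dots> = real N * integral\<^sup>L riesz_measure f"
      by simp
    finally show ?thesis
      using N by (simp add: field_simps)
  qed
  note le = this
  have "(\<lambda>n. integral\<^sup>L riesz_measure f + 1 / real (Suc n)) \<longlonglongrightarrow> integral\<^sup>L riesz_measure f + 0"
    by (intro tendsto_intros LIMSEQ_Suc[OF lim_1_over_n])
  then show ?thesis
    using le[of "Suc _"] by (intro LIMSEQ_le_const[where X = "\<lambda>n. integral\<^sup>L riesz_measure f + 1 / real (Suc n)"]) (simp_all del: of_nat_Suc)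
qed

text \<open>Composition with \<open>T\<close> turns a function subordinate to \<open>U\<close> into
  one subordinate to the preimage, so open sets do not lose measure under the image measure. Closed
  sets inherit both inequalities, one by complements and one by approximation from outside, and they
  form an intersection-stable generator.\<close>

lemma riesz_measure_preserving:
  assumes T: "continuous_map X X T"
    and inv: "\<And>f. continuous_map X euclideanreal f \<Longrightarrow> \<Lambda> (\<lambda>x. f (T x)) = \<Lambda> f"
  shows "measure_preserving_map riesz_measure T"
proof -
  let ?R = riesz_measure
  interpret R: prob_space ?R
    by (rule prob_space_riesz_measure)
  note sets_open = openin_sets_riesz
  have pre: "openin X (T -` U \<inter> topspace X)" if "openin X U" for U
    using openin_continuous_map_preimage[OF T that] by (simp add: vimage_def Int_def conj_commute)
  have Tsp: "T \<in> topspace X \<rightarrow> topspace X"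
    using T by (auto simp: continuous_map_def)
  have Tm[measurable]: "T \<in> measurable ?R ?R"
    using openin_subset Tsp sets_open[OF pre]
    by (intro measurable_sigma_sets[OF sets_riesz_measure_eq]) (auto simp: space_riesz_measure)
  interpret D: prob_space "distr ?R ?R T"
    by (rule R.prob_space_distr) simp
  have ge: "R.prob U \<le> D.prob U" if U: "openin X U" for U
  proof -
    have "emeasure ?R U \<le> emeasure ?R (T -` U \<inter> topspace X)"
      unfolding emeasure_riesz_measure[OF U] emeasure_riesz_measure[OF pre[OF U]] ucontent_def[of U]
    proof (rule SUP_least, safe)
      fix f assume f: "subord f U"
      then have cf: "continuous_map X euclideanreal f"
        by (simp add: subord_def)
      have "continuous_map X euclideanreal (\<lambda>x. f (T x))"
        using continuous_map_compose[OF T cf] by (simp add: o_def)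
      then have "subord (\<lambda>x. f (T x)) (T -` U \<inter> topspace X)"
        using f Tsp by (auto simp: subord_def)
      from subord_le_ucontent[OF this] show "ennreal (\<Lambda> f) \<le> ucontent (T -` U \<inter> topspace X)"
        by (simp add: inv[OF cf])
    qed
    then show ?thesis
      using sets_open[OF U] by (simp add: measure_distr space_riesz_measure R.emeasure_eq_measure)
  qed
  have closed_sets: "C \<in> sets ?R" if "closedin X C" for C
  proof -
    have "C = topspace X - (topspace X - C)"
      using closedin_subset[OF that] by blast
    moreover have "topspace X - C \<in> sets ?R"
      using that by (intro sets_open) (simp add: closedin_def)
    ultimately show ?thesis
      using sets.compl_sets[of "topspace X - C" ?R] by (simp add: space_riesz_measure)
  qed
  have "distr ?R ?R T = ?R"
  proof (rule measure_eqI_generator_eq[where E = "{C. closedin X C}" and \<Omega> = "topspace X" and A = "\<lambda>_. topspace X"])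
    show "Int_stable {C. closedin X C}"
      by (auto simp: Int_stable_def)
    show "{C. closedin X C} \<subseteq> Pow (topspace X)"
      using closedin_subset by auto
    have eqs: "sigma_sets (topspace X) {C. closedin X C} = sets ?R"
    proof
      show "sigma_sets (topspace X) {C. closedin X C} \<subseteq> sets ?R"
        using sets.sigma_sets_subset[of "{C. closedin X C}" ?R] closed_sets by (auto simp: space_riesz_measure)
      show "sets ?R \<subseteq> sigma_sets (topspace X) {C. closedin X C}"
        unfolding sets_riesz_measure_eq
      proof (rule sigma_sets_mono, safe)
        fix U assume U: "openin X U"
        then have "U = topspace X - (topspace X - U)" "topspace X - U \<in> {C. closedin X C}"
          using openin_subset[OF U] by auto
        then show "U \<in> sigma_sets (topspace X) {C. closedin X C}"
          by (metis sigma_sets.Basic sigma_sets.Compl)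
      qed
    qed
    then show "sets (distr ?R ?R T) = sigma_sets (topspace X) {C. closedin X C}"
      "sets ?R = sigma_sets (topspace X) {C. closedin X C}"
      by simp_all
    fix C assume "C \<in> {C. closedin X C}"
    then have C: "closedin X C"
      by simp
    have "D.prob C = R.prob C"
    proof (rule antisym)
      have "R.prob (topspace X - C) \<le> D.prob (topspace X - C)"
        using C by (intro ge) auto
      then show "D.prob C \<le> R.prob C"
        using R.prob_compl[OF closed_sets[OF C]] D.prob_compl[of C] closed_sets[OF C]
        by (simp add: space_riesz_measure)
      \<comment> \<open>In a metrizable space a closed set is a decreasing intersection of open
        sets, so the inequality for open sets passes to \<open>C\<close> by continuity from
        above.\<close>
      obtain G where G: "\<And>n :: nat. openin X (G n)" "\<And>n. G (Suc n) \<subseteq> G n" "(\<Inter>n. G n) = C"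
        using closed_imp_gdelta_in[OF metr C] unfolding gdelta_in_descending by blast
      have dec: "decseq G"
        using G(2) by (rule decseq_SucI)
      have "(\<lambda>n. R.prob (G n)) \<longlonglongrightarrow> R.prob (\<Inter>n. G n)"
        using G(1) dec by (intro R.finite_Lim_measure_decseq) (auto intro: sets_open)
      moreover have "(\<lambda>n. D.prob (G n)) \<longlonglongrightarrow> D.prob (\<Inter>n. G n)"
        using G(1) dec by (intro D.finite_Lim_measure_decseq) (auto intro: sets_open)
      ultimately show "R.prob C \<le> D.prob C"
        using ge[OF G(1)] unfolding G(3) by (intro LIMSEQ_le[of "\<lambda>n. R.prob (G n)" _ "\<lambda>n. D.prob (G n)"]) auto
    qed
    then show "emeasure (distr ?R ?R T) C = emeasure ?R C"
      by (simp add: D.emeasure_eq_measure R.emeasure_eq_measure)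
  qed (auto simp: D.emeasure_eq_measure)
  then show ?thesis
    by (simp add: measure_preserving_map_def)
qed

end

text \<open>Otherwise a cluster point of the time averages along the exceptional times is the functional of an
  invariant measure other than \<open>M\<close>.\<close>

lemma uniquely_ergodic_birkhoff_le:
  fixes M :: "'a measure"
  assumes M: "prob_space M" "measure_preserving_map M T"
    and X: "topspace X = space M" "sets (borel_of_topology X) = sets M" "compact_space X" "metrizable_space X"
      "continuous_map X X T" "uniquely_ergodic_map X T"
    and f0: "continuous_map X euclideanreal f0" and x0: "x0 \<in> space M"
  shows "birkhoff_le M T f0 x0"
proof (rule ccontr)
  interpret prob_space M by fact
  assume "\<not> birkhoff_le M T f0 x0"
  then obtain \<delta> where \<delta>: "\<delta> > 0"
    "\<exists>\<^sub>F n in sequentially. \<not> (\<Sum>j<n. f0 ((T ^^ j) x0)) \<le> real n * (integral\<^sup>L M f0 + \<delta>)"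
    by (auto simp: birkhoff_le_def frequently_def)
  define C where "C = {f. continuous_map X euclideanreal f}"
  have x0X: "x0 \<in> topspace X"
    using x0 X(1) by simp
  have Tj: "(T ^^ j) x0 \<in> topspace X" for j
    by (induction j) (use x0X X(5) in \<open>auto simp: continuous_map_def\<close>)
  have "\<exists>B. \<forall>x\<in>topspace X. \<bar>f x\<bar> \<le> B" if "f \<in> C" for f
  proof -
    have "compactin euclideanreal (f ` topspace X)"
      using that X(3) by (intro image_compactin[of X]) (auto simp: C_def compact_space_def)
    then have "bounded (f ` topspace X)"
      by (simp add: compact_imp_bounded compactin_euclidean_iff)
    then show ?thesis
      by (auto simp: bounded_iff)
  qed
  then obtain B where B: "\<And>f x. f \<in> C \<Longrightarrow> x \<in> topspace X \<Longrightarrow> \<bar>f x\<bar> \<le> B f"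
    by metis
  define A where "A n f = (\<Sum>j<n. f ((T ^^ j) x0)) / real n" for n :: nat and f :: "'a \<Rightarrow> real"
  \<comment> \<open>The averages are set to 0 off \<open>C\<close>, so every \<open>a n\<close> lies
    in a product of compact intervals indexed by all functions. Tychonoff's theorem then gives one
    cluster point for all averages at once.\<close>
  define a where "a n f = (if f \<in> C then A n f else 0)" for n f
  define K where "K = (PiE UNIV (\<lambda>f. if f \<in> C then {- \<bar>B f\<bar>..\<bar>B f\<bar>} else {0 :: real}))"
  have A_le: "\<bar>A n f\<bar> \<le> \<bar>B f\<bar>" if "f \<in> C" for n f
  proof -
    have "\<bar>\<Sum>j<n. f ((T ^^ j) x0)\<bar> \<le> (\<Sum>j<n. \<bar>B f\<bar>)"
      by (rule order_trans[OF sum_abs], rule sum_mono, rule order_trans[OF B[OF that Tj]]) simp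
    then show ?thesis
      by (cases "n = 0") (auto simp: A_def abs_mult divide_simps mult.commute)
  qed
  have aK: "a n \<in> K" for n
  proof -
    have "- \<bar>B f\<bar> \<le> A n f \<and> A n f \<le> \<bar>B f\<bar>" if "f \<in> C" for f
      using A_le[OF that, of n] by linarith
    then show ?thesis
      by (auto simp: K_def PiE_iff a_def)
  qed
  have "compactin (product_topology (\<lambda>_. euclideanreal) UNIV) K"
    unfolding K_def by (subst compactin_PiE) auto
  then have "compact K"
    by (simp add: euclidean_product_topology)
  \<comment> \<open>Large times, restricted to those that violate the claimed bound.\<close>
  define \<F> where "\<F> = inf sequentially (principal {n. \<not> (\<Sum>j<n. f0 ((T ^^ j) x0)) \<le> real n * (integral\<^sup>L M f0 + \<delta>)})"
  have "\<F> \<noteq> bot"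
    using \<delta>(2) by (simp add: \<F>_def frequently_def trivial_limit_def eventually_inf_principal)
  have evF: "eventually P sequentially \<Longrightarrow> eventually P \<F>" for P
    unfolding \<F>_def eventually_inf_principal by (auto elim: eventually_mono)
  have evF0: "\<forall>\<^sub>F n in \<F>. real n * (integral\<^sup>L M f0 + \<delta>) \<le> (\<Sum>j<n. f0 ((T ^^ j) x0))"
    unfolding \<F>_def eventually_inf_principal by (auto simp: not_le intro!: always_eventually)
  have "filtermap a \<F> \<noteq> bot"
    using \<open>\<F> \<noteq> bot\<close> by (simp add: filtermap_bot_iff)
  moreover have "eventually (\<lambda>u. u \<in> K) (filtermap a \<F>)"
    using aK by (simp add: eventually_filtermap)
  ultimately obtain \<Lambda> where \<Lambda>: "\<Lambda> \<in> K" "inf (nhds \<Lambda>) (filtermap a \<F>) \<noteq> bot"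
    using \<open>compact K\<close>[unfolded compact_filter] by blast
  \<comment> \<open>Inequalities that hold up to every \<open>e > 0\<close> along the filter pass to
    the cluster point. Linearity, positivity, normalisation and invariance of
    \<open>\<Lambda>\<close> are all obtained this way.\<close>
  have limit: "\<phi> \<Lambda> \<le> 0"
    if cont: "(\<phi> \<longlongrightarrow> \<phi> \<Lambda>) (nhds \<Lambda>)" and ev: "\<And>e. e > 0 \<Longrightarrow> \<forall>\<^sub>F n in \<F>. \<phi> (a n) \<le> e"
    for \<phi> :: "(('a \<Rightarrow> real) \<Rightarrow> real) \<Rightarrow> real"
  proof (rule ccontr)
    assume "\<not> \<phi> \<Lambda> \<le> 0"
    then have pos: "\<phi> \<Lambda> / 2 > 0" "\<phi> \<Lambda> / 2 < \<phi> \<Lambda>"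
      by auto
    have "\<forall>\<^sub>F u in nhds \<Lambda>. \<phi> \<Lambda> / 2 < \<phi> u"
      using order_tendstoD(1)[OF cont pos(2)] .
    moreover have "\<forall>\<^sub>F u in filtermap a \<F>. \<phi> u \<le> \<phi> \<Lambda> / 2"
      using ev[OF pos(1)] by (simp add: eventually_filtermap)
    ultimately have "eventually (\<lambda>u. False) (inf (nhds \<Lambda>) (filtermap a \<F>))"
      unfolding eventually_inf by (metis not_le)
    then show False
      using \<Lambda>(2) by (simp add: trivial_limit_def)
  qed
  have coord: "((\<lambda>u. u f) \<longlongrightarrow> \<Lambda> f) (nhds \<Lambda>)" for f
  proof -
    have "continuous_on UNIV (\<lambda>u :: ('a \<Rightarrow> real) \<Rightarrow> real. u f)"
      by (rule continuous_on_product_coordinates)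
    then have "((\<lambda>u :: ('a \<Rightarrow> real) \<Rightarrow> real. u f) \<longlongrightarrow> \<Lambda> f) (at \<Lambda>)"
      by (simp add: continuous_on_def)
    then show ?thesis
      by (rule tendsto_at_iff_tendsto_nhds[THEN iffD1])
  qed
  have ev_pos: "\<forall>\<^sub>F n in \<F>. 0 < n"
    by (rule evF[OF eventually_gt_at_top])
  have const: "(\<lambda>x. c) \<in> C" for c
    by (simp add: C_def)
  have add_le: "\<Lambda> (\<lambda>x. f x + g x) = \<Lambda> f + \<Lambda> g" if "f \<in> C" "g \<in> C" for f g
  proof -
    have fg: "(\<lambda>x. f x + g x) \<in> C"
      using that by (auto simp: C_def intro: continuous_map_add)
    have eq: "a n (\<lambda>x. f x + g x) = a n f + a n g" for n
      using that fg by (simp add: a_def A_def sum.distrib add_divide_distrib)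
    have "\<Lambda> (\<lambda>x. f x + g x) - (\<Lambda> f + \<Lambda> g) \<le> 0"
      by (rule limit[of "\<lambda>u. u (\<lambda>x. f x + g x) - (u f + u g)"]) (auto intro!: tendsto_intros coord simp: eq)
    moreover have "(\<Lambda> f + \<Lambda> g) - \<Lambda> (\<lambda>x. f x + g x) \<le> 0"
      by (rule limit[of "\<lambda>u. (u f + u g) - u (\<lambda>x. f x + g x)"]) (auto intro!: tendsto_intros coord simp: eq)
    ultimately show ?thesis
      by simp
  qed
  have scale: "\<Lambda> (\<lambda>x. c * f x) = c * \<Lambda> f" if "f \<in> C" for f c
  proof -
    have fg: "(\<lambda>x. c * f x) \<in> C"
      using that by (auto simp: C_def intro: continuous_map_real_mult)
    have eq: "a n (\<lambda>x. c * f x) = c * a n f" for n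
      using that fg by (simp add: a_def A_def sum_distrib_left)
    have "\<Lambda> (\<lambda>x. c * f x) - c * \<Lambda> f \<le> 0"
      by (rule limit[of "\<lambda>u. u (\<lambda>x. c * f x) - c * u f"]) (auto intro!: tendsto_intros coord simp: eq)
    moreover have "c * \<Lambda> f - \<Lambda> (\<lambda>x. c * f x) \<le> 0"
      by (rule limit[of "\<lambda>u. c * u f - u (\<lambda>x. c * f x)"]) (auto intro!: tendsto_intros coord simp: eq)
    ultimately show ?thesis
      by simp
  qed
  have mono: "\<Lambda> f \<le> \<Lambda> g" if "f \<in> C" "g \<in> C" "\<And>x. x \<in> topspace X \<Longrightarrow> f x \<le> g x" for f g
  proof -
    have "a n f \<le> a n g" for n
      using that Tj by (auto simp: a_def A_def intro!: divide_right_mono sum_mono)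
    then have le: "a n f - a n g \<le> e" if "e > 0" for n e
      using that by (smt (verit))
    have "\<Lambda> f - \<Lambda> g \<le> 0"
      by (rule limit[of "\<lambda>u. u f - u g"]) (auto intro!: tendsto_intros coord always_eventually le)
    then show ?thesis
      by simp
  qed
  have one: "\<Lambda> (\<lambda>x. 1) = 1"
  proof -
    have ev: "\<forall>\<^sub>F n in \<F>. a n (\<lambda>x. 1) = 1"
      using ev_pos by eventually_elim (simp add: a_def A_def const)
    have "\<Lambda> (\<lambda>x. 1) - 1 \<le> 0"
      by (rule limit[of "\<lambda>u. u (\<lambda>x. 1) - 1"])
        (auto intro!: tendsto_intros coord eventually_mono[OF ev])
    moreover have "1 - \<Lambda> (\<lambda>x. 1) \<le> 0"
      by (rule limit[of "\<lambda>u. 1 - u (\<lambda>x. 1)"])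
        (auto intro!: tendsto_intros coord eventually_mono[OF ev])
    ultimately show ?thesis
      by simp
  qed
  have inv: "\<Lambda> (\<lambda>x. f (T x)) = \<Lambda> f" if f: "f \<in> C" for f
  proof -
    have fT: "(\<lambda>x. f (T x)) \<in> C"
      using continuous_map_compose[OF X(5), of euclideanreal f] f by (simp add: C_def o_def)
    have eq: "a n (\<lambda>x. f (T x)) - a n f = (f ((T ^^ n) x0) - f x0) / n" for n
    proof -
      have "(\<Sum>j<n. f (T ((T ^^ j) x0))) - (\<Sum>j<n. f ((T ^^ j) x0)) = f ((T ^^ n) x0) - f x0"
        using sum_lessThan_telescope[of "\<lambda>j. f ((T ^^ j) x0)" n] by (simp add: sum_subtractf)
      then show ?thesis
        using f fT by (simp add: a_def A_def diff_divide_distrib[symmetric])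
    qed
    have ev: "\<forall>\<^sub>F n in \<F>. \<bar>a n (\<lambda>x. f (T x)) - a n f\<bar> \<le> e" if "e > 0" for e
    proof (rule evF)
      have "(\<lambda>n. 2 * \<bar>B f\<bar> / real n) \<longlonglongrightarrow> 0"
        by (rule lim_const_over_n)
      then have "\<forall>\<^sub>F n in sequentially. 2 * \<bar>B f\<bar> / real n < e"
        by (rule order_tendstoD) (rule that)
      then show "\<forall>\<^sub>F n in sequentially. \<bar>a n (\<lambda>x. f (T x)) - a n f\<bar> \<le> e"
      proof eventually_elim
        fix n :: nat assume n: "2 * \<bar>B f\<bar> / real n < e"
        have "\<bar>f ((T ^^ n) x0) - f x0\<bar> \<le> 2 * \<bar>B f\<bar>"
          using B[OF f Tj[of n]] B[OF f x0X] by linarith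
        then have "\<bar>(f ((T ^^ n) x0) - f x0) / n\<bar> \<le> 2 * \<bar>B f\<bar> / real n"
          by (simp add: divide_right_mono)
        then show "\<bar>a n (\<lambda>x. f (T x)) - a n f\<bar> \<le> e"
          using n by (simp add: eq)
      qed
    qed
    have "\<Lambda> (\<lambda>x. f (T x)) - \<Lambda> f \<le> 0"
      by (rule limit[of "\<lambda>u. u (\<lambda>x. f (T x)) - u f"])
        (auto intro!: tendsto_intros coord elim: eventually_mono[OF ev])
    moreover have "\<Lambda> f - \<Lambda> (\<lambda>x. f (T x)) \<le> 0"
      by (rule limit[of "\<lambda>u. u f - u (\<lambda>x. f (T x))"])
        (auto intro!: tendsto_intros coord elim: eventually_mono[OF ev])
    ultimately show ?thesis
      by simp
  qed
  have f0C: "f0 \<in> C"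
    using f0 by (simp add: C_def)
  have big: "integral\<^sup>L M f0 + \<delta> \<le> \<Lambda> f0"
  proof -
    have ev: "\<forall>\<^sub>F n in \<F>. integral\<^sup>L M f0 + \<delta> \<le> a n f0"
      using ev_pos evF0 by eventually_elim (simp add: a_def A_def f0C field_simps)
    have "(integral\<^sup>L M f0 + \<delta>) - \<Lambda> f0 \<le> 0"
      by (rule limit[of "\<lambda>u. (integral\<^sup>L M f0 + \<delta>) - u f0"])
        (auto intro!: tendsto_intros coord eventually_mono[OF ev])
    then show ?thesis
      by simp
  qed
  interpret P: positive_functional X \<Lambda>
    by standard (use X(3,4) add_le scale mono one in \<open>simp_all add: C_def\<close>)
  have mpR: "measure_preserving_map P.riesz_measure T"
    by (rule P.riesz_measure_preserving[OF X(5)]) (simp add: inv C_def)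
  have "P.riesz_measure = M"
  proof -
    have "prob_space P.riesz_measure \<and> space P.riesz_measure = topspace X \<and>
        sets P.riesz_measure = sets (borel_of_topology X) \<and> measure_preserving_map P.riesz_measure T"
      using mpR by (simp add: P.prob_space_riesz_measure P.space_riesz_measure P.sets_riesz_measure)
    moreover have "prob_space M \<and> space M = topspace X \<and> sets M = sets (borel_of_topology X) \<and> measure_preserving_map M T"
      using M X(1,2) by simp
    ultimately show ?thesis
      using X(6) unfolding uniquely_ergodic_map_def by blast
  qed
  define b where "b = \<bar>B f0\<bar> + 1"
  have b: "b > 0" "\<And>x. x \<in> topspace X \<Longrightarrow> \<bar>f0 x\<bar> \<le> b"
    using B[OF f0C] by (auto simp: b_def) (smt (verit))
  \<comment> \<open>\<open>P.functional_le_integral\<close> asks for values in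
    \<open>[0, 1]\<close>, so \<open>f0\<close> is rescaled affinely.\<close>
  define g where "g x = 1 / 2 + (1 / (2 * b)) * f0 x" for x
  have g: "continuous_map X euclideanreal g"
    unfolding g_def[abs_def] by (intro continuous_intros f0)
  have "\<Lambda> g \<le> integral\<^sup>L M g"
    unfolding \<open>P.riesz_measure = M\<close>[symmetric]
  proof (rule P.functional_le_integral[OF g])
    show "0 \<le> g x \<and> g x \<le> 1" if "x \<in> topspace X" for x
      using b(1) b(2)[OF that] by (auto simp: g_def field_simps abs_le_iff)
  qed
  moreover have "\<Lambda> g = 1 / 2 + (1 / (2 * b)) * \<Lambda> f0"
  proof -
    have c: "(\<lambda>x. (1 / (2 * b)) * f0 x) \<in> C"
      unfolding C_def mem_Collect_eq by (intro continuous_intros f0)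
    have h: "\<Lambda> (\<lambda>x. 1 / 2) = 1 / 2"
      using scale[OF const[of 1], of "1 / 2"] one by simp
    show ?thesis
      unfolding g_def[abs_def] using add_le[OF const c, of "1 / 2"] scale[OF f0C, of "1 / (2 * b)"] h by simp
  qed
  moreover have "integral\<^sup>L M g = 1 / 2 + (1 / (2 * b)) * integral\<^sup>L M f0"
  proof -
    have "integrable M f0"
      using b(2) X(1) P.borel_measurable_riesz[OF f0] unfolding \<open>P.riesz_measure = M\<close>
      by (intro integrable_const_bound[of _ b]) auto
    then show ?thesis
      unfolding g_def by (subst Bochner_Integration.integral_add) (auto simp: prob_space)
  qed
  ultimately have "\<Lambda> f0 \<le> integral\<^sup>L M f0"
    using b(1) by (simp add: field_simps)
  then show False
    using big \<delta>(1) by simp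
qed

text \<open>The topology is universally quantified because \<open>uniquely_ergodic_case\<close> only
  asserts that one exists; continuity must be available for whichever witness occurs.\<close>

definition observable :: "'a measure \<Rightarrow> ('a \<Rightarrow> 'a) \<Rightarrow> ('a \<Rightarrow> 'b::topological_space) \<Rightarrow> ('a \<Rightarrow> real) \<Rightarrow> bool" where
  "observable M T F f \<longleftrightarrow> integrable M f \<and>
    (\<forall>X. topspace X = space M \<and> continuous_map X X T \<and> continuous_map X euclidean F \<longrightarrow>
      continuous_map X euclideanreal f)"

lemma almost_star_surely_birkhoff_le:
  assumes M: "prob_space M" and erg: "ergodic_map M T"
    and I: "countable I" and f: "\<And>i. i \<in> I \<Longrightarrow> observable M T F (f i)"
  shows "almost_star_surely M T F (\<lambda>\<omega>. \<forall>i\<in>I. birkhoff_le M T (f i) \<omega>)"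
  unfolding almost_star_surely_def
proof (intro conjI impI)
  show "AE \<omega> in M. \<forall>i\<in>I. birkhoff_le M T (f i) \<omega>"
    using f by (subst AE_ball_countable[OF I]) (auto intro: AE_birkhoff_le[OF M erg] simp: observable_def)
  assume "uniquely_ergodic_case M T F"
  then obtain X where X: "topspace X = space M" "sets (borel_of_topology X) = sets M" "compact_space X" "metrizable_space X"
      "continuous_map X X T" "uniquely_ergodic_map X T" "continuous_map X euclidean F"
    unfolding uniquely_ergodic_case_def by blast
  show "\<forall>\<omega>\<in>space M. \<forall>i\<in>I. birkhoff_le M T (f i) \<omega>"
  proof (intro ballI)
    fix \<omega> i assume "\<omega> \<in> space M" "i \<in> I"
    then show "birkhoff_le M T (f i) \<omega>"
      using erg f[OF \<open>i \<in> I\<close>] X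
      by (intro uniquely_ergodic_birkhoff_le[OF M _ X(1-6)]) (auto simp: ergodic_map_def observable_def)
  qed
qed

lemma almost_star_surely_mono:
  assumes "almost_star_surely M T F P" "\<And>\<omega>. \<omega> \<in> space M \<Longrightarrow> P \<omega> \<Longrightarrow> Q \<omega>"
  shows "almost_star_surely M T F Q"
  using assms unfolding almost_star_surely_def by (auto elim!: AE_mp)

section \<open>Subadditive sequences and subadditive cocycles\<close>

lemma fekete:
  fixes a :: "nat \<Rightarrow> real"
  assumes sub: "\<And>n m. n \<ge> 1 \<Longrightarrow> m \<ge> 1 \<Longrightarrow> a (n + m) \<le> a n + a m"
    and low: "\<And>n. n \<ge> 1 \<Longrightarrow> c * n \<le> a n"
  shows "\<exists>L. (\<lambda>n. a n / n) \<longlonglongrightarrow> L \<and> (\<forall>n\<ge>1. L \<le> a n / n)"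
proof -
  define L where "L = Inf ((\<lambda>n. a n / n) ` {1..})"
  have bdd: "bdd_below ((\<lambda>n. a n / n) ` {1..})"
    using low by (intro bdd_belowI[of _ c]) (auto simp: field_simps)
  have L_le: "L \<le> a n / n" if "n \<ge> 1" for n
    unfolding L_def using that bdd by (intro cInf_lower) auto
  have mult: "a (q * m + r) \<le> q * a m + (if r = 0 then 0 else a r)" if "m \<ge> 1" "q \<ge> 1 \<or> r \<ge> 1" for q m r
    using that(2)
  proof (induction q)
    case (Suc q)
    show ?case
    proof (cases "q = 0 \<and> r = 0")
      case False
      have "a (m + (q * m + r)) \<le> a m + a (q * m + r)"
        using that(1) False by (intro sub) (auto simp: Suc_le_eq)
      moreover have "a (q * m + r) \<le> q * a m + (if r = 0 then 0 else a r)"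
        using False by (intro Suc.IH) auto
      moreover have "Suc q * m + r = m + (q * m + r)"
        by simp
      ultimately show ?thesis
        by (simp add: algebra_simps)
    qed auto
  qed auto
  have "(\<lambda>n. a n / n) \<longlonglongrightarrow> L"
  proof (rule LIMSEQ_I)
    fix e :: real assume e: "e > 0"
    have "\<exists>x\<in>(\<lambda>n. a n / n) ` {1..}. x < L + e / 2"
      unfolding L_def using e bdd by (intro cInf_lessD) auto
    then obtain m where m: "m \<ge> 1" "a m / m < L + e / 2"
      by auto
    define C where "C = (\<Sum>r<m. \<bar>a r\<bar>) + \<bar>a m\<bar>"
    have C: "(if r = 0 then 0 else a r) \<le> (\<Sum>r<m. \<bar>a r\<bar>)" if "r < m" for r
    proof -
      have "\<bar>a r\<bar> \<le> (\<Sum>r<m. \<bar>a r\<bar>)"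
        using that by (intro member_le_sum) auto
      then show ?thesis
        by (auto intro: sum_nonneg)
    qed
    obtain N0 :: nat where N0: "real N0 > 2 * C / e"
      using reals_Archimedean2 by blast
    define N where "N = Suc N0"
    have N: "N \<ge> 1" "real N > 2 * C / e"
      using N0 by (simp_all add: N_def)
    have "norm (a n / n - L) < e" if n: "n \<ge> N" for n
    proof -
      have n1: "n \<ge> 1"
        using n N by simp
      define q r where "q = n div m" and "r = n mod m"
      have nqr: "n = q * m + r" "r < m"
        using m by (auto simp: q_def r_def)
      have qr: "q \<ge> 1 \<or> r \<ge> 1"
        using n1 nqr by (cases q) auto
      have "a n \<le> q * a m + (\<Sum>r<m. \<bar>a r\<bar>)"
        using mult[OF m(1) qr] C[OF nqr(2)] nqr(1) by simp
      also have "real q * a m = (real n - real r) * (a m / m)"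
        using m by (simp add: nqr(1))
      also have "\<dots> \<le> real n * (a m / m) + \<bar>a m\<bar>"
      proof -
        have "real r * (- (a m / m)) \<le> real m * \<bar>a m / m\<bar>"
          using nqr(2) by (intro order_trans[OF mult_left_mono[OF abs_ge_minus_self] mult_right_mono]) auto
        also have "\<dots> = \<bar>a m\<bar>"
          using m by (simp add: abs_divide)
        finally show ?thesis
          by (simp only: left_diff_distrib mult_minus_right)
      qed
      finally have "a n \<le> real n * (a m / m) + C"
        by (simp add: C_def)
      also have "\<dots> < real n * (L + e / 2) + real n * (e / 2)"
      proof (rule add_less_le_mono)
        show "real n * (a m / m) < real n * (L + e / 2)"
          using m n1 by (intro mult_strict_left_mono) auto
        have "C \<le> real N * (e / 2)"
          using N e by (simp add: field_simps)
        also have "\<dots> \<le> real n * (e / 2)"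
          using n e by (intro mult_right_mono) auto
        finally show "C \<le> real n * (e / 2)" .
      qed
      also have "\<dots> = real n * (L + e)"
        by (simp add: algebra_simps)
      finally have "a n / n < L + e"
        using n1 by (simp add: divide_less_eq mult.commute)
      then show ?thesis
        using L_le[OF n1] by simp
    qed
    then show "\<exists>N. \<forall>n\<ge>N. norm (a n / n - L) < e"
      by blast
  qed
  then show ?thesis
    using L_le by blast
qed

text \<open>Averaging the decomposition into blocks of length \<open>m\<close> over the \<open>m\<close> possible offsets.\<close>

lemma subadditive_block_bound:
  fixes a :: "nat \<Rightarrow> nat \<Rightarrow> real" and \<beta> :: "nat \<Rightarrow> real"
  assumes sub: "\<And>i j l. i \<le> j \<Longrightarrow> j \<le> l \<Longrightarrow> a i l \<le> a i j + a j l"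
    and le: "\<And>i j. i \<le> j \<Longrightarrow> a i j \<le> (\<Sum>t\<in>{i..<j}. \<beta> t)" and \<beta>: "\<And>t. \<beta> t \<ge> 0"
    and m: "m \<ge> 1" and n: "n \<ge> 2 * m"
  shows "real m * a 0 n \<le> (\<Sum>j<(n div m - 1) * m. a j (j + m)) + real m * ((\<Sum>t<m. \<beta> t) + (\<Sum>t\<in>{n - 2 * m..<n}. \<beta> t))"
proof -
  \<comment> \<open>One block fewer than fits, so that \<open>N\<close> full blocks remain inside
    \<open>[0, n)\<close> for every offset \<open>i < m\<close>; what is left over on the right lies
    in the last \<open>2 * m\<close> sites.\<close>
  define N where "N = n div m - 1"
  have "n div m \<ge> 2"
    using m n by (simp add: less_eq_div_iff_mult_less_eq)
  then have Nm: "N * m + m \<le> n" "n < N * m + 2 * m"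
  proof -
    have "n = n div m * m + n mod m"
      by simp
    also have "n div m = Suc N"
      using \<open>n div m \<ge> 2\<close> by (simp add: N_def)
    finally have "n = N * m + m + n mod m"
      by simp
    then show "N * m + m \<le> n" "n < N * m + 2 * m"
      using mod_less_divisor[of m n] m by linarith+
  qed
  have chain: "a i (i + q * m) \<le> (\<Sum>p<q. a (i + p * m) (i + p * m + m))" for i q
  proof (induction q)
    case 0
    then show ?case
      using le[of i i] by simp
  next
    case (Suc q)
    have "a i (i + Suc q * m) \<le> a i (i + q * m) + a (i + q * m) (i + Suc q * m)"
      by (intro sub) auto
    moreover have eq: "i + Suc q * m = i + q * m + m"
      by simp
    ultimately show ?case
      using Suc unfolding eq sum.lessThan_Suc by linarith
  qed
  have one: "a 0 n \<le> (\<Sum>p<N. a (i + p * m) (i + p * m + m)) + ((\<Sum>t<m. \<beta> t) + (\<Sum>t\<in>{n - 2 * m..<n}. \<beta> t))" if i: "i < m" for i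
  proof -
    have "a 0 n \<le> a 0 i + a i n"
      using i Nm by (intro sub) auto
    also have "a i n \<le> a i (i + N * m) + a (i + N * m) n"
      using i Nm by (intro sub) auto
    also have "a 0 i \<le> (\<Sum>t\<in>{0..<i}. \<beta> t)"
      by (rule le) simp
    also have "\<dots> \<le> (\<Sum>t<m. \<beta> t)"
      using i \<beta> by (intro sum_mono2) auto
    also have "a (i + N * m) n \<le> (\<Sum>t\<in>{i + N * m..<n}. \<beta> t)"
      using i Nm by (intro le) auto
    also have "\<dots> \<le> (\<Sum>t\<in>{n - 2 * m..<n}. \<beta> t)"
      using Nm \<beta> by (intro sum_mono2) auto
    finally show ?thesis
      using chain[of i N] by simp
  qed
  have "real m * a 0 n = (\<Sum>i<m. a 0 n)"
    by simp
  also have "\<dots> \<le> (\<Sum>i<m. (\<Sum>p<N. a (i + p * m) (i + p * m + m)) + ((\<Sum>t<m. \<beta> t) + (\<Sum>t\<in>{n - 2 * m..<n}. \<beta> t)))"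
    by (intro sum_mono one) auto
  also have "\<dots> = (\<Sum>i<m. \<Sum>p<N. a (i + p * m) (i + p * m + m)) + real m * ((\<Sum>t<m. \<beta> t) + (\<Sum>t\<in>{n - 2 * m..<n}. \<beta> t))"
    by (simp add: sum.distrib)
  also have "(\<Sum>i<m. \<Sum>p<N. a (i + p * m) (i + p * m + m)) = (\<Sum>p<N. \<Sum>i<m. a (i + p * m) (i + p * m + m))"
    by (rule sum.swap)
  also have "\<dots> = (\<Sum>p<N. \<Sum>j\<in>{p * m..<p * m + m}. a j (j + m))"
  proof (rule sum.cong[OF refl])
    fix p
    show "(\<Sum>i<m. a (i + p * m) (i + p * m + m)) = (\<Sum>j\<in>{p * m..<p * m + m}. a j (j + m))"
      using sum.shift_bounds_nat_ivl[of "\<lambda>j. a j (j + m)" 0 "p * m" m] by (simp add: atLeast0LessThan add.commute)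
  qed
  also have "\<dots> = (\<Sum>j<N * m. a j (j + m))"
    by (rule sum.nat_group)
  finally show ?thesis
    by (simp add: N_def)
qed

lemma funpow_add_apply: "(T ^^ n) ((T ^^ m) \<omega>) = (T ^^ (n + m)) \<omega>"
  by (simp add: funpow_add)

text \<open>Averaging the block decomposition over the offsets leaves a Birkhoff sum of
  \<open>g\<close>, which may be any majorant of \<open>f m\<close> along the orbit; thus one
  observable can serve all nearby spectral parameters. The boundary blocks are controlled by
  \<open>\<beta>\<close>, whose averages are assumed to be bounded from both sides for this
  purpose.\<close>

lemma subadditive_birkhoff:
  fixes f :: "nat \<Rightarrow> 'a \<Rightarrow> real"
  assumes sub: "\<And>n m i. n \<ge> 1 \<Longrightarrow> m \<ge> 1 \<Longrightarrow> f (n + m) ((T ^^ i) \<omega>) \<le> f n ((T ^^ i) \<omega>) + f m ((T ^^ (i + n)) \<omega>)"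
    and le: "\<And>n i. n \<ge> 1 \<Longrightarrow> f n ((T ^^ i) \<omega>) \<le> (\<Sum>t<n. \<beta> ((T ^^ (i + t)) \<omega>))" and \<beta>: "\<And>\<omega>. \<beta> \<omega> \<ge> 0"
    and b1: "birkhoff_le M T \<beta> \<omega>" and b2: "birkhoff_le M T (\<lambda>\<omega>. - \<beta> \<omega>) \<omega>"
    and m: "m \<ge> 1" and g: "\<And>i. f m ((T ^^ i) \<omega>) \<le> g ((T ^^ i) \<omega>)" and bg: "birkhoff_le M T g \<omega>"
    and \<delta>: "\<delta> > 0"
  shows "\<forall>\<^sub>F n in sequentially. f n \<omega> \<le> real n * (integral\<^sup>L M g / m + \<delta>)"
proof -
  define S where "S h n = (\<Sum>j<n. h ((T ^^ j) \<omega>))" for h :: "'a \<Rightarrow> real" and n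
  define G where "G = integral\<^sup>L M g"
  define B where "B = integral\<^sup>L M \<beta>"
  define \<eta> where "\<eta> = \<delta> / 8"
  have \<eta>: "\<eta> > 0"
    using \<delta> by (simp add: \<eta>_def)
  define a where "a i j = (if i = j then 0 else f (j - i) ((T ^^ i) \<omega>))" for i j
  have bb: "real m * a 0 n \<le> (\<Sum>j<(n div m - 1) * m. a j (j + m)) +
      real m * ((\<Sum>t<m. \<beta> ((T ^^ t) \<omega>)) + (\<Sum>t\<in>{n - 2 * m..<n}. \<beta> ((T ^^ t) \<omega>)))" if "n \<ge> 2 * m" for n
  proof (rule subadditive_block_bound[OF _ _ \<beta> m that])
    show "a i l \<le> a i j + a j l" if "i \<le> j" "j \<le> l" for i j l
    proof (cases "i = j \<or> j = l")
      case False
      then have "1 \<le> j - i" "1 \<le> l - j" "j - i + (l - j) = l - i" "i + (j - i) = j"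
        using that by auto
      then show ?thesis
        using sub[of "j - i" "l - j" i] False that by (auto simp: a_def)
    qed (auto simp: a_def)
    show "a i j \<le> (\<Sum>t\<in>{i..<j}. \<beta> ((T ^^ t) \<omega>))" if "i \<le> j" for i j
    proof (cases "i = j")
      case False
      have "(\<Sum>t<j - i. \<beta> ((T ^^ (i + t)) \<omega>)) = (\<Sum>t\<in>{i..<j}. \<beta> ((T ^^ t) \<omega>))"
        using sum.shift_bounds_nat_ivl[of "\<lambda>t. \<beta> ((T ^^ t) \<omega>)" 0 i "j - i"] that
        by (simp add: atLeast0LessThan add.commute)
      then show ?thesis
        using le[of "j - i" i] False that by (simp add: a_def)
    qed (simp add: a_def)
  qed
  have ev1: "\<forall>\<^sub>F n in sequentially. S g n \<le> real n * (G + \<eta>)"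
    using bg \<eta> unfolding birkhoff_le_def S_def G_def by blast
  have ev2: "\<forall>\<^sub>F n in sequentially. S \<beta> n \<le> real n * (B + \<eta>)"
    using b1 \<eta> unfolding birkhoff_le_def S_def B_def by blast
  have ev3: "\<forall>\<^sub>F n in sequentially. real n * (B - \<eta>) \<le> S \<beta> n"
  proof -
    have "\<forall>\<^sub>F n in sequentially. (\<Sum>j<n. - \<beta> ((T ^^ j) \<omega>)) \<le> real n * (integral\<^sup>L M (\<lambda>\<omega>. - \<beta> \<omega>) + \<eta>)"
      using b2 \<eta> unfolding birkhoff_le_def by blast
    then show ?thesis
      by eventually_elim (simp add: S_def B_def sum_negf algebra_simps)
  qed
  obtain N0 where N0: "\<And>n. n \<ge> N0 \<Longrightarrow> S g n \<le> real n * (G + \<eta>)" "\<And>n. n \<ge> N0 \<Longrightarrow> S \<beta> n \<le> real n * (B + \<eta>)"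
    "\<And>n. n \<ge> N0 \<Longrightarrow> real n * (B - \<eta>) \<le> S \<beta> n"
    using eventually_conj[OF ev1 eventually_conj[OF ev2 ev3]] unfolding eventually_sequentially by blast
  define C where "C = 2 * real m * \<bar>G + \<eta>\<bar> + real m * (S \<beta> m + 2 * real m * \<bar>B - \<eta>\<bar>)"
  have main: "f n \<omega> \<le> real n * (G / m + 3 * \<eta>) + C" if n: "n \<ge> N0 + 2 * m" "n \<ge> 1" for n
  proof -
    define K where "K = (n div m - 1) * m"
    have "n div m \<ge> 2"
      using m n by (simp add: less_eq_div_iff_mult_less_eq)
    then have K: "K + m \<le> n" "n < K + 2 * m"
    proof -
      have "n = n div m * m + n mod m"
        by simp
      also have "n div m = Suc (n div m - 1)"
        using \<open>n div m \<ge> 2\<close> by simp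
      finally have "n = K + m + n mod m"
        by (simp add: K_def)
      then show "K + m \<le> n" "n < K + 2 * m"
        using mod_less_divisor[of m n] m by linarith+
    qed
    then have KN: "K \<ge> N0"
      using n by simp
    have "(\<Sum>j<K. a j (j + m)) \<le> S g K"
      unfolding S_def using m g by (intro sum_mono) (simp add: a_def)
    also have "\<dots> \<le> real K * (G + \<eta>)"
      by (rule N0(1)[OF KN])
    also have "\<dots> = real n * (G + \<eta>) - (real n - real K) * (G + \<eta>)"
      by (simp add: algebra_simps)
    also have "\<dots> \<le> real n * (G + \<eta>) + 2 * real m * \<bar>G + \<eta>\<bar>"
    proof -
      have "- ((real n - real K) * (G + \<eta>)) \<le> (real n - real K) * \<bar>G + \<eta>\<bar>"
        using K mult_left_mono[of "- (G + \<eta>)" "\<bar>G + \<eta>\<bar>" "real n - real K"]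
        by (simp only: mult_minus_right)
      also have "\<dots> \<le> 2 * real m * \<bar>G + \<eta>\<bar>"
        using K by (intro mult_right_mono) auto
      finally show ?thesis
        by simp
    qed
    finally have 1: "(\<Sum>j<K. a j (j + m)) \<le> real n * (G + \<eta>) + 2 * real m * \<bar>G + \<eta>\<bar>" .
    \<comment> \<open>A difference of two Birkhoff sums of nearly equal length: the upper bound for
      one and the lower bound for the other leave \<open>2 * n * \<eta>\<close> plus a
      constant.\<close>
    have "(\<Sum>t\<in>{n - 2 * m..<n}. \<beta> ((T ^^ t) \<omega>)) = S \<beta> n - S \<beta> (n - 2 * m)"
      using sum_diff_nat_ivl[of 0 "n - 2 * m" n "\<lambda>t. \<beta> ((T ^^ t) \<omega>)"] by (simp add: S_def atLeast0LessThan)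
    also have "\<dots> \<le> real n * (B + \<eta>) - real (n - 2 * m) * (B - \<eta>)"
    proof -
      have "N0 \<le> n" "N0 \<le> n - 2 * m"
        using n by simp_all
      then show ?thesis
        using N0(2)[of n] N0(3)[of "n - 2 * m"] by simp
    qed
    also have "\<dots> = 2 * real n * \<eta> + 2 * real m * (B - \<eta>)"
      using n by (simp add: of_nat_diff algebra_simps)
    also have "\<dots> \<le> 2 * real n * \<eta> + 2 * real m * \<bar>B - \<eta>\<bar>"
      by (intro add_left_mono mult_left_mono) auto
    finally have 2: "(\<Sum>t\<in>{n - 2 * m..<n}. \<beta> ((T ^^ t) \<omega>)) \<le> 2 * real n * \<eta> + 2 * real m * \<bar>B - \<eta>\<bar>" .
    have "real m * f n \<omega> \<le> (real n * (G + \<eta>) + 2 * real m * \<bar>G + \<eta>\<bar>) +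
        real m * (S \<beta> m + (2 * real n * \<eta> + 2 * real m * \<bar>B - \<eta>\<bar>))"
      using bb[of n] 1 mult_left_mono[OF 2, of "real m"] n by (simp add: a_def S_def[of \<beta> m] K_def distrib_left)
    also have "\<dots> = real m * (real n * (G / m + 2 * \<eta>)) + real n * \<eta> + C"
      using m by (simp add: C_def field_simps)
    also have "\<dots> \<le> real m * (real n * (G / m + 2 * \<eta>)) + real m * (real n * \<eta>) + real m * C"
    proof -
      have "C \<ge> 0"
        unfolding C_def S_def using \<beta> by (auto intro!: add_nonneg_nonneg mult_nonneg_nonneg sum_nonneg)
      then have "C \<le> real m * C"
        using m by (simp add: mult_le_cancel_right1)
      moreover have "1 * (real n * \<eta>) \<le> real m * (real n * \<eta>)"
        using m \<eta> by (intro mult_right_mono) auto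
      ultimately show ?thesis
        by simp
    qed
    also have "\<dots> = real m * (real n * (G / m + 3 * \<eta>) + C)"
      by (simp add: algebra_simps)
    finally show ?thesis
      using m by simp
  qed
  obtain N1 :: nat where N1: "real N1 > C / \<eta>"
    using reals_Archimedean2 by blast
  have "f n \<omega> \<le> real n * (G / m + \<delta>)" if "n \<ge> N0 + 2 * m + N1 + 1" for n
  proof -
    have "C \<le> real N1 * \<eta>"
      using N1 \<eta> by (simp add: field_simps)
    also have "\<dots> \<le> real n * \<eta>"
      using that \<eta> by (intro mult_right_mono) auto
    finally have "f n \<omega> \<le> real n * (G / m + 4 * \<eta>)"
      using main[of n] that by (simp add: algebra_simps)
    also have "\<dots> \<le> real n * (G / m + \<delta>)"
      using \<delta> by (intro mult_left_mono) (auto simp: \<eta>_def)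
    finally show ?thesis .
  qed
  then show ?thesis
    unfolding G_def eventually_sequentially by blast
qed

section \<open>Minors and singular values\<close>

definition minor :: "nat \<Rightarrow> complex ^ 'n ^ 'm \<Rightarrow> (nat \<Rightarrow> 'm) \<Rightarrow> (nat \<Rightarrow> 'n) \<Rightarrow> complex" where
  "minor k A f g = (\<Sum>p | p permutes {..<k}. of_int (sign p) * (\<Prod>i<k. A $ f i $ g (p i)))"

text \<open>Ordered tuples with repetitions. Those that are not injective give zero minors and
  reorderings give equal absolute values, so the sums agree with sums over index sets up to a factor
  depending on \<open>k\<close>, and products can be expanded without choosing orderings. For
  \<open>k = 0\<close> the only minor is 1.\<close>

definition tuples :: "nat \<Rightarrow> (nat \<Rightarrow> 'n) set" where
  "tuples k = PiE {..<k} (\<lambda>_. UNIV)"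

definition minors_sum :: "nat \<Rightarrow> complex ^ 'n ^ 'm \<Rightarrow> real" where
  "minors_sum k A = (\<Sum>f\<in>tuples k. \<Sum>g\<in>tuples k. cmod (minor k A f g))"

lemma abs_of_int_sign [simp]: "\<bar>real_of_int (sign p)\<bar> = 1"
  by (simp add: sign_def)

lemma finite_tuples [simp]: "finite (tuples k :: (nat \<Rightarrow> 'n::finite) set)"
  by (simp add: tuples_def finite_PiE)

lemma card_tuples: "card (tuples k :: (nat \<Rightarrow> 'n::finite) set) = CARD('n) ^ k"
  by (simp add: tuples_def card_PiE)

lemma minors_sum_nonneg: "minors_sum k A \<ge> 0"
  unfolding minors_sum_def by (intro sum_nonneg) auto

lemma minor_le_minors_sum:
  assumes "f \<in> tuples k" "g \<in> tuples k"
  shows "cmod (minor k A f g) \<le> minors_sum k A"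
proof -
  have "cmod (minor k A f g) \<le> (\<Sum>g\<in>tuples k. cmod (minor k A f g))"
    using assms by (intro member_le_sum) auto
  also have "\<dots> \<le> minors_sum k A"
    unfolding minors_sum_def using assms
    by (intro member_le_sum[of f _ "\<lambda>f. \<Sum>g\<in>tuples k. cmod (minor k A f g)"]) (auto intro: sum_nonneg)
  finally show ?thesis .
qed

lemma minor_restrict: "minor k A (restrict f {..<k}) (restrict g {..<k}) = minor k A f g"
proof -
  have "(\<Prod>i<k. A $ restrict f {..<k} i $ restrict g {..<k} (p i)) = (\<Prod>i<k. A $ f i $ g (p i))"
    if "p permutes {..<k}" for p
    using permutes_in_image[OF that] by (intro prod.cong) auto
  then show ?thesis
    unfolding minor_def by (intro sum.cong) auto
qed

lemma minor_le_minors_sum': "cmod (minor k A f g) \<le> minors_sum k A"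
  by (subst minor_restrict[symmetric], rule minor_le_minors_sum) (auto simp: tuples_def)

lemma minor_comp_rows:
  assumes q: "q permutes {..<k}"
  shows "minor k A (f \<circ> q) g = of_int (sign q) * minor k A f g"
proof -
  have "minor k A (f \<circ> q) g =
      (\<Sum>p | p permutes {..<k}. of_int (sign (p \<circ> q)) * (\<Prod>i<k. A $ f (q i) $ g (p (q i))))"
    unfolding minor_def
    by (subst sum_permutations_compose_right[OF q]) simp
  also have "\<dots> = (\<Sum>p | p permutes {..<k}. of_int (sign p) * of_int (sign q) * (\<Prod>i<k. A $ f i $ g (p i)))"
  proof (rule sum.cong, safe)
    fix p assume p: "p permutes {..<k}"
    have "permutation p" "permutation q"
      using p q permutation_permutes finite_lessThan by blast+
    then have s: "sign (p \<circ> q) = sign p * sign q"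
      by (rule sign_compose)
    have "(\<Prod>i<k. A $ f (q i) $ g (p (q i))) = (\<Prod>i<k. A $ f i $ g (p i))"
      using prod.permute[OF q, of "\<lambda>i. A $ f i $ g (p i)"] by (simp add: o_def)
    then show "of_int (sign (p \<circ> q)) * (\<Prod>i<k. A $ f (q i) $ g (p (q i))) =
      of_int (sign p) * of_int (sign q) * (\<Prod>i<k. A $ f i $ g (p i))"
      by (simp add: s)
  qed
  also have "\<dots> = of_int (sign q) * minor k A f g"
    by (simp add: minor_def sum_distrib_left mult_ac)
  finally show ?thesis .
qed

lemma minor_transpose: "minor k (transpose A) g f = minor k A f g"
proof -
  have "minor k A f g = (\<Sum>p | p permutes {..<k}. of_int (sign (inv p)) * (\<Prod>i<k. A $ f i $ g (inv p i)))"
    unfolding minor_def by (subst sum_permutations_inverse) simp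
  also have "\<dots> = minor k (transpose A) g f"
    unfolding minor_def
  proof (rule sum.cong, safe)
    fix p assume p: "p permutes {..<k}"
    have s: "sign (inv p) = sign p"
      using p by (intro sign_inverse) (meson finite_lessThan permutation_permutes)
    have "(\<Prod>i<k. A $ f i $ g (inv p i)) = (\<Prod>i<k. A $ f (p i) $ g (inv p (p i)))"
      using prod.permute[OF p, of "\<lambda>i. A $ f i $ g (inv p i)"] by (simp add: o_def)
    also have "\<dots> = (\<Prod>i<k. transpose A $ g i $ f (p i))"
      using permutes_inverses[OF p] by (simp add: transpose_def)
    finally show "of_int (sign (inv p)) * (\<Prod>i<k. A $ f i $ g (inv p i)) =
       of_int (sign p) * (\<Prod>i<k. transpose A $ g i $ f (p i))"
      by (simp add: s)
  qed
  finally show ?thesis ..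
qed

lemma minor_rows_not_inj:
  assumes "\<not> inj_on f {..<k}"
  shows "minor k A f g = 0"
proof -
  obtain i j where ij: "i < k" "j < k" "i \<noteq> j" "f i = f j"
    using assms unfolding inj_on_def by auto
  have "f \<circ> Transposition.transpose i j = f"
    using ij by (auto simp: fun_eq_iff Transposition.transpose_def)
  moreover have "minor k A (f \<circ> Transposition.transpose i j) g = - minor k A f g"
    using minor_comp_rows[of "Transposition.transpose i j" k A f g] ij
    by (simp add: permutes_swap_id sign_swap_id)
  ultimately show ?thesis
    by simp
qed

lemma minor_cols_not_inj:
  assumes "\<not> inj_on g {..<k}"
  shows "minor k A f g = 0"
  using minor_rows_not_inj[OF assms, of "transpose A" f] by (simp add: minor_transpose)

text \<open>Multilinearity in the rows: expanding the entries of \<open>A ** B\<close> picks a row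
  \<open>h i\<close> of \<open>B\<close> for every \<open>i\<close>.\<close>

lemma minor_mult_rows:
  fixes A :: "complex ^ 'n ^ 'm" and B :: "complex ^ 'l ^ 'n"
  shows "minor k (A ** B) f g = (\<Sum>h\<in>tuples k. (\<Prod>i<k. A $ f i $ h i) * minor k B h g)"
proof -
  have "minor k (A ** B) f g = (\<Sum>p | p permutes {..<k}. of_int (sign p) *
      (\<Sum>h\<in>tuples k. \<Prod>i<k. A $ f i $ h i * B $ h i $ g (p i)))"
    unfolding minor_def tuples_def by (subst prod_sum_PiE[symmetric]) (auto simp: matrix_matrix_mult_def)
  also have "\<dots> = (\<Sum>p | p permutes {..<k}. \<Sum>h\<in>tuples k.
      (\<Prod>i<k. A $ f i $ h i) * (of_int (sign p) * (\<Prod>i<k. B $ h i $ g (p i))))"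
    by (simp add: sum_distrib_left prod.distrib mult_ac)
  also have "\<dots> = (\<Sum>h\<in>tuples k. (\<Prod>i<k. A $ f i $ h i) * minor k B h g)"
    by (subst sum.swap) (simp add: sum_distrib_left minor_def)
  finally show ?thesis .
qed

lemma comp_in_tuples:
  assumes "q permutes {..<k}" "h \<in> tuples k"
  shows "h \<circ> q \<in> tuples k"
  using assms permutes_not_in[OF assms(1)] by (auto simp: tuples_def PiE_iff extensional_def)

lemma tuples_comp_permutes:
  assumes "p permutes {..<k}"
  shows "bij_betw (\<lambda>h. h \<circ> p) (tuples k) (tuples k)"
  by (rule bij_betwI[where g = "\<lambda>h. h \<circ> inv p"])
     (auto simp: fun_eq_iff permutes_inverses[OF assms] intro!: comp_in_tuples assms permutes_inv)

text \<open>The Cauchy--Binet formula, with the \<open>k!\<close> orderings of every column set counted separately.\<close>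

lemma minor_mult:
  fixes A :: "complex ^ 'n ^ 'm" and B :: "complex ^ 'l ^ 'n"
  shows "fact k * minor k (A ** B) f g = (\<Sum>h\<in>tuples k. minor k A f h * minor k B h g)"
proof -
  have "(\<Sum>h\<in>tuples k. minor k A f h * minor k B h g) =
      (\<Sum>p | p permutes {..<k}. \<Sum>h\<in>tuples k. (\<Prod>i<k. A $ f i $ (h \<circ> p) i) * (of_int (sign p) * minor k B h g))"
    unfolding minor_def[of k A]
    by (subst sum.swap) (simp add: sum_distrib_right sum_distrib_left mult_ac)
  also have "\<dots> = (\<Sum>p | p permutes {..<k}. \<Sum>h\<in>tuples k. (\<Prod>i<k. A $ f i $ (h \<circ> p) i) * minor k B (h \<circ> p) g)"
    by (intro sum.cong refl) (simp only: minor_comp_rows mem_Collect_eq)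
  also have "\<dots> = (\<Sum>p | p permutes {..<k}. \<Sum>h\<in>tuples k. (\<Prod>i<k. A $ f i $ h i) * minor k B h g)"
    by (rule sum.cong[OF refl], rule sum.reindex_bij_betw[OF tuples_comp_permutes]) auto
  also have "\<dots> = fact k * minor k (A ** B) f g"
    by (simp add: minor_mult_rows[of k A] card_permutations[of _ k])
  finally show ?thesis ..
qed

text \<open>Cauchy--Binet in absolute values; the factor \<open>fact k \<ge> 1\<close> is dropped,
  and letting the two inner tuples vary independently only enlarges the right-hand side.\<close>

lemma minors_sum_mult:
  fixes A :: "complex ^ 'n ^ 'm" and B :: "complex ^ 'l ^ 'n"
  shows "minors_sum k (A ** B) \<le> minors_sum k A * minors_sum k B"
proof -
  have *: "cmod (minor k (A ** B) f g) \<le> (\<Sum>h\<in>tuples k. cmod (minor k A f h) * cmod (minor k B h g))" for f g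
  proof -
    have "cmod (minor k (A ** B) f g) \<le> fact k * cmod (minor k (A ** B) f g)"
      using mult_right_mono[OF fact_ge_1[of k, where 'a=real], of "cmod (minor k (A ** B) f g)"] by simp
    also have "\<dots> = cmod (\<Sum>h\<in>tuples k. minor k A f h * minor k B h g)"
      by (simp add: minor_mult[symmetric] norm_mult)
    also have "\<dots> \<le> (\<Sum>h\<in>tuples k. cmod (minor k A f h) * cmod (minor k B h g))"
      by (rule order_trans[OF norm_sum]) (simp add: norm_mult)
    finally show ?thesis .
  qed
  have "minors_sum k (A ** B) \<le> (\<Sum>f\<in>tuples k. \<Sum>g\<in>tuples k. \<Sum>h\<in>tuples k. cmod (minor k A f h) * cmod (minor k B h g))"
    unfolding minors_sum_def by (intro sum_mono *)
  also have "\<dots> = (\<Sum>f\<in>tuples k. \<Sum>h\<in>tuples k. cmod (minor k A f h) * (\<Sum>g\<in>tuples k. cmod (minor k B h g)))"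
    by (subst sum.swap) (simp add: sum_distrib_left)
  also have "\<dots> \<le> (\<Sum>f\<in>tuples k. \<Sum>h\<in>tuples k. cmod (minor k A f h) * minors_sum k B)"
    unfolding minors_sum_def[of k B]
    by (intro sum_mono mult_left_mono member_le_sum[where f = "\<lambda>h. \<Sum>g\<in>tuples k. cmod (minor k B h g)"])
       (auto intro: sum_nonneg)
  also have "\<dots> = minors_sum k A * minors_sum k B"
    by (simp add: minors_sum_def[of k A] sum_distrib_right)
  finally show ?thesis .
qed

lemma norm_minor_le:
  fixes A :: "complex ^ 'n ^ 'm"
  assumes "\<And>i j. cmod (A $ i $ j) \<le> R"
  shows "cmod (minor k A f g) \<le> fact k * R ^ k"
proof -
  have "cmod (minor k A f g) \<le> (\<Sum>p | p permutes {..<k}. (\<Prod>i<k. cmod (A $ f i $ g (p i))))"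
    unfolding minor_def by (rule order_trans[OF norm_sum]) (simp add: norm_mult prod_norm[symmetric])
  also have "\<dots> \<le> (\<Sum>p\<in>{p. p permutes {..<k}}. R ^ k)"
  proof (intro sum_mono)
    fix p
    have "(\<Prod>i<k. cmod (A $ f i $ g (p i))) \<le> (\<Prod>i<k. R)"
      using assms by (intro prod_mono) auto
    then show "(\<Prod>i<k. cmod (A $ f i $ g (p i))) \<le> R ^ k"
      by simp
  qed
  also have "\<dots> = fact k * R ^ k"
    by (simp add: card_permutations[of _ k])
  finally show ?thesis .
qed

lemma minors_sum_le:
  fixes A :: "complex ^ 'n ^ 'm"
  assumes "\<And>i j. cmod (A $ i $ j) \<le> R"
  shows "minors_sum k A \<le> real (CARD('m) ^ k * CARD('n) ^ k) * fact k * R ^ k"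
proof -
  have "minors_sum k A \<le> (\<Sum>f\<in>(tuples k :: (nat \<Rightarrow> 'm) set). \<Sum>g\<in>(tuples k :: (nat \<Rightarrow> 'n) set). fact k * R ^ k)"
    unfolding minors_sum_def by (intro sum_mono norm_minor_le assms)
  also have "\<dots> = real (CARD('m) ^ k * CARD('n) ^ k) * fact k * R ^ k"
    by (simp add: card_tuples)
  finally show ?thesis .
qed

lemma prod_diff_le:
  fixes a b :: "nat \<Rightarrow> complex"
  assumes "\<And>i. cmod (a i) \<le> R" "\<And>i. cmod (b i) \<le> R" "\<And>i. cmod (a i - b i) \<le> e" "R \<ge> 1"
  shows "cmod ((\<Prod>i<k. a i) - (\<Prod>i<k. b i)) \<le> real k * R ^ k * e"
proof (induction k)
  case (Suc k)
  have e: "e \<ge> 0"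
    using assms(3)[of 0] norm_ge_zero order_trans by blast
  have "(\<Prod>i<Suc k. a i) - (\<Prod>i<Suc k. b i) =
      ((\<Prod>i<k. a i) - (\<Prod>i<k. b i)) * a k + (\<Prod>i<k. b i) * (a k - b k)"
    by (simp add: algebra_simps)
  also have "cmod \<dots> \<le> cmod ((\<Prod>i<k. a i) - (\<Prod>i<k. b i)) * cmod (a k) + cmod (\<Prod>i<k. b i) * cmod (a k - b k)"
    by (metis norm_mult norm_triangle_ineq)
  also have "\<dots> \<le> (real k * R ^ k * e) * R + R ^ k * e"
  proof (intro add_mono mult_mono)
    show "cmod (\<Prod>i<k. b i) \<le> R ^ k"
      using prod_mono[of "{..<k}" "\<lambda>i. cmod (b i)" "\<lambda>_. R"] assms(2) by (simp add: prod_norm[symmetric])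
  qed (use Suc assms e in auto)
  also have "\<dots> \<le> (real k * R ^ k * e) * R + R ^ Suc k * e"
    using assms(4) e by (intro add_left_mono mult_right_mono) (auto simp: mult_le_cancel_right1)
  also have "\<dots> = real (Suc k) * R ^ Suc k * e"
    by (simp add: algebra_simps)
  finally show ?case .
qed auto

lemma minors_sum_diff_le:
  fixes A B :: "complex ^ 'n ^ 'm"
  assumes "\<And>i j. cmod (A $ i $ j) \<le> R" "\<And>i j. cmod (B $ i $ j) \<le> R"
    "\<And>i j. cmod (A $ i $ j - B $ i $ j) \<le> e" "R \<ge> 1"
  shows "\<bar>minors_sum k A - minors_sum k B\<bar> \<le> real (CARD('m) ^ k * CARD('n) ^ k) * fact k * (real k * R ^ k * e)"
proof -
  have *: "cmod (minor k A f g - minor k B f g) \<le> fact k * (real k * R ^ k * e)" for f g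
  proof -
    have "cmod (minor k A f g - minor k B f g) =
        cmod (\<Sum>p | p permutes {..<k}. of_int (sign p) * ((\<Prod>i<k. A $ f i $ g (p i)) - (\<Prod>i<k. B $ f i $ g (p i))))"
      by (simp add: minor_def sum_subtractf right_diff_distrib)
    also have "\<dots> \<le> (\<Sum>p | p permutes {..<k}. real k * R ^ k * e)"
      by (rule order_trans[OF norm_sum], rule sum_mono, simp add: norm_mult)
         (rule prod_diff_le, use assms in auto)
    finally show ?thesis
      by (simp add: card_permutations[of _ k])
  qed
  have "\<bar>minors_sum k A - minors_sum k B\<bar> =
     \<bar>\<Sum>f\<in>tuples k. \<Sum>g\<in>tuples k. cmod (minor k A f g) - cmod (minor k B f g)\<bar>"
    by (simp add: minors_sum_def sum_subtractf)
  also have "\<dots> \<le> (\<Sum>f\<in>(tuples k :: (nat \<Rightarrow> 'm) set). \<Sum>g\<in>(tuples k :: (nat \<Rightarrow> 'n) set). fact k * (real k * R ^ k * e))"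
    by (intro order_trans[OF sum_abs] sum_mono order_trans[OF norm_triangle_ineq3 *])
  finally show ?thesis
    by (simp add: card_tuples)
qed

section \<open>Minors of diagonal matrices and full-size minors\<close>

definition diag :: "('n \<Rightarrow> complex) \<Rightarrow> complex ^ 'n ^ 'n" where
  "diag d = (\<chi> i j. if i = j then d i else 0)"

lemma minor_diag_self:
  assumes "inj_on f {..<k}"
  shows "minor k (diag d) f f = (\<Prod>i<k. d (f i))"
proof -
  have "(\<Prod>i<k. diag d $ f i $ f (p i)) = 0" if "p permutes {..<k}" "p \<noteq> id" for p
  proof -
    obtain i where i: "p i \<noteq> i"
      using \<open>p \<noteq> id\<close> by fastforce
    then have "i < k" "p i < k"
      using that(1) permutes_not_in[OF that(1)] permutes_in_image[OF that(1), of i] by fastforce+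
    with i assms have "f i \<noteq> f (p i)"
      by (metis inj_onD lessThan_iff)
    then show ?thesis
      using \<open>i < k\<close> by (intro prod_zero) (auto simp: diag_def)
  qed
  then have "minor k (diag d) f f = (\<Sum>p\<in>{id}. of_int (sign p) * (\<Prod>i<k. diag d $ f i $ f (p i)))"
    unfolding minor_def by (intro sum.mono_neutral_right) (auto simp: permutes_id finite_permutations)
  then show ?thesis
    by (simp add: diag_def)
qed

lemma norm_minor_diag_le:
  "cmod (minor k (diag d) f g) \<le> fact k * (\<Prod>i<k. cmod (d (f i)))"
proof -
  have "cmod (minor k (diag d) f g) \<le> (\<Sum>p | p permutes {..<k}. (\<Prod>i<k. cmod (diag d $ f i $ g (p i))))"
    unfolding minor_def by (rule order_trans[OF norm_sum]) (simp add: norm_mult prod_norm[symmetric])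
  also have "\<dots> \<le> (\<Sum>p\<in>{p. p permutes {..<k}}. (\<Prod>i<k. cmod (d (f i))))"
    by (rule sum_mono, rule prod_mono) (simp add: diag_def)
  also have "\<dots> = fact k * (\<Prod>i<k. cmod (d (f i)))"
    by (simp add: card_permutations[of _ k])
  finally show ?thesis .
qed

lemma minors_sum_diag_le:
  fixes d :: "'n::finite \<Rightarrow> complex"
  assumes "\<And>f. inj_on f {..<k} \<Longrightarrow> (\<Prod>i<k. cmod (d (f i))) \<le> R" "R \<ge> 0"
  shows "minors_sum k (diag d) \<le> real (CARD('n) ^ k * CARD('n) ^ k) * fact k * R"
proof -
  have "cmod (minor k (diag d) f g) \<le> fact k * R" for f g
  proof (cases "inj_on f {..<k}")
    case True
    then show ?thesis
      by (intro order_trans[OF norm_minor_diag_le mult_left_mono] assms(1)) auto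
  qed (use assms in \<open>auto simp: minor_rows_not_inj\<close>)
  then have "minors_sum k (diag d) \<le>
      (\<Sum>f\<in>(tuples k :: (nat \<Rightarrow> 'n) set). \<Sum>g\<in>(tuples k :: (nat \<Rightarrow> 'n) set). fact k * R)"
    unfolding minors_sum_def by (intro sum_mono)
  then show ?thesis
    by (simp add: card_tuples)
qed

text \<open>The enumeration \<open>e\<close> carries permutations of \<open>{..<k}\<close> to
  permutations of the index type and preserves signs.\<close>

lemma det_eq_minor:
  fixes A :: "complex ^ 'n ^ 'n"
  assumes e: "bij_betw e {..<k} (UNIV :: 'n set)"
  shows "det A = minor k A e e"
proof -
  let ?m = "map_permutation {..<k} e"
  have m: "?m p = (\<lambda>x. e (p (inv_into {..<k} e x)))" for p
    using bij_betw_imp_surj_on[OF e] by (auto simp: map_permutation_def restrict_id_def fun_eq_iff)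
  have bij: "bij_betw ?m {p. p permutes {..<k}} {p. p permutes (UNIV :: 'n set)}"
    using bij_betw_permutations[OF e] by (simp add: m[abs_def])
  have "minor k A e e = (\<Sum>p | p permutes {..<k}. of_int (sign (?m p)) * (\<Prod>i\<in>UNIV. A $ i $ ?m p i))"
    unfolding minor_def
  proof (rule sum.cong, safe)
    fix p assume p: "p permutes {..<k}"
    have "sign (?m p) = sign p"
      using p e by (intro sign_map_permutation) (auto simp: bij_betw_def)
    moreover have "(\<Prod>i\<in>UNIV. A $ i $ ?m p i) = (\<Prod>i<k. A $ e i $ ?m p (e i))"
      using prod.reindex_bij_betw[OF e, of "\<lambda>i. A $ i $ ?m p i"] by simp
    moreover have "?m p (e i) = e (p i)" if "i < k" for i
      using that e by (simp add: m bij_betw_def)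
    ultimately show "of_int (sign p) * (\<Prod>i<k. A $ e i $ e (p i)) =
        of_int (sign (?m p)) * (\<Prod>i\<in>UNIV. A $ i $ ?m p i)"
      by simp
  qed
  also have "\<dots> = det A"
    unfolding det_def
    using sum.reindex_bij_betw[OF bij, of "\<lambda>p. of_int (sign p) * (\<Prod>i\<in>UNIV. A $ i $ p i)"] by simp
  finally show ?thesis ..
qed

lemma minor_bij_rows:
  assumes e: "bij_betw e {..<k} (UNIV :: 'n set)" and f: "bij_betw f {..<k} (UNIV :: 'n set)"
  shows "cmod (minor k (A :: complex ^ 'l ^ 'n) f g) = cmod (minor k A e g)"
proof -
  define q where "q i = (if i < k then inv_into {..<k} e (f i) else i)" for i
  have "bij_betw (inv_into {..<k} e \<circ> f) {..<k} {..<k}"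
    using bij_betw_inv_into[OF e] f bij_betw_trans by blast
  then have "bij_betw q {..<k} {..<k}"
    by (subst bij_betw_cong[of _ _ "inv_into {..<k} e \<circ> f"]) (auto simp: q_def)
  then have q: "q permutes {..<k}"
    by (intro bij_imp_permutes) (auto simp: q_def)
  have "restrict f {..<k} = restrict (e \<circ> q) {..<k}"
  proof
    fix i
    have "f i \<in> e ` {..<k}"
      using bij_betw_imp_surj_on[OF e] by simp
    then show "restrict f {..<k} i = restrict (e \<circ> q) {..<k} i"
      by (auto simp: q_def f_inv_into_f)
  qed
  then have "minor k A f g = minor k A (e \<circ> q) g"
    by (metis minor_restrict)
  then show ?thesis
    using minor_comp_rows[OF q, of A e g] by (simp add: norm_mult)
qed

lemma norm_minor_eq_det:
  fixes A :: "complex ^ 'n ^ 'n"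
  assumes "inj_on f {..<CARD('n)}" "inj_on g {..<CARD('n)}"
  shows "cmod (minor CARD('n) A f g) = cmod (det A)"
proof -
  have bij: "bij_betw h {..<CARD('n)} (UNIV :: 'n set)" if "inj_on h {..<CARD('n)}" for h
    using that by (simp add: bij_betw_def card_image card_subset_eq)
  note f = bij[OF assms(1)] and g = bij[OF assms(2)]
  have "cmod (minor CARD('n) A f g) = cmod (minor CARD('n) A g g)"
    by (rule minor_bij_rows[OF g f])
  then show ?thesis
    by (simp add: det_eq_minor[OF g])
qed

text \<open>A full-size minor is \<open>det A\<close> up to sign, or 0 when an index repeats; the
  factor counts the pairs of tuples.\<close>

lemma minors_sum_le_det:
  fixes A :: "complex ^ 'n ^ 'n"
  shows "minors_sum CARD('n) A \<le> CARD('n) ^ CARD('n) * CARD('n) ^ CARD('n) * cmod (det A)"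
proof -
  have "cmod (minor CARD('n) A f g) \<le> cmod (det A)" for f g
    using norm_minor_eq_det[of f g A]
    by (cases "inj_on f {..<CARD('n)}"; cases "inj_on g {..<CARD('n)}")
       (auto simp: minor_rows_not_inj minor_cols_not_inj)
  then have "minors_sum CARD('n) A \<le>
      (\<Sum>f\<in>(tuples CARD('n) :: (nat \<Rightarrow> 'n) set). \<Sum>g\<in>(tuples CARD('n) :: (nat \<Rightarrow> 'n) set). cmod (det A))"
    unfolding minors_sum_def by (intro sum_mono)
  then show ?thesis
    by (simp add: card_tuples)
qed

lemma det_submatrix_le_minors_sum:
  fixes A :: "complex ^ 'n ^ 'm" and r :: "'d::finite \<Rightarrow> 'm" and c :: "'d \<Rightarrow> 'n"
  shows "cmod (det (\<chi> i j. A $ r i $ c j :: complex ^ 'd ^ 'd)) \<le> minors_sum CARD('d) A"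
proof -
  obtain e where e: "bij_betw e {..<CARD('d)} (UNIV :: 'd set)"
    using ex_bij_betw_nat_finite[of "UNIV :: 'd set"] by (auto simp: atLeast0LessThan)
  have "det (\<chi> i j. A $ r i $ c j :: complex ^ 'd ^ 'd) = minor CARD('d) A (r \<circ> e) (c \<circ> e)"
    by (simp add: det_eq_minor[OF e] minor_def)
  then show ?thesis
    using minor_le_minors_sum' by simp
qed

lemma norm_det_le:
  fixes A :: "complex ^ 'n ^ 'n"
  assumes "\<And>i j. cmod (A $ i $ j) \<le> R"
  shows "cmod (det A) \<le> fact CARD('n) * R ^ CARD('n)"
proof -
  obtain e where e: "bij_betw e {..<CARD('n)} (UNIV :: 'n set)"
    using ex_bij_betw_nat_finite[of "UNIV :: 'n set"] by (auto simp: atLeast0LessThan)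
  show ?thesis
    unfolding det_eq_minor[OF e] by (rule norm_minor_le[OF assms])
qed

lemma matrix_vector_mult_axis:
  fixes A :: "'a::semiring_1 ^ 'n ^ 'm"
  shows "A *v axis j 1 = column j A"
  by (simp add: vec_eq_iff matrix_vector_mult_def column_def axis_def if_distrib[of "(*) _"] cong: if_cong)

lemma norm_entry_le:
  fixes A :: "complex ^ 'n ^ 'm"
  assumes "\<And>x. norm (A *v x) \<le> R * norm x"
  shows "cmod (A $ i $ j) \<le> R"
proof -
  have "cmod (A $ i $ j) = cmod ((A *v axis j 1) $ i)"
    by (simp add: matrix_vector_mult_axis column_def)
  also have "\<dots> \<le> norm (A *v axis j 1)"
    by (rule Finite_Cartesian_Product.norm_nth_le)
  also have "\<dots> \<le> R * norm (axis j (1::complex) :: complex ^ 'n)"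
    by (rule assms)
  also have "norm (axis j (1::complex) :: complex ^ 'n) = 1"
    by (simp add: norm_vec_def L2_set_def axis_def if_distrib[of norm] if_distrib[of "\<lambda>x. x\<^sup>2"] cong: if_cong)
  finally show ?thesis
    by simp
qed

section \<open>Hermitian geometry\<close>

lemma cinner_add_left: "cinner (x + y) w = cinner x w + cinner y w"
  by (simp add: cinner_def algebra_simps sum.distrib)

lemma cinner_commute: "cinner y x = cnj (cinner x y)"
  by (simp add: cinner_def mult.commute)

lemma cinner_add_right: "cinner w (x + y) = cinner w x + cinner w y"
  by (simp add: cinner_def algebra_simps sum.distrib)

lemma cinner_diff_right: "cinner w (x - y) = cinner w x - cinner w y"
  by (simp add: cinner_def algebra_simps sum_subtractf)

lemma cinner_scale_right: "cinner w (c *s x) = cnj c * cinner w x"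
  by (simp add: cinner_def sum_distrib_left mult_ac)

lemma cinner_zero [simp]: "cinner 0 x = 0" "cinner x 0 = 0"
  by (simp_all add: cinner_def)

lemma cinner_sum_left: "cinner (\<Sum>i\<in>I. f i) w = (\<Sum>i\<in>I. cinner (f i) w)"
  by (induction I rule: infinite_finite_induct) (simp_all add: cinner_add_left)

lemma norm_cinner_le: "cmod (cinner x y) \<le> norm x * norm y"
proof -
  have "cmod (cinner x y) \<le> (\<Sum>i\<in>UNIV. \<bar>cmod (x $ i)\<bar> * \<bar>cmod (y $ i)\<bar>)"
    unfolding cinner_def by (rule order_trans[OF norm_sum]) (simp add: norm_mult)
  also have "\<dots> \<le> norm x * norm y"
    unfolding norm_vec_def by (rule L2_set_mult_ineq)
  finally show ?thesis .
qed

lemma norm_scale_complex: "norm (c *s x :: complex ^ 'n) = cmod c * norm x"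
proof -
  have "of_real ((norm (c *s x))\<^sup>2) = (of_real ((cmod c * norm x)\<^sup>2) :: complex)"
    by (simp only: cinner_self[symmetric] power_mult_distrib of_real_mult complex_norm_square
        cinner_scale_left cinner_scale_right mult_ac)
  then have "(norm (c *s x))\<^sup>2 = (cmod c * norm x)\<^sup>2"
    by (simp only: of_real_eq_iff)
  then show ?thesis
    by simp
qed

lemma norm_add_scale_complex:
  "(norm (a + q *s b))\<^sup>2 = (norm a)\<^sup>2 + 2 * Re (cnj q * cinner a b) + (cmod q)\<^sup>2 * (norm b)\<^sup>2"
proof -
  have "complex_of_real ((norm (a + q *s b))\<^sup>2) =
      cinner a a + (cnj q * cinner a b + cnj (cnj q * cinner a b)) + (q * cnj q) * cinner b b"
    by (simp only: cinner_self[symmetric] cinner_add_left cinner_add_right cinner_scale_left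
        cinner_scale_right cinner_commute[of b a] complex_cnj_mult complex_cnj_cnj) (simp add: algebra_simps)
  also have "\<dots> = of_real ((norm a)\<^sup>2 + 2 * Re (cnj q * cinner a b) + (cmod q)\<^sup>2 * (norm b)\<^sup>2)"
    by (simp only: cinner_self complex_add_cnj complex_norm_square[symmetric] of_real_add of_real_mult)
  finally show ?thesis
    by (simp only: of_real_eq_iff)
qed

lemma cinner_orth_span:
  assumes "\<And>b. b \<in> B \<Longrightarrow> cinner y b = 0" "w \<in> vec.span B"
  shows "cinner y w = 0"
  using assms(2)
  by (induction rule: vec.span_induct_alt) (simp_all add: cinner_add_right cinner_scale_right assms(1))

lemma vec_subspace_imp_subspace:
  assumes "vec.subspace (U :: (complex ^ 'n) set)"
  shows "subspace U"
proof (rule subspaceI)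
  fix c :: real and x assume "x \<in> U"
  have "c *\<^sub>R x = complex_of_real c *s x"
    by (simp add: vec_eq_iff scaleR_conv_of_real[where 'a = complex])
  with \<open>x \<in> U\<close> assms show "c *\<^sub>R x \<in> U"
    by (simp add: vec.subspace_scale)
qed (use assms in \<open>simp_all add: vec.subspace_0 vec.subspace_add\<close>)

lemma continuous_on_matrix_vector_mult:
  fixes A :: "complex ^ 'n ^ 'm"
  shows "continuous_on S (\<lambda>x. A *v x)"
  unfolding matrix_vector_mult_def
  by (intro continuous_on_vec_lambda continuous_intros)

section \<open>Orthonormal families and singular value decomposition\<close>

definition orthonormal_on :: "nat set \<Rightarrow> (nat \<Rightarrow> complex ^ 'n) \<Rightarrow> bool" where
  "orthonormal_on I v \<longleftrightarrow> (\<forall>i\<in>I. \<forall>j\<in>I. cinner (v i) (v j) = of_bool (i = j))"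

lemma orthonormal_on_inj: "orthonormal_on I v \<Longrightarrow> inj_on v I"
  unfolding orthonormal_on_def inj_on_def by (metis of_bool_eq(1) of_bool_eq(2) zero_neq_one)

lemma orthonormal_on_subset: "orthonormal_on I v \<Longrightarrow> J \<subseteq> I \<Longrightarrow> orthonormal_on J v"
  unfolding orthonormal_on_def by blast

lemma dim_span_orthonormal:
  assumes "orthonormal_on I v"
  shows "vec.dim (vec.span (v ` I)) = card I"
proof -
  have "vec.independent (v ` I)"
  proof
    assume "vec.dependent (v ` I)"
    then obtain i where i: "i \<in> I" "v i \<in> vec.span (v ` I - {v i})"
      unfolding vec.dependent_def by blast
    have "cinner (v i) b = 0" if "b \<in> v ` I - {v i}" for b
      using that i(1) assms unfolding orthonormal_on_def by auto
    then have "cinner (v i) (v i) = 0"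
      using cinner_orth_span[OF _ i(2)] by blast
    then show False
      using i(1) assms unfolding orthonormal_on_def by auto
  qed
  then show ?thesis
    using card_image[OF orthonormal_on_inj[OF assms]] by (simp add: vec.dim_eq_card_independent)
qed

lemma orthonormal_on_expansion:
  assumes "orthonormal_on I v" "finite I" "x \<in> vec.span (v ` I)"
  shows "x = (\<Sum>i\<in>I. cinner x (v i) *s v i)"
proof -
  define y where "y = x - (\<Sum>i\<in>I. cinner x (v i) *s v i)"
  have "y \<in> vec.span (v ` I)"
    unfolding y_def by (intro vec.span_diff[OF assms(3)] vec.span_sum vec.span_scale vec.span_base) auto
  moreover have "cinner y (v j) = 0" if "j \<in> I" for j
  proof -
    have "(\<Sum>i\<in>I. cinner x (v i) * cinner (v i) (v j)) = (\<Sum>i\<in>I. if i = j then cinner x (v i) else 0)"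
      using assms(1) that unfolding orthonormal_on_def by (intro sum.cong) auto
    then show ?thesis
      using that assms(2) by (simp add: y_def cinner_diff_left cinner_sum_left cinner_scale_left)
  qed
  ultimately have "cinner y y = 0"
    using cinner_orth_span[of "v ` I" y y] by blast
  then show ?thesis
    by (simp add: y_def cinner_self)
qed

text \<open>Right singular vectors of the restriction of \<open>A\<close> to \<open>U\<close>, in
  decreasing order of their values. The last clause places \<open>v i\<close> in
  \<open>singular_space U A (s i)\<close>, which ties the decomposition to the multiplicities behind
  \<open>sv_on\<close>.\<close>

definition singular_basis ::
  "(complex ^ 'n) set \<Rightarrow> complex ^ 'n ^ 'm \<Rightarrow> nat \<Rightarrow> (nat \<Rightarrow> complex ^ 'n) \<Rightarrow> (nat \<Rightarrow> real) \<Rightarrow> bool" where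
  "singular_basis U A d v s \<longleftrightarrow> orthonormal_on {..<d} v \<and> U = vec.span (v ` {..<d}) \<and>
     (\<forall>i<d. 0 \<le> s i) \<and> (\<forall>j<d. \<forall>i\<le>j. s j \<le> s i) \<and>
     (\<forall>i<d. \<forall>w\<in>U. cinner (A *v v i) (A *v w) = of_real ((s i)\<^sup>2) * cinner (v i) w)"

text \<open>A unit vector at which \<open>\<parallel>A v\<parallel>\<close> is maximal is a singular vector; its orthogonal
  complement is treated recursively.\<close>

lemma maximizer_singular:
  fixes A :: "complex ^ 'n ^ 'm"
  assumes U: "vec.subspace U" and v: "v \<in> U" "norm v = 1"
    and max: "\<And>w. w \<in> U \<Longrightarrow> norm (A *v w) \<le> s * norm w" and s: "norm (A *v v) = s"
    and w: "w \<in> U"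
  shows "cinner (A *v v) (A *v w) = of_real (s\<^sup>2) * cinner v w"
proof -
  have orth: "cinner (A *v v) (A *v w) = 0" if w: "w \<in> U" "cinner v w = 0" for w
  proof (rule ccontr)
    let ?k = "cinner (A *v v) (A *v w)"
    assume k: "?k \<noteq> 0"
    define K where "K = (s\<^sup>2 * (norm w)\<^sup>2)"
    \<comment> \<open>Maximality is tested at \<open>v\<close> perturbed by \<open>t * ?k\<close>
      times \<open>w\<close>: the gain is linear in \<open>t\<close> and the cost quadratic, so a
      small \<open>t\<close> contradicts \<open>?k \<noteq> 0\<close>.\<close>
    have *: "2 * t * (cmod ?k)\<^sup>2 \<le> t\<^sup>2 * (cmod ?k)\<^sup>2 * K" for t :: real
    proof -
      let ?x = "v + (of_real t * ?k) *s w"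
      have x: "?x \<in> U"
        using U v w by (intro vec.subspace_add vec.subspace_scale) auto
      have nx: "(norm ?x)\<^sup>2 = 1 + t\<^sup>2 * (cmod ?k)\<^sup>2 * (norm w)\<^sup>2"
        unfolding norm_add_scale_complex by (simp add: v(2) w(2) norm_mult power_mult_distrib)
      have "A *v ?x = A *v v + (of_real t * ?k) *s (A *v w)"
        by (simp add: matrix_vector_right_distrib vector_scalar_commute)
      moreover have "Re (cnj (of_real t * ?k) * ?k) = t * (cmod ?k)\<^sup>2"
        unfolding cmod_power2 by (simp add: power2_eq_square algebra_simps)
      ultimately have nAx: "(norm (A *v ?x))\<^sup>2 = s\<^sup>2 + 2 * t * (cmod ?k)\<^sup>2 + t\<^sup>2 * (cmod ?k)\<^sup>2 * (norm (A *v w))\<^sup>2"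
        by (simp add: norm_add_scale_complex s norm_mult power_mult_distrib del: complex_cnj_mult times_complex.sel)
      have "(norm (A *v ?x))\<^sup>2 \<le> s\<^sup>2 * (norm ?x)\<^sup>2"
        using power_mono[OF max[OF x], of 2] by (simp add: power_mult_distrib)
      then have "2 * t * (cmod ?k)\<^sup>2 + t\<^sup>2 * (cmod ?k)\<^sup>2 * (norm (A *v w))\<^sup>2 \<le> t\<^sup>2 * (cmod ?k)\<^sup>2 * K"
        unfolding nx nAx K_def by (simp add: algebra_simps)
      moreover have "0 \<le> t\<^sup>2 * (cmod ?k)\<^sup>2 * (norm (A *v w))\<^sup>2"
        by simp
      ultimately show ?thesis
        by linarith
    qed
    have K: "K \<ge> 0"
      by (simp add: K_def)
    define t where "t = 1 / (K + 1)"
    have "t > 0" "t * K < 2"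
      using K by (simp_all add: t_def field_simps)
    then have "t * (t * K) * (cmod ?k)\<^sup>2 < t * 2 * (cmod ?k)\<^sup>2"
      using k by (intro mult_strict_right_mono mult_strict_left_mono) auto
    with *[of t] show False
      by (simp add: power2_eq_square mult_ac)
  qed
  \<comment> \<open>Subtracting the component along \<open>v\<close> reduces the claim to the
    orthogonal case; \<open>cnj\<close> appears because \<open>cinner\<close> is conjugate-linear in
    its second argument.\<close>
  let ?w = "w - cnj (cinner v w) *s v"
  have vv: "cinner v v = 1"
    using v(2) by (simp add: cinner_self)
  have "?w \<in> U"
    using U v w by (intro vec.subspace_diff vec.subspace_scale) auto
  moreover have "cinner v ?w = 0"
    by (simp add: cinner_diff_right cinner_scale_right vv)
  ultimately have "cinner (A *v v) (A *v ?w) = 0"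
    by (rule orth)
  moreover have "A *v ?w = A *v w - cnj (cinner v w) *s (A *v v)"
    by (simp add: matrix_vector_mult_diff_distrib vector_scalar_commute)
  ultimately show ?thesis
    by (simp add: cinner_diff_right cinner_scale_right cinner_self s)
qed

lemma singular_basis_exists:
  fixes A :: "complex ^ 'n ^ 'm"
  assumes "vec.subspace U"
  shows "\<exists>d v s. singular_basis U A d v s"
  using assms
proof (induction "vec.dim U" arbitrary: U rule: less_induct)
  case less
  note U = less.prems
  show ?case
  proof (cases "U \<subseteq> {0}")
    case True
    then have "U = {0}"
      using vec.subspace_0[OF U] by auto
    then have "singular_basis U A 0 v s" for v s
      by (simp add: singular_basis_def orthonormal_on_def)
    then show ?thesis
      by blast
  next
    case False
    then obtain u where u: "u \<in> U" "u \<noteq> 0"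
      by blast
    let ?S = "U \<inter> sphere 0 1"
    have "of_real (1 / norm u) *s u \<in> ?S"
      using u U by (simp add: vec.subspace_scale norm_scale_complex norm_divide)
    moreover have "compact ?S"
      using closed_subspace[OF vec_subspace_imp_subspace[OF U]] by (intro closed_Int_compact) auto
    ultimately obtain v0 where v0: "v0 \<in> ?S" "\<And>w. w \<in> ?S \<Longrightarrow> norm (A *v w) \<le> norm (A *v v0)"
      using continuous_attains_sup[of ?S "\<lambda>x. norm (A *v x)"]
      by (metis continuous_on_matrix_vector_mult continuous_on_norm empty_iff)
    define s0 where "s0 = norm (A *v v0)"
    have v0': "v0 \<in> U" "norm v0 = 1"
      using v0(1) by auto
    have vv: "cinner v0 v0 = 1"
      using v0'(2) by (simp add: cinner_self)
    have max: "norm (A *v w) \<le> s0 * norm w" if w: "w \<in> U" for w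
    proof (cases "w = 0")
      case False
      have "of_real (1 / norm w) *s w \<in> ?S"
        using w False U by (simp add: vec.subspace_scale norm_scale_complex norm_divide)
      from v0(2)[OF this] have "norm (A *v w) / norm w \<le> s0"
        by (simp add: vector_scalar_commute norm_scale_complex norm_divide s0_def)
      then show ?thesis
        using False by (simp add: divide_le_eq)
    qed auto
    have sing: "cinner (A *v v0) (A *v w) = of_real (s0\<^sup>2) * cinner v0 w" if "w \<in> U" for w
      by (rule maximizer_singular[OF U v0' max _ that]) (simp_all add: s0_def)
    define U' where "U' = {w \<in> U. cinner v0 w = 0}"
    have U': "vec.subspace U'"
      using U unfolding U'_def vec.subspace_def by (simp add: cinner_add_right cinner_scale_right)
    have "v0 \<notin> U'" "U' \<subseteq> U"
      using vv by (auto simp: U'_def)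
    then have "vec.dim U' < vec.dim U"
      using v0' vec.dim_psubset[of U' U] U U' by (metis psubsetI vec.span_eq_iff)
    from less.hyps[OF this U'] obtain d v s where b: "singular_basis U' A d v s"
      by blast
    have vU: "v i \<in> U'" if "i < d" for i
      using b that vec.span_base[of "v i" "v ` {..<d}"] by (auto simp: singular_basis_def)
    define v' where "v' = case_nat v0 v"
    define s' where "s' = case_nat s0 s"
    have img: "v' ` {..<Suc d} = insert v0 (v ` {..<d})"
      by (auto simp: v'_def lessThan_Suc_eq_insert_0 image_image)
    have orth: "cinner v0 (v i) = 0" "cinner (v i) v0 = 0" if "i < d" for i
      using vU[OF that] cinner_commute[of "v i" v0] by (auto simp: U'_def)
    have si: "s i \<le> s0" if "i < d" for i
    proof -
      have "v i \<in> U'" "cinner (v i) (v i) = 1"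
        using that b vU by (auto simp: singular_basis_def orthonormal_on_def)
      then have "(norm (v i))\<^sup>2 = 1"
        by (metis cinner_self of_real_eq_1_iff)
      then have n: "norm (v i) = 1"
        by (simp add: power2_eq_1_iff) (smt (verit) norm_ge_zero)
      have "cinner (A *v v i) (A *v v i) = of_real ((s i)\<^sup>2)"
        using b that \<open>v i \<in> U'\<close> \<open>cinner (v i) (v i) = 1\<close> by (simp add: singular_basis_def)
      then have "(norm (A *v v i))\<^sup>2 = (s i)\<^sup>2"
        by (simp only: cinner_self of_real_eq_iff)
      then have "s i = norm (A *v v i)"
        using b that by (simp add: singular_basis_def)
      then show ?thesis
        using max[of "v i"] n vU[OF that] by (simp add: U'_def)
    qed
    have "singular_basis U A (Suc d) v' s'"
      unfolding singular_basis_def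
    proof (intro conjI allI impI ballI)
      show "orthonormal_on {..<Suc d} v'"
        using b orth vv unfolding orthonormal_on_def singular_basis_def
        by (auto simp: v'_def split: nat.splits)
      show "U = vec.span (v' ` {..<Suc d})"
      proof
        show "vec.span (v' ` {..<Suc d}) \<subseteq> U"
          unfolding img using U v0' vU by (intro vec.span_minimal) (auto simp: U'_def)
        show "U \<subseteq> vec.span (v' ` {..<Suc d})"
        proof
          fix w assume w: "w \<in> U"
          let ?w = "w - cnj (cinner v0 w) *s v0"
          have "?w \<in> U'"
            unfolding U'_def using w U v0'
            by (simp add: cinner_diff_right cinner_scale_right vv vec.subspace_diff vec.subspace_scale)
          then have "?w \<in> vec.span (v' ` {..<Suc d})"
            using b unfolding img singular_basis_def
            by (metis subsetD vec.span_mono subset_insertI)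
          moreover have "cnj (cinner v0 w) *s v0 \<in> vec.span (v' ` {..<Suc d})"
            unfolding img by (intro vec.span_scale vec.span_base) auto
          ultimately have "?w + cnj (cinner v0 w) *s v0 \<in> vec.span (v' ` {..<Suc d})"
            by (rule vec.span_add)
          then show "w \<in> vec.span (v' ` {..<Suc d})"
            by simp
        qed
      qed
      show "0 \<le> s' i" if "i < Suc d" for i
        using that b by (auto simp: s'_def s0_def singular_basis_def split: nat.splits)
      show "s' j \<le> s' i" if "j < Suc d" "i \<le> j" for i j
        using that b si by (auto simp: s'_def singular_basis_def split: nat.splits)
      show "cinner (A *v v' i) (A *v w) = of_real ((s' i)\<^sup>2) * cinner (v' i) w"
        if i: "i < Suc d" and w: "w \<in> U" for i w
      proof (cases i)
        case 0
        then show ?thesis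
          using sing[OF w] by (simp add: v'_def s'_def)
      next
        case (Suc k)
        then have k: "k < d"
          using i by simp
        let ?w = "w - cnj (cinner v0 w) *s v0"
        have "?w \<in> U'"
          unfolding U'_def using w U v0'
          by (simp add: cinner_diff_right cinner_scale_right vv vec.subspace_diff vec.subspace_scale)
        then have *: "cinner (A *v v k) (A *v ?w) = of_real ((s k)\<^sup>2) * cinner (v k) ?w"
          using b k unfolding singular_basis_def by blast
        have "cinner (A *v v0) (A *v v k) = 0"
          using sing[of "v k"] vU[OF k] by (simp add: U'_def)
        then have "cinner (A *v v k) (A *v v0) = 0"
          using cinner_commute[of "A *v v k" "A *v v0"] by simp
        then have "cinner (A *v v k) (A *v ?w) = cinner (A *v v k) (A *v w)"
          by (simp add: matrix_vector_mult_diff_distrib vector_scalar_commute cinner_diff_right cinner_scale_right)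
        moreover have "cinner (v k) ?w = cinner (v k) w"
          using orth[OF k] by (simp add: cinner_diff_right cinner_scale_right)
        ultimately show ?thesis
          using * Suc by (simp add: v'_def s'_def)
      qed
    qed
    then show ?thesis
      by blast
  qed
qed

lemma singular_basis_dim:
  assumes "singular_basis U A d v s"
  shows "vec.dim U = d"
  using assms dim_span_orthonormal[of "{..<d}" v] by (simp add: singular_basis_def)

text \<open>Singular vectors for different values are orthogonal: evaluating the form on
  \<open>x\<close> and \<open>v i\<close> from either side gives \<open>\<sigma>\<^sup>2 * cinner x
  (v i) = (s i)\<^sup>2 * cinner x (v i)\<close>.\<close>

lemma singular_basis_space:
  assumes b: "singular_basis U A d v s" and "\<sigma> \<ge> 0"
  shows "singular_space U A \<sigma> = vec.span (v ` {i. i < d \<and> s i = \<sigma>})"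
proof
  have o: "orthonormal_on {..<d} v" and U: "U = vec.span (v ` {..<d})"
    and s: "\<And>i. i < d \<Longrightarrow> 0 \<le> s i"
    and sing: "\<And>i w. i < d \<Longrightarrow> w \<in> U \<Longrightarrow> cinner (A *v v i) (A *v w) = of_real ((s i)\<^sup>2) * cinner (v i) w"
    using b by (auto simp: singular_basis_def)
  have vU: "v i \<in> U" if "i < d" for i
    using that unfolding U by (intro vec.span_base) auto
  have "vec.subspace U"
    unfolding U by simp
  then have "vec.subspace (singular_space U A \<sigma>)"
    unfolding singular_space_def vec.subspace_def
    by (simp add: cinner_add_left cinner_scale_left matrix_vector_right_distrib vector_scalar_commute
        algebra_simps)
  then show "vec.span (v ` {i. i < d \<and> s i = \<sigma>}) \<subseteq> singular_space U A \<sigma>"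
    by (intro vec.span_minimal) (auto simp: singular_space_def sing vU)
  show "singular_space U A \<sigma> \<subseteq> vec.span (v ` {i. i < d \<and> s i = \<sigma>})"
  proof
    fix x assume x: "x \<in> singular_space U A \<sigma>"
    then have xU: "x \<in> U"
      by (simp add: singular_space_def)
    have "cinner x (v i) *s v i \<in> vec.span (v ` {i. i < d \<and> s i = \<sigma>})" if i: "i < d" for i
    proof (cases "s i = \<sigma>")
      case True
      then show ?thesis
        using i by (intro vec.span_scale vec.span_base) auto
    next
      case False
      have "of_real (\<sigma>\<^sup>2) * cinner x (v i) = cinner (A *v x) (A *v v i)"
        using x vU[OF i] by (simp add: singular_space_def)
      also have "\<dots> = cnj (of_real ((s i)\<^sup>2) * cinner (v i) x)"
        by (subst cinner_commute) (simp only: sing[OF i xU])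
      also have "\<dots> = of_real ((s i)\<^sup>2) * cinner x (v i)"
        using cinner_commute[of x "v i"] by simp
      finally have "cinner x (v i) = 0 \<or> of_real (\<sigma>\<^sup>2) = (of_real ((s i)\<^sup>2) :: complex)"
        by (simp only: mult_cancel_right)
      moreover have "\<sigma>\<^sup>2 \<noteq> (s i)\<^sup>2"
        using False s[OF i] \<open>\<sigma> \<ge> 0\<close> by (simp add: power2_eq_iff_nonneg)
      ultimately have "cinner x (v i) = 0"
        by (simp only: of_real_eq_iff) blast
      then show ?thesis
        by (simp add: vec.span_zero)
    qed
    then have "(\<Sum>i<d. cinner x (v i) *s v i) \<in> vec.span (v ` {i. i < d \<and> s i = \<sigma>})"
      by (intro vec.span_sum) auto
    moreover have "x = (\<Sum>i<d. cinner x (v i) *s v i)"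
      using orthonormal_on_expansion[OF o finite_lessThan] xU U by simp
    ultimately show "x \<in> vec.span (v ` {i. i < d \<and> s i = \<sigma>})"
      by simp
  qed
qed

text \<open>The multiplicity of a value is the number of indices at which \<open>s\<close> takes it,
  so sorting the multiset of singular values recovers the list of the \<open>s i\<close>.
  \<open>sv_on\<close> counts from 1 and \<open>s\<close> from 0.\<close>

lemma sv_on_eq:
  assumes b: "singular_basis U A d v s" and j: "1 \<le> j" "j \<le> d"
  shows "sv_on U j A = s (j - 1)"
proof -
  have o: "orthonormal_on {..<d} v" and s: "\<And>i. i < d \<Longrightarrow> 0 \<le> s i"
    and mono: "\<And>i j. j < d \<Longrightarrow> i \<le> j \<Longrightarrow> s j \<le> s i"
    using b by (auto simp: singular_basis_def)
  have mult: "singular_multiplicity U A \<sigma> = card {i. i < d \<and> s i = \<sigma>}" if "\<sigma> \<ge> 0" for \<sigma>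
    unfolding singular_multiplicity_def singular_basis_space[OF b that]
    by (intro dim_span_orthonormal orthonormal_on_subset[OF o]) auto
  have fin: "finite {i. i < d \<and> s i = \<sigma>}" for \<sigma>
    by simp
  have set: "{\<sigma>. 0 \<le> \<sigma> \<and> singular_multiplicity U A \<sigma> > 0} = s ` {..<d}"
    using s by (auto simp: mult card_gt_0_iff)
  have "singular_values_on U A = mset (map s [0..<d])"
  proof (rule multiset_eqI)
    fix \<sigma>
    have "count (singular_values_on U A) \<sigma> =
        (\<Sum>\<tau>\<in>s ` {..<d}. if \<sigma> = \<tau> then singular_multiplicity U A \<tau> else 0)"
      unfolding singular_values_on_def set count_sum by (intro sum.cong) auto
    also have "\<dots> = (if \<sigma> \<in> s ` {..<d} then singular_multiplicity U A \<sigma> else 0)"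
      by simp
    also have "\<dots> = card {i. i < d \<and> s i = \<sigma>}"
    proof (cases "\<sigma> \<in> s ` {..<d}")
      case True
      then have "\<sigma> \<ge> 0"
        using s by auto
      then show ?thesis
        using True by (simp add: mult)
    next
      case False
      then have "{i. i < d \<and> s i = \<sigma>} = {}"
        by auto
      then show ?thesis
        using False by simp
    qed
    also have "\<dots> = count (mset (map s [0..<d])) \<sigma>"
    proof (induction d)
      case (Suc d)
      have "{i. i < Suc d \<and> s i = \<sigma>} = (if s d = \<sigma> then insert d {i. i < d \<and> s i = \<sigma>} else {i. i < d \<and> s i = \<sigma>})"
        by (auto simp: less_Suc_eq)
      then show ?case
        using Suc by simp
    qed simp
    finally show "count (singular_values_on U A) \<sigma> = count (mset (map s [0..<d])) \<sigma>" .
  qed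
  moreover have "sort (map s [0..<d]) = rev (map s [0..<d])"
    by (rule properties_for_sort) (auto simp: sorted_wrt_iff_nth_less rev_nth intro!: mono)
  ultimately have "rev (sorted_list_of_multiset (singular_values_on U A)) = map s [0..<d]"
    by (simp only: sorted_list_of_multiset_mset rev_rev_ident)
  then show ?thesis
    using j by (simp add: sv_on_def)
qed

lemma singular_basis_norm:
  assumes b: "singular_basis U A d v s" and x: "x \<in> U"
  shows "(norm x)\<^sup>2 = (\<Sum>i<d. (cmod (cinner x (v i)))\<^sup>2)"
    and "(norm (A *v x))\<^sup>2 = (\<Sum>i<d. (s i)\<^sup>2 * (cmod (cinner x (v i)))\<^sup>2)"
proof -
  have o: "orthonormal_on {..<d} v" and U: "U = vec.span (v ` {..<d})"
    and sing: "\<And>i w. i < d \<Longrightarrow> w \<in> U \<Longrightarrow> cinner (A *v v i) (A *v w) = of_real ((s i)\<^sup>2) * cinner (v i) w"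
    using b by (auto simp: singular_basis_def)
  have e: "(\<Sum>i<d. cinner x (v i) *s v i) = x"
    using orthonormal_on_expansion[OF o, of x] x U by simp
  have "of_real ((norm x)\<^sup>2) = cinner (\<Sum>i<d. cinner x (v i) *s v i) x"
    by (simp only: e cinner_self)
  also have "\<dots> = (\<Sum>i<d. cinner x (v i) * cnj (cinner x (v i)))"
    by (simp only: cinner_sum_left cinner_scale_left cinner_commute[of "v _" x])
  also have "\<dots> = of_real (\<Sum>i<d. (cmod (cinner x (v i)))\<^sup>2)"
    by (simp only: complex_norm_square[symmetric] of_real_sum)
  finally show "(norm x)\<^sup>2 = (\<Sum>i<d. (cmod (cinner x (v i)))\<^sup>2)"
    by (simp only: of_real_eq_iff)
  have "A *v (\<Sum>i\<in>I. f i) = (\<Sum>i\<in>I. A *v f i)" for I :: "nat set" and f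
    by (induction I rule: infinite_finite_induct) (simp_all add: matrix_vector_right_distrib)
  then have "A *v (\<Sum>i<d. cinner x (v i) *s v i) = (\<Sum>i<d. cinner x (v i) *s (A *v v i))"
    by (simp add: vector_scalar_commute)
  then have "of_real ((norm (A *v x))\<^sup>2) = cinner (\<Sum>i<d. cinner x (v i) *s (A *v v i)) (A *v x)"
    by (simp only: e cinner_self)
  also have "\<dots> = (\<Sum>i<d. cinner x (v i) * (of_real ((s i)\<^sup>2) * cnj (cinner x (v i))))"
    using x by (simp add: cinner_sum_left cinner_scale_left sing cinner_commute[of "v _" x])
  also have "\<dots> = of_real (\<Sum>i<d. (s i)\<^sup>2 * (cmod (cinner x (v i)))\<^sup>2)"
    by (simp only: complex_norm_square of_real_sum of_real_mult mult_ac)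
  finally show "(norm (A *v x))\<^sup>2 = (\<Sum>i<d. (s i)\<^sup>2 * (cmod (cinner x (v i)))\<^sup>2)"
    by (simp only: of_real_eq_iff)
qed

definition entry_sum :: "complex ^ 'n ^ 'm \<Rightarrow> real" where
  "entry_sum A = (\<Sum>i\<in>UNIV. \<Sum>j\<in>UNIV. cmod (A $ i $ j))"

lemma entry_sum_add: "entry_sum (A + B) \<le> entry_sum A + entry_sum B"
  unfolding entry_sum_def by (simp add: sum.distrib[symmetric] sum_mono norm_triangle_ineq)

lemma norm_matrix_vector_le: "norm (A *v x) \<le> entry_sum A * norm x" for A :: "complex ^ 'n ^ 'm"
proof -
  have "norm (A *v x) \<le> (\<Sum>i\<in>UNIV. cmod ((A *v x) $ i))"
    unfolding norm_vec_def by (rule L2_set_le_sum) auto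
  also have "\<dots> \<le> (\<Sum>i\<in>UNIV. \<Sum>j\<in>UNIV. cmod (A $ i $ j) * norm x)"
  proof (rule sum_mono)
    fix i
    have "cmod ((A *v x) $ i) \<le> (\<Sum>j\<in>UNIV. cmod (A $ i $ j * x $ j))"
      unfolding matrix_vector_mult_def by (simp add: norm_sum)
    also have "\<dots> \<le> (\<Sum>j\<in>UNIV. cmod (A $ i $ j) * norm x)"
      by (intro sum_mono) (simp add: norm_mult mult_left_mono Finite_Cartesian_Product.norm_nth_le)
    finally show "cmod ((A *v x) $ i) \<le> (\<Sum>j\<in>UNIV. cmod (A $ i $ j) * norm x)" .
  qed
  also have "\<dots> = entry_sum A * norm x"
    by (simp add: entry_sum_def sum_distrib_right)
  finally show ?thesis .
qed

text \<open>Weyl's inequality: the span of the top \<open>j\<close> singular vectors of \<open>A\<close> meets the span of the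
  singular vectors of \<open>B\<close> with index at least \<open>j\<close>.\<close>

lemma sv_on_perturb:
  fixes A B :: "complex ^ 'n ^ 'm"
  assumes U: "vec.subspace U" and j: "1 \<le> j" "j \<le> vec.dim U"
    and K: "\<And>x. norm (A *v x - B *v x) \<le> K * norm x"
  shows "sv_on U j A \<le> sv_on U j B + K"
proof -
  obtain d v s where a: "singular_basis U A d v s"
    using singular_basis_exists[OF U] by blast
  obtain d' w t where b': "singular_basis U B d' w t"
    using singular_basis_exists[OF U] by blast
  have "d' = d"
    using singular_basis_dim[OF a] singular_basis_dim[OF b'] by simp
  then have b: "singular_basis U B d w t"
    using b' by simp
  have jd: "j \<le> d"
    using j singular_basis_dim[OF a] by simp
  have ov: "orthonormal_on {..<d} v" and ow: "orthonormal_on {..<d} w"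
    and Uv: "U = vec.span (v ` {..<d})" and Uw: "U = vec.span (w ` {..<d})"
    using a b by (auto simp: singular_basis_def)
  define S where "S = vec.span (v ` {..<j})"
  define R where "R = vec.span (w ` {j - 1..<d})"
  have "vec.dim S = j"
    unfolding S_def using dim_span_orthonormal[OF orthonormal_on_subset[OF ov, of "{..<j}"]] jd by auto
  moreover have "vec.dim R = d - (j - 1)"
    unfolding R_def by (subst dim_span_orthonormal[OF orthonormal_on_subset[OF ow, of "{j - 1..<d}"]]) auto
  moreover have SU: "S \<subseteq> U"
    unfolding S_def Uv using jd by (intro vec.span_mono) auto
  moreover have RU: "R \<subseteq> U"
    unfolding R_def Uw using jd by (intro vec.span_mono) auto
  have "{x + y |x y. x \<in> S \<and> y \<in> R} \<subseteq> U"
    using SU RU U by (auto intro: vec.subspace_add)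
  then have "vec.dim {x + y |x y. x \<in> S \<and> y \<in> R} \<le> d"
    unfolding singular_basis_dim[OF a, symmetric] by (rule vec.dim_subset)
  moreover have "vec.dim {x + y |x y. x \<in> S \<and> y \<in> R} + vec.dim (S \<inter> R) = vec.dim S + vec.dim R"
    by (rule vec.dim_sums_Int) (simp_all add: S_def R_def)
  ultimately have "vec.dim (S \<inter> R) > 0"
    using j jd by linarith
  then have "\<not> S \<inter> R \<subseteq> {0}"
    using vec.dim_eq_0 by (metis not_gr_zero)
  then obtain x where x: "x \<in> S" "x \<in> R" "x \<noteq> 0"
    by blast
  have xU: "x \<in> U"
    using x SU by blast
  have vx: "cinner x (v i) = 0" if "j \<le> i" "i < d" for i
  proof -
    have "cinner (v i) y = 0" if "y \<in> v ` {..<j}" for y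
      using that \<open>j \<le> i\<close> \<open>i < d\<close> ov by (auto simp: orthonormal_on_def)
    then have "cinner (v i) x = 0"
      using cinner_orth_span x(1) unfolding S_def by blast
    then show ?thesis
      using cinner_commute[of x "v i"] by simp
  qed
  have wx: "cinner x (w i) = 0" if "i < j - 1" for i
  proof -
    have "cinner (w i) y = 0" if "y \<in> w ` {j - 1..<d}" for y
      using that \<open>i < j - 1\<close> jd ow by (auto simp: orthonormal_on_def)
    then have "cinner (w i) x = 0"
      using cinner_orth_span x(2) unfolding R_def by blast
    then show ?thesis
      using cinner_commute[of x "w i"] by simp
  qed
  have s0: "0 \<le> s (j - 1)" and t0: "0 \<le> t (j - 1)"
    using a b j jd by (auto simp: singular_basis_def)
  have "(s (j - 1) * norm x)\<^sup>2 = (\<Sum>i<d. (s (j - 1))\<^sup>2 * (cmod (cinner x (v i)))\<^sup>2)"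
    by (simp add: power_mult_distrib singular_basis_norm(1)[OF a xU] sum_distrib_left)
  also have "\<dots> \<le> (\<Sum>i<d. (s i)\<^sup>2 * (cmod (cinner x (v i)))\<^sup>2)"
  proof (rule sum_mono)
    fix i assume "i \<in> {..<d}"
    then show "(s (j - 1))\<^sup>2 * (cmod (cinner x (v i)))\<^sup>2 \<le> (s i)\<^sup>2 * (cmod (cinner x (v i)))\<^sup>2"
      using vx[of i] s0 a j jd
      by (cases "j \<le> i") (auto simp: singular_basis_def intro!: mult_right_mono power_mono)
  qed
  also have "\<dots> = (norm (A *v x))\<^sup>2"
    by (rule singular_basis_norm(2)[OF a xU, symmetric])
  finally have 1: "s (j - 1) * norm x \<le> norm (A *v x)"
    by (rule power2_le_imp_le) simp
  have "(norm (B *v x))\<^sup>2 = (\<Sum>i<d. (t i)\<^sup>2 * (cmod (cinner x (w i)))\<^sup>2)"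
    by (rule singular_basis_norm(2)[OF b xU])
  also have "\<dots> \<le> (\<Sum>i<d. (t (j - 1))\<^sup>2 * (cmod (cinner x (w i)))\<^sup>2)"
  proof (rule sum_mono)
    fix i assume "i \<in> {..<d}"
    then show "(t i)\<^sup>2 * (cmod (cinner x (w i)))\<^sup>2 \<le> (t (j - 1))\<^sup>2 * (cmod (cinner x (w i)))\<^sup>2"
      using wx[of i] t0 b j jd
      by (cases "i < j - 1") (auto simp: singular_basis_def intro!: mult_right_mono power_mono)
  qed
  also have "\<dots> = (t (j - 1) * norm x)\<^sup>2"
    by (simp add: power_mult_distrib singular_basis_norm(1)[OF b xU] sum_distrib_left)
  finally have 2: "norm (B *v x) \<le> t (j - 1) * norm x"
    by (rule power2_le_imp_le) (intro mult_nonneg_nonneg t0 norm_ge_zero)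
  have "norm (A *v x) \<le> norm (B *v x) + norm (A *v x - B *v x)"
    by (rule norm_triangle_sub)
  with 1 2 K[of x] have "s (j - 1) * norm x \<le> (t (j - 1) + K) * norm x"
    by (simp add: algebra_simps)
  then have "s (j - 1) \<le> t (j - 1) + K"
    using x(3) by simp
  then show ?thesis
    using sv_on_eq[OF a] sv_on_eq[OF b] j jd by simp
qed

text \<open>Continuity makes the singular values of the cocycle measurable in
  \<open>\<omega>\<close>, which their expectations presuppose.\<close>

lemma continuous_on_sv_on:
  assumes U: "vec.subspace U" and j: "1 \<le> j" "j \<le> vec.dim U"
  shows "continuous_on UNIV (sv_on U j :: complex ^ 'n ^ 'm \<Rightarrow> real)"
proof -
  have le: "sv_on U j A \<le> sv_on U j B + entry_sum (A - B)" for A B :: "complex ^ 'n ^ 'm"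
    by (rule sv_on_perturb[OF assms]) (metis matrix_vector_mult_diff_rdistrib norm_matrix_vector_le)
  have sym: "entry_sum (B - A) = entry_sum (A - B)" for A B :: "complex ^ 'n ^ 'm"
    by (simp add: entry_sum_def norm_minus_commute)
  have "(sv_on U j \<longlongrightarrow> sv_on U j A) (at A)" for A :: "complex ^ 'n ^ 'm"
  proof -
    have "((\<lambda>B. entry_sum (B - A)) \<longlongrightarrow> entry_sum (A - A)) (at A)"
      unfolding entry_sum_def by (intro tendsto_intros)
    then have lim: "((\<lambda>B. entry_sum (B - A)) \<longlongrightarrow> 0) (at A)"
      by (simp add: entry_sum_def)
    have "norm (sv_on U j B - sv_on U j A) \<le> entry_sum (B - A)" for B
      using le[of A B] le[of B A] sym[of A B] by (simp add: abs_le_iff)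
    then have "((\<lambda>B. sv_on U j B - sv_on U j A) \<longlongrightarrow> 0) (at A)"
      by (intro Lim_null_comparison[OF always_eventually lim]) blast
    then show ?thesis
      by (rule LIM_zero_cancel)
  qed
  then show ?thesis
    by (simp add: continuous_on_def)
qed

section \<open>Singular values compared with minors\<close>

definition minors_const :: "nat \<Rightarrow> nat \<Rightarrow> nat \<Rightarrow> real" where
  "minors_const k m n = real (m ^ k * n ^ k) * fact k"

lemma minors_const_pos: "m > 0 \<Longrightarrow> n > 0 \<Longrightarrow> minors_const k m n > 0"
  by (simp add: minors_const_def)

lemma minors_sum_le_const:
  fixes A :: "complex ^ 'n ^ 'm"
  assumes "\<And>i j. cmod (A $ i $ j) \<le> 1"
  shows "minors_sum k A \<le> minors_const k CARD('m) CARD('n)"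
  using minors_sum_le[OF assms, where k = k] by (simp add: minors_const_def)

text \<open>The largest index of \<open>S\<close> is at least \<open>card S - 1\<close>, so its
  factor is at most the one at that position; the rest is induction.\<close>

lemma prod_antimono_le:
  fixes s :: "nat \<Rightarrow> real"
  assumes "\<And>i. i < d \<Longrightarrow> 0 \<le> s i" "\<And>i j. j < d \<Longrightarrow> i \<le> j \<Longrightarrow> s j \<le> s i"
  shows "S \<subseteq> {..<d} \<Longrightarrow> (\<Prod>i\<in>S. s i) \<le> (\<Prod>i<card S. s i)"
proof (induction "card S" arbitrary: S)
  case 0
  then show ?case
    using finite_subset by fastforce
next
  case (Suc k)
  have fin: "finite S" and ne: "S \<noteq> {}"
    using Suc.prems Suc.hyps(2) finite_subset by fastforce+
  let ?m = "Max S"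
  have m: "?m \<in> S" "?m < d"
    using fin ne Suc.prems Max_in by blast+
  have "S \<subseteq> {..?m}"
    using fin by auto
  then have "Suc k \<le> Suc ?m"
    using card_mono[of "{..?m}" S] Suc.hyps(2) by simp
  then have km: "k \<le> ?m"
    by simp
  have c: "card (S - {?m}) = k"
    using m fin Suc.hyps(2) by simp
  have IH: "(\<Prod>i\<in>S - {?m}. s i) \<le> (\<Prod>i<k. s i)"
    using Suc.hyps(1)[of "S - {?m}"] c Suc.prems by auto
  have "(\<Prod>i\<in>S. s i) = s ?m * (\<Prod>i\<in>S - {?m}. s i)"
    using m fin by (simp add: prod.remove)
  also have "\<dots> \<le> s k * (\<Prod>i<k. s i)"
    using assms(1)[OF m(2)] assms(2)[OF m(2) km] IH assms(1) m(2) km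
    using Suc.prems by (intro mult_mono) (auto intro!: prod_nonneg assms(1))
  finally show ?case
    by (simp add: Suc.hyps(2)[symmetric] mult.commute)
qed

text \<open>Matrix form of the singular value decomposition of an \<open>A\<close> that is injective
  on \<open>U\<close>: the columns of \<open>V\<close> are right and those of \<open>Y\<close> left
  singular vectors, and \<open>V_proj\<close> says that \<open>V\<close> times its adjoint fixes
  \<open>U\<close>. Injectivity makes the values positive, so that \<open>Y\<close> can be defined
  by division. Entries of size at most 1 bound all minors of \<open>V\<close> and \<open>Y\<close>
  by constants of the dimensions.\<close>

locale singular_frame =
  fixes U :: "(complex ^ 'n) set" and A :: "complex ^ 'n ^ 'm" and V :: "complex ^ 'd ^ 'n"
    and Y :: "complex ^ 'd ^ 'm" and e :: "nat \<Rightarrow> 'd" and s :: "'d \<Rightarrow> real"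
  assumes bij: "bij_betw e {..<CARD('d)} UNIV"
    and s_eq: "\<And>i. i < CARD('d) \<Longrightarrow> s (e i) = sv_on U (Suc i) A"
    and s_pos: "\<And>c. s c > 0"
    and s_mono: "\<And>i j. i \<le> j \<Longrightarrow> j < CARD('d) \<Longrightarrow> s (e j) \<le> s (e i)"
    and AV: "A ** V = Y ** diag (\<lambda>c. of_real (s c))"
    and YAV: "conj_transpose Y ** A ** V = diag (\<lambda>c. of_real (s c))"
    and V_le: "\<And>i j. cmod (V $ i $ j) \<le> 1"
    and Y_le: "\<And>i j. cmod (Y $ i $ j) \<le> 1"
    and V_proj: "\<And>B :: complex ^ 'd ^ 'n. (\<And>j. column j B \<in> U) \<Longrightarrow> B = V ** (conj_transpose V ** B)"
    and V_norm: "\<And>j. norm (column j V) = 1"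
    and Y_norm: "\<And>j. norm (column j Y) = 1"

lemma column_matrix_mult: "column j (A ** B) = A *v column j B"
  by (simp add: vec_eq_iff column_def matrix_matrix_mult_def matrix_vector_mult_def)

lemma conj_transpose_mult_entry:
  "(conj_transpose A ** B) $ i $ j = cinner (column j B) (column i A)"
  by (simp add: conj_transpose_def matrix_matrix_mult_def cinner_def column_def mult.commute)

lemma norm_entry_le_column: "cmod (A $ i $ j) \<le> norm (column j A)"
  using Finite_Cartesian_Product.norm_nth_le[of "column j A" i] by (simp add: column_def)

lemma mult_diag_column: "column j (Y ** diag d) = d j *s column j Y"
  by (simp add: vec_eq_iff column_def matrix_matrix_mult_def diag_def if_distrib[of "(*) _"] mult.commute cong: if_cong)

lemma singular_frame_exists:
  fixes A :: "complex ^ 'n ^ 'm"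
  assumes U: "vec.subspace U" and dim: "vec.dim U = CARD('d::finite)"
    and inj: "\<And>x. x \<in> U \<Longrightarrow> A *v x = 0 \<Longrightarrow> x = 0"
  shows "\<exists>V Y (e :: nat \<Rightarrow> 'd) s. singular_frame U A V Y e s"
proof -
  obtain d v t where "singular_basis U A d v t"
    using singular_basis_exists[OF U] by blast
  then have b: "singular_basis U A CARD('d) v t"
    using singular_basis_dim dim by metis
  obtain e where e: "bij_betw e {..<CARD('d)} (UNIV :: 'd set)"
    using ex_bij_betw_nat_finite[of "UNIV :: 'd set"] by (auto simp: atLeast0LessThan)
  define idx where "idx = inv_into {..<CARD('d)} e"
  have idx: "idx c < CARD('d)" "e (idx c) = c" for c
    using bij_betwE[OF bij_betw_inv_into[OF e]] bij_betw_inv_into_right[OF e, of c] by (auto simp: idx_def)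
  have idx_e: "idx (e i) = i" if "i < CARD('d)" for i
    using bij_betw_inv_into_left[OF e] that by (simp add: idx_def)
  have idx_inj: "idx c = idx c' \<longleftrightarrow> c = c'" for c c'
    using idx(2) by metis
  define s where "s c = t (idx c)" for c
  define V :: "complex ^ 'd ^ 'n" where "V = (\<chi> r c. v (idx c) $ r)"
  define Y :: "complex ^ 'd ^ 'm" where "Y = (\<chi> r c. (A *v v (idx c)) $ r / of_real (s c))"
  have o: "orthonormal_on {..<CARD('d)} v" and Uv: "U = vec.span (v ` {..<CARD('d)})"
    and t0: "\<And>i. i < CARD('d) \<Longrightarrow> 0 \<le> t i"
    and tm: "\<And>i j. j < CARD('d) \<Longrightarrow> i \<le> j \<Longrightarrow> t j \<le> t i"
    and sing: "\<And>i w. i < CARD('d) \<Longrightarrow> w \<in> U \<Longrightarrow> cinner (A *v v i) (A *v w) = of_real ((t i)\<^sup>2) * cinner (v i) w"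
    using b by (auto simp: singular_basis_def)
  have vU: "v i \<in> U" if "i < CARD('d)" for i
    using that unfolding Uv by (intro vec.span_base) auto
  have vv: "cinner (v (idx c)) (v (idx c')) = of_bool (c = c')" for c c'
    using o idx(1) idx_inj by (auto simp: orthonormal_on_def)
  have nv: "norm (v (idx c)) = 1" for c
  proof -
    have "complex_of_real ((norm (v (idx c)))\<^sup>2) = of_real (1\<^sup>2)"
      unfolding cinner_self[symmetric] by (simp add: vv)
    then have "(norm (v (idx c)))\<^sup>2 = 1\<^sup>2"
      by (simp only: of_real_eq_iff)
    then show ?thesis
      by (rule power2_eq_imp_eq) auto
  qed
  have AvAv: "cinner (A *v v (idx c)) (A *v v (idx c')) = of_real ((s c)\<^sup>2) * of_bool (c = c')" for c c'
    using sing[OF idx(1) vU[OF idx(1)], of c c'] by (simp add: vv s_def)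
  have nAv: "norm (A *v v (idx c)) = s c" for c
  proof -
    have "complex_of_real ((norm (A *v v (idx c)))\<^sup>2) = of_real ((s c)\<^sup>2)"
      unfolding cinner_self[symmetric] by (simp add: AvAv)
    then have "(norm (A *v v (idx c)))\<^sup>2 = (s c)\<^sup>2"
      by (simp only: of_real_eq_iff)
    then show ?thesis
      by (rule power2_eq_imp_eq) (auto simp: s_def t0 idx)
  qed
  have s_pos: "s c > 0" for c
  proof -
    have "A *v v (idx c) \<noteq> 0"
      using inj[OF vU[OF idx(1)]] nv[of c] by force
    then show ?thesis
      unfolding nAv[symmetric] by simp
  qed
  have colV: "column c V = v (idx c)" for c
    by (simp add: column_def V_def vec_eq_iff)
  have colY: "of_real (s c) *s column c Y = A *v v (idx c)" for c
    using s_pos[of c] by (simp add: column_def Y_def vec_eq_iff)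
  have colY': "column c Y = of_real (1 / s c) *s (A *v v (idx c))" for c
    by (simp add: column_def Y_def vec_eq_iff)
  have cols: "P = Q" if "\<And>j. column j P = column j Q" for P Q :: "complex ^ 'd ^ 'k"
    using that by (simp add: vec_eq_iff column_def)
  have "singular_frame U A V Y e s"
  proof
    show "bij_betw e {..<CARD('d)} UNIV"
      by (rule e)
    show "s (e i) = sv_on U (Suc i) A" if "i < CARD('d)" for i
      using sv_on_eq[OF b, of "Suc i"] that by (simp add: s_def idx_e)
    show "s (e j) \<le> s (e i)" if "i \<le> j" "j < CARD('d)" for i j
      using that tm by (simp add: s_def idx_e)
    show "A ** V = Y ** diag (\<lambda>c. of_real (s c))"
      by (rule cols) (simp only: mult_diag_column colY, simp add: column_matrix_mult colV)
    show "conj_transpose Y ** A ** V = diag (\<lambda>c. of_real (s c))"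
    proof -
      have "(conj_transpose Y ** (A ** V)) $ i $ j = diag (\<lambda>c. of_real (s c)) $ i $ j" for i j
        using s_pos[of i] s_pos[of j]
        by (auto simp: conj_transpose_mult_entry column_matrix_mult colV colY' cinner_scale_right AvAv diag_def
            power2_eq_square)
      then show ?thesis
        by (simp add: vec_eq_iff matrix_mul_assoc)
    qed
    show "norm (column c V) = 1" for c
      by (simp add: colV nv)
    then show "cmod (V $ i $ c) \<le> 1" for i c
      using norm_entry_le_column[of V i c] by simp
    show "norm (column c Y) = 1" for c
      unfolding colY' norm_scale_complex using s_pos[of c] by (simp add: nAv norm_divide)
    then show "cmod (Y $ i $ c) \<le> 1" for i c
      using norm_entry_le_column[of Y i c] by simp
    show "B = V ** (conj_transpose V ** B)" if B: "\<And>j. column j B \<in> U" for B :: "complex ^ 'd ^ 'n"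
    proof (rule cols)
      fix j
      have "column j B = (\<Sum>i<CARD('d). cinner (column j B) (v i) *s v i)"
        using orthonormal_on_expansion[OF o, of "column j B"] B Uv by simp
      also have "\<dots> = (\<Sum>c\<in>UNIV. cinner (column j B) (v (idx c)) *s v (idx c))"
        by (rule sum.reindex_bij_betw[OF bij_betw_inv_into[OF e], folded idx_def, symmetric])
      also have "\<dots> = column j (V ** (conj_transpose V ** B))"
      proof -
        have "(V ** (conj_transpose V ** B)) $ r $ j = (\<Sum>c\<in>UNIV. V $ r $ c * cinner (column j B) (v (idx c)))" for r
          unfolding matrix_matrix_mult_def[of V] by (simp add: conj_transpose_mult_entry colV)
        moreover have "V $ r $ c = v (idx c) $ r" for r c
          by (simp add: V_def)
        ultimately have "column j (V ** (conj_transpose V ** B)) $ r =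
            (\<Sum>c\<in>UNIV. v (idx c) $ r * cinner (column j B) (v (idx c)))" for r
          by (simp add: column_def)
        then show ?thesis
          by (simp add: vec_eq_iff mult.commute)
      qed
      finally show "column j B = column j (V ** (conj_transpose V ** B))" .
    qed
  qed (rule s_pos)
  then show ?thesis
    by blast
qed

context singular_frame
begin

text \<open>The product is a diagonal minor of \<open>conj_transpose Y ** A ** V\<close>, and
  \<open>minors_sum\<close> is submultiplicative.\<close>

lemma prod_sv_le_minors_sum:
  assumes "k \<le> CARD('d)"
  shows "(\<Prod>i<k. sv_on U (Suc i) A) \<le>
    minors_const k CARD('d) CARD('m) * minors_const k CARD('n) CARD('d) * minors_sum k A"
proof -
  have "inj_on e {..<k}"
    using bij assms by (auto simp: bij_betw_def intro: inj_on_subset)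
  have "(\<Prod>i<k. sv_on U (Suc i) A) = (\<Prod>i<k. s (e i))"
    using assms by (intro prod.cong) (auto simp: s_eq)
  also have "\<dots> = cmod (minor k (diag (\<lambda>c. of_real (s c))) e e)"
    using s_pos by (simp add: minor_diag_self[OF \<open>inj_on e {..<k}\<close>] prod_norm[symmetric] less_imp_le)
  also have "\<dots> \<le> minors_sum k (conj_transpose Y ** A ** V)"
    unfolding YAV by (rule minor_le_minors_sum')
  also have "\<dots> \<le> minors_sum k (conj_transpose Y) * minors_sum k A * minors_sum k V"
    by (intro order_trans[OF minors_sum_mult] mult_right_mono minors_sum_mult minors_sum_nonneg)
  also have "\<dots> \<le> minors_const k CARD('d) CARD('m) * minors_sum k A * minors_const k CARD('n) CARD('d)"
    using V_le Y_le
    by (intro mult_mono minors_sum_le_const mult_nonneg_nonneg minors_sum_nonneg)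
       (auto simp: conj_transpose_def minors_const_def)
  finally show ?thesis
    by (simp add: mult_ac)
qed

text \<open>As the columns of \<open>B\<close> lie in \<open>U\<close>, the product
  \<open>A ** B\<close> factors through the diagonal matrix, and a product of \<open>k\<close>
  distinct diagonal entries is at most that of the \<open>k\<close> largest.\<close>

lemma minors_sum_le_prod_sv:
  fixes B :: "complex ^ 'd ^ 'n"
  assumes k: "k \<le> CARD('d)" and B: "\<And>j. column j B \<in> U" "\<And>j. norm (column j B) \<le> 1"
  shows "minors_sum k (A ** B) \<le>
    minors_const k CARD('m) CARD('d) * minors_const k CARD('d) CARD('d) * minors_const k CARD('d) CARD('d)
      * (\<Prod>i<k. sv_on U (Suc i) A)"
proof -
  let ?D = "diag (\<lambda>c. of_real (s c)) :: complex ^ 'd ^ 'd"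
  let ?p = "\<Prod>i<k. sv_on U (Suc i) A"
  have p: "?p = (\<Prod>i<k. s (e i))"
    using k by (intro prod.cong) (auto simp: s_eq)
  have p0: "?p \<ge> 0"
    unfolding p using s_pos by (intro prod_nonneg) (auto simp: less_imp_le)
  have "A ** B = A ** (V ** (conj_transpose V ** B))"
    using V_proj[OF B(1)] by simp
  also have "\<dots> = Y ** ?D ** (conj_transpose V ** B)"
    by (simp add: matrix_mul_assoc AV)
  finally have "minors_sum k (A ** B) \<le> minors_sum k Y * minors_sum k ?D * minors_sum k (conj_transpose V ** B)"
    by (simp only:) (intro order_trans[OF minors_sum_mult] mult_right_mono minors_sum_mult minors_sum_nonneg)
  also have "\<dots> \<le> minors_const k CARD('m) CARD('d) * (minors_const k CARD('d) CARD('d) * ?p) * minors_const k CARD('d) CARD('d)"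
  proof (intro mult_mono minors_sum_nonneg mult_nonneg_nonneg p0)
    show "minors_sum k Y \<le> minors_const k CARD('m) CARD('d)"
      using Y_le by (rule minors_sum_le_const)
    have "cmod ((conj_transpose V ** B) $ i $ j) \<le> 1" for i j
      using norm_cinner_le[of "column j B" "column i V"] B(2)[of j]
      by (simp add: conj_transpose_mult_entry V_norm)
    then show "minors_sum k (conj_transpose V ** B) \<le> minors_const k CARD('d) CARD('d)"
      by (rule minors_sum_le_const)
    show "minors_sum k ?D \<le> minors_const k CARD('d) CARD('d) * ?p"
      unfolding minors_const_def
    proof (intro minors_sum_diag_le p0)
      fix f :: "nat \<Rightarrow> 'd" assume f: "inj_on f {..<k}"
      define S where "S = inv_into {..<CARD('d)} e ` f ` {..<k}"
      have ie: "bij_betw (inv_into {..<CARD('d)} e) UNIV {..<CARD('d)}"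
        by (rule bij_betw_inv_into[OF bij])
      have inj: "inj_on (inv_into {..<CARD('d)} e) X" for X
        using ie by (auto simp: bij_betw_def intro: inj_on_subset)
      have "(\<Prod>i<k. cmod (complex_of_real (s (f i)))) = (\<Prod>c\<in>f ` {..<k}. s c)"
        using s_pos f by (simp add: prod.reindex less_imp_le)
      also have "\<dots> = (\<Prod>i\<in>S. s (e i))"
        unfolding S_def by (subst prod.reindex[OF inj]) (simp add: bij_betw_inv_into_right[OF bij])
      also have "\<dots> \<le> (\<Prod>i<card S. s (e i))"
        using bij_betwE[OF ie] s_pos s_mono unfolding S_def
        by (intro prod_antimono_le[where d = "CARD('d)"]) (auto simp: less_imp_le)
      also have "card S = k"
        unfolding S_def using f by (simp add: card_image[OF inj] card_image)
      finally show "(\<Prod>i<k. cmod (complex_of_real (s (f i)))) \<le> ?p"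
        by (simp only: p)
    qed
  qed (auto simp: minors_const_def)
  finally show ?thesis
    by (simp add: mult_ac)
qed

lemma sv_on_pos: "1 \<le> j \<Longrightarrow> j \<le> CARD('d) \<Longrightarrow> sv_on U j A > 0"
  using s_pos s_eq[of "j - 1"] by (metis Suc_diff_1 Suc_le_lessD less_le_trans diff_less zero_less_one)

end

section \<open>Transfer matrices\<close>

definition top_part :: "'b ^ ('w::finite + 'w) \<Rightarrow> 'b ^ 'w" where
  "top_part x = (\<chi> i. x $ Inl i)"

definition bot_part :: "'b ^ ('w::finite + 'w) \<Rightarrow> 'b ^ 'w" where
  "bot_part x = (\<chi> i. x $ Inr i)"

definition pair_vec :: "'b ^ 'w \<Rightarrow> 'b ^ 'w \<Rightarrow> 'b ^ ('w::finite + 'w)" where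
  "pair_vec p q = (\<chi> i. case i of Inl a \<Rightarrow> p $ a | Inr a \<Rightarrow> q $ a)"

lemma sum_UNIV_Plus:
  "(\<Sum>i\<in>(UNIV :: ('a::finite + 'b::finite) set). f i) = (\<Sum>i\<in>UNIV. f (Inl i)) + (\<Sum>i\<in>UNIV. f (Inr i))"
  unfolding UNIV_Plus_UNIV[symmetric] by (subst sum.Plus) auto

lemma parts_pair_vec [simp]: "top_part (pair_vec p q) = p" "bot_part (pair_vec p q) = q"
  by (simp_all add: top_part_def bot_part_def pair_vec_def vec_eq_iff)

lemma pair_vec_parts [simp]: "pair_vec (top_part x) (bot_part x) = x"
  by (auto simp: top_part_def bot_part_def pair_vec_def vec_eq_iff split: sum.split)

lemma parts_diff:
  "top_part (x - y :: 'b::ab_group_add ^ ('w::finite + 'w)) = top_part x - top_part y"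
  "bot_part (x - y) = bot_part x - bot_part y"
  by (simp_all add: top_part_def bot_part_def vec_eq_iff)

lemma norm_parts: "(norm (x :: complex ^ ('w::finite + 'w)))\<^sup>2 = (norm (top_part x))\<^sup>2 + (norm (bot_part x))\<^sup>2"
  by (simp add: norm_vec_def L2_set_def sum_nonneg sum_UNIV_Plus top_part_def bot_part_def)

lemma norm_le_parts: "norm (x :: complex ^ ('w::finite + 'w)) \<le> norm (top_part x) + norm (bot_part x)"
  by (rule power2_le_imp_le) (auto simp: norm_parts power2_sum)

lemma parts_block_matrix_mult:
  fixes A B C D :: "complex ^ 'w ^ 'w"
  shows "top_part (block_matrix A B C D *v x) = A *v top_part x + B *v bot_part x"
    and "bot_part (block_matrix A B C D *v x) = C *v top_part x + D *v bot_part x"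
  by (simp_all add: vec_eq_iff matrix_vector_mult_def top_part_def bot_part_def block_matrix_def sum_UNIV_Plus)

lemma block_matrix_mult:
  fixes A B C D :: "complex ^ 'w ^ 'w"
  shows "block_matrix A B C D ** block_matrix A' B' C' D' =
    block_matrix (A ** A' + B ** C') (A ** B' + B ** D') (C ** A' + D ** C') (C ** B' + D ** D')"
  by (auto simp: vec_eq_iff matrix_matrix_mult_def block_matrix_def sum_UNIV_Plus split: sum.split)

definition top_left :: "complex ^ ('w::finite + 'w) ^ ('w + 'w) \<Rightarrow> complex ^ 'w ^ 'w" where
  "top_left M = (\<chi> i j. M $ Inl i $ Inl j)"

lemma block_matrix_cases:
  obtains A B C D where "M = block_matrix A B C (D :: complex ^ 'w ^ 'w)"
proof
  show "M = block_matrix (\<chi> i j. M $ Inl i $ Inl j) (\<chi> i j. M $ Inl i $ Inr j) (\<chi> i j. M $ Inr i $ Inl j) (\<chi> i j. M $ Inr i $ Inr j)"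
    by (auto simp: block_matrix_def vec_eq_iff split: sum.split)
qed

lemma top_left_block_matrix [simp]: "top_left (block_matrix A B C D) = A"
  by (simp add: top_left_def block_matrix_def vec_eq_iff)

lemma top_left_mult: "top_left M *v p = top_part (M *v pair_vec p 0)"
  by (rule block_matrix_cases[of M]) (simp add: parts_block_matrix_mult)

lemma mat_mult_vec: "mat c *v x = c *s x" for c :: complex
  by (simp add: vec_eq_iff matrix_vector_mult_def mat_def if_distrib[of "\<lambda>x. x * _"] cong: if_cong)

section \<open>Determinants and minors of block matrices\<close>

lemma inverse_matrix_exists:
  fixes A :: "complex ^ 'n ^ 'n"
  assumes "\<And>x. norm x \<le> K * norm (A *v x)"
  shows "\<exists>A'. A' ** A = mat 1 \<and> A ** A' = mat 1 \<and> (\<forall>x. norm (A' *v x) \<le> K * norm x)"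
proof -
  have "x = y" if "A *v x = A *v y" for x y
    using assms[of "x - y"] that by (simp add: matrix_vector_mult_diff_distrib)
  then have "inj ((*v) A)"
    by (intro injI)
  then obtain A' where A': "A' ** A = mat 1"
    using matrix_left_invertible_injective[of A] by blast
  then have "A ** A' = mat 1"
    by (simp add: matrix_left_right_inverse)
  then have "norm (A' *v x) \<le> K * norm x" for x
    using assms[of "A' *v x"] by (simp add: matrix_vector_mul_assoc)
  with A' \<open>A ** A' = mat 1\<close> show ?thesis
    by blast
qed

text \<open>The inverse has operator norm at most \<open>K\<close>, hence entries at most
  \<open>K\<close>, and the permutation expansion bounds its determinant.\<close>

lemma det_lower_bound:
  fixes A :: "complex ^ 'n ^ 'n"
  assumes "\<And>x. norm x \<le> K * norm (A *v x)"
  shows "1 \<le> fact CARD('n) * K ^ CARD('n) * cmod (det A)"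
proof -
  obtain A' where A': "A' ** A = mat 1" "\<And>x. norm (A' *v x) \<le> K * norm x"
    using inverse_matrix_exists[OF assms] by blast
  have "det A' * det A = 1"
    using A'(1) by (metis det_I det_mul)
  then have "1 = cmod (det A') * cmod (det A)"
    by (metis norm_mult norm_one)
  also have "\<dots> \<le> (fact CARD('n) * K ^ CARD('n)) * cmod (det A)"
    by (intro mult_right_mono norm_det_le norm_entry_le A'(2)) auto
  finally show ?thesis .
qed

lemma minors_sum_le_power:
  fixes A :: "complex ^ 'n ^ 'm"
  assumes "\<And>i j. cmod (A $ i $ j) \<le> R"
  shows "minors_sum k A \<le> minors_const k CARD('m) CARD('n) * R ^ k"
  using minors_sum_le[OF assms, where k = k] by (simp add: minors_const_def)

text \<open>After a singular value decomposition of \<open>a\<close> the matrix is diagonal with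
  entries \<open>s c\<close> and 1. A product of distinct diagonal entries is at most the product of
  all \<open>max 1 (s c)\<close>, and since \<open>K * s c \<ge> 1\<close> this is at most the
  product of all \<open>K * s c\<close>. The full product of the \<open>s c\<close> is comparable to
  \<open>det a\<close>.\<close>

lemma minors_sum_block_diag_le:
  fixes a :: "complex ^ 'w ^ 'w"
  assumes K: "K \<ge> 1" and a: "\<And>x. norm x \<le> K * norm (a *v x)"
  shows "minors_sum CARD('w) (block_matrix a 0 0 (mat 1)) \<le>
    minors_const CARD('w) (CARD('w) + CARD('w)) (CARD('w) + CARD('w)) ^ 3 * K ^ CARD('w) *
    (minors_const CARD('w) CARD('w) CARD('w) ^ 2 * (real (CARD('w) ^ CARD('w) * CARD('w) ^ CARD('w)) * cmod (det a)))"
proof -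
  let ?W = "CARD('w)"
  let ?c = "minors_const ?W (?W + ?W) (?W + ?W)"
  have "\<exists>V Y (e :: nat \<Rightarrow> 'w) s. singular_frame UNIV a V Y e s"
  proof (rule singular_frame_exists)
    show "x = 0" if "a *v x = 0" for x
      using a[of x] that by simp
  qed (auto simp: card_cart_basis)
  then obtain V Y and e :: "nat \<Rightarrow> 'w" and s where "singular_frame UNIV a V Y e s"
    by blast
  then interpret singular_frame UNIV a V Y e s .
  have "a = a ** (V ** (conj_transpose V ** mat 1))"
    by (subst V_proj[of "mat 1", symmetric]) auto
  then have a_eq: "a = Y ** diag (\<lambda>c. of_real (s c)) ** conj_transpose V"
    by (simp add: matrix_mul_assoc AV)
  define d :: "'w + 'w \<Rightarrow> complex" where "d = case_sum (\<lambda>c. complex_of_real (s c)) (\<lambda>_. 1)"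
  have d_eq: "block_matrix (diag (\<lambda>c. of_real (s c))) 0 0 (mat 1) = diag d"
    by (auto simp: block_matrix_def diag_def d_def mat_def vec_eq_iff split: sum.split)
  have eq: "block_matrix a 0 0 (mat 1) = block_matrix Y 0 0 (mat 1) ** diag d ** block_matrix (conj_transpose V) 0 0 (mat 1)"
    unfolding d_eq[symmetric] by (simp add: block_matrix_mult a_eq)
  have s_ge: "1 \<le> K * s c" for c
  proof -
    have "a *v column c V = of_real (s c) *s column c Y"
      using arg_cong[OF AV, of "column c"] by (simp only: column_matrix_mult[symmetric] mult_diag_column)
    then show ?thesis
      using a[of "column c V"] s_pos[of c] by (simp add: V_norm Y_norm norm_scale_complex)
  qed
  have prod_s: "(\<Prod>c\<in>UNIV. s c) = (\<Prod>i<?W. sv_on UNIV (Suc i) a)"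
    by (subst prod.reindex_bij_betw[OF bij, symmetric]) (simp add: s_eq)
  have diag_le: "minors_sum ?W (diag d) \<le> ?c * (K ^ ?W * (\<Prod>c\<in>UNIV. s c))"
  proof -
    have "(\<Prod>i<?W. cmod (d (f i))) \<le> K ^ ?W * (\<Prod>c\<in>UNIV. s c)" if f: "inj_on f {..<?W}" for f
    proof -
      have "(\<Prod>i<?W. cmod (d (f i))) \<le> (\<Prod>i<?W. max 1 (cmod (d (f i))))"
        by (intro prod_mono) auto
      also have "\<dots> = (\<Prod>x\<in>f ` {..<?W}. max 1 (cmod (d x)))"
        using f by (simp add: prod.reindex)
      also have "\<dots> \<le> (\<Prod>x\<in>UNIV. max 1 (cmod (d x)))"
        by (intro prod_mono2) auto
      also have "\<dots> = (\<Prod>c\<in>UNIV. max 1 (s c))"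
        unfolding UNIV_Plus_UNIV[symmetric]
        by (subst prod.Plus) (auto simp: d_def s_pos less_imp_le)
      also have "\<dots> \<le> (\<Prod>c\<in>UNIV. K * s c)"
      proof (intro prod_mono conjI)
        show "max 1 (s c) \<le> K * s c" for c
          using s_ge[of c] mult_right_mono[OF K, of "s c"] s_pos[of c] by simp
      qed auto
      also have "\<dots> = K ^ ?W * (\<Prod>c\<in>UNIV. s c)"
        by (simp add: prod.distrib)
      finally show ?thesis .
    qed
    then show ?thesis
      using minors_sum_diag_le[of ?W d "K ^ ?W * (\<Prod>c\<in>UNIV. s c)"] K s_pos
      by (simp add: minors_const_def prod_nonneg less_imp_le)
  qed
  have ent: "cmod (block_matrix X 0 0 (mat 1) $ i $ j) \<le> 1" if "\<And>i j. cmod (X $ i $ j) \<le> 1" for X :: "complex ^ 'w ^ 'w" and i j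
    using that by (auto simp: block_matrix_def mat_def split: sum.split)
  have "minors_sum ?W (block_matrix a 0 0 (mat 1)) \<le>
      minors_sum ?W (block_matrix Y 0 0 (mat 1)) * minors_sum ?W (diag d) * minors_sum ?W (block_matrix (conj_transpose V) 0 0 (mat 1))"
    unfolding eq by (intro order_trans[OF minors_sum_mult] mult_right_mono minors_sum_mult minors_sum_nonneg)
  also have "\<dots> \<le> ?c * (?c * (K ^ ?W * (\<Prod>c\<in>UNIV. s c))) * ?c"
  proof (intro mult_mono minors_sum_nonneg mult_nonneg_nonneg diag_le)
    show "minors_sum ?W (block_matrix Y 0 0 (mat 1)) \<le> ?c"
      using minors_sum_le_const[OF ent[OF Y_le], of ?W] by simp
    show "minors_sum ?W (block_matrix (conj_transpose V) 0 0 (mat 1)) \<le> ?c"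
      using minors_sum_le_const[OF ent[of "conj_transpose V"], of ?W] V_le by (simp add: conj_transpose_def)
  qed (use K s_pos in \<open>auto simp: minors_const_def less_imp_le intro!: prod_nonneg\<close>)
  also have "\<dots> = ?c ^ 3 * K ^ ?W * (\<Prod>c\<in>UNIV. s c)"
    by (simp add: power3_eq_cube)
  also have "\<dots> \<le> ?c ^ 3 * K ^ ?W * (minors_const ?W ?W ?W ^ 2 * (real (?W ^ ?W * ?W ^ ?W) * cmod (det a)))"
  proof (intro mult_left_mono)
    have "(\<Prod>c\<in>UNIV. s c) \<le> minors_const ?W ?W ?W ^ 2 * minors_sum ?W a"
      unfolding prod_s power2_eq_square by (rule prod_sv_le_minors_sum) simp
    also have "\<dots> \<le> minors_const ?W ?W ?W ^ 2 * (real (?W ^ ?W * ?W ^ ?W) * cmod (det a))"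
      using minors_sum_le_det[of a] by (intro mult_left_mono) simp_all
    finally show "(\<Prod>c\<in>UNIV. s c) \<le> minors_const ?W ?W ?W ^ 2 * (real (?W ^ ?W * ?W ^ ?W) * cmod (det a))" .
  qed (use K in \<open>auto simp: minors_const_def\<close>)
  finally show ?thesis .
qed

text \<open>Bounds for the two Dirichlet problems. For \<open>M\<close> with blocks
  \<open>a b c d\<close>, a zero initial bottom part controls the inverse of \<open>a\<close> and
  \<open>c\<close> times that inverse; a zero final top part controls the inverse times
  \<open>b\<close> and the Schur complement of \<open>a\<close>.\<close>

definition boundary_bounded :: "real \<Rightarrow> complex ^ ('w::finite + 'w) ^ ('w + 'w) \<Rightarrow> bool" where
  "boundary_bounded K M \<longleftrightarrow>
    (\<forall>x. bot_part x = 0 \<longrightarrow> norm (top_part x) \<le> K * norm (top_part (M *v x)) \<and> norm (bot_part (M *v x)) \<le> K * norm (top_part (M *v x))) \<and>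
    (\<forall>x. top_part (M *v x) = 0 \<longrightarrow> norm (top_part x) \<le> K * norm (bot_part x) \<and> norm (bot_part (M *v x)) \<le> K * norm (bot_part x))"

lemma boundary_bounded_top_left:
  assumes "boundary_bounded K M"
  shows "norm x \<le> K * norm (top_left M *v x)"
  using assms unfolding boundary_bounded_def top_left_mult by (metis parts_pair_vec)

text \<open>Block elimination: \<open>M\<close> is a product of two block triangular factors and
  \<open>diag(A, S)\<close>, and \<open>boundary_bounded\<close> bounds the triangular factors, \<open>S\<close> and the
  inverse of the upper left block \<open>A\<close>.\<close>

lemma minors_sum_le_det_top_left:
  assumes K: "K \<ge> 1"
  shows "\<exists>C>0. \<forall>M :: complex ^ ('w::finite + 'w) ^ ('w + 'w). boundary_bounded K M \<longrightarrow>
    minors_sum CARD('w) M \<le> C * cmod (det (top_left M))"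
proof -
  let ?W = "CARD('w)"
  let ?c = "minors_const ?W (?W + ?W) (?W + ?W)"
  define C0 where "C0 = ?c ^ 3 * K ^ ?W * (minors_const ?W ?W ?W ^ 2 * real (?W ^ ?W * ?W ^ ?W))"
  define C where "C = (?c * K ^ ?W) ^ 3 * C0"
  have c0: "?c > 0"
    by (rule minors_const_pos) auto
  have "C0 > 0"
    using K minors_const_pos[of ?W ?W ?W] c0 by (auto simp: C0_def)
  then have "C > 0"
    using K c0 by (simp add: C_def)
  moreover have "minors_sum ?W M \<le> C * cmod (det (top_left M))"
    if M: "boundary_bounded K M" for M :: "complex ^ ('w + 'w) ^ ('w + 'w)"
  proof (rule block_matrix_cases[of M])
    fix a b c d :: "complex ^ 'w ^ 'w"
    assume eq: "M = block_matrix a b c d"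
    have 1: "norm p \<le> K * norm (a *v p)" "norm (c *v p) \<le> K * norm (a *v p)" for p
      using M[unfolded boundary_bounded_def, THEN conjunct1, rule_format, of "pair_vec p 0"]
      by (simp_all add: eq parts_block_matrix_mult)
    have 2: "norm p \<le> K * norm q" "norm (c *v p + d *v q) \<le> K * norm q" if "a *v p + b *v q = 0" for p q
      using M[unfolded boundary_bounded_def, THEN conjunct2, rule_format, of "pair_vec p q"] that
      by (simp_all add: eq parts_block_matrix_mult)
    obtain a' where a': "a' ** a = mat 1" "a ** a' = mat 1" "\<And>x. norm (a' *v x) \<le> K * norm x"
      using inverse_matrix_exists[OF 1(1)] by blast
    define S where "S = d - c ** (a' ** b)"
    have aa: "a *v (a' *v x) = x" "a ** (a' ** X) = X" "c ** a' ** a = c" for x and X :: "complex ^ 'w ^ 'w"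
      using a' by (simp_all add: matrix_vector_mul_assoc matrix_mul_assoc) (metis a'(1) matrix_mul_assoc matrix_mul_rid)
    have "block_matrix (mat 1) 0 (c ** a') (mat 1) ** (block_matrix a 0 0 (mat 1) ** block_matrix (mat 1) 0 0 S) **
        block_matrix (mat 1) (a' ** b) 0 (mat 1) = block_matrix a b c (c ** (a' ** b) + S)"
      by (simp add: block_matrix_mult aa matrix_mul_assoc[of "c ** a'" a] matrix_mul_assoc[of c a' b])
    then have M_eq: "M = block_matrix (mat 1) 0 (c ** a') (mat 1) ** (block_matrix a 0 0 (mat 1) ** block_matrix (mat 1) 0 0 S) **
        block_matrix (mat 1) (a' ** b) 0 (mat 1)"
      by (simp add: eq S_def)
    have ent: "cmod (block_matrix P Q R T $ i $ j) \<le> K"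
      if "\<And>i j. cmod (P $ i $ j) \<le> K" "\<And>i j. cmod (Q $ i $ j) \<le> K" "\<And>i j. cmod (R $ i $ j) \<le> K" "\<And>i j. cmod (T $ i $ j) \<le> K"
      for P Q R T :: "complex ^ 'w ^ 'w" and i j
      using that by (auto simp: block_matrix_def split: sum.split)
    have entry: "cmod ((mat 1 :: complex ^ 'w ^ 'w) $ i $ j) \<le> K" "cmod ((0 :: complex ^ 'w ^ 'w) $ i $ j) \<le> K" for i j
      using K by (auto simp: mat_def)
    have e1: "cmod ((c ** a') $ i $ j) \<le> K" for i j
      using 1(2)[of "a' *v _"] by (intro norm_entry_le) (simp add: matrix_vector_mul_assoc[symmetric] aa)
    \<comment> \<open>Bottom part \<open>q\<close> and top part \<open>- (a' ** b) *v q\<close> are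
      annihilated by the upper block row, so the second half of \<open>boundary_bounded\<close>
      applies to them.\<close>
    have z: "a *v (- ((a' ** b) *v q)) + b *v q = 0" for q
      using aa(1)[of "b *v q"] by (simp add: matrix_vector_mul_assoc[symmetric] vec.neg)
    have e2: "cmod ((a' ** b) $ i $ j) \<le> K" for i j
      using 2(1)[OF z] by (intro norm_entry_le) simp
    have e3: "cmod (S $ i $ j) \<le> K" for i j
      using 2(2)[OF z] by (intro norm_entry_le)
        (simp add: S_def matrix_vector_mult_diff_rdistrib matrix_vector_mul_assoc[symmetric] vec.neg)
    have ms: "minors_sum ?W X \<le> ?c * K ^ ?W" if "\<And>i j. cmod (X $ i $ j) \<le> K" for X :: "complex ^ ('w + 'w) ^ ('w + 'w)"
      using minors_sum_le_power[OF that, of ?W] by simp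
    have "minors_sum ?W M \<le> minors_sum ?W (block_matrix (mat 1) 0 (c ** a') (mat 1)) *
        (minors_sum ?W (block_matrix a 0 0 (mat 1)) * minors_sum ?W (block_matrix (mat 1) 0 0 S)) *
        minors_sum ?W (block_matrix (mat 1) (a' ** b) 0 (mat 1))"
      unfolding M_eq
      by (intro order_trans[OF minors_sum_mult] mult_mono order_refl minors_sum_mult minors_sum_nonneg mult_nonneg_nonneg)
    also have "\<dots> \<le> (?c * K ^ ?W) * (C0 * cmod (det a) * (?c * K ^ ?W)) * (?c * K ^ ?W)"
    proof (intro mult_mono minors_sum_nonneg mult_nonneg_nonneg)
      show "minors_sum ?W (block_matrix a 0 0 (mat 1)) \<le> C0 * cmod (det a)"
        using minors_sum_block_diag_le[OF K 1(1)] by (simp add: C0_def mult_ac)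
    qed (use K c0 \<open>C0 > 0\<close> in \<open>auto intro!: ms ent entry e1 e2 e3\<close>)
    also have "\<dots> = C * cmod (det (top_left M))"
      by (simp add: C_def eq power3_eq_cube mult_ac)
    finally show ?thesis .
  qed
  ultimately show ?thesis
    by blast
qed

section \<open>Products of transfer matrices and the Wronskian\<close>

definition tmat :: "real ^ 'w ^ 'w \<Rightarrow> complex \<Rightarrow> complex ^ ('w::finite + 'w) ^ ('w + 'w)" where
  "tmat V z = block_matrix (mat z - (\<chi> i j. of_real (V $ i $ j))) (- mat 1) (mat 1) 0"

text \<open>\<open>V 0\<close> is the potential at site 1 of the cocycle. Taking the potentials as a
  bare sequence turns a restart at a later site into a shift of \<open>V\<close>.\<close>

primrec tprod :: "(nat \<Rightarrow> real ^ 'w ^ 'w) \<Rightarrow> complex \<Rightarrow> nat \<Rightarrow> complex ^ ('w::finite + 'w) ^ ('w + 'w)" where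
  "tprod V z 0 = mat 1"
| "tprod V z (Suc n) = tmat (V n) z ** tprod V z n"

lemma cocycle_eq_tprod: "cocycle T F z n \<omega> = tprod (\<lambda>i. F ((T ^^ Suc i) \<omega>)) z n"
  by (induction n) (simp_all add: transfer_matrix_def tmat_def)

lemma tprod_add: "tprod V z (n + m) = tprod (\<lambda>i. V (i + n)) z m ** tprod V z n"
  by (induction m) (simp_all add: matrix_mul_assoc add.commute)

definition wronskian :: "complex ^ ('w::finite + 'w) \<Rightarrow> real" where
  "wronskian x = Im (cinner (top_part x) (bot_part x))"

lemma cinner_symmetric_real:
  fixes V :: "real ^ 'w ^ 'w"
  assumes "transpose V = V"
  shows "Im (cinner ((\<chi> i j. complex_of_real (V $ i $ j)) *v x) x) = 0"
proof -
  have V: "V $ i $ j = V $ j $ i" for i j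
  proof -
    have "transpose V $ j $ i = V $ j $ i"
      by (simp only: assms)
    then show ?thesis
      by (simp add: transpose_def)
  qed
  have eq: "cinner ((\<chi> i j. complex_of_real (V $ i $ j)) *v x) x =
      (\<Sum>i\<in>UNIV. \<Sum>j\<in>UNIV. of_real (V $ i $ j) * x $ j * cnj (x $ i))"
    by (simp add: cinner_def matrix_vector_mult_def sum_distrib_right)
  have "cnj (cinner ((\<chi> i j. complex_of_real (V $ i $ j)) *v x) x) =
      (\<Sum>i\<in>UNIV. \<Sum>j\<in>UNIV. of_real (V $ i $ j) * cnj (x $ j) * x $ i)"
    unfolding eq by simp
  also have "\<dots> = (\<Sum>j\<in>UNIV. \<Sum>i\<in>UNIV. of_real (V $ i $ j) * cnj (x $ j) * x $ i)"
    by (rule sum.swap)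
  also have "\<dots> = cinner ((\<chi> i j. complex_of_real (V $ i $ j)) *v x) x"
    unfolding eq by (intro sum.cong refl) (subst V, simp add: mult_ac)
  finally have "cinner ((\<chi> i j. complex_of_real (V $ i $ j)) *v x) x \<in> \<real>"
    by (simp only: Reals_cnj_iff)
  then show ?thesis
    by (simp only: complex_is_Real_iff)
qed

lemma parts_tmat:
  "top_part (tmat V z *v x) = z *s top_part x - (\<chi> i j. of_real (V $ i $ j)) *v top_part x - bot_part x"
  "bot_part (tmat V z *v x) = top_part x"
proof -
  have "- mat 1 *v y = - y" for y :: "complex ^ 'w"
    using matrix_vector_mult_diff_rdistrib[of 0 "mat 1" y] by simp
  then show "top_part (tmat V z *v x) = z *s top_part x - (\<chi> i j. of_real (V $ i $ j)) *v top_part x - bot_part x"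
    "bot_part (tmat V z *v x) = top_part x"
    by (simp_all add: tmat_def parts_block_matrix_mult matrix_vector_mult_diff_rdistrib mat_mult_vec)
qed

text \<open>A real symmetric potential contributes a real quadratic form and drops out of the
  imaginary part, so only \<open>Im z\<close> remains. All bounds at nonreal parameters come from
  iterating this identity.\<close>

lemma wronskian_tmat:
  assumes "transpose V = V"
  shows "wronskian (tmat V z *v x) = wronskian x + Im z * (norm (top_part x))\<^sup>2"
proof -
  have "Im (cinner (bot_part x) (top_part x)) = - Im (cinner (top_part x) (bot_part x))"
    by (subst cinner_commute) simp
  then show ?thesis
    using cinner_symmetric_real[OF assms, of "top_part x"]
    by (simp add: wronskian_def parts_tmat cinner_diff_left cinner_scale_left cinner_self
        flip: of_real_power)
qed

lemma wronskian_tprod: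
  assumes "\<And>i. transpose (V i) = V i"
  shows "wronskian (tprod V z n *v x) = wronskian x + Im z * (\<Sum>k<n. (norm (top_part (tprod V z k *v x)))\<^sup>2)"
  by (induction n) (simp_all add: wronskian_tmat[OF assms] matrix_vector_mul_assoc[symmetric] algebra_simps)

lemma abs_wronskian_le: "\<bar>wronskian x\<bar> \<le> norm (top_part x) * norm (bot_part x)"
  unfolding wronskian_def by (rule order_trans[OF abs_Im_le_cmod norm_cinner_le])

lemma bot_part_tprod: "n \<ge> 1 \<Longrightarrow> bot_part (tprod V z n *v x) = top_part (tprod V z (n - 1) *v x)"
  by (cases n) (simp_all add: matrix_vector_mul_assoc[symmetric] parts_tmat)

text \<open>The sum contains the initial top part (\<open>k = 0\<close>) and the final bottom part,
  which is the top part one step earlier (\<open>k = n - 1\<close>).\<close>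

lemma tprod_energy_ge:
  assumes "n \<ge> 1"
  shows "(norm (top_part x))\<^sup>2 \<le> (\<Sum>k<n. (norm (top_part (tprod V z k *v x)))\<^sup>2)"
    and "(norm (bot_part (tprod V z n *v x)))\<^sup>2 \<le> (\<Sum>k<n. (norm (top_part (tprod V z k *v x)))\<^sup>2)"
proof -
  have "(norm (top_part (tprod V z k *v x)))\<^sup>2 \<le> (\<Sum>k<n. (norm (top_part (tprod V z k *v x)))\<^sup>2)" if "k < n" for k
    using that by (intro member_le_sum) auto
  from this[of 0] this[of "n - 1"]
  show "(norm (top_part x))\<^sup>2 \<le> (\<Sum>k<n. (norm (top_part (tprod V z k *v x)))\<^sup>2)"
    "(norm (bot_part (tprod V z n *v x)))\<^sup>2 \<le> (\<Sum>k<n. (norm (top_part (tprod V z k *v x)))\<^sup>2)"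
    using assms by (simp_all add: bot_part_tprod)
qed

lemma mult_square_le_imp_le:
  fixes e a b :: real
  assumes "e * a\<^sup>2 \<le> b * a" "0 \<le> a" "0 \<le> b"
  shows "e * a \<le> b"
proof (cases "a = 0")
  case False
  then show ?thesis
    using assms by (simp add: power2_eq_square flip: mult.assoc)
qed (use assms in auto)

context
  fixes V :: "nat \<Rightarrow> real ^ 'w ^ 'w" and z :: complex and \<epsilon> :: real
  assumes sym: "\<And>i. transpose (V i) = V i" and eps: "Im z = \<epsilon>" "\<epsilon> > 0"
begin

text \<open>The Wronskian starts at 0, so its final value is \<open>\<epsilon>\<close> times the
  energy and is at most the product of the norms of the two final parts. Keeping one energy term at
  a time gives the two inequalities.\<close>

lemma tprod_bounds_bot_zero:
  assumes n: "n \<ge> 1" and x: "bot_part x = 0"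
  shows "\<epsilon> * norm (top_part x) \<le> norm (top_part (tprod V z n *v x))"
    and "\<epsilon> * norm (bot_part (tprod V z n *v x)) \<le> norm (top_part (tprod V z n *v x))"
proof -
  let ?p = "norm (top_part (tprod V z n *v x))" and ?q = "norm (bot_part (tprod V z n *v x))"
  let ?E = "\<Sum>k<n. (norm (top_part (tprod V z k *v x)))\<^sup>2"
  have "wronskian x = 0"
    using x by (simp add: wronskian_def)
  then have "\<epsilon> * ?E = wronskian (tprod V z n *v x)"
    by (simp add: wronskian_tprod[where V = V, OF sym] eps)
  then have E: "\<epsilon> * ?E \<le> ?p * ?q"
    using abs_wronskian_le[of "tprod V z n *v x"] by linarith
  have "\<epsilon> * ?q\<^sup>2 \<le> ?p * ?q"
    by (rule order_trans[OF mult_left_mono[OF tprod_energy_ge(2)[OF n]] E]) (use eps in simp)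
  then show q: "\<epsilon> * ?q \<le> ?p"
    by (rule mult_square_le_imp_le) auto
  have "\<epsilon> * (norm (top_part x))\<^sup>2 \<le> ?p * ?q"
    by (rule order_trans[OF mult_left_mono[OF tprod_energy_ge(1)[OF n]] E]) (use eps in simp)
  then have "\<epsilon> * (\<epsilon> * (norm (top_part x))\<^sup>2) \<le> \<epsilon> * (?p * ?q)"
    using eps by simp
  also have "\<dots> \<le> ?p * ?p"
    using mult_left_mono[OF q, of ?p] by (simp add: mult_ac)
  finally have "(\<epsilon> * norm (top_part x))\<^sup>2 \<le> ?p\<^sup>2"
    by (simp add: power2_eq_square mult_ac)
  then show "\<epsilon> * norm (top_part x) \<le> ?p"
    by (rule power2_le_imp_le) simp
qed

text \<open>The mirror image: the Wronskian ends at 0, so it starts at minus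
  \<open>\<epsilon>\<close> times the energy.\<close>

lemma tprod_bounds_top_zero:
  assumes n: "n \<ge> 1" and x: "top_part (tprod V z n *v x) = 0"
  shows "\<epsilon> * norm (top_part x) \<le> norm (bot_part x)"
    and "\<epsilon> * norm (bot_part (tprod V z n *v x)) \<le> norm (bot_part x)"
    and "wronskian x \<le> 0"
proof -
  let ?p = "norm (top_part x)" and ?q = "norm (bot_part x)"
  let ?r = "norm (bot_part (tprod V z n *v x))"
  let ?E = "\<Sum>k<n. (norm (top_part (tprod V z k *v x)))\<^sup>2"
  have w: "- wronskian x = \<epsilon> * ?E"
    using x wronskian_tprod[where V = V and z = z and n = n and x = x, OF sym]
    by (simp add: eps wronskian_def)
  moreover have "?E \<ge> 0"
    by (intro sum_nonneg) auto
  ultimately show "wronskian x \<le> 0"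
    using eps by (smt (verit) mult_nonneg_nonneg)
  have E: "\<epsilon> * ?E \<le> ?p * ?q"
    using w abs_wronskian_le[of x] by linarith
  have "\<epsilon> * ?p\<^sup>2 \<le> ?q * ?p"
    unfolding mult.commute[of ?q]
    by (rule order_trans[OF mult_left_mono[OF tprod_energy_ge(1)[OF n]] E]) (use eps in simp)
  then show p: "\<epsilon> * ?p \<le> ?q"
    by (rule mult_square_le_imp_le) auto
  have "\<epsilon> * ?r\<^sup>2 \<le> ?p * ?q"
    by (rule order_trans[OF mult_left_mono[OF tprod_energy_ge(2)[OF n]] E]) (use eps in simp)
  then have "\<epsilon> * (\<epsilon> * ?r\<^sup>2) \<le> \<epsilon> * (?p * ?q)"
    using eps by simp
  also have "\<dots> \<le> ?q * ?q"
    using mult_right_mono[OF p, of ?q] by (simp add: mult_ac)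
  finally have "(\<epsilon> * ?r)\<^sup>2 \<le> ?q\<^sup>2"
    by (simp add: power2_eq_square mult_ac)
  then show "\<epsilon> * ?r \<le> ?q"
    by (rule power2_le_imp_le) simp
qed

text \<open>The constant depends on \<open>\<epsilon>\<close> alone and not on the potential or the
  length; this is what makes it invisible to exponential growth rates.\<close>

lemma boundary_bounded_tprod:
  assumes n: "n \<ge> 1"
  shows "boundary_bounded (max 1 (1 / \<epsilon>)) (tprod V z n)"
proof -
  have le: "a \<le> max 1 (1 / \<epsilon>) * b" if "\<epsilon> * a \<le> b" "0 \<le> b" for a b
  proof -
    have "a \<le> 1 / \<epsilon> * b"
      using that eps by (simp add: field_simps)
    also have "\<dots> \<le> max 1 (1 / \<epsilon>) * b"
      using that by (intro mult_right_mono) auto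
    finally show ?thesis .
  qed
  show ?thesis
    unfolding boundary_bounded_def
    by (intro conjI allI impI le tprod_bounds_bot_zero[OF n] tprod_bounds_top_zero[OF n]) auto
qed

lemma top_left_tprod_lower:
  assumes n: "n \<ge> 1"
  shows "norm x \<le> (1 / \<epsilon>) * norm (top_left (tprod V z n) *v x)"
  using tprod_bounds_bot_zero(1)[OF n, of "pair_vec x 0"] eps by (simp add: top_left_mult field_simps)

lemma det_top_left_tprod_lower:
  assumes n: "n \<ge> 1"
  shows "1 \<le> fact CARD('w) * (1 / \<epsilon>) ^ CARD('w) * cmod (det (top_left (tprod V z n)))"
  by (rule det_lower_bound[OF top_left_tprod_lower[OF n]])

end

lemma parts_eqI:
  assumes "top_part x = top_part y" "bot_part x = bot_part y"
  shows "x = y"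
proof -
  have "x = pair_vec (top_part x) (bot_part x)"
    by simp
  also have "\<dots> = y"
    by (simp only: assms pair_vec_parts)
  finally show ?thesis .
qed

context
  fixes z :: complex and \<epsilon> :: real
  assumes eps: "Im z = \<epsilon>" "\<epsilon> > 0"
begin

text \<open>Restarting with Dirichlet data at site \<open>n\<close> changes \<open>log \<bar>det\<bar>\<close> by an amount
  depending on \<open>Im z\<close> only.\<close>

lemma det_top_left_superadditive:
  fixes V :: "nat \<Rightarrow> real ^ 'w ^ 'w"
  assumes sym: "\<And>i. transpose (V i) = V i" and n: "n \<ge> 1" and m: "m \<ge> 1"
  shows "cmod (det (top_left (tprod V z n))) * cmod (det (top_left (tprod (\<lambda>i. V (i + n)) z m))) \<le>
    fact CARD('w) * (1 + 1 / \<epsilon>\<^sup>2) ^ CARD('w) * cmod (det (top_left (tprod V z (n + m))))"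
proof -
  let ?A = "top_left (tprod V z n)" and ?B = "top_left (tprod (\<lambda>i. V (i + n)) z m)"
  let ?C = "top_left (tprod V z (n + m))"
  obtain A' where A': "A' ** ?A = mat 1" "?A ** A' = mat 1"
    using inverse_matrix_exists[OF top_left_tprod_lower[of V, OF sym eps n]] by blast
  obtain B' where B': "B' ** ?B = mat 1" "?B ** B' = mat 1"
    using inverse_matrix_exists[OF top_left_tprod_lower[of "\<lambda>i. V (i + n)", OF sym eps m]] by blast
  \<comment> \<open>Since \<open>det ?C = det ?B * det E * det ?A\<close>, the claim amounts to a
    lower bound for \<open>E\<close>.\<close>
  define E where "E = B' ** ?C ** A'"
  have "norm w \<le> (1 + 1 / \<epsilon>\<^sup>2) * norm (E *v w)" for w
  proof -
    define p where "p = A' *v w"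
    define y where "y = tprod V z n *v pair_vec p 0"
    define e where "e = E *v w"
    have "top_part y = ?A *v p"
      by (simp add: y_def top_left_mult)
    then have y1: "top_part y = w"
      using A' by (simp add: p_def matrix_vector_mul_assoc)
    have Be: "?B *v e = ?C *v p"
      using B' by (simp add: e_def E_def p_def matrix_vector_mul_assoc matrix_mul_assoc)
    \<comment> \<open>\<open>e\<close> is the Dirichlet datum at the restart that reproduces the
      final top part of the solution through \<open>y\<close>. The difference \<open>y2\<close>
      therefore ends with top part 0, so its Wronskian at the restart is nonpositive.\<close>
    define y2 where "y2 = pair_vec (w - e) (bot_part y)"
    have y2: "y2 = y - pair_vec e 0"
      by (rule parts_eqI) (simp_all add: y2_def parts_diff y1)
    have "top_part (tprod (\<lambda>i. V (i + n)) z m *v y2) = 0"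
    proof -
      have "tprod (\<lambda>i. V (i + n)) z m *v y = tprod V z (n + m) *v pair_vec p 0"
        by (simp add: y_def tprod_add matrix_vector_mul_assoc)
      then show ?thesis
        using Be by (simp add: y2 matrix_vector_mult_diff_distrib parts_diff top_left_mult)
    qed
    note tz = tprod_bounds_top_zero[of "\<lambda>i. V (i + n)", OF sym eps m this]
    have 1: "\<epsilon> * norm (w - e) \<le> norm (bot_part y)" and 2: "wronskian y2 \<le> 0"
      using tz(1,3) by (simp_all add: y2_def)
    have "wronskian (pair_vec p 0) = 0"
      by (simp add: wronskian_def)
    then have "wronskian y = \<epsilon> * (\<Sum>k<n. (norm (top_part (tprod V z k *v pair_vec p 0)))\<^sup>2)"
      using wronskian_tprod[where V = V and z = z and n = n and x = "pair_vec p 0", OF sym] by (simp add: y_def eps)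
    then have "\<epsilon> * (norm (bot_part y))\<^sup>2 \<le> wronskian y"
      using tprod_energy_ge(2)[OF n, of V z "pair_vec p 0"] eps by (simp add: y_def)
    also have "wronskian y = wronskian y2 + Im (cinner e (bot_part y))"
      by (simp add: wronskian_def y1 y2_def cinner_diff_left)
    also have "\<dots> \<le> Im (cinner e (bot_part y))"
      using 2 by simp
    also have "\<dots> \<le> norm e * norm (bot_part y)"
      using norm_cinner_le[of e "bot_part y"] abs_Im_le_cmod[of "cinner e (bot_part y)"] by linarith
    finally have 3: "\<epsilon> * norm (bot_part y) \<le> norm e"
      by (rule mult_square_le_imp_le) auto
    have "\<epsilon> * (\<epsilon> * norm (w - e)) \<le> \<epsilon> * norm (bot_part y)"
      using 1 eps by simp
    with 3 have "\<epsilon>\<^sup>2 * norm (w - e) \<le> norm e"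
      by (simp add: power2_eq_square)
    then have "norm (w - e) \<le> 1 / \<epsilon>\<^sup>2 * norm e"
      using eps by (simp add: field_simps)
    then show ?thesis
      using norm_triangle_sub[of w e] by (simp add: e_def algebra_simps)
  qed
  from det_lower_bound[OF this]
  have E: "1 \<le> fact CARD('w) * (1 + 1 / \<epsilon>\<^sup>2) ^ CARD('w) * cmod (det E)" .
  have "E ** ?A = B' ** ?C"
    by (simp add: E_def matrix_mul_assoc[symmetric] A'(1))
  then have "?B ** (E ** ?A) = ?C"
    by (simp add: matrix_mul_assoc B'(2))
  then have "det ?C = det (?B ** (E ** ?A))"
    by simp
  then have "det ?C = det ?B * (det E * det ?A)"
    by (simp only: det_mul)
  then have "cmod (det ?C) = cmod (det ?A) * cmod (det ?B) * cmod (det E)"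
    by (simp add: norm_mult)
  then show ?thesis
    using mult_left_mono[OF E, of "cmod (det ?A) * cmod (det ?B)"] by (simp add: mult_ac)
qed

text \<open>Comparison of the frame \<open>B\<close> with Dirichlet data. For given \<open>c\<close>
  let \<open>e\<close> be the Dirichlet datum with the same top part at \<open>n\<close>; the
  difference ends with top part 0, and because \<open>B\<close> is isotropic,
  \<open>\<epsilon>\<close> times its energy is the imaginary part of the pairing of
  \<open>e\<close> with \<open>bot_part (B *v c)\<close>. The first two sites, present since
  \<open>n \<ge> 2\<close>, control that bottom part through the equation at the first site. Thus
  \<open>V 0\<close> enters the constant and \<open>n\<close> does not.\<close>

lemma det_frame_lower:
  fixes V :: "nat \<Rightarrow> real ^ 'w ^ 'w" and B :: "complex ^ 'w ^ ('w + 'w)"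
  assumes sym: "\<And>i. transpose (V i) = V i"
    and B: "\<And>c. wronskian (B *v c) = 0" "\<And>c. norm c \<le> norm (B *v c)"
    and R: "R \<ge> 1" and V0: "entry_sum (mat z - (\<chi> i j. of_real (V 0 $ i $ j)) :: complex ^ 'w ^ 'w) \<le> R - 1"
    and n: "n \<ge> 2"
  shows "cmod (det (top_left (tprod V z n))) \<le>
    fact CARD('w) * (1 + 2 * R / \<epsilon> + 2 * R\<^sup>2 / \<epsilon>) ^ CARD('w) * cmod (det (\<chi> i j. (tprod V z n ** B) $ Inl i $ j))"
proof -
  define K where "K = 1 + 2 * R / \<epsilon> + 2 * R\<^sup>2 / \<epsilon>"
  have K: "K > 0"
    using R eps unfolding K_def by (intro add_pos_nonneg) auto
  show ?thesis
  proof -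
    let ?A = "top_left (tprod V z n)" and ?Q = "(\<chi> i j. (tprod V z n ** B) $ Inl i $ j) :: complex ^ 'w ^ 'w"
    have n1: "n \<ge> 1"
      using n by simp
    obtain A' where A': "A' ** ?A = mat 1" "?A ** A' = mat 1"
      using inverse_matrix_exists[OF top_left_tprod_lower[of V, OF sym eps n1]] by blast
    have Q: "?Q *v c = top_part (tprod V z n *v (B *v c))" for c
      by (simp add: matrix_vector_mul_assoc) (simp add: vec_eq_iff top_part_def matrix_vector_mult_def)
    define E where "E = A' ** ?Q"
    have "norm c \<le> K * norm (E *v c)" for c
    proof -
      define x where "x = B *v c"
      define e where "e = E *v c"
      define y where "y = x - pair_vec e 0"
      have "?A *v e = ?Q *v c"
        using A' by (simp add: e_def E_def matrix_vector_mul_assoc matrix_mul_assoc)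
      moreover have "top_part (tprod V z n *v y) = ?Q *v c - ?A *v e"
        by (simp only: y_def x_def matrix_vector_mult_diff_distrib parts_diff Q top_left_mult)
      ultimately have "top_part (tprod V z n *v y) = 0"
        by simp
      then have "wronskian (tprod V z n *v y) = 0"
        by (simp add: wronskian_def)
      then have "\<epsilon> * (\<Sum>k<n. (norm (top_part (tprod V z k *v y)))\<^sup>2) = - wronskian y"
        using wronskian_tprod[where V = V and z = z and n = n and x = y, OF sym] by (simp add: eps)
      also have "\<dots> = Im (cinner e (bot_part x))"
        using B(1)[of c] by (simp add: wronskian_def y_def parts_diff cinner_diff_left x_def)
      also have "\<dots> \<le> norm e * norm (bot_part x)"
        using norm_cinner_le[of e "bot_part x"] abs_Im_le_cmod[of "cinner e (bot_part x)"] by linarith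
      finally have E: "\<epsilon> * (\<Sum>k<n. (norm (top_part (tprod V z k *v y)))\<^sup>2) \<le> norm e * norm (bot_part x)" .
      define a where "a = norm (top_part y)"
      define b where "b = norm (top_part (tmat (V 0) z *v y))"
      have "a\<^sup>2 + b\<^sup>2 = (\<Sum>k<2. (norm (top_part (tprod V z k *v y)))\<^sup>2)"
        by (simp add: numeral_2_eq_2 a_def b_def)
      also have "\<dots> \<le> (\<Sum>k<n. (norm (top_part (tprod V z k *v y)))\<^sup>2)"
        using n by (intro sum_mono2) auto
      finally have ab: "\<epsilon> * (a\<^sup>2 + b\<^sup>2) \<le> norm e * norm (bot_part x)"
        using E eps by (meson mult_left_mono order_trans less_imp_le)
      have "bot_part x = bot_part y"
        by (simp add: y_def parts_diff)
      also have "bot_part y = (mat z - (\<chi> i j. of_real (V 0 $ i $ j))) *v top_part y - top_part (tmat (V 0) z *v y)"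
        by (simp add: parts_tmat matrix_vector_mult_diff_rdistrib mat_mult_vec)
      also have "norm \<dots> \<le> (R - 1) * a + b"
        using norm_triangle_ineq4[of "(mat z - (\<chi> i j. of_real (V 0 $ i $ j))) *v top_part y" "top_part (tmat (V 0) z *v y)"]
          order_trans[OF norm_matrix_vector_le[of "mat z - (\<chi> i j. of_real (V 0 $ i $ j))" "top_part y"] mult_right_mono[OF V0 norm_ge_zero]]
        unfolding a_def b_def by linarith
      finally have "norm (bot_part x) \<le> (R - 1) * a + b" .
      also have "\<dots> \<le> R * (a + b)"
      proof -
        have "0 \<le> a" "b \<le> R * b"
          using mult_right_mono[OF R, of b] by (simp_all add: a_def b_def)
        then show ?thesis
          by (simp add: algebra_simps)
      qed
      finally have bx: "norm (bot_part x) \<le> R * (a + b)" .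
      have "(norm (bot_part x))\<^sup>2 \<le> (R * (a + b))\<^sup>2"
        using bx by (intro power_mono) auto
      also have "\<dots> \<le> R\<^sup>2 * (2 * (a\<^sup>2 + b\<^sup>2))"
        using sum_squares_bound[of a b] by (simp add: power_mult_distrib power2_sum mult_left_mono)
      finally have "\<epsilon> * (norm (bot_part x))\<^sup>2 \<le> \<epsilon> * (R\<^sup>2 * (2 * (a\<^sup>2 + b\<^sup>2)))"
        using eps by (intro mult_left_mono) auto
      then have "\<epsilon> * (norm (bot_part x))\<^sup>2 \<le> 2 * R\<^sup>2 * (\<epsilon> * (a\<^sup>2 + b\<^sup>2))"
        by (simp add: algebra_simps)
      also have "\<dots> \<le> (2 * R\<^sup>2 * norm e) * norm (bot_part x)"
        using ab by (simp add: mult_left_mono mult.assoc)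
      finally have "\<epsilon> * norm (bot_part x) \<le> 2 * R\<^sup>2 * norm e"
        by (rule mult_square_le_imp_le) auto
      then have bx2: "norm (bot_part x) \<le> (2 * R\<^sup>2 / \<epsilon>) * norm e"
        using eps by (simp add: field_simps)
      have "\<epsilon> * a\<^sup>2 \<le> norm e * norm (bot_part x)"
        using ab eps by (smt (verit) mult_left_mono zero_le_power2)
      also have "\<dots> \<le> norm e * ((2 * R\<^sup>2 / \<epsilon>) * norm e)"
        by (intro mult_left_mono bx2) auto
      finally have "(\<epsilon> * a)\<^sup>2 \<le> 2 * (R * norm e)\<^sup>2"
        using eps by (simp add: field_simps power2_eq_square)
      also have "\<dots> \<le> (2 * R * norm e)\<^sup>2"
        by (simp add: power_mult_distrib)
      finally have "\<epsilon> * a \<le> 2 * R * norm e"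
        using R by (intro power2_le_imp_le[of "\<epsilon> * a" "2 * R * norm e"]) auto
      then have "a \<le> (2 * R / \<epsilon>) * norm e"
        using eps by (simp add: field_simps)
      moreover have "norm (top_part x) \<le> norm e + a"
        using norm_triangle_sub[of "top_part x" e] by (simp add: a_def y_def parts_diff)
      ultimately have "norm x \<le> K * norm e"
        using bx2 norm_le_parts[of x] by (simp add: K_def algebra_simps)
      then show ?thesis
        using B(2)[of c] by (simp add: x_def e_def)
    qed
    from det_lower_bound[OF this]
    have E: "1 \<le> fact CARD('w) * K ^ CARD('w) * cmod (det E)" .
    have "?A ** E = ?Q"
      by (simp add: E_def matrix_mul_assoc A'(2))
    then have "det ?Q = det (?A ** E)"
      by simp
    then have "det ?Q = det ?A * det E"
      by (simp only: det_mul)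
    then show ?thesis
      using mult_left_mono[OF E, of "cmod (det ?A)"] by (simp add: mult_ac norm_mult K_def)
  qed
qed

end

subsection \<open>Polynomial dependence on the spectral parameter\<close>

definition polynomial_matrix :: "nat \<Rightarrow> (complex \<Rightarrow> complex ^ 'n ^ 'm) \<Rightarrow> bool" where
  "polynomial_matrix d A \<longleftrightarrow> (\<forall>i j. \<exists>p. degree p \<le> d \<and> (\<forall>z. A z $ i $ j = poly p z))"

lemma polynomial_matrix_const: "polynomial_matrix 0 (\<lambda>z. A)"
  unfolding polynomial_matrix_def by (metis degree_pCons_0 le_refl poly_const_conv)

lemma polynomial_matrix_mult:
  assumes "polynomial_matrix c A" "polynomial_matrix d B"
  shows "polynomial_matrix (c + d) (\<lambda>z. A z ** B z)"
proof -
  obtain p where p: "\<And>i j. degree (p i j) \<le> c" "\<And>i j z. A z $ i $ j = poly (p i j) z"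
    using assms(1) unfolding polynomial_matrix_def by metis
  obtain q where q: "\<And>i j. degree (q i j) \<le> d" "\<And>i j z. B z $ i $ j = poly (q i j) z"
    using assms(2) unfolding polynomial_matrix_def by metis
  have "\<exists>r. degree r \<le> c + d \<and> (\<forall>z. (A z ** B z) $ i $ j = poly r z)" for i j
  proof (intro exI[of _ "\<Sum>k\<in>UNIV. p i k * q k j"] conjI allI)
    show "degree (\<Sum>k\<in>UNIV. p i k * q k j) \<le> c + d"
      by (intro degree_sum_le order_trans[OF degree_mult_le] add_mono p q) auto
  qed (simp add: matrix_matrix_mult_def poly_sum p q)
  then show ?thesis
    by (simp add: polynomial_matrix_def)
qed

lemma polynomial_matrix_det:
  fixes A :: "complex \<Rightarrow> complex ^ 'n ^ 'n"
  assumes "polynomial_matrix d A"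
  shows "\<exists>p. degree p \<le> d * CARD('n) \<and> (\<forall>z. det (A z) = poly p z)"
proof -
  obtain p where p: "\<And>i j. degree (p i j) \<le> d" "\<And>i j z. A z $ i $ j = poly (p i j) z"
    using assms unfolding polynomial_matrix_def by metis
  show ?thesis
  proof (intro exI[of _ "\<Sum>\<pi> | \<pi> permutes UNIV. of_int (sign \<pi>) * (\<Prod>i\<in>UNIV. p i (\<pi> i))"] conjI allI)
    show "degree (\<Sum>\<pi> | \<pi> permutes UNIV. of_int (sign \<pi>) * (\<Prod>i\<in>UNIV. p i (\<pi> i))) \<le> d * CARD('n)"
    proof (rule degree_sum_le)
      fix \<pi> :: "'n \<Rightarrow> 'n"
      have "degree (\<Prod>i\<in>UNIV. p i (\<pi> i)) \<le> (\<Sum>i\<in>UNIV. degree (p i (\<pi> i)))"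
        using degree_prod_sum_le[of UNIV "\<lambda>i. p i (\<pi> i)"] by (simp add: o_def)
      also have "\<dots> \<le> (\<Sum>i\<in>(UNIV :: 'n set). d)"
        by (intro sum_mono p)
      finally have "degree (\<Prod>i\<in>UNIV. p i (\<pi> i)) \<le> d * CARD('n)"
        by (simp add: mult.commute)
      moreover have "degree (of_int (sign \<pi>) :: complex poly) = 0"
        by simp
      ultimately show "degree (of_int (sign \<pi>) * (\<Prod>i\<in>UNIV. p i (\<pi> i))) \<le> d * CARD('n)"
        using degree_mult_le[of "of_int (sign \<pi>)" "\<Prod>i\<in>UNIV. p i (\<pi> i)"] by simp
    qed (simp add: finite_permutations)
  qed (simp add: det_def poly_sum poly_prod p)
qed

lemma polynomial_matrix_tprod: "polynomial_matrix n (\<lambda>z. tprod V z n)"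
proof (induction n)
  case 0
  then show ?case
    using polynomial_matrix_const by simp
next
  case (Suc n)
  have "polynomial_matrix 1 (tmat (V n))"
    unfolding polynomial_matrix_def
  proof (intro allI)
    fix i j
    let ?c = "tmat (V n) 0 $ i $ j"
    let ?d = "if i = j \<and> (\<exists>a. i = Inl a) then 1 else 0"
    have "tmat (V n) z $ i $ j = poly [:?c, ?d:] z" for z
      by (auto simp: tmat_def block_matrix_def mat_def split: sum.split)
    moreover have "degree [:?c, ?d:] \<le> 1"
      by simp
    ultimately show "\<exists>p. degree p \<le> 1 \<and> (\<forall>z. tmat (V n) z $ i $ j = poly p z)"
      by blast
  qed
  from polynomial_matrix_mult[OF this Suc] show ?case
    by simp
qed

lemma polynomial_matrix_submatrix:
  assumes "polynomial_matrix d A"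
  shows "polynomial_matrix d (\<lambda>z. (\<chi> i j. A z $ r i $ c j))"
  using assms by (simp add: polynomial_matrix_def)

lemma poly_norm_factors:
  fixes p :: "complex poly"
  obtains r where "\<And>z. cmod (poly p z) = cmod (lead_coeff p) * (\<Prod>i<degree p. cmod (z - r i))"
    and "p \<noteq> 0 \<Longrightarrow> (\<And>i. i < degree p \<Longrightarrow> poly p (r i) = 0)"
proof -
  obtain r where r: "smult (lead_coeff p) (\<Prod>i<degree p. [:- r i, 1:]) = p"
    by (rule complex_poly_decompose')
  have eq: "poly p z = lead_coeff p * (\<Prod>i<degree p. z - r i)" for z
    by (subst r[symmetric]) (simp add: poly_prod)
  show ?thesis
  proof
    show "cmod (poly p z) = cmod (lead_coeff p) * (\<Prod>i<degree p. cmod (z - r i))" for z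
      unfolding eq by (simp add: norm_mult prod_norm)
    show "poly p (r i) = 0" if "i < degree p" for i
      unfolding eq using that by auto
  qed
qed

text \<open>All zeros lie in the closed lower half-plane, so moving up from the real axis increases
  the distance to each of them.\<close>

lemma poly_norm_mono_Im:
  assumes roots: "\<And>z. Im z > 0 \<Longrightarrow> poly p z \<noteq> 0" and "\<epsilon> \<ge> 0"
  shows "cmod (poly p (of_real x)) \<le> cmod (poly p (Complex x \<epsilon>))"
proof (cases "p = 0")
  case False
  obtain r where r: "\<And>z. cmod (poly p z) = cmod (lead_coeff p) * (\<Prod>i<degree p. cmod (z - r i))"
    "\<And>i. i < degree p \<Longrightarrow> poly p (r i) = 0"
    using poly_norm_factors[of p] False by metis
  show ?thesis
    unfolding r(1)
  proof (intro mult_left_mono prod_mono conjI)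
    fix i assume "i \<in> {..<degree p}"
    then have "Im (r i) \<le> 0"
      using roots[of "r i"] r(2)[of i] by force
    then have "(Im (r i))\<^sup>2 \<le> (\<epsilon> - Im (r i))\<^sup>2"
      using \<open>\<epsilon> \<ge> 0\<close> by (intro abs_le_square_iff[THEN iffD1]) auto
    then show "cmod (of_real x - r i) \<le> cmod (Complex x \<epsilon> - r i)"
      by (simp add: cmod_def)
  qed auto
qed auto

text \<open>Every zero is at distance at least \<open>Im w\<close> from \<open>w\<close>, so passing
  to \<open>z\<close> multiplies each factor by at most \<open>1 + cmod (z - w) / Im w\<close>. For
  Dirichlet determinants the degree is at most linear in \<open>n\<close>, and the growth rates
  become Lipschitz uniformly in \<open>n\<close>.\<close>

lemma poly_norm_lipschitz:
  assumes roots: "\<And>z. Im z > 0 \<Longrightarrow> poly p z \<noteq> 0" and "Im w > 0"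
  shows "cmod (poly p z) \<le> cmod (poly p w) * exp (degree p * (cmod (z - w) / Im w))"
proof (cases "p = 0")
  case False
  obtain r where r: "\<And>z. cmod (poly p z) = cmod (lead_coeff p) * (\<Prod>i<degree p. cmod (z - r i))"
    "\<And>i. i < degree p \<Longrightarrow> poly p (r i) = 0"
    using poly_norm_factors[of p] False by metis
  have "(\<Prod>i<degree p. cmod (z - r i)) \<le> (\<Prod>i<degree p. cmod (w - r i) * exp (cmod (z - w) / Im w))"
  proof (intro prod_mono conjI)
    fix i assume "i \<in> {..<degree p}"
    then have "Im (r i) \<le> 0"
      using roots[of "r i"] r(2)[of i] by force
    then have w: "Im w \<le> cmod (w - r i)"
      using abs_Im_le_cmod[of "w - r i"] by simp
    have "cmod (z - r i) \<le> cmod (w - r i) + cmod (z - w)"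
      using norm_triangle_ineq[of "w - r i" "z - w"] by simp
    also have "\<dots> \<le> cmod (w - r i) * (1 + cmod (z - w) / Im w)"
      using w \<open>Im w > 0\<close> mult_right_mono[OF w, of "cmod (z - w) / Im w"] by (simp add: field_simps)
    also have "\<dots> \<le> cmod (w - r i) * exp (cmod (z - w) / Im w)"
      by (intro mult_left_mono exp_ge_add_one_self) auto
    finally show "cmod (z - r i) \<le> cmod (w - r i) * exp (cmod (z - w) / Im w)" .
  qed auto
  also have "\<dots> = (\<Prod>i<degree p. cmod (w - r i)) * exp (degree p * (cmod (z - w) / Im w))"
    by (simp only: prod.distrib exp_of_nat_mult prod_constant card_lessThan)
  finally show ?thesis
    unfolding r(1) by (simp add: mult_left_mono mult.assoc)
qed auto

subsection \<open>Comparison of real and complex spectral parameters\<close>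

text \<open>The constant \<open>1 / \<epsilon>\<close> is useless on the real axis. In Cayley
  coordinates the Wronskian is a difference of squared norms, and its mere monotonicity yields
  bounds even for \<open>Im z = 0\<close>.\<close>

definition cayley :: "complex ^ ('w::finite + 'w) ^ ('w + 'w)" where
  "cayley = block_matrix (mat 1) (mat \<i>) (mat 1) (mat (- \<i>))"

definition cayley_inv :: "complex ^ ('w::finite + 'w) ^ ('w + 'w)" where
  "cayley_inv = block_matrix (mat (1 / 2)) (mat (1 / 2)) (mat (- \<i> / 2)) (mat (\<i> / 2))"

lemma parts_cayley:
  "top_part (cayley *v x) = top_part x + \<i> *s bot_part x"
  "bot_part (cayley *v x) = top_part x - \<i> *s bot_part x"
  by (simp_all add: cayley_def parts_block_matrix_mult mat_mult_vec)

lemma mat_mult_mat: "(mat a :: complex ^ 'n ^ 'n) ** mat b = mat (a * b)"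
  by (simp add: vec_eq_iff matrix_matrix_mult_def mat_def if_distrib[of "\<lambda>x. x * _"] cong: if_cong)

lemma mat_add: "(mat a :: complex ^ 'n ^ 'n) + mat b = mat (a + b)"
  by (simp add: vec_eq_iff mat_def)

lemma block_mat_one: "block_matrix (mat 1) 0 0 (mat 1) = (mat 1 :: complex ^ ('w::finite + 'w) ^ ('w + 'w))"
  by (auto simp: block_matrix_def vec_eq_iff mat_def split: sum.split)

lemma cayley_inverse: "cayley ** cayley_inv = mat 1" "cayley_inv ** cayley = mat 1"
proof -
  have "(mat 0 :: complex ^ 'n ^ 'n) = 0"
    by (simp add: vec_eq_iff mat_def)
  then show "cayley ** cayley_inv = mat 1" "cayley_inv ** cayley = mat 1"
    by (simp_all add: cayley_def cayley_inv_def block_matrix_mult mat_mult_mat mat_add flip: block_mat_one)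
qed

lemma cayley_wronskian:
  "(norm (top_part (cayley *v x)))\<^sup>2 - (norm (bot_part (cayley *v x)))\<^sup>2 = 4 * wronskian x"
proof -
  have "top_part x - \<i> *s bot_part x = top_part x + (- \<i>) *s bot_part x"
    by (simp add: vec_eq_iff)
  then show ?thesis
    unfolding parts_cayley by (simp only: norm_add_scale_complex) (simp add: wronskian_def)
qed

text \<open>For \<open>Im z \<ge> 0\<close> the difference of squared norms does not decrease. If
  the initial bottom part or the final top part vanishes, the remaining three squares give both
  inequalities with constant 1.\<close>

lemma cayley_boundary_bounded:
  assumes "\<And>i. transpose (V i) = V i" "Im z \<ge> 0"
  shows "boundary_bounded 1 (cayley ** tprod V z n ** cayley_inv)"
proof -
  have key: "(norm (top_part u))\<^sup>2 - (norm (bot_part u))\<^sup>2 \<le>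
      (norm (top_part ((cayley ** tprod V z n ** cayley_inv) *v u)))\<^sup>2 -
      (norm (bot_part ((cayley ** tprod V z n ** cayley_inv) *v u)))\<^sup>2" for u
  proof -
    define x where "x = cayley_inv *v u"
    have u: "u = cayley *v x"
      by (simp add: x_def matrix_vector_mul_assoc cayley_inverse)
    have "wronskian x \<le> wronskian (tprod V z n *v x)"
      unfolding wronskian_tprod[where V = V, OF assms(1)] using assms(2) by (simp add: sum_nonneg)
    moreover have "(cayley ** tprod V z n ** cayley_inv) *v u = cayley *v (tprod V z n *v x)"
      by (simp add: x_def matrix_vector_mul_assoc matrix_mul_assoc)
    ultimately show ?thesis
      using cayley_wronskian[of x] cayley_wronskian[of "tprod V z n *v x"] by (simp add: u[symmetric])
  qed
  show ?thesis
    unfolding boundary_bounded_def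
  proof (intro conjI allI impI; rule power2_le_imp_le)
    fix x :: "complex ^ ('a + 'a)"
    let ?y = "(cayley ** tprod V z n ** cayley_inv) *v x"
    note k = key[of x] zero_le_power2[of "norm (bot_part ?y)"] zero_le_power2[of "norm (top_part x)"]
    show "(norm (top_part x))\<^sup>2 \<le> (1 * norm (top_part ?y))\<^sup>2" "(norm (bot_part ?y))\<^sup>2 \<le> (1 * norm (top_part ?y))\<^sup>2"
      if "bot_part x = 0"
    proof -
      have "(norm (bot_part x))\<^sup>2 = 0"
        using that by simp
      then show "(norm (top_part x))\<^sup>2 \<le> (1 * norm (top_part ?y))\<^sup>2" "(norm (bot_part ?y))\<^sup>2 \<le> (1 * norm (top_part ?y))\<^sup>2"
        using k unfolding mult_1 by linarith+
    qed
    show "(norm (top_part x))\<^sup>2 \<le> (1 * norm (bot_part x))\<^sup>2" "(norm (bot_part ?y))\<^sup>2 \<le> (1 * norm (bot_part x))\<^sup>2"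
      if "top_part ?y = 0"
    proof -
      have "(norm (top_part ?y))\<^sup>2 = 0"
        using that by simp
      then show "(norm (top_part x))\<^sup>2 \<le> (1 * norm (bot_part x))\<^sup>2" "(norm (bot_part ?y))\<^sup>2 \<le> (1 * norm (bot_part x))\<^sup>2"
        using k unfolding mult_1 by linarith+
    qed
  qed auto
qed

text \<open>The corner determinant of the Cayley-conjugated product dominates the minors and is
  dominated by them, at real and complex parameters alike. It is polynomial in \<open>z\<close> and
  has no zero with \<open>Im z > 0\<close>, so its modulus at \<open>x\<close> is at most the one at
  \<open>Complex x \<epsilon>\<close>.\<close>

lemma minors_sum_real_le_complex:
  shows "\<exists>C>0. \<forall>(V :: nat \<Rightarrow> real ^ 'w::finite ^ 'w) n x \<epsilon>. (\<forall>i. transpose (V i) = V i) \<longrightarrow> \<epsilon> \<ge> 0 \<longrightarrow>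
    minors_sum CARD('w) (tprod V (of_real x) n) \<le> C * minors_sum CARD('w) (tprod V (Complex x \<epsilon>) n)"
proof -
  let ?W = "CARD('w)"
  let ?c = "minors_sum ?W (cayley :: complex ^ ('w + 'w) ^ ('w + 'w))"
  let ?c' = "minors_sum ?W (cayley_inv :: complex ^ ('w + 'w) ^ ('w + 'w))"
  obtain C1 where C1: "C1 > 0" "\<And>M :: complex ^ ('w + 'w) ^ ('w + 'w). boundary_bounded 1 M \<Longrightarrow>
      minors_sum ?W M \<le> C1 * cmod (det (top_left M))"
    using minors_sum_le_det_top_left[of 1, where 'w = 'w] by auto
  \<comment> \<open>The summand 1 ensures \<open>C > 0\<close>; of the sums of minors in the other
    term only nonnegativity is at hand.\<close>
  define C where "C = 1 + ?c' * C1 * ?c * ?c' * ?c"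
  have C: "C > 0"
    using C1(1) by (auto simp: C_def minors_sum_nonneg intro!: add_pos_nonneg mult_nonneg_nonneg)
  have "minors_sum ?W (tprod V (of_real x) n) \<le> C * minors_sum ?W (tprod V (Complex x \<epsilon>) n)"
    if sym: "\<And>i. transpose (V i) = V i" and "\<epsilon> \<ge> 0" for V :: "nat \<Rightarrow> real ^ 'w ^ 'w" and n x \<epsilon>
  proof -
    let ?M = "\<lambda>z. cayley ** tprod V z n ** cayley_inv"
    have "polynomial_matrix (0 + n + 0) ?M"
      by (intro polynomial_matrix_mult polynomial_matrix_const polynomial_matrix_tprod)
    then have "polynomial_matrix n (\<lambda>z. top_left (?M z))"
      unfolding top_left_def by (intro polynomial_matrix_submatrix) simp
    then obtain p where p: "\<And>z. det (top_left (?M z)) = poly p z"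
      using polynomial_matrix_det by blast
    have roots: "poly p z \<noteq> 0" if "Im z > 0" for z
    proof
      assume 0: "poly p z = 0"
      have "boundary_bounded 1 (?M z)"
        using that by (intro cayley_boundary_bounded sym) auto
      from det_lower_bound[OF boundary_bounded_top_left[OF this]] show False
        by (simp add: p 0)
    qed
    have "tprod V (of_real x) n = cayley_inv ** (?M (of_real x)) ** cayley"
      by (simp add: matrix_mul_assoc cayley_inverse) (simp add: matrix_mul_assoc[symmetric] cayley_inverse)
    moreover have "minors_sum ?W (cayley_inv ** (?M (of_real x)) ** cayley) \<le> ?c' * minors_sum ?W (?M (of_real x)) * ?c"
      by (intro order_trans[OF minors_sum_mult] mult_right_mono minors_sum_mult minors_sum_nonneg)
    ultimately have "minors_sum ?W (tprod V (of_real x) n) \<le> ?c' * minors_sum ?W (?M (of_real x)) * ?c"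
      by (simp only:)
    also have "\<dots> \<le> ?c' * (C1 * cmod (poly p (of_real x))) * ?c"
      unfolding p[symmetric] using sym
      by (intro mult_right_mono mult_left_mono C1(2) minors_sum_nonneg cayley_boundary_bounded) auto
    also have "\<dots> \<le> ?c' * (C1 * cmod (poly p (Complex x \<epsilon>))) * ?c"
      using C1(1) poly_norm_mono_Im[OF roots \<open>\<epsilon> \<ge> 0\<close>, of x]
      by (intro mult_right_mono mult_left_mono minors_sum_nonneg) auto
    also have "\<dots> \<le> ?c' * (C1 * (?c * minors_sum ?W (tprod V (Complex x \<epsilon>) n) * ?c')) * ?c"
    proof (intro mult_right_mono mult_left_mono minors_sum_nonneg)
      have "cmod (poly p (Complex x \<epsilon>)) \<le> minors_sum ?W (?M (Complex x \<epsilon>))"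
        unfolding p[symmetric] top_left_def by (rule det_submatrix_le_minors_sum)
      also have "\<dots> \<le> ?c * minors_sum ?W (tprod V (Complex x \<epsilon>) n) * ?c'"
        by (intro order_trans[OF minors_sum_mult] mult_right_mono minors_sum_mult minors_sum_nonneg)
      finally show "cmod (poly p (Complex x \<epsilon>)) \<le> ?c * minors_sum ?W (tprod V (Complex x \<epsilon>) n) * ?c'" .
    qed (use C1 in auto)
    also have "\<dots> \<le> C * minors_sum ?W (tprod V (Complex x \<epsilon>) n)"
      using minors_sum_nonneg[of ?W "tprod V (Complex x \<epsilon>) n"] by (simp add: C_def algebra_simps)
    finally show ?thesis .
  qed
  then show ?thesis
    using C by blast
qed

section \<open>Logarithmic potentials\<close>

lemma log_capacity_eq_0I:
  assumes "\<And>\<mu>. \<mu> \<in> compactly_supported_probs E \<Longrightarrow> log_energy \<mu> = \<infinity>"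
  shows "log_capacity E = 0"
  unfolding log_capacity_def using assms by (intro antisym SUP_least) auto

definition log_kernel_pos :: "complex \<Rightarrow> complex \<Rightarrow> ennreal" where
  "log_kernel_pos x y = e2ennreal (log_kernel x y)"

text \<open>In the extended reals \<open>\<infinity> - x = \<infinity>\<close> for every
  \<open>x\<close>, so an infinite positive part forces infinite energy whatever the negative part
  is.\<close>

lemma log_energy_finiteD:
  assumes "log_energy \<mu> \<noteq> \<infinity>"
  shows "(\<integral>\<^sup>+x. \<integral>\<^sup>+y. log_kernel_pos x y \<partial>\<mu> \<partial>\<mu>) \<noteq> \<infinity>"
proof
  assume "(\<integral>\<^sup>+x. \<integral>\<^sup>+y. log_kernel_pos x y \<partial>\<mu> \<partial>\<mu>) = \<infinity>"
  then have "enn2ereal (\<integral>\<^sup>+x. \<integral>\<^sup>+y. log_kernel_pos x y \<partial>\<mu> \<partial>\<mu>) = \<infinity>"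
    by simp
  then have "log_energy \<mu> = \<infinity>"
    unfolding log_energy_def log_kernel_pos_def by simp
  with assms show False ..
qed

lemma log_kernel_pos_eq:
  "log_kernel_pos x y = (if dist x y = 0 then \<infinity> else ennreal (ln (1 / dist x y)))"
  by (simp add: log_kernel_pos_def log_kernel_def e2ennreal_ereal)

lemma measurable_log_kernel_pos [measurable (raw)]:
  assumes [measurable]: "f \<in> borel_measurable M" "g \<in> borel_measurable M"
  shows "(\<lambda>x. log_kernel_pos (f x) (g x)) \<in> borel_measurable M"
  unfolding log_kernel_pos_eq by measurable

text \<open>Halving the distance adds \<open>ln 2\<close> to the kernel, and
  \<open>dist x y \<le> 1 / 2\<close> makes this at most \<open>ln (1 / dist x y)\<close>.\<close>

lemma log_kernel_pos_nearest:
  assumes y: "dist x y \<le> 2 * dist z y" "dist x y \<le> 1 / 2"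
  shows "log_kernel_pos z y \<le> 2 * log_kernel_pos x y"
proof (cases "x = y")
  case True
  then show ?thesis
    by (simp add: log_kernel_pos_eq ennreal_mult_top)
next
  case False
  then have d: "dist x y > 0" "dist z y > 0"
    using y by (auto simp: zero_less_dist_iff)
  have "1 / dist z y \<le> 2 * (1 / dist x y)"
    using d y by (simp add: field_simps)
  then have "ln (1 / dist z y) \<le> ln (2 * (1 / dist x y))"
    using d by (intro ln_mono) auto
  also have "\<dots> = ln 2 + ln (1 / dist x y)"
    using d by (intro ln_mult_pos) auto
  also have "ln 2 \<le> ln (1 / dist x y)"
    using d y by (intro ln_mono) (auto simp: field_simps)
  finally have "ln (1 / dist z y) \<le> 2 * ln (1 / dist x y)"
    by simp
  then have "ennreal (ln (1 / dist z y)) \<le> ennreal (2 * ln (1 / dist x y))"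
    by (rule ennreal_leI)
  also have "\<dots> = 2 * ennreal (ln (1 / dist x y))"
    using ennreal_mult'[of 2 "ln (1 / dist x y)"] by simp
  finally show ?thesis
    using d by (simp add: log_kernel_pos_eq)
qed

text \<open>The local potential is small on a large compact subset by almost everywhere convergence;
  passing to the nearest point of that subset extends the bound to the whole plane.\<close>

lemma small_log_potential:
  fixes \<mu> :: "complex measure"
  assumes \<mu>: "prob_space \<mu>" "sets \<mu> = sets borel"
    and fin: "(\<integral>\<^sup>+x. \<integral>\<^sup>+y. log_kernel_pos x y \<partial>\<mu> \<partial>\<mu>) \<noteq> \<infinity>"
    and S: "S \<in> sets borel" "measure \<mu> S > 0" and \<eta>: "\<eta> > 0"
  obtains K r where "compact K" "K \<subseteq> S" "measure \<mu> K \<ge> measure \<mu> S / 4" "0 < r" "r \<le> 1 / 4"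
    "\<And>z. (\<integral>\<^sup>+y. indicator (K \<inter> ball z r) y * log_kernel_pos z y \<partial>\<mu>) \<le> ennreal \<eta>"
proof -
  interpret prob_space \<mu> by fact
  note [measurable_cong] = \<mu>(2)
  have sp: "space \<mu> = UNIV"
    using sets_eq_imp_space_eq[OF \<mu>(2)] by simp
  define u where "u x = (\<integral>\<^sup>+y. log_kernel_pos x y \<partial>\<mu>)" for x
  have u[measurable]: "u \<in> borel_measurable \<mu>"
    unfolding u_def by measurable
  have "AE x in \<mu>. u x \<noteq> \<infinity>"
    using fin by (intro nn_integral_PInf_AE u) (simp add: u_def)
  \<comment> \<open>The radii \<open>1 / (j + 2)\<close> tend to 0 and never exceed 1/2, the range
    in which \<open>log_kernel_pos_nearest\<close> applies.\<close>
  define U where "U j x = (\<integral>\<^sup>+y. indicator (ball x (1 / real (j + 2))) y * log_kernel_pos x y \<partial>\<mu>)" for j x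
  have ind: "indicator (ball x c) y = (if dist x y < c then 1 else 0 :: ennreal)" for x y c
    by (simp add: indicator_def)
  have [measurable]: "U j \<in> borel_measurable \<mu>" for j
    unfolding U_def ind by measurable
  have lim: "AE x in \<mu>. (\<lambda>j. U j x) \<longlonglongrightarrow> 0"
    using \<open>AE x in \<mu>. u x \<noteq> \<infinity>\<close>
  proof eventually_elim
    fix x assume ux: "u x \<noteq> \<infinity>"
    have "AE y in \<mu>. log_kernel_pos x y \<noteq> \<infinity>"
      using ux unfolding u_def by (intro nn_integral_PInf_AE) auto
    then have ne: "AE y in \<mu>. x \<noteq> y"
      by eventually_elim (auto simp: log_kernel_pos_eq)
    have "(\<lambda>j. U j x) \<longlonglongrightarrow> (\<integral>\<^sup>+y. 0 \<partial>\<mu>)"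
      unfolding U_def
    proof (rule nn_integral_dominated_convergence[where w = "log_kernel_pos x"])
      show "AE y in \<mu>. (\<lambda>j. indicator (ball x (1 / real (j + 2))) y * log_kernel_pos x y) \<longlonglongrightarrow> 0"
        using ne
      proof eventually_elim
        fix y assume "x \<noteq> y"
        then have "dist x y > 0"
          by simp
        moreover have "(\<lambda>j. 1 / real (j + 2)) \<longlonglongrightarrow> 0"
          using LIMSEQ_ignore_initial_segment[OF lim_1_over_n, of 2] by simp
        ultimately have "\<forall>\<^sub>F j in sequentially. 1 / real (j + 2) < dist x y"
          by (intro order_tendstoD) auto
        then have "\<forall>\<^sub>F j in sequentially. indicator (ball x (1 / real (j + 2))) y * log_kernel_pos x y = 0"
          by eventually_elim (simp add: ind)
        then show "(\<lambda>j. indicator (ball x (1 / real (j + 2))) y * log_kernel_pos x y) \<longlonglongrightarrow> 0"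
          by (rule tendsto_eventually)
      qed
      show "AE y in \<mu>. indicator (ball x (1 / real (j + 2))) y * log_kernel_pos x y \<le> log_kernel_pos x y" for j
        by (auto simp: indicator_def)
      show "(\<lambda>y. indicator (ball x (1 / real (j + 2))) y * log_kernel_pos x y) \<in> borel_measurable \<mu>" for j
        unfolding ind by measurable
      show "(\<integral>\<^sup>+ y. log_kernel_pos x y \<partial>\<mu>) < \<infinity>"
        using ux by (simp add: u_def less_top)
    qed auto
    then show "(\<lambda>j. U j x) \<longlonglongrightarrow> 0"
      by simp
  qed
  have Umono: "U j x \<le> U i x" if "i \<le> j" for i j x
    unfolding U_def
  proof (intro nn_integral_mono mult_right_mono)
    have "1 / real (j + 2) \<le> 1 / real (i + 2)"
      using that by (intro frac_le) auto
    then have "ball x (1 / real (j + 2)) \<subseteq> ball x (1 / real (i + 2))"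
      by (rule subset_ball)
    then show "indicator (ball x (1 / real (j + 2))) y \<le> (indicator (ball x (1 / real (i + 2))) y :: ennreal)" for y
      by (auto simp: indicator_def)
  qed auto
  define B where "B j = {x \<in> S. U j x \<le> ennreal (\<eta> / 2)}" for j
  have B[measurable]: "B j \<in> sets \<mu>" for j
  proof -
    have "B j = S \<inter> {x \<in> space \<mu>. U j x \<le> ennreal (\<eta> / 2)}"
      by (auto simp: B_def sp)
    then show ?thesis
      using S(1) \<mu>(2) by simp
  qed
  have "incseq B"
    using Umono by (auto simp: incseq_def B_def intro: order_trans)
  then have "(\<lambda>j. prob (B j)) \<longlonglongrightarrow> prob (\<Union>j. B j)"
    using B by (intro finite_Lim_measure_incseq) auto
  moreover have "prob (\<Union>j. B j) = prob S"
  proof (rule finite_measure_eq_AE)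
    show "AE x in \<mu>. x \<in> (\<Union>j. B j) \<longleftrightarrow> x \<in> S"
      using lim
    proof eventually_elim
      fix x assume "(\<lambda>j. U j x) \<longlonglongrightarrow> 0"
      then have "\<forall>\<^sub>F j in sequentially. U j x < ennreal (\<eta> / 2)"
        using \<eta> by (intro order_tendstoD) auto
      then obtain j where "U j x < ennreal (\<eta> / 2)"
        by (auto simp: eventually_sequentially)
      then show "x \<in> (\<Union>j. B j) \<longleftrightarrow> x \<in> S"
        by (auto simp: B_def intro: less_imp_le)
    qed
  qed (use B S(1) \<mu>(2) in auto)
  \<comment> \<open>Monotone exhaustion keeps more than half of the mass of \<open>S\<close>; inner
    regularity will keep more than a quarter.\<close>
  ultimately have "\<forall>\<^sub>F j in sequentially. prob S / 2 < prob (B j)"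
    using S(2) by (intro order_tendstoD(1)) auto
  then obtain j where j: "prob S / 2 < prob (B j)"
    by (auto simp: eventually_sequentially)
  have "emeasure \<mu> (B j) = (SUP K\<in>{K. K \<subseteq> B j \<and> compact K}. emeasure \<mu> K)"
    using \<mu>(2) B by (intro inner_regular) (auto simp: emeasure_eq_measure)
  moreover have "ennreal (prob S / 4) < emeasure \<mu> (B j)"
    using j S(2) by (simp add: emeasure_eq_measure ennreal_less_iff)
  ultimately obtain K where K: "K \<subseteq> B j" "compact K" "ennreal (prob S / 4) < emeasure \<mu> K"
    by (auto simp: less_SUP_iff)
  \<comment> \<open>Half of the radius for \<open>U j\<close>: if \<open>x\<close> is the point of
    \<open>K\<close> nearest to \<open>z\<close>, then \<open>K \<inter> ball z r\<close> lies in
    the ball of radius \<open>2 * r\<close> about \<open>x\<close>.\<close>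
  define r where "r = 1 / (2 * real (j + 2))"
  have r: "0 < r" "r \<le> 1 / 4" "2 * r = 1 / real (j + 2)"
    by (auto simp: r_def field_simps)
  have "(\<integral>\<^sup>+y. indicator (K \<inter> ball z r) y * log_kernel_pos z y \<partial>\<mu>) \<le> ennreal \<eta>" for z
  proof (cases "K = {}")
    case False
    obtain x where x: "x \<in> K" "\<And>y. y \<in> K \<Longrightarrow> dist z x \<le> dist z y"
      using distance_attains_inf[OF compact_imp_closed[OF K(2)] False, of z] by blast
    have "(\<integral>\<^sup>+y. indicator (K \<inter> ball z r) y * log_kernel_pos z y \<partial>\<mu>) \<le>
        (\<integral>\<^sup>+y. 2 * (indicator (ball x (1 / real (j + 2))) y * log_kernel_pos x y) \<partial>\<mu>)"
    proof (rule nn_integral_mono)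
      fix y
      show "indicator (K \<inter> ball z r) y * log_kernel_pos z y \<le>
          2 * (indicator (ball x (1 / real (j + 2))) y * log_kernel_pos x y)"
      proof (cases "y \<in> K \<inter> ball z r")
        case True
        have "dist x y \<le> dist z x + dist z y"
          by (metis dist_commute dist_triangle)
        then have xy: "dist x y \<le> 2 * dist z y"
          using x(2)[of y] True by simp
        then have lt: "dist x y < 1 / real (j + 2)"
          using True r(3) by simp
        have "1 / real (j + 2) \<le> 1 / 2"
          by (simp add: field_simps)
        with lt have "dist x y \<le> 1 / 2"
          by linarith
        with xy have "log_kernel_pos z y \<le> 2 * log_kernel_pos x y"
          by (rule log_kernel_pos_nearest)
        then show ?thesis
          using True lt by simp
      qed auto
    qed
    also have "\<dots> = 2 * U j x"
      unfolding U_def ind by (rule nn_integral_cmult) measurable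
    also have "\<dots> \<le> 2 * ennreal (\<eta> / 2)"
      using x(1) K(1) by (intro mult_left_mono) (auto simp: B_def)
    also have "\<dots> = ennreal \<eta>"
      using \<eta> ennreal_mult'[of 2 "\<eta> / 2"] by simp
    finally show ?thesis .
  qed simp
  moreover have "K \<subseteq> S"
    using K(1) by (auto simp: B_def)
  moreover have "prob S / 4 \<le> prob K"
    using K(3) S(2) by (simp add: emeasure_eq_measure ennreal_less_iff less_imp_le)
  ultimately show ?thesis
    using that[of K r] K(2) r by blast
qed

section \<open>Shifting logarithmic integrals against a measure with small local potential\<close>

locale small_potential = prob_space \<mu> for \<mu> :: "complex measure" +
  fixes K r \<eta>
  assumes sets_mu: "sets \<mu> = sets borel" and compact_K: "compact K" and r: "0 < r" "r \<le> 1 / 4" and eta: "\<eta> > 0"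
    and small: "\<And>z. (\<integral>\<^sup>+y. indicator (K \<inter> ball z r) y * log_kernel_pos z y \<partial>\<mu>) \<le> ennreal \<eta>"
begin

lemma sets_K [measurable]: "K \<in> sets \<mu>"
  using compact_K sets_mu by (simp add: compact_imp_closed)

lemma measurable_from_borel: "f \<in> borel_measurable borel \<Longrightarrow> f \<in> borel_measurable \<mu>"
  using measurable_cong_sets[OF sets_mu refl] by blast

text \<open>The kernel on the part of \<open>K\<close> close to \<open>z\<close>, nonnegative
  because \<open>r \<le> 1 / 4\<close>. At \<open>x = z\<close> it has the value 0, from
  \<open>ln 0 = 0\<close>, instead of \<open>\<infinity>\<close>.\<close>

definition near :: "complex \<Rightarrow> complex \<Rightarrow> real" where
  "near z x = indicator (K \<inter> ball z r) x * (- ln (cmod (x - z)))"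

lemma near_nonneg: "near z x \<ge> 0"
proof (cases "x \<in> ball z r")
  case True
  then have "cmod (x - z) < 1"
    using r by (simp add: dist_norm norm_minus_commute)
  then show ?thesis
    by (cases "x = z") (auto simp: near_def indicator_def ln_le_zero_iff)
qed (simp add: near_def)

lemma measurable_near [measurable]: "near z \<in> borel_measurable \<mu>"
proof -
  have "K \<inter> ball z r \<in> sets borel"
    using compact_K by (intro sets.Int) (auto simp: compact_imp_closed)
  then have "(indicator (K \<inter> ball z r) :: complex \<Rightarrow> real) \<in> borel_measurable borel"
    by (rule borel_measurable_indicator)
  moreover have "(\<lambda>x. - ln (cmod (x - z))) \<in> borel_measurable borel"
    by measurable
  ultimately show ?thesis
    unfolding near_def[abs_def] by (intro measurable_from_borel borel_measurable_times)
qed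

lemma nn_integral_near: "(\<integral>\<^sup>+x. ennreal (near z x) \<partial>\<mu>) \<le> ennreal \<eta>"
proof (rule order_trans[OF nn_integral_mono small[of z]])
  fix x
  show "ennreal (near z x) \<le> indicator (K \<inter> ball z r) x * log_kernel_pos z x"
    by (auto simp: near_def indicator_def log_kernel_pos_eq ln_div dist_norm norm_minus_commute ennreal_neg)
qed

lemma integrable_near: "integrable \<mu> (near z)" and integral_near: "integral\<^sup>L \<mu> (near z) \<le> \<eta>"
proof -
  show int: "integrable \<mu> (near z)"
    using nn_integral_near[of z] near_nonneg
    by (intro integrableI_nonneg) (auto simp: le_less_trans[OF _ ennreal_less_top])
  have "ennreal (integral\<^sup>L \<mu> (near z)) \<le> ennreal \<eta>"
    using nn_integral_near[of z] near_nonneg by (subst nn_integral_eq_integral[OF int, symmetric]) auto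
  then show "integral\<^sup>L \<mu> (near z) \<le> \<eta>"
    using eta by simp
qed

text \<open>The kernel is infinite on the diagonal, so a finite local potential rules out atoms in
  \<open>K\<close>.\<close>

lemma null_point: "AE x in \<mu>. x \<in> K \<longrightarrow> x \<noteq> z"
proof -
  have "AE x in \<mu>. indicator (K \<inter> ball z r) x * log_kernel_pos z x \<noteq> \<infinity>"
  proof (rule nn_integral_PInf_AE)
    have "K \<inter> ball z r \<in> sets \<mu>"
      using compact_K sets_mu by (simp add: compact_imp_closed)
    then show "(\<lambda>x. indicator (K \<inter> ball z r) x * log_kernel_pos z x) \<in> borel_measurable \<mu>"
      by (intro borel_measurable_times_ennreal borel_measurable_indicator measurable_log_kernel_pos measurable_from_borel) auto
    show "(\<integral>\<^sup>+x. indicator (K \<inter> ball z r) x * log_kernel_pos z x \<partial>\<mu>) \<noteq> \<infinity>"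
      using small[of z] by (auto simp: top_unique)
  qed
  then show ?thesis
    by eventually_elim (use r in \<open>auto simp: log_kernel_pos_eq indicator_def split: if_splits\<close>)
qed

lemma integrable_ln: "integrable \<mu> (\<lambda>x. indicator K x * ln (cmod (x - z)))"
proof -
  obtain b where b: "\<And>x. x \<in> K \<Longrightarrow> cmod x \<le> b"
    using compact_imp_bounded[OF compact_K] by (auto simp: bounded_iff)
  define C where "C = \<bar>ln r\<bar> + \<bar>b\<bar> + cmod z"
  show ?thesis
  proof (rule Bochner_Integration.integrable_bound[where f = "\<lambda>x. C + near z x"])
    show "integrable \<mu> (\<lambda>x. C + near z x)"
      using integrable_near[of z] by simp
    show "(\<lambda>x. indicator K x * ln (cmod (x - z))) \<in> borel_measurable \<mu>"
      using compact_K by (intro measurable_from_borel borel_measurable_times borel_measurable_indicator)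
        (auto simp: compact_imp_closed)
    have "norm (indicator K x * ln (cmod (x - z))) \<le> norm (C + near z x)" for x
    proof -
      have C: "C \<ge> 0"
        by (simp add: C_def)
      have "\<bar>ln (cmod (x - z))\<bar> \<le> C + near z x" if x: "x \<in> K"
      proof (cases "x \<in> ball z r")
        case True
        then have "\<bar>ln (cmod (x - z))\<bar> = near z x"
          using near_nonneg[of z x] x by (simp add: near_def)
        then show ?thesis
          using C by simp
      next
        case False
        then have rx: "r \<le> cmod (x - z)"
          by (simp add: dist_norm norm_minus_commute)
        have "ln r \<le> ln (cmod (x - z))"
          using rx r by (intro ln_mono) auto
        moreover have "ln (cmod (x - z)) \<le> cmod (x - z)"
          using rx r ln_le_minus_one[of "cmod (x - z)"] by linarith
        moreover have "cmod (x - z) \<le> b + cmod z"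
          using norm_triangle_ineq4[of x z] b[OF x] by simp
        ultimately show ?thesis
          using near_nonneg[of z x] abs_ge_self[of b] abs_ge_minus_self[of "ln r"] norm_ge_zero[of z] abs_ge_zero[of "ln r"]
            abs_ge_zero[of b] unfolding C_def by (intro abs_leI) linarith+
      qed
      then show ?thesis
        using C near_nonneg[of z x] by (cases "x \<in> K") auto
    qed
    then show "AE x in \<mu>. norm (indicator K x * ln (cmod (x - z))) \<le> norm (C + near z x)"
      by simp
  qed
qed

text \<open>Within distance \<open>r\<close> of \<open>z\<close> the shifted logarithm is
  nonpositive because \<open>2 * r \<le> 1\<close>, so the increase is at most
  \<open>near z x\<close>, whose integral is at most \<open>\<eta>\<close>. Elsewhere a shift by
  \<open>e\<close> raises the logarithm by at most \<open>e / r\<close>.\<close>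

lemma integral_ln_shift:
  assumes e: "0 < e" "e < r"
  shows "(\<integral>x. indicator K x * ln (cmod (x + \<i> * of_real e - z)) \<partial>\<mu>) - (\<integral>x. indicator K x * ln (cmod (x - z)) \<partial>\<mu>) \<le> \<eta> + e / r"
proof -
  have eq: "x + \<i> * of_real e - z = x - (z - \<i> * of_real e)" for x
    by simp
  have int: "integrable \<mu> (\<lambda>x. indicator K x * ln (cmod (x + \<i> * of_real e - z)))"
    unfolding eq by (rule integrable_ln)
  have "(\<integral>x. indicator K x * ln (cmod (x + \<i> * of_real e - z)) \<partial>\<mu>) - (\<integral>x. indicator K x * ln (cmod (x - z)) \<partial>\<mu>)
      = (\<integral>x. indicator K x * ln (cmod (x + \<i> * of_real e - z)) - indicator K x * ln (cmod (x - z)) \<partial>\<mu>)"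
    by (rule Bochner_Integration.integral_diff[OF int integrable_ln, symmetric])
  also have "\<dots> \<le> (\<integral>x. near z x + e / r \<partial>\<mu>)"
  proof (rule integral_mono_AE)
    show "AE x in \<mu>. indicator K x * ln (cmod (x + \<i> * of_real e - z)) - indicator K x * ln (cmod (x - z)) \<le> near z x + e / r"
      using null_point[of z]
    proof eventually_elim
      fix x assume ne: "x \<in> K \<longrightarrow> x \<noteq> z"
      have er: "e / r \<ge> 0"
        using e r by simp
      have tri: "cmod (x + \<i> * of_real e - z) \<le> cmod (x - z) + e"
        using norm_triangle_ineq[of "x - z" "\<i> * of_real e"] e by (simp add: norm_mult algebra_simps)
      consider "x \<notin> K" | "x \<in> K" "x \<in> ball z r" | "x \<in> K" "x \<notin> ball z r"
        by blast
      then show "indicator K x * ln (cmod (x + \<i> * of_real e - z)) - indicator K x * ln (cmod (x - z)) \<le> near z x + e / r"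
      proof cases
        case 1
        then show ?thesis
          using er near_nonneg[of z x] by simp
      next
        case 2
        then have "cmod (x + \<i> * of_real e - z) \<le> 1"
          using tri e r by (simp add: dist_norm norm_minus_commute)
        \<comment> \<open>If the shifted point hits \<open>z\<close>, the convention
          \<open>ln 0 = 0\<close> keeps the inequality.\<close>
        then have "ln (cmod (x + \<i> * of_real e - z)) \<le> 0"
          by (cases "cmod (x + \<i> * of_real e - z) = 0") (auto simp: ln_le_zero_iff)
        then show ?thesis
          using 2 er by (simp add: near_def)
      next
        case 3
        then have rx: "r \<le> cmod (x - z)"
          by (simp add: dist_norm norm_minus_commute)
        have "cmod (x - z) - e \<le> cmod (x + \<i> * of_real e - z)"
          using norm_triangle_ineq4[of "x + \<i> * of_real e - z" "\<i> * of_real e"] e by (simp add: norm_mult)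
        then have pos: "cmod (x + \<i> * of_real e - z) > 0" "cmod (x - z) > 0"
          using rx e r by linarith+
        have "ln (cmod (x + \<i> * of_real e - z)) - ln (cmod (x - z)) = ln (cmod (x + \<i> * of_real e - z) / cmod (x - z))"
          using pos by (simp add: ln_div)
        also have "\<dots> \<le> cmod (x + \<i> * of_real e - z) / cmod (x - z) - 1"
          using pos by (intro ln_le_minus_one) auto
        also have "\<dots> \<le> e / cmod (x - z)"
        proof -
          have "cmod (x + \<i> * of_real e - z) / cmod (x - z) - 1 = (cmod (x + \<i> * of_real e - z) - cmod (x - z)) / cmod (x - z)"
            using pos(2) by (simp add: diff_divide_distrib)
          also have "\<dots> \<le> e / cmod (x - z)"
            using tri by (intro divide_right_mono) auto
          finally show ?thesis .
        qed
        also have "\<dots> \<le> e / r"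
          using rx r e by (intro frac_le) auto
        finally show ?thesis
          using 3 near_nonneg[of z x] by simp
      qed
    qed
  qed (use int integrable_ln integrable_near in auto)
  also have "\<dots> = integral\<^sup>L \<mu> (near z) + e / r"
    using integrable_near[of z] by (subst Bochner_Integration.integral_add) (auto simp: prob_space)
  also have "\<dots> \<le> \<eta> + e / r"
    using integral_near[of z] by simp
  finally show ?thesis .
qed

text \<open>The estimate for one logarithm is uniform in \<open>z\<close>, so it adds up over the
  zeros of \<open>p\<close> wherever they lie; the leading coefficient cancels in the
  difference.\<close>

lemma integral_ln_poly_shift:
  fixes p :: "complex poly"
  assumes p: "p \<noteq> 0" and e: "0 < e" "e < r"
  shows "AE x in \<mu>. x \<in> K \<longrightarrow> poly p x \<noteq> 0"
    and "integrable \<mu> (\<lambda>x. indicator K x * ln (cmod (poly p x)))"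
    and "integrable \<mu> (\<lambda>x. indicator K x * ln (cmod (poly p (x + \<i> * of_real e))))"
    and "(\<integral>x. indicator K x * ln (cmod (poly p (x + \<i> * of_real e))) \<partial>\<mu>) - (\<integral>x. indicator K x * ln (cmod (poly p x)) \<partial>\<mu>)
      \<le> real (degree p) * (\<eta> + e / r)"
proof -
  obtain rt where rt: "smult (lead_coeff p) (\<Prod>i<degree p. [:- rt i, 1:]) = p"
    by (rule complex_poly_decompose')
  have eq: "poly p z = lead_coeff p * (\<Prod>i<degree p. z - rt i)" for z
    by (subst rt[symmetric]) (simp add: poly_prod)
  have lc: "lead_coeff p \<noteq> 0"
    using p by simp
  have ln_eq: "ln (cmod (poly p z)) = ln (cmod (lead_coeff p)) + (\<Sum>i<degree p. ln (cmod (z - rt i)))"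
    if "\<forall>i<degree p. z \<noteq> rt i" for z
  proof -
    have "ln (cmod (poly p z)) = ln (cmod (lead_coeff p) * (\<Prod>i<degree p. cmod (z - rt i)))"
      unfolding eq by (simp add: norm_mult prod_norm)
    also have "\<dots> = ln (cmod (lead_coeff p)) + ln (\<Prod>i<degree p. cmod (z - rt i))"
      using lc that by (intro ln_mult_pos) (auto intro!: prod_pos)
    also have "ln (\<Prod>i<degree p. cmod (z - rt i)) = (\<Sum>i<degree p. ln (cmod (z - rt i)))"
      using that by (intro ln_prod) auto
    finally show ?thesis .
  qed
  have ne: "AE x in \<mu>. x \<in> K \<longrightarrow> (\<forall>i<degree p. x \<noteq> w i)" for w :: "nat \<Rightarrow> complex"
  proof -
    have "AE x in \<mu>. \<forall>i. x \<in> K \<longrightarrow> x \<noteq> w i"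
      unfolding AE_all_countable using null_point by blast
    then show ?thesis
      by eventually_elim blast
  qed
  show "AE x in \<mu>. x \<in> K \<longrightarrow> poly p x \<noteq> 0"
    using ne[of rt] by eventually_elim (use lc in \<open>auto simp: eq\<close>)
  have shift: "x + \<i> * of_real e - z = x - (z - \<i> * of_real e)" for x z
    by simp
  have sets_K': "K \<in> sets borel"
    using compact_K by (simp add: compact_imp_closed)
  have intS: "integrable \<mu> (\<lambda>x. indicator K x * c + (\<Sum>i\<in>I. indicator K x * ln (cmod (x - w i))))" for I w and c :: real
    by (intro Bochner_Integration.integrable_add Bochner_Integration.integrable_sum integrable_ln integrable_mult_left
        integrable_real_indicator) (auto simp: emeasure_eq_measure)
  have a1: "AE x in \<mu>. indicator K x * ln (cmod (poly p x)) =
      indicator K x * ln (cmod (lead_coeff p)) + (\<Sum>i<degree p. indicator K x * ln (cmod (x - rt i)))"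
    using ne[of rt] by eventually_elim (auto simp: ln_eq indicator_def)
  have a2: "AE x in \<mu>. indicator K x * ln (cmod (poly p (x + \<i> * of_real e))) =
      indicator K x * ln (cmod (lead_coeff p)) + (\<Sum>i<degree p. indicator K x * ln (cmod (x - (rt i - \<i> * of_real e))))"
    using ne[of "\<lambda>i. rt i - \<i> * of_real e"]
  proof eventually_elim
    fix x assume x: "x \<in> K \<longrightarrow> (\<forall>i<degree p. x \<noteq> rt i - \<i> * of_real e)"
    show "indicator K x * ln (cmod (poly p (x + \<i> * of_real e))) =
      indicator K x * ln (cmod (lead_coeff p)) + (\<Sum>i<degree p. indicator K x * ln (cmod (x - (rt i - \<i> * of_real e))))"
    proof (cases "x \<in> K")
      case True
      then have "\<forall>i<degree p. x + \<i> * of_real e \<noteq> rt i"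
        using x by (auto simp: algebra_simps)
      then show ?thesis
        using True by (simp add: ln_eq shift)
    qed simp
  qed
  have m1: "(\<lambda>x. indicator K x * ln (cmod (poly p x))) \<in> borel_measurable \<mu>"
    using sets_K' by (intro measurable_from_borel borel_measurable_times borel_measurable_indicator borel_measurable_ln
        borel_measurable_continuous_onI continuous_intros)
  have m2: "(\<lambda>x. indicator K x * ln (cmod (poly p (x + \<i> * of_real e)))) \<in> borel_measurable \<mu>"
    using sets_K' by (intro measurable_from_borel borel_measurable_times borel_measurable_indicator borel_measurable_ln
        borel_measurable_continuous_onI continuous_intros)
  note ms = borel_measurable_integrable[OF intS]
  show "integrable \<mu> (\<lambda>x. indicator K x * ln (cmod (poly p x)))"
    by (subst integrable_cong_AE[OF m1 ms a1]) (rule intS)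
  show "integrable \<mu> (\<lambda>x. indicator K x * ln (cmod (poly p (x + \<i> * of_real e))))"
    by (subst integrable_cong_AE[OF m2 ms a2]) (rule intS)
  have val: "(\<integral>x. indicator K x * c + (\<Sum>i\<in>I. indicator K x * ln (cmod (x - w i))) \<partial>\<mu>) =
      (\<integral>x. indicator K x * c \<partial>\<mu>) + (\<Sum>i\<in>I. \<integral>x. indicator K x * ln (cmod (x - w i)) \<partial>\<mu>)" for I w and c :: real
    by (subst Bochner_Integration.integral_add)
      (auto intro!: Bochner_Integration.integrable_sum integrable_ln integrable_mult_left integrable_real_indicator
        Bochner_Integration.integral_sum simp: emeasure_eq_measure)
  have "(\<integral>x. indicator K x * ln (cmod (poly p (x + \<i> * of_real e))) \<partial>\<mu>) - (\<integral>x. indicator K x * ln (cmod (poly p x)) \<partial>\<mu>)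
      = (\<Sum>i<degree p. (\<integral>x. indicator K x * ln (cmod (x - (rt i - \<i> * of_real e))) \<partial>\<mu>) - (\<integral>x. indicator K x * ln (cmod (x - rt i)) \<partial>\<mu>))"
    unfolding integral_cong_AE[OF m1 ms a1] integral_cong_AE[OF m2 ms a2] val by (simp add: sum_subtractf)
  also have "\<dots> \<le> (\<Sum>i<degree p. \<eta> + e / r)"
    by (intro sum_mono) (use integral_ln_shift[OF e] in \<open>simp add: shift\<close>)
  finally show "(\<integral>x. indicator K x * ln (cmod (poly p (x + \<i> * of_real e))) \<partial>\<mu>) - (\<integral>x. indicator K x * ln (cmod (poly p x)) \<partial>\<mu>)
      \<le> real (degree p) * (\<eta> + e / r)"
    by simp
qed

end

text \<open>The upper envelope theorem for logarithmic potentials of zeros, tested against a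
  measure of finite energy on the exceptional set.\<close>

lemma log_capacity_exceptional_set:
  fixes p :: "nat \<Rightarrow> complex poly" and G :: "complex \<Rightarrow> real"
  assumes deg: "\<And>n. degree (p n) \<le> n * W" and nz: "\<And>n. n \<ge> N0 \<Longrightarrow> p n \<noteq> 0"
    and real: "\<And>z. z \<in> E \<Longrightarrow> Im z = 0"
    and G_meas: "G \<in> borel_measurable borel" and G_bd: "\<And>R. \<exists>C. \<forall>z. cmod z \<le> R \<longrightarrow> \<bar>G z\<bar> \<le> C"
    and low: "\<And>e R. e > 0 \<Longrightarrow> \<exists>c. \<forall>n\<ge>N0. \<forall>x. Im x = 0 \<longrightarrow> cmod x \<le> R \<longrightarrow> - c \<le> ln (cmod (poly (p n) (x + \<i> * of_real e))) / n"
    and liminf: "\<And>x e \<delta>. Im x = 0 \<Longrightarrow> e > 0 \<Longrightarrow> \<delta> > 0 \<Longrightarrow>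
      \<forall>\<^sub>F n in sequentially. G x - \<delta> \<le> ln (cmod (poly (p n) (x + \<i> * of_real e))) / n"
    and E: "\<And>x. x \<in> E \<Longrightarrow> \<exists>\<delta>>0. \<forall>\<^sub>F n in sequentially. poly (p n) x \<noteq> 0 \<longrightarrow> ln (cmod (poly (p n) x)) / n \<le> G x - \<delta>"
  shows "log_capacity E = 0"
proof (rule log_capacity_eq_0I, rule ccontr)
  fix \<mu> assume mu: "\<mu> \<in> compactly_supported_probs E" and fin: "log_energy \<mu> \<noteq> \<infinity>"
  from mu obtain K0 where K0: "compact K0" "K0 \<subseteq> E" "emeasure \<mu> K0 = 1"
    and mu': "prob_space \<mu>" "sets \<mu> = sets borel"
    by (auto simp: compactly_supported_probs_def)
  interpret P: prob_space \<mu> by (rule mu')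
  define u where "u n x = ln (cmod (poly (p n) x)) / real n" for n x
  have u_meas: "u n \<in> borel_measurable borel" for n
    unfolding u_def[abs_def]
    by (intro borel_measurable_divide borel_measurable_ln borel_measurable_continuous_onI continuous_intros borel_measurable_const)
  \<comment> \<open>Pieces of the compact set on which both the deficit and the starting index are
    uniform. Zeros of \<open>p n\<close> are exempted because \<open>ln 0 = 0\<close> would
    misrepresent the value \<open>-\<infinity>\<close>.\<close>
  define S where "S j = {x \<in> K0. \<forall>n\<ge>j + N0. poly (p n) x \<noteq> 0 \<longrightarrow> u n x \<le> G x - 1 / real (Suc j)}" for j
  have S_sets: "S j \<in> sets borel" for j
  proof -
    have 1: "{x. poly (p n) x = 0} \<in> sets borel" for n
    proof -
      have "closed {x. poly (p n) x = 0}"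
        by (intro closed_Collect_eq continuous_intros)
      then show ?thesis
        by simp
    qed
    have 2: "{x. u n x \<le> G x - c} \<in> sets borel" for n c
    proof -
      have "(\<lambda>x. G x - c) \<in> borel_measurable borel"
        using G_meas by measurable
      then show ?thesis
        using borel_measurable_le[OF u_meas] by simp
    qed
    have "S j = K0 \<inter> (\<Inter>n\<in>{j + N0..}. {x. poly (p n) x = 0} \<union> {x. u n x \<le> G x - 1 / real (Suc j)})"
      by (auto simp: S_def)
    then show ?thesis
      using K0(1) 1 2 by (auto intro!: sets.Int sets.countable_INT'' sets.Un simp: compact_imp_closed)
  qed
  have K0_eq: "K0 = (\<Union>j. S j)"
  proof
    show "K0 \<subseteq> (\<Union>j. S j)"
    proof
      fix x assume x: "x \<in> K0"
      then obtain \<delta> where \<delta>: "\<delta> > 0" "\<forall>\<^sub>F n in sequentially. poly (p n) x \<noteq> 0 \<longrightarrow> ln (cmod (poly (p n) x)) / n \<le> G x - \<delta>"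
        using E K0(2) by blast
      then obtain N where N: "\<And>n. n \<ge> N \<Longrightarrow> poly (p n) x \<noteq> 0 \<Longrightarrow> u n x \<le> G x - \<delta>"
        unfolding eventually_sequentially u_def by blast
      obtain i where i: "1 / real (Suc i) < \<delta>"
        using reals_Archimedean[OF \<delta>(1)] by (auto simp: inverse_eq_divide)
      have le: "1 / real (Suc (i + N)) \<le> 1 / real (Suc i)"
        by (intro frac_le) auto
      have "x \<in> S (i + N)"
        unfolding S_def
      proof (intro CollectI conjI x allI impI)
        fix n assume "n \<ge> i + N + N0" "poly (p n) x \<noteq> 0"
        then have "u n x \<le> G x - \<delta>"
          using N[of n] by simp
        then show "u n x \<le> G x - 1 / real (Suc (i + N))"
          using i le by linarith
      qed
      then show "x \<in> (\<Union>j. S j)"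
        by blast
    qed
  qed (auto simp: S_def)
  have "\<exists>j. P.prob (S j) > 0"
  proof (rule ccontr)
    assume "\<not> (\<exists>j. P.prob (S j) > 0)"
    then have "emeasure \<mu> (S j) = 0" for j
      by (metis P.emeasure_eq_measure ennreal_0 measure_nonneg order_le_less)
    then have "emeasure \<mu> (\<Union>j. S j) = 0"
      using S_sets mu'(2) by (intro emeasure_UN_eq_0) auto
    then show False
      using K0(3) K0_eq by simp
  qed
  then obtain j where j: "P.prob (S j) > 0"
    by blast
  define c where "c = P.prob (S j)"
  \<comment> \<open>Chosen so that the total error \<open>2 * W * \<eta>\<close> is at most
    \<open>c / (8 * Suc j)\<close>, half of the deficit \<open>c / (4 * Suc j)\<close> guaranteed on
    \<open>K\<close>.\<close>
  define \<eta> where "\<eta> = c / (16 * real (Suc j) * real (Suc W))"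
  have c: "c > 0"
    using j by (simp add: c_def)
  then have \<eta>: "\<eta> > 0"
    by (simp add: \<eta>_def)
  obtain K r where K: "compact K" "K \<subseteq> S j" "c / 4 \<le> P.prob K" "0 < r" "r \<le> 1 / 4"
    "\<And>z. (\<integral>\<^sup>+y. indicator (K \<inter> ball z r) y * log_kernel_pos z y \<partial>\<mu>) \<le> ennreal \<eta>"
    using small_log_potential[OF mu' log_energy_finiteD[OF fin] S_sets j \<eta>] unfolding c_def by blast
  interpret small_potential \<mu> K r \<eta>
    by unfold_locales (use K mu' \<eta> in auto)
  \<comment> \<open>A shift smaller than \<open>r\<close> whose far-field error \<open>e / r\<close>
    does not exceed the near-field error \<open>\<eta>\<close>.\<close>
  define e where "e = min (r / 2) (r * \<eta>)"
  have e: "0 < e" "e < r" "e / r \<le> \<eta>"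
    using K(4) \<eta> by (auto simp: e_def min_def field_simps)
  have K_real: "Im x = 0" if "x \<in> K" for x
    using that K(2) K0(2) real by (auto simp: S_def)
  obtain R where R: "\<And>x. x \<in> K \<Longrightarrow> cmod x \<le> R"
    using compact_imp_bounded[OF K(1)] by (auto simp: bounded_iff)
  obtain C where C: "\<And>x. x \<in> K \<Longrightarrow> \<bar>G x\<bar> \<le> C"
    using G_bd[of R] R by blast
  obtain d where d: "\<And>n x. n \<ge> N0 \<Longrightarrow> x \<in> K \<Longrightarrow> - d \<le> u n (x + \<i> * of_real e)"
    using low[OF e(1), of R] R K_real unfolding u_def by meson
  \<comment> \<open>The amount by which \<open>u n\<close> at the shifted points falls short of
    \<open>G\<close>. It tends to 0 pointwise and is bounded uniformly in \<open>n\<close>, hence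
    tends to 0 in the mean.\<close>
  define h where "h n x = indicator K x * max 0 (G x - u n (x + \<i> * of_real e))" for n x
  have Kb: "K \<in> sets borel"
    using K(1) by (simp add: compact_imp_closed)
  have h_meas: "h n \<in> borel_measurable \<mu>" for n
  proof (rule measurable_from_borel)
    have "(\<lambda>x. u n (x + \<i> * of_real e)) \<in> borel_measurable borel"
      by (rule measurable_compose[OF _ u_meas]) measurable
    then show "h n \<in> borel_measurable borel"
      unfolding h_def[abs_def] using Kb G_meas by measurable
  qed
  have GK_int: "integrable \<mu> (\<lambda>x. indicator K x * G x)"
    using C Kb G_meas
    by (intro P.integrable_const_bound[where B = "\<bar>C\<bar>"] measurable_from_borel borel_measurable_times borel_measurable_indicator)
      (auto simp: indicator_def intro!: order_trans[OF C])
  have h_bd: "norm (h n x) \<le> \<bar>C\<bar> + \<bar>d\<bar>" if "n \<ge> N0" for n x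
  proof (cases "x \<in> K")
    case True
    then show ?thesis
      using C[OF True] d[OF that True] by (auto simp: h_def)
  qed (simp add: h_def)
  have h_int: "integrable \<mu> (h n)" if "n \<ge> N0" for n
    using h_bd[OF that] h_meas by (intro P.integrable_const_bound[where B = "\<bar>C\<bar> + \<bar>d\<bar>"]) auto
  have h_lim: "(\<lambda>n. integral\<^sup>L \<mu> (h (n + N0))) \<longlonglongrightarrow> integral\<^sup>L \<mu> (\<lambda>x. 0)"
  proof (rule integral_dominated_convergence[where w = "\<lambda>_. \<bar>C\<bar> + \<bar>d\<bar>"])
    show "AE x in \<mu>. norm (h (n + N0) x) \<le> \<bar>C\<bar> + \<bar>d\<bar>" for n
      using h_bd by simp
    show "AE x in \<mu>. (\<lambda>n. h (n + N0) x) \<longlonglongrightarrow> 0"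
    proof (rule AE_I2)
      fix x
      have "(\<lambda>n. h n x) \<longlonglongrightarrow> 0"
      proof (cases "x \<in> K")
        case True
        show ?thesis
        proof (rule tendstoI)
          fix \<delta> :: real assume \<delta>: "\<delta> > 0"
          have "\<forall>\<^sub>F n in sequentially. G x - \<delta> / 2 \<le> u n (x + \<i> * of_real e)"
            unfolding u_def using \<delta> by (intro liminf K_real True e(1)) auto
          then show "\<forall>\<^sub>F n in sequentially. dist (h n x) 0 < \<delta>"
            by eventually_elim (use True \<delta> in \<open>simp add: h_def\<close>)
        qed
      qed (simp add: h_def)
      then show "(\<lambda>n. h (n + N0) x) \<longlonglongrightarrow> 0"
        by (rule LIMSEQ_ignore_initial_segment)
    qed
  qed (use h_meas in auto)
  \<comment> \<open>On \<open>K\<close> the values at unshifted points lie below \<open>G\<close> by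
    \<open>1 / Suc j\<close>, while those at shifted points reach \<open>G\<close> up to
    \<open>h n\<close>; the difference is bounded by the cost of the shift.\<close>
  have main: "P.prob K / real (Suc j) \<le> integral\<^sup>L \<mu> (h n) + 2 * (real W * \<eta>)" if n: "n \<ge> j + N0" "n \<ge> 1" for n
  proof -
    have pn: "p n \<noteq> 0"
      using nz n by simp
    note sh = integral_ln_poly_shift[OF pn e(1,2)]
    have i1: "integrable \<mu> (\<lambda>x. indicator K x * u n x)"
      using integrable_divide[OF sh(2), of "real n"] by (simp add: u_def)
    have i2: "integrable \<mu> (\<lambda>x. indicator K x * u n (x + \<i> * of_real e))"
      using integrable_divide[OF sh(3), of "real n"] by (simp add: u_def)
    have "(\<integral>x. indicator K x * u n (x + \<i> * of_real e) \<partial>\<mu>) - (\<integral>x. indicator K x * u n x \<partial>\<mu>) =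
        ((\<integral>x. indicator K x * ln (cmod (poly (p n) (x + \<i> * of_real e))) \<partial>\<mu>) - (\<integral>x. indicator K x * ln (cmod (poly (p n) x)) \<partial>\<mu>)) / real n"
      unfolding u_def by (simp add: diff_divide_distrib)
    also have "\<dots> \<le> (real (degree (p n)) * (\<eta> + e / r)) / real n"
      by (intro divide_right_mono sh(4)) auto
    also have "\<dots> \<le> (real (n * W) * (\<eta> + \<eta>)) / real n"
      using deg[of n] e \<eta> K(4) by (intro divide_right_mono mult_mono add_mono) (auto simp: of_nat_mult[symmetric] simp del: of_nat_mult)
    also have "\<dots> = 2 * (real W * \<eta>)"
      using n by simp
    finally have 1: "(\<integral>x. indicator K x * u n (x + \<i> * of_real e) \<partial>\<mu>) \<le> (\<integral>x. indicator K x * u n x \<partial>\<mu>) + 2 * (real W * \<eta>)"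
      by simp
    have "(\<integral>x. indicator K x * u n x \<partial>\<mu>) \<le> (\<integral>x. indicator K x * G x - indicator K x * (1 / real (Suc j)) \<partial>\<mu>)"
    proof (rule integral_mono_AE[OF i1])
      show "integrable \<mu> (\<lambda>x. indicator K x * G x - indicator K x * (1 / real (Suc j)))"
        using GK_int sets_K by (intro Bochner_Integration.integrable_diff integrable_mult_left integrable_real_indicator)
          (auto simp: P.emeasure_eq_measure)
      show "AE x in \<mu>. indicator K x * u n x \<le> indicator K x * G x - indicator K x * (1 / real (Suc j))"
        using sh(1)
      proof eventually_elim
        fix x assume x: "x \<in> K \<longrightarrow> poly (p n) x \<noteq> 0"
        show "indicator K x * u n x \<le> indicator K x * G x - indicator K x * (1 / real (Suc j))"
        proof (cases "x \<in> K")
          case True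
          then have "u n x \<le> G x - 1 / real (Suc j)"
            using x K(2) n by (auto simp: S_def)
          then show ?thesis
            using True by simp
        qed simp
      qed
    qed
    also have "\<dots> = (\<integral>x. indicator K x * G x \<partial>\<mu>) - P.prob K * (1 / real (Suc j))"
      using GK_int sets_K by (subst Bochner_Integration.integral_diff) (auto simp: P.emeasure_eq_measure intro!: integrable_mult_left integrable_real_indicator)
    finally have 2: "(\<integral>x. indicator K x * u n x \<partial>\<mu>) \<le> (\<integral>x. indicator K x * G x \<partial>\<mu>) - P.prob K / real (Suc j)"
      by simp
    have "(\<integral>x. indicator K x * G x \<partial>\<mu>) - integral\<^sup>L \<mu> (h n) = (\<integral>x. indicator K x * G x - h n x \<partial>\<mu>)"
      using h_int[of n] GK_int n by simp
    also have "\<dots> \<le> (\<integral>x. indicator K x * u n (x + \<i> * of_real e) \<partial>\<mu>)"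
    proof (rule integral_mono[OF Bochner_Integration.integrable_diff[OF GK_int h_int] i2])
      show "indicator K x * G x - h n x \<le> indicator K x * u n (x + \<i> * of_real e)" for x
        by (simp add: h_def indicator_def max_def)
    qed (use n in simp)
    finally show ?thesis
      using 1 2 by linarith
  qed
  have "(\<lambda>n. integral\<^sup>L \<mu> (h (n + N0)) + 2 * (real W * \<eta>)) \<longlonglongrightarrow> 0 + 2 * (real W * \<eta>)"
    using h_lim by (intro tendsto_intros) auto
  moreover have "\<forall>\<^sub>F n in sequentially. P.prob K / real (Suc j) \<le> integral\<^sup>L \<mu> (h (n + N0)) + 2 * (real W * \<eta>)"
    using eventually_ge_at_top[of "Suc j"] by eventually_elim (rule main, auto)
  ultimately have "P.prob K / real (Suc j) \<le> 0 + 2 * (real W * \<eta>)"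
    by (intro tendsto_lowerbound) auto
  moreover have "c / 4 / real (Suc j) \<le> P.prob K / real (Suc j)"
    using K(3) by (intro divide_right_mono) auto
  ultimately have "c / 4 / real (Suc j) \<le> 2 * (real W * \<eta>)"
    by simp
  also have "\<dots> = (c / 8 / real (Suc j)) * (real W / real (Suc W))"
    by (simp add: \<eta>_def field_simps del: of_nat_Suc)
  also have "\<dots> \<le> (c / 8 / real (Suc j)) * 1"
    using c by (intro mult_left_mono) auto
  finally have "c / 4 / real (Suc j) \<le> c / 8 / real (Suc j)"
    by simp
  moreover have "c / 8 / real (Suc j) < c / 4 / real (Suc j)"
    using c by (intro divide_strict_right_mono) auto
  ultimately show False
    by simp
qed

section \<open>Growth of the cocycle\<close>

text \<open>The summand \<open>2 * CARD('w)\<close> covers the two identity blocks of a transfer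
  matrix and makes the bound at least 1, so that its logarithm is nonnegative.\<close>

definition vbound :: "(nat \<Rightarrow> real ^ 'w::finite ^ 'w) \<Rightarrow> nat \<Rightarrow> real" where
  "vbound V t = 2 * real CARD('w) + (\<Sum>i\<in>UNIV. \<Sum>j\<in>UNIV. \<bar>V t $ i $ j\<bar>)"

definition pbound :: "real \<Rightarrow> (nat \<Rightarrow> real ^ 'w::finite ^ 'w) \<Rightarrow> nat \<Rightarrow> real" where
  "pbound R V n = (\<Prod>t<n. (1 + R) * vbound V t)"

lemma vbound_ge_1: "vbound V t \<ge> 1"
proof -
  have "real CARD('a) \<ge> 1"
    using zero_less_card_finite[where 'a = 'a] by linarith
  moreover have "(\<Sum>i\<in>UNIV. \<Sum>j\<in>UNIV. \<bar>V t $ i $ j\<bar>) \<ge> 0"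
    by (intro sum_nonneg) auto
  ultimately show ?thesis
    unfolding vbound_def by linarith
qed

lemma pbound_step_ge_1: "R \<ge> 0 \<Longrightarrow> (1 + R) * vbound V t \<ge> 1"
  using mult_mono[of 1 "1 + R" 1 "vbound V t"] vbound_ge_1[of V t] by simp

lemma pbound_ge_1: "R \<ge> 0 \<Longrightarrow> pbound R V n \<ge> 1"
  unfolding pbound_def by (intro prod_ge_1 pbound_step_ge_1)

lemma ln_pbound:
  assumes "R \<ge> 0"
  shows "ln (pbound R V n) = (\<Sum>t<n. ln (1 + R) + ln (vbound V t))"
proof -
  have "(1 + R) * vbound V t \<noteq> 0" for t
    using pbound_step_ge_1[OF assms, of V t] by linarith
  then have "ln (pbound R V n) = (\<Sum>t<n. ln ((1 + R) * vbound V t))"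
    unfolding pbound_def by (intro ln_prod) simp_all
  also have "\<dots> = (\<Sum>t<n. ln (1 + R) + ln (vbound V t))"
    using assms vbound_ge_1[of V] by (intro sum.cong refl ln_mult_pos) (auto intro: less_le_trans[OF zero_less_one])
  finally show ?thesis .
qed

lemma entry_sum_block_matrix:
  "entry_sum (block_matrix A B C D) = entry_sum A + entry_sum B + entry_sum C + entry_sum (D :: complex ^ 'w ^ 'w)"
  by (simp add: entry_sum_def block_matrix_def sum_UNIV_Plus sum.distrib)

lemma entry_sum_mat: "entry_sum (mat c :: complex ^ 'w ^ 'w) = real CARD('w) * cmod c"
proof -
  have "cmod ((mat c :: complex ^ 'w ^ 'w) $ i $ j) = (if i = j then cmod c else 0)" for i j
    by (simp add: mat_def)
  then show ?thesis
    by (simp add: entry_sum_def)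
qed

lemma entry_sum_uminus [simp]: "entry_sum (- A) = entry_sum A"
  by (simp add: entry_sum_def)

lemma entry_sum_zero [simp]: "entry_sum 0 = 0"
  by (simp add: entry_sum_def)

lemma entry_sum_potential: "entry_sum (mat z - (\<chi> i j. complex_of_real (V $ i $ j)) :: complex ^ 'w ^ 'w) \<le>
    real CARD('w) * cmod z + (\<Sum>i\<in>UNIV. \<Sum>j\<in>UNIV. \<bar>V $ i $ j\<bar>)"
proof -
  have "entry_sum (mat z + - (\<chi> i j. complex_of_real (V $ i $ j)) :: complex ^ 'w ^ 'w) \<le>
      entry_sum (mat z :: complex ^ 'w ^ 'w) + entry_sum (- (\<chi> i j. complex_of_real (V $ i $ j)) :: complex ^ 'w ^ 'w)"
    by (rule entry_sum_add)
  then show ?thesis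
    by (simp add: entry_sum_mat) (simp add: entry_sum_def)
qed

lemma vbound_linear_le:
  assumes "cmod z \<le> R"
  shows "real CARD('w) * cmod z + (\<Sum>i\<in>UNIV. \<Sum>j\<in>UNIV. \<bar>V t $ i $ j\<bar>) + 2 * real CARD('w) \<le> (1 + R) * vbound (V :: nat \<Rightarrow> real ^ 'w ^ 'w) t"
proof -
  define s where "s = (\<Sum>i\<in>UNIV. \<Sum>j\<in>UNIV. \<bar>V t $ i $ j\<bar>)"
  have R: "R \<ge> 0"
    using assms norm_ge_zero order_trans by blast
  have "real CARD('w) * cmod z \<le> real CARD('w) * R" "s \<ge> 0"
    using assms by (auto simp: s_def intro!: sum_nonneg)
  moreover have "0 \<le> R * s" "0 \<le> real CARD('w) * R"
    using R \<open>s \<ge> 0\<close> by simp_all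
  moreover have "(1 + R) * (2 * real CARD('w) + s) = 2 * real CARD('w) + s + 2 * (real CARD('w) * R) + R * s"
    by (simp add: algebra_simps)
  ultimately show ?thesis
    unfolding vbound_def s_def[symmetric] by linarith
qed

lemma entry_sum_tmat:
  assumes "cmod z \<le> R"
  shows "entry_sum (tmat (V t) z) \<le> (1 + R) * vbound V t"
  using entry_sum_potential[of z "V t"] vbound_linear_le[OF assms, of V t]
  by (simp add: tmat_def entry_sum_block_matrix entry_sum_mat)

lemma entry_mult_le_left: "(\<And>i j. cmod (B $ i $ j) \<le> r) \<Longrightarrow> cmod ((A ** B) $ i $ j) \<le> entry_sum A * r"
proof -
  assume B: "\<And>i j. cmod (B $ i $ j) \<le> r"
  have r: "r \<ge> 0"
    using B norm_ge_zero order_trans by blast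
  have "cmod ((A ** B) $ i $ j) \<le> (\<Sum>k\<in>UNIV. cmod (A $ i $ k) * r)"
    unfolding matrix_matrix_mult_def
    by (simp, rule order_trans[OF norm_sum], rule sum_mono) (simp add: norm_mult mult_left_mono B)
  also have "\<dots> = (\<Sum>k\<in>UNIV. cmod (A $ i $ k)) * r"
    by (simp add: sum_distrib_right)
  also have "\<dots> \<le> entry_sum A * r"
    unfolding entry_sum_def using r
    by (intro mult_right_mono member_le_sum[where f = "\<lambda>i. \<Sum>j\<in>UNIV. cmod (A $ i $ j)"]) (auto intro: sum_nonneg)
  finally show ?thesis .
qed

lemma entry_mult_le_right: "(\<And>i j. cmod (A $ i $ j) \<le> r) \<Longrightarrow> cmod ((A ** B) $ i $ j) \<le> r * entry_sum B"
proof -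
  assume A: "\<And>i j. cmod (A $ i $ j) \<le> r"
  have r: "r \<ge> 0"
    using A norm_ge_zero order_trans by blast
  have "cmod ((A ** B) $ i $ j) \<le> (\<Sum>k\<in>UNIV. r * cmod (B $ k $ j))"
    unfolding matrix_matrix_mult_def
    by (simp, rule order_trans[OF norm_sum], rule sum_mono) (simp add: norm_mult mult_right_mono A)
  also have "\<dots> = r * (\<Sum>k\<in>UNIV. cmod (B $ k $ j))"
    by (simp add: sum_distrib_left)
  also have "\<dots> \<le> r * entry_sum B"
    unfolding entry_sum_def using r
    by (intro mult_left_mono sum_mono member_le_sum[where f = "\<lambda>j. cmod (B $ _ $ j)"]) auto
  finally show ?thesis .
qed

section \<open>A priori bounds for products, their inverses and their minors\<close>

lemma tprod_entry_le:
  assumes "cmod z \<le> R"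
  shows "cmod (tprod V z n $ i $ j) \<le> pbound R V n"
proof (induction n arbitrary: i j)
  case (Suc n)
  have "pbound R V n \<ge> 0"
    using pbound_ge_1[of R V n] assms norm_ge_zero[of z] by linarith
  have "cmod (tprod V z (Suc n) $ i $ j) \<le> entry_sum (tmat (V n) z) * pbound R V n"
    using entry_mult_le_left[OF Suc] by simp
  also have "\<dots> \<le> ((1 + R) * vbound V n) * pbound R V n"
    by (intro mult_right_mono entry_sum_tmat assms) fact
  finally show ?case
    by (simp add: pbound_def mult_ac)
qed (simp add: pbound_def mat_def)

text \<open>The inverse of a transfer matrix has the same blocks up to position and sign, hence
  obeys the same bound; lower bounds for minors come from here.\<close>

lemma tprod_inverse:
  assumes "cmod z \<le> R"
  shows "\<exists>Q. Q ** tprod V z n = mat 1 \<and> (\<forall>i j. cmod (Q $ i $ j) \<le> pbound R V n)"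
proof (induction n)
  case 0
  then show ?case
    by (intro exI[of _ "mat 1"] conjI) (simp, simp add: pbound_def mat_def)
next
  case (Suc n)
  then obtain Q where Q: "Q ** tprod V z n = mat 1" "\<And>i j. cmod (Q $ i $ j) \<le> pbound R V n"
    by blast
  let ?P = "mat z - (\<chi> i j. complex_of_real (V n $ i $ j)) :: complex ^ 'a ^ 'a"
  let ?I = "block_matrix 0 (mat 1) (- mat 1) ?P"
  have neg: "- mat 1 ** A = - A" "A ** - mat 1 = - A" for A :: "complex ^ 'a ^ 'a"
    by (simp_all add: vec_eq_iff matrix_matrix_mult_def mat_def if_distrib[of "\<lambda>x. x * _"] if_distrib[of "(*) _"] if_distrib[of uminus] cong: if_cong)
  have I: "?I ** tmat (V n) z = mat 1"
    by (simp add: tmat_def block_matrix_mult neg flip: block_mat_one)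
  have "pbound R V n \<ge> 0"
    using pbound_ge_1[of R V n] assms norm_ge_zero[of z] by linarith
  have "entry_sum ?I \<le> (1 + R) * vbound V n"
    using entry_sum_potential[of z "V n"] vbound_linear_le[OF assms, of V n]
    by (simp add: entry_sum_block_matrix entry_sum_mat)
  then have "cmod ((Q ** ?I) $ i $ j) \<le> pbound R V (Suc n)" for i j
    using order_trans[OF entry_mult_le_right[OF Q(2)] mult_left_mono] \<open>pbound R V n \<ge> 0\<close>
    by (simp add: pbound_def)
  moreover have "(Q ** ?I) ** tprod V z (Suc n) = Q ** ((?I ** tmat (V n) z) ** tprod V z n)"
    by (simp add: matrix_mul_assoc)
  ultimately show ?case
    by (intro exI[of _ "Q ** ?I"]) (simp add: I Q(1))
qed

lemma tprod_diff_entry_le: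
  assumes z: "cmod z \<le> R" "cmod w \<le> R"
  shows "cmod (tprod V z n $ i $ j - tprod V w n $ i $ j) \<le> real n * real CARD('w) * cmod (z - w) * pbound R (V :: nat \<Rightarrow> real ^ 'w ^ 'w) n"
proof (induction n arbitrary: i j)
  case (Suc n)
  let ?p = "(1 + R) * vbound V n"
  have R: "R \<ge> 0"
    using assms norm_ge_zero order_trans by blast
  have P: "pbound R V n \<ge> 1" "?p \<ge> 1"
    using pbound_ge_1[OF R] pbound_step_ge_1[OF R] by auto
  have "tmat (V n) z - tmat (V n) w = block_matrix (mat (z - w)) 0 0 0"
    by (auto simp: tmat_def block_matrix_def mat_def vec_eq_iff split: sum.split)
  then have es: "entry_sum (tmat (V n) z - tmat (V n) w) = real CARD('w) * cmod (z - w)"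
    by (simp add: entry_sum_block_matrix entry_sum_mat)
  have "tprod V z (Suc n) - tprod V w (Suc n) =
      (tmat (V n) z - tmat (V n) w) ** tprod V z n + tmat (V n) w ** (tprod V z n - tprod V w n)"
    by (simp add: vec_eq_iff matrix_matrix_mult_def left_diff_distrib right_diff_distrib sum_subtractf)
  then have "cmod (tprod V z (Suc n) $ i $ j - tprod V w (Suc n) $ i $ j) \<le>
      cmod (((tmat (V n) z - tmat (V n) w) ** tprod V z n) $ i $ j) + cmod ((tmat (V n) w ** (tprod V z n - tprod V w n)) $ i $ j)"
    by (metis norm_triangle_ineq vector_add_component vector_minus_component)
  also have "\<dots> \<le> (real CARD('w) * cmod (z - w)) * pbound R V n + ?p * (real n * real CARD('w) * cmod (z - w) * pbound R V n)"
  proof (rule add_mono)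
    show "cmod (((tmat (V n) z - tmat (V n) w) ** tprod V z n) $ i $ j) \<le> (real CARD('w) * cmod (z - w)) * pbound R V n"
      using entry_mult_le_left[OF tprod_entry_le[OF z(1)]] es by metis
    have "cmod ((tmat (V n) w ** (tprod V z n - tprod V w n)) $ i $ j) \<le>
        entry_sum (tmat (V n) w) * (real n * real CARD('w) * cmod (z - w) * pbound R V n)"
      by (rule entry_mult_le_left) (simp add: Suc)
    also have "\<dots> \<le> ?p * (real n * real CARD('w) * cmod (z - w) * pbound R V n)"
      using P by (intro mult_right_mono entry_sum_tmat z mult_nonneg_nonneg) auto
    finally show "cmod ((tmat (V n) w ** (tprod V z n - tprod V w n)) $ i $ j) \<le>
        ?p * (real n * real CARD('w) * cmod (z - w) * pbound R V n)" .
  qed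
  also have "\<dots> \<le> ?p * ((real CARD('w) * cmod (z - w)) * pbound R V n) + ?p * (real n * real CARD('w) * cmod (z - w) * pbound R V n)"
    using P mult_right_mono[OF P(2), of "(real CARD('w) * cmod (z - w)) * pbound R V n"] by simp
  also have "\<dots> = real (Suc n) * real CARD('w) * cmod (z - w) * pbound R V (Suc n)"
    by (simp add: pbound_def algebra_simps)
  finally show ?case .
qed simp

lemma minors_sum_one_ge:
  assumes "k \<le> CARD('n)"
  shows "1 \<le> minors_sum k (mat 1 :: complex ^ 'n ^ 'n)"
proof -
  obtain e where e: "bij_betw e {..<CARD('n)} (UNIV :: 'n set)"
    using ex_bij_betw_nat_finite[of "UNIV :: 'n set"] by (auto simp: atLeast0LessThan)
  then have inj: "inj_on e {..<k}"
    using assms by (auto simp: bij_betw_def intro: inj_on_subset)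
  have "mat 1 = (diag (\<lambda>_. 1) :: complex ^ 'n ^ 'n)"
    by (simp add: mat_def diag_def)
  then show ?thesis
    using minor_diag_self[OF inj, of "\<lambda>_. 1"] minor_le_minors_sum'[of k "diag (\<lambda>_. 1)" e e] by simp
qed

abbreviation mconst :: "nat \<Rightarrow> 'w::finite itself \<Rightarrow> real" where
  "mconst k TYPE('w) \<equiv> minors_const k (CARD('w) + CARD('w)) (CARD('w) + CARD('w))"

lemma minors_const_ge_1: "m > 0 \<Longrightarrow> n > 0 \<Longrightarrow> minors_const k m n \<ge> 1"
proof -
  assume "m > 0" "n > 0"
  then have "m ^ k * n ^ k \<ge> 1"
    by (simp add: Suc_le_eq)
  then have "real (m ^ k * n ^ k) \<ge> 1"
    by linarith
  then show ?thesis
    unfolding minors_const_def using mult_mono[of 1 "real (m ^ k * n ^ k)" 1 "fact k :: real"] by simp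
qed

text \<open>The lower bound is submultiplicativity applied to the identity, written as the inverse
  times the product.\<close>

lemma minors_sum_tprod_bounds:
  fixes V :: "nat \<Rightarrow> real ^ 'w::finite ^ 'w"
  assumes k: "k \<le> CARD('w) + CARD('w)" and z: "cmod z \<le> R"
  shows "minors_sum k (tprod V z n) \<le> mconst k TYPE('w) * pbound R V n ^ k"
    and "1 \<le> mconst k TYPE('w) * pbound R V n ^ k * minors_sum k (tprod V z n)"
    and "minors_sum k (tprod V z n) > 0"
proof -
  show "minors_sum k (tprod V z n) \<le> mconst k TYPE('w) * pbound R V n ^ k"
    using minors_sum_le_power[OF tprod_entry_le[OF z], of k V n] by simp
  obtain Q where Q: "Q ** tprod V z n = mat 1" "\<And>i j. cmod (Q $ i $ j) \<le> pbound R V n"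
    using tprod_inverse[OF z] by blast
  have "1 \<le> minors_sum k (mat 1 :: complex ^ ('w + 'w) ^ ('w + 'w))"
    using k by (intro minors_sum_one_ge) simp
  also have "\<dots> \<le> minors_sum k Q * minors_sum k (tprod V z n)"
    unfolding Q(1)[symmetric] by (rule minors_sum_mult)
  also have "\<dots> \<le> (mconst k TYPE('w) * pbound R V n ^ k) * minors_sum k (tprod V z n)"
    using minors_sum_le_power[OF Q(2), of k] by (intro mult_right_mono minors_sum_nonneg) simp
  finally show *: "1 \<le> mconst k TYPE('w) * pbound R V n ^ k * minors_sum k (tprod V z n)"
    by simp
  show "minors_sum k (tprod V z n) > 0"
    using * minors_sum_nonneg[of k "tprod V z n"] by (cases "minors_sum k (tprod V z n) = 0") auto
qed

lemma abs_ln_minors_sum_tprod_le: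
  fixes V :: "nat \<Rightarrow> real ^ 'w::finite ^ 'w"
  assumes k: "k \<le> CARD('w) + CARD('w)" and z: "cmod z \<le> R"
  shows "\<bar>ln (minors_sum k (tprod V z n))\<bar> \<le> ln (mconst k TYPE('w)) + real k * (\<Sum>t<n. ln (1 + R) + ln (vbound V t))"
proof -
  have R: "R \<ge> 0"
    using assms norm_ge_zero order_trans by blast
  let ?N = "minors_sum k (tprod V z n)" and ?c = "mconst k TYPE('w)" and ?P = "pbound R V n"
  have c: "?c > 0"
    by (rule minors_const_pos) auto
  have P: "?P > 0"
    using pbound_ge_1[OF R, of V n] by linarith
  note b = minors_sum_tprod_bounds[OF k z, of V n]
  have ln_cP: "ln (?c * ?P ^ k) = ln ?c + real k * (\<Sum>t<n. ln (1 + R) + ln (vbound V t))"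
    using c P by (simp add: ln_mult_pos ln_realpow ln_pbound[OF R])
  have "ln ?N \<le> ln (?c * ?P ^ k)"
    using b by (intro ln_mono) auto
  moreover have "ln 1 \<le> ln ((?c * ?P ^ k) * ?N)"
    using b by (intro ln_mono) auto
  moreover have "ln ((?c * ?P ^ k) * ?N) = ln (?c * ?P ^ k) + ln ?N"
    using b c P by (intro ln_mult_pos) auto
  ultimately show ?thesis
    unfolding ln_cP[symmetric] by (intro abs_leI) simp_all
qed

text \<open>Only finitely many sites enter, so the product topology on potential sequences
  suffices.\<close>

lemma continuous_on_tprod_entry:
  fixes i j :: "'w::finite + 'w"
  shows "continuous_on UNIV (\<lambda>p :: complex \<times> (nat \<Rightarrow> real ^ 'w ^ 'w). tprod (snd p) (fst p) n $ i $ j)"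
proof (induction n arbitrary: i j)
  case (Suc n)
  have "continuous_on UNIV (\<lambda>p :: complex \<times> (nat \<Rightarrow> real ^ 'w ^ 'w). snd p n)"
    by (rule continuous_on_product_then_coordinatewise) (rule continuous_on_snd[OF continuous_on_id])
  then have c: "continuous_on UNIV (\<lambda>p :: complex \<times> (nat \<Rightarrow> real ^ 'w ^ 'w). snd p n $ a $ b)" for a b
    by (intro continuous_intros)
  have "continuous_on UNIV (\<lambda>p :: complex \<times> (nat \<Rightarrow> real ^ 'w ^ 'w). tmat (snd p n) (fst p) $ i $ j)" for i j
  proof -
    have "continuous_on UNIV (\<lambda>p :: complex \<times> (nat \<Rightarrow> real ^ 'w ^ 'w). if P then fst p else 0)" for P
      by (cases P) (auto intro: continuous_intros)
    then show ?thesis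
      by (cases i; cases j) (auto simp: tmat_def block_matrix_def mat_def intro!: continuous_intros c)
  qed
  then show ?case
    by (simp add: matrix_matrix_mult_def) (intro continuous_on_sum continuous_on_mult Suc)
qed (simp add: mat_def)

lemma continuous_on_tprod_entry':
  fixes i j :: "'w::finite + 'w"
  shows "continuous_on UNIV (\<lambda>V :: nat \<Rightarrow> real ^ 'w ^ 'w. tprod V z n $ i $ j)"
  using continuous_on_compose2[OF continuous_on_tprod_entry[of n i j], of UNIV "\<lambda>V. (z, V)"]
  by (simp add: continuous_on_Pair)

lemma continuous_on_minors_sum:
  assumes "\<And>i j. continuous_on S (\<lambda>x. A x $ i $ j)"
  shows "continuous_on S (\<lambda>x. minors_sum k (A x))"
  unfolding minors_sum_def minor_def by (intro continuous_intros assms)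

lemma continuous_on_det_entries:
  fixes A :: "_ \<Rightarrow> complex ^ 'n ^ 'n"
  assumes "\<And>i j. continuous_on S (\<lambda>x. A x $ i $ j)"
  shows "continuous_on S (\<lambda>x. det (A x))"
  unfolding det_def by (intro continuous_intros assms)

lemma continuous_on_vbound: "continuous_on UNIV (\<lambda>V. vbound V t)"
proof -
  have "continuous_on UNIV (\<lambda>V :: nat \<Rightarrow> real ^ 'w ^ 'w. V t)"
    by (rule continuous_on_product_coordinates)
  then show ?thesis
    unfolding vbound_def by (intro continuous_intros)
qed

section \<open>The cocycle of an ergodic system and its observables\<close>

locale schrodinger_cocycle = prob_space M
  for M :: "'a measure" and T :: "'a \<Rightarrow> 'a" and F :: "'a \<Rightarrow> real ^ 'w::finite ^ 'w" +
  assumes erg: "ergodic_map M T" and F_meas: "F \<in> borel_measurable M"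
    and F_sym: "\<And>\<omega>. \<omega> \<in> space M \<Longrightarrow> transpose (F \<omega>) = F \<omega>"
    and F_int: "integrable M (\<lambda>\<omega>. log_plus (onorm (\<lambda>x. F \<omega> *v x)))"
begin

definition pot :: "'a \<Rightarrow> nat \<Rightarrow> real ^ 'w ^ 'w" where
  "pot \<omega> i = F ((T ^^ Suc i) \<omega>)"

lemma cocycle_eq: "cocycle T F z n \<omega> = tprod (pot \<omega>) z n"
  by (simp add: cocycle_eq_tprod pot_def[abs_def])

lemma mp: "measure_preserving_map M T"
  using erg by (simp add: ergodic_map_def)

lemma T_meas [measurable]: "T \<in> measurable M M"
  using mp by (simp add: measure_preserving_map_def)

lemma T_iter_meas [measurable]: "(T ^^ n) \<in> measurable M M"
proof (induction n)
  case (Suc n)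
  then show ?case
    using measurable_comp[OF Suc T_meas] by (simp add: o_def)
qed (simp add: id_def[symmetric])

lemma T_iter_space: "\<omega> \<in> space M \<Longrightarrow> (T ^^ n) \<omega> \<in> space M"
  using measurable_space[OF T_iter_meas] by blast

lemma pot_shift: "pot ((T ^^ k) \<omega>) = (\<lambda>i. pot \<omega> (i + k))"
  by (simp add: pot_def fun_eq_iff funpow_add)

lemma pot_sym: "\<omega> \<in> space M \<Longrightarrow> transpose (pot \<omega> i) = pot \<omega> i"
  unfolding pot_def by (intro F_sym T_iter_space)

lemma tprod_pot_add: "tprod (pot \<omega>) z (n + m) = tprod (pot ((T ^^ n) \<omega>)) z m ** tprod (pot \<omega>) z n"
  by (simp add: tprod_add pot_shift)

lemma iter_integral:
  assumes "integrable M (f :: 'a \<Rightarrow> real)"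
  shows "integrable M (\<lambda>\<omega>. f ((T ^^ n) \<omega>)) \<and> integral\<^sup>L M (\<lambda>\<omega>. f ((T ^^ n) \<omega>)) = integral\<^sup>L M f"
proof (induction n)
  case (Suc n)
  then show ?case
    using measure_preserving_integrable[OF mp, of "\<lambda>\<omega>. f ((T ^^ n) \<omega>)"] by (simp add: funpow_swap1)
qed (simp add: assms)

lemma pot_meas [measurable]: "pot \<in> borel_measurable M"
proof (rule measurable_coordinatewise_then_product)
  fix i
  show "(\<lambda>\<omega>. pot \<omega> i) \<in> borel_measurable M"
    unfolding pot_def by (rule measurable_compose[OF T_iter_meas F_meas])
qed

definition logb :: "'a \<Rightarrow> real" where
  "logb \<omega> = ln (vbound (pot \<omega>) 0)"

lemma logb_iter: "logb ((T ^^ t) \<omega>) = ln (vbound (pot \<omega>) t)"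
  by (simp add: logb_def pot_shift vbound_def)

lemma logb_nonneg: "logb \<omega> \<ge> 0"
  unfolding logb_def using vbound_ge_1 by (intro ln_ge_zero)

lemma continuous_pot_comp_meas:
  fixes g :: "(nat \<Rightarrow> real ^ 'w ^ 'w) \<Rightarrow> real"
  assumes "continuous_on UNIV g"
  shows "(\<lambda>\<omega>. g (pot \<omega>)) \<in> borel_measurable M"
  by (rule measurable_compose[OF pot_meas borel_measurable_continuous_onI[OF assms]])

text \<open>Continuity in the potential sequence transfers to every topology that makes
  \<open>T\<close> and \<open>F\<close> continuous, so observables can be described without a
  topology on the base space.\<close>

lemma continuous_pot_comp:
  fixes g :: "(nat \<Rightarrow> real ^ 'w ^ 'w) \<Rightarrow> real"
  assumes "continuous_on UNIV g" "continuous_map X X T" "continuous_map X euclidean F"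
  shows "continuous_map X euclideanreal (\<lambda>\<omega>. g (pot \<omega>))"
proof -
  have T: "continuous_map X X (T ^^ n)" for n
  proof (induction n)
    case (Suc n)
    show ?case
      unfolding funpow.simps by (rule continuous_map_compose[OF Suc assms(2)])
  qed simp
  have "continuous_map X euclidean (\<lambda>\<omega>. pot \<omega> i)" for i
    using continuous_map_compose[OF T[of "Suc i"] assms(3)] by (simp add: pot_def o_def)
  then have "continuous_map X (product_topology (\<lambda>_. euclidean) UNIV) pot"
    by (subst continuous_map_componentwise_UNIV) auto
  then have "continuous_map X euclidean pot"
    by (simp add: euclidean_product_topology)
  moreover have "continuous_map euclidean euclideanreal g"
    using assms(1) by simp
  ultimately show ?thesis
    using continuous_map_compose[of X euclidean pot euclideanreal g] by (simp add: o_def)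
qed

lemma continuous_on_ln_vbound: "continuous_on UNIV (\<lambda>V. ln (vbound V t))"
proof (intro continuous_on_ln continuous_on_vbound ballI)
  show "vbound V t \<noteq> 0" for V :: "nat \<Rightarrow> real ^ 'b ^ 'b"
    using vbound_ge_1[of V t] by linarith
qed

text \<open>Entries are bounded by the operator norm, so \<open>logb\<close> is at most a constant
  plus \<open>log_plus\<close> of the norm of \<open>F\<close> at \<open>T \<omega>\<close>;
  composition with \<open>T\<close> preserves integrability.\<close>

lemma integrable_logb: "integrable M logb"
proof -
  define W where "W = real CARD('w)"
  define h where "h \<omega> = ln (2 * W + W * W) + log_plus (onorm (\<lambda>x. F \<omega> *v x))" for \<omega>
  have W: "W \<ge> 1"
    unfolding W_def using zero_less_card_finite[where 'a = 'w] by linarith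
  have int: "integrable M (\<lambda>\<omega>. h (T \<omega>))"
    using F_int by (intro measure_preserving_integrable(1)[OF mp]) (simp add: h_def)
  show ?thesis
  proof (rule Bochner_Integration.integrable_bound[OF int])
    show "logb \<in> borel_measurable M"
      unfolding logb_def[abs_def] by (rule continuous_pot_comp_meas[OF continuous_on_ln_vbound])
    show "AE \<omega> in M. norm (logb \<omega>) \<le> norm (h (T \<omega>))"
    proof (rule AE_I2)
      fix \<omega>
      define A where "A = F (T \<omega>)"
      define q where "q = max 1 (onorm (\<lambda>x. A *v x))"
      have ent: "\<bar>A $ i $ j\<bar> \<le> q" for i j
      proof -
        have "\<bar>A $ i $ j\<bar> = \<bar>(A *v axis j 1) $ i\<bar>"
          by (simp add: matrix_vector_mult_axis column_def)
        also have "\<dots> \<le> norm (A *v axis j 1)"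
          by (rule component_le_norm_cart)
        also have "\<dots> \<le> onorm (\<lambda>x. A *v x) * norm (axis j (1 :: real) :: real ^ 'w)"
          by (rule onorm) (rule matrix_vector_mul_bounded_linear)
        finally show ?thesis
          by (simp add: q_def)
      qed
      have "(\<Sum>i\<in>UNIV. \<Sum>j\<in>UNIV. \<bar>A $ i $ j\<bar>) \<le> (\<Sum>i\<in>(UNIV :: 'w set). \<Sum>j\<in>(UNIV :: 'w set). q)"
        by (intro sum_mono ent)
      then have "vbound (pot \<omega>) 0 \<le> 2 * W * 1 + W * W * q"
        by (simp add: vbound_def pot_def A_def W_def)
      also have "\<dots> \<le> 2 * W * q + W * W * q"
        using W by (intro add_mono mult_left_mono) (auto simp: q_def)
      also have "\<dots> = (2 * W + W * W) * q"
        by (simp add: algebra_simps)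
      finally have "logb \<omega> \<le> ln ((2 * W + W * W) * q)"
        unfolding logb_def using vbound_ge_1[of "pot \<omega>" 0] by (intro ln_mono) auto
      also have "\<dots> = h (T \<omega>)"
        using W by (subst ln_mult_pos) (auto simp: h_def log_plus_def q_def A_def intro: add_pos_pos)
      finally show "norm (logb \<omega>) \<le> norm (h (T \<omega>))"
        using logb_nonneg[of \<omega>] by simp
    qed
  qed
qed

lemma observable_cont:
  fixes g :: "(nat \<Rightarrow> real ^ 'w ^ 'w) \<Rightarrow> real"
  assumes "continuous_on UNIV g"
    and bd: "\<And>\<omega>. \<omega> \<in> space M \<Longrightarrow> \<bar>g (pot \<omega>)\<bar> \<le> c + d * (\<Sum>t<m. logb ((T ^^ t) \<omega>))"
  shows "observable M T F (\<lambda>\<omega>. g (pot \<omega>))"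
  unfolding observable_def
proof (intro conjI allI impI)
  have "integrable M (\<lambda>\<omega>. c + d * (\<Sum>t<m. logb ((T ^^ t) \<omega>)))"
    by (intro Bochner_Integration.integrable_add integrable_mult_right Bochner_Integration.integrable_sum)
      (simp_all add: iter_integral integrable_logb)
  then show "integrable M (\<lambda>\<omega>. g (pot \<omega>))"
  proof (rule Bochner_Integration.integrable_bound)
    show "(\<lambda>\<omega>. g (pot \<omega>)) \<in> borel_measurable M"
      by (rule continuous_pot_comp_meas[OF assms(1)])
    show "AE \<omega> in M. norm (g (pot \<omega>)) \<le> norm (c + d * (\<Sum>t<m. logb ((T ^^ t) \<omega>)))"
      by (rule AE_I2) (use bd in fastforce)
  qed
qed (use continuous_pot_comp[OF assms(1)] in auto)

lemma observable_logb: "observable M T F logb"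
  unfolding logb_def[abs_def]
  by (rule observable_cont[OF continuous_on_ln_vbound, where c = 0 and d = 1 and m = 1]) (simp add: logb_def[symmetric] logb_nonneg)

lemma observable_uminus_logb: "observable M T F (\<lambda>\<omega>. - logb \<omega>)"
  unfolding logb_def
  by (rule observable_cont[OF continuous_on_minus[OF continuous_on_ln_vbound], where c = 0 and d = 1 and m = 1])
    (simp add: logb_def[symmetric] logb_nonneg)

definition perturb_const :: "nat \<Rightarrow> nat \<Rightarrow> real" where
  "perturb_const k m = mconst k TYPE('w) * (real k * (real m * real CARD('w)))"

lemma perturb_const_nonneg: "perturb_const k m \<ge> 0"
  by (simp add: perturb_const_def minors_const_def)

text \<open>The second summand makes \<open>upper_obs k m z r R\<close> a common upper bound for all spectral parameters at
  distance at most \<open>r\<close> from \<open>z\<close> in the disc of radius \<open>R\<close>.\<close>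

definition upper_obs :: "nat \<Rightarrow> nat \<Rightarrow> complex \<Rightarrow> real \<Rightarrow> real \<Rightarrow> (nat \<Rightarrow> real ^ 'w ^ 'w) \<Rightarrow> real" where
  "upper_obs k m z r R V = ln (minors_sum k (tprod V z m) + r * (perturb_const k m * pbound R V m ^ Suc k))"

lemma minors_sum_tprod_perturb:
  fixes V :: "nat \<Rightarrow> real ^ 'w ^ 'w"
  assumes z: "cmod z \<le> R" "cmod w \<le> R"
  shows "\<bar>minors_sum k (tprod V z m) - minors_sum k (tprod V w m)\<bar> \<le> cmod (z - w) * (perturb_const k m * pbound R V m ^ Suc k)"
proof -
  have R: "R \<ge> 0"
    using assms norm_ge_zero order_trans by blast
  have "\<bar>minors_sum k (tprod V z m) - minors_sum k (tprod V w m)\<bar> \<le>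
      real (CARD('w + 'w) ^ k * CARD('w + 'w) ^ k) * fact k * (real k * pbound R V m ^ k * (real m * real CARD('w) * cmod (z - w) * pbound R V m))"
    by (intro minors_sum_diff_le tprod_entry_le tprod_diff_entry_le z pbound_ge_1 R)
  then show ?thesis
    by (simp add: perturb_const_def minors_const_def mult_ac)
qed

lemma pbound_nonneg: "R \<ge> 0 \<Longrightarrow> pbound R V m \<ge> 0"
  using pbound_ge_1[of R V m] by linarith

text \<open>Changing the parameter is paid for by a larger perturbation radius. It serves in both
  directions, from \<open>z\<close> to a rational point and back.\<close>

lemma minors_sum_le_upper_obs:
  fixes V :: "nat \<Rightarrow> real ^ 'w ^ 'w"
  assumes k: "k \<le> CARD('w) + CARD('w)" and z: "cmod z \<le> R" "cmod w \<le> R" "cmod (z - w) \<le> r" and s: "s \<ge> 0"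
  shows "upper_obs k m z s R V \<le> upper_obs k m w (r + s) R V"
proof -
  have R: "R \<ge> 0" "r \<ge> 0"
    using z norm_ge_zero order_trans by blast+
  have E: "perturb_const k m * pbound R V m ^ Suc k \<ge> 0"
    using pbound_nonneg[OF R(1)] by (intro mult_nonneg_nonneg perturb_const_nonneg zero_le_power)
  have "minors_sum k (tprod V z m) \<le> minors_sum k (tprod V w m) + r * (perturb_const k m * pbound R V m ^ Suc k)"
    using minors_sum_tprod_perturb[OF z(1,2), of k V m] mult_right_mono[OF z(3) E] by linarith
  then show ?thesis
    unfolding upper_obs_def using minors_sum_tprod_bounds(3)[OF k z(1), of V m] E s
    by (intro ln_mono) (auto simp: algebra_simps intro: add_pos_nonneg)
qed

text \<open>The bound is uniform in \<open>s \<le> c\<close>, which supplies the dominating function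
  when the perturbation radius tends to 0.\<close>

lemma abs_upper_obs_le:
  fixes V :: "nat \<Rightarrow> real ^ 'w ^ 'w"
  assumes k: "k \<le> CARD('w) + CARD('w)" and z: "cmod z \<le> R" and s: "0 \<le> s" "s \<le> c"
  shows "\<bar>upper_obs k m z s R V\<bar> \<le> ln (mconst k TYPE('w) + c * perturb_const k m) +
    real (Suc k) * (\<Sum>t<m. ln (1 + R) + ln (vbound V t))"
proof -
  have R: "R \<ge> 0"
    using z norm_ge_zero order_trans by blast
  let ?N = "minors_sum k (tprod V z m)" and ?P = "pbound R V m" and ?c = "mconst k TYPE('w)"
  let ?E = "perturb_const k m * ?P ^ Suc k"
  note b = minors_sum_tprod_bounds[OF k z, of V m]
  have P: "?P \<ge> 1"
    by (rule pbound_ge_1[OF R])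
  have c1: "?c \<ge> 1"
    by (rule minors_const_ge_1) auto
  have E: "?E \<ge> 0"
    using P by (intro mult_nonneg_nonneg perturb_const_nonneg zero_le_power) auto
  have lnP: "ln (?P ^ j) = real j * (\<Sum>t<m. ln (1 + R) + ln (vbound V t))" for j
    using P by (simp add: ln_realpow ln_pbound[OF R])
  have S0: "(\<Sum>t<m. ln (1 + R) + ln (vbound V t)) \<ge> 0"
    using R vbound_ge_1[of V] by (intro sum_nonneg add_nonneg_nonneg ln_ge_zero) auto
  have cc: "?c \<le> ?c + c * perturb_const k m"
    using s perturb_const_nonneg by (simp add: mult_nonneg_nonneg)
  have "?N + s * ?E \<le> ?c * ?P ^ Suc k + c * ?E"
  proof (rule add_mono)
    have "?N \<le> ?c * ?P ^ k"
      by (rule b(1))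
    also have "\<dots> \<le> ?c * ?P ^ Suc k"
      using P c1 by (intro mult_left_mono power_increasing) auto
    finally show "?N \<le> ?c * ?P ^ Suc k" .
    show "s * ?E \<le> c * ?E"
      using s E by (intro mult_right_mono) auto
  qed
  also have "\<dots> = (?c + c * perturb_const k m) * ?P ^ Suc k"
    by (simp add: algebra_simps)
  finally have "upper_obs k m z s R V \<le> ln ((?c + c * perturb_const k m) * ?P ^ Suc k)"
    unfolding upper_obs_def using b(3) s E by (intro ln_mono add_pos_nonneg) auto
  also have "\<dots> = ln (?c + c * perturb_const k m) + real (Suc k) * (\<Sum>t<m. ln (1 + R) + ln (vbound V t))"
    using cc c1 P by (subst ln_mult_pos) (auto simp: lnP simp del: power_Suc)
  finally have 1: "upper_obs k m z s R V \<le> ln (?c + c * perturb_const k m) + real (Suc k) * (\<Sum>t<m. ln (1 + R) + ln (vbound V t))" .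
  have "- ln ?c - real k * (\<Sum>t<m. ln (1 + R) + ln (vbound V t)) \<le> ln ?N"
    using abs_ln_minors_sum_tprod_le[OF k z, of V m] by linarith
  also have "ln ?N \<le> upper_obs k m z s R V"
    unfolding upper_obs_def using b(3) s E by (intro ln_mono) auto
  finally have "- upper_obs k m z s R V \<le> ln ?c + real k * (\<Sum>t<m. ln (1 + R) + ln (vbound V t))"
    by simp
  also have "\<dots> \<le> ln (?c + c * perturb_const k m) + real (Suc k) * (\<Sum>t<m. ln (1 + R) + ln (vbound V t))"
    using cc c1 S0 by (intro add_mono mult_right_mono ln_mono) auto
  finally show ?thesis
    using 1 by (intro abs_leI)
qed

lemma observable_upper_obs:
  assumes k: "k \<le> CARD('w) + CARD('w)" and z: "cmod z \<le> R" and s: "0 \<le> s"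
  shows "observable M T F (\<lambda>\<omega>. upper_obs k m z s R (pot \<omega>))"
proof (rule observable_cont[where m = m and d = "real (Suc k)" and
      c = "ln (mconst k TYPE('w) + s * perturb_const k m) + real (Suc k) * (real m * ln (1 + R))"])
  have R: "R \<ge> 0"
    using z norm_ge_zero order_trans by blast
  show "continuous_on UNIV (upper_obs k m z s R)"
    unfolding upper_obs_def[abs_def] pbound_def
  proof (intro continuous_on_ln continuous_on_add continuous_on_mult continuous_on_const continuous_on_minors_sum
      continuous_on_tprod_entry' continuous_on_power continuous_on_prod continuous_on_vbound ballI)
    fix V :: "nat \<Rightarrow> real ^ 'w ^ 'w"
    have "0 \<le> s * (perturb_const k m * pbound R V m ^ Suc k)"
      using pbound_nonneg[OF R, of V m] s by (intro mult_nonneg_nonneg perturb_const_nonneg zero_le_power)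
    then show "minors_sum k (tprod V z m) + s * (perturb_const k m * (\<Prod>t<m. (1 + R) * vbound V t) ^ Suc k) \<noteq> 0"
      using minors_sum_tprod_bounds(3)[OF k z, of V m] unfolding pbound_def by linarith
  qed
  fix \<omega>
  have "\<bar>upper_obs k m z s R (pot \<omega>)\<bar> \<le> ln (mconst k TYPE('w) + s * perturb_const k m) +
    real (Suc k) * (\<Sum>t<m. ln (1 + R) + ln (vbound (pot \<omega>) t))"
    by (rule abs_upper_obs_le[OF k z s order_refl])
  then show "\<bar>upper_obs k m z s R (pot \<omega>)\<bar> \<le> (ln (mconst k TYPE('w) + s * perturb_const k m) + real (Suc k) * (real m * ln (1 + R))) +
      real (Suc k) * (\<Sum>t<m. logb ((T ^^ t) \<omega>))"
    by (simp add: logb_iter sum.distrib distrib_left)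
qed

section \<open>Expected growth of minors\<close>

definition exp_minors :: "nat \<Rightarrow> complex \<Rightarrow> nat \<Rightarrow> real" where
  "exp_minors k z n = (\<integral>\<omega>. ln (minors_sum k (tprod (pot \<omega>) z n)) \<partial>M)"

lemma upper_obs_zero: "upper_obs k m z 0 R V = ln (minors_sum k (tprod V z m))"
  by (simp add: upper_obs_def)

lemma observable_minors:
  assumes k: "k \<le> CARD('w) + CARD('w)"
  shows "observable M T F (\<lambda>\<omega>. ln (minors_sum k (tprod (pot \<omega>) z m)))"
  using observable_upper_obs[OF k order_refl order_refl, of m z] by (simp add: upper_obs_zero)

lemma integrable_minors:
  assumes k: "k \<le> CARD('w) + CARD('w)"
  shows "integrable M (\<lambda>\<omega>. ln (minors_sum k (tprod (pot \<omega>) z m)))"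
  using observable_minors[OF k] by (simp add: observable_def)

lemma ln_minors_sum_subadd:
  assumes k: "k \<le> CARD('w) + CARD('w)"
  shows "ln (minors_sum k (tprod (pot \<omega>) z (n + m))) \<le>
    ln (minors_sum k (tprod (pot \<omega>) z n)) + ln (minors_sum k (tprod (pot ((T ^^ n) \<omega>)) z m))"
proof -
  note pos = minors_sum_tprod_bounds(3)[OF k order_refl]
  have "ln (minors_sum k (tprod (pot \<omega>) z (n + m))) \<le>
      ln (minors_sum k (tprod (pot ((T ^^ n) \<omega>)) z m) * minors_sum k (tprod (pot \<omega>) z n))"
    unfolding tprod_pot_add by (intro ln_mono minors_sum_mult) (metis pos tprod_pot_add)
  also have "\<dots> = ln (minors_sum k (tprod (pot ((T ^^ n) \<omega>)) z m)) + ln (minors_sum k (tprod (pot \<omega>) z n))"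
    by (intro ln_mult_pos pos)
  finally show ?thesis
    by simp
qed

definition lyap_sum :: "nat \<Rightarrow> complex \<Rightarrow> real" where
  "lyap_sum k z = lim (\<lambda>n. exp_minors k z n / n)"

lemma abs_exp_minors_le:
  assumes k: "k \<le> CARD('w) + CARD('w)" and z: "cmod z \<le> R"
  shows "\<bar>exp_minors k z n\<bar> \<le> ln (mconst k TYPE('w)) + real k * (real n * (ln (1 + R) + integral\<^sup>L M logb))"
proof -
  have int: "integrable M (\<lambda>\<omega>. logb ((T ^^ t) \<omega>))" "(\<integral>\<omega>. logb ((T ^^ t) \<omega>) \<partial>M) = integral\<^sup>L M logb" for t
    using iter_integral[OF integrable_logb] by auto
  have "\<bar>exp_minors k z n\<bar> \<le> (\<integral>\<omega>. \<bar>ln (minors_sum k (tprod (pot \<omega>) z n))\<bar> \<partial>M)"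
    unfolding exp_minors_def by (rule integral_abs_bound)
  also have "\<dots> \<le> (\<integral>\<omega>. ln (mconst k TYPE('w)) + real k * (\<Sum>t<n. ln (1 + R) + logb ((T ^^ t) \<omega>)) \<partial>M)"
    using abs_ln_minors_sum_tprod_le[OF k z] int
    by (intro integral_mono Bochner_Integration.integrable_add integrable_mult_right Bochner_Integration.integrable_sum
        integrable_abs integrable_minors k) (auto simp: logb_iter)
  also have "\<dots> = ln (mconst k TYPE('w)) + real k * (real n * (ln (1 + R) + integral\<^sup>L M logb))"
    using int by (simp add: prob_space)
  finally show ?thesis .
qed

text \<open>Invariance of the measure turns pointwise subadditivity into subadditivity of the
  expectations; the linear lower bound keeps the limit finite.\<close>

lemma lyap_sum:
  assumes k: "k \<le> CARD('w) + CARD('w)"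
  shows "(\<lambda>n. exp_minors k z n / n) \<longlonglongrightarrow> lyap_sum k z" and "n \<ge> 1 \<Longrightarrow> lyap_sum k z \<le> exp_minors k z n / n"
proof -
  have sub: "exp_minors k z (n + m) \<le> exp_minors k z n + exp_minors k z m" for n m
  proof -
    have "exp_minors k z (n + m) \<le> (\<integral>\<omega>. ln (minors_sum k (tprod (pot \<omega>) z n)) + ln (minors_sum k (tprod (pot ((T ^^ n) \<omega>)) z m)) \<partial>M)"
      unfolding exp_minors_def using iter_integral[OF integrable_minors[OF k]]
      by (intro integral_mono Bochner_Integration.integrable_add integrable_minors k ln_minors_sum_subadd) auto
    also have "\<dots> = exp_minors k z n + exp_minors k z m"
      unfolding exp_minors_def using iter_integral[OF integrable_minors[OF k], of n z m]
      by (subst Bochner_Integration.integral_add) (auto intro: integrable_minors k)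
    finally show ?thesis .
  qed
  define c where "c = - (ln (mconst k TYPE('w)) + real k * (ln (1 + cmod z) + integral\<^sup>L M logb))"
  have low: "c * n \<le> exp_minors k z n" if "n \<ge> 1" for n :: nat
  proof -
    have "ln (mconst k TYPE('w)) \<ge> 0"
      by (intro ln_ge_zero minors_const_ge_1) auto
    then have "ln (mconst k TYPE('w)) \<le> real n * ln (mconst k TYPE('w))"
      using that mult_right_mono[of 1 "real n" "ln (mconst k TYPE('w))"] by simp
    then show ?thesis
      using abs_exp_minors_le[OF k order_refl, of z n] by (simp add: c_def algebra_simps abs_le_iff)
  qed
  obtain L where L: "(\<lambda>n. exp_minors k z n / n) \<longlonglongrightarrow> L" "\<forall>n\<ge>1. L \<le> exp_minors k z n / n"
    using fekete[OF sub low] by blast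
  then have "lyap_sum k z = L"
    unfolding lyap_sum_def by (intro limI)
  then show "(\<lambda>n. exp_minors k z n / n) \<longlonglongrightarrow> lyap_sum k z" "n \<ge> 1 \<Longrightarrow> lyap_sum k z \<le> exp_minors k z n / n"
    using L by auto
qed

lemma lyap_sum_bounded:
  assumes k: "k \<le> CARD('w) + CARD('w)"
  shows "\<exists>C. \<forall>z. cmod z \<le> R \<longrightarrow> \<bar>lyap_sum k z\<bar> \<le> C"
proof (intro exI allI impI)
  fix z assume z: "cmod z \<le> R"
  let ?L = "ln (mconst k TYPE('w))"
  have L: "?L \<ge> 0"
    by (intro ln_ge_zero minors_const_ge_1) auto
  have "(\<lambda>n. \<bar>exp_minors k z n / n\<bar>) \<longlonglongrightarrow> \<bar>lyap_sum k z\<bar>"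
    by (intro tendsto_rabs lyap_sum k)
  moreover have "\<forall>\<^sub>F n in sequentially. \<bar>exp_minors k z n / n\<bar> \<le> ?L + real k * (ln (1 + R) + integral\<^sup>L M logb)"
    using eventually_ge_at_top[of 1]
  proof eventually_elim
    fix n :: nat assume n: "n \<ge> 1"
    have "\<bar>exp_minors k z n\<bar> \<le> real n * ?L + real k * (real n * (ln (1 + R) + integral\<^sup>L M logb))"
      using abs_exp_minors_le[OF k z, of n] mult_right_mono[of 1 "real n" ?L] L n by simp
    then show "\<bar>exp_minors k z n / n\<bar> \<le> ?L + real k * (ln (1 + R) + integral\<^sup>L M logb)"
      using n by (simp add: abs_divide divide_le_eq algebra_simps)
  qed
  ultimately show "\<bar>lyap_sum k z\<bar> \<le> ?L + real k * (ln (1 + R) + integral\<^sup>L M logb)"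
    by (intro tendsto_upperbound) auto
qed

text \<open>Joint continuity in parameter and potential makes the integrand jointly measurable, so
  the expectations are measurable in \<open>z\<close>, and so is their limit.\<close>

lemma lyap_sum_measurable:
  assumes k: "k \<le> CARD('w) + CARD('w)"
  shows "lyap_sum k \<in> borel_measurable borel"
proof (rule borel_measurable_LIMSEQ_real)
  show "(\<lambda>n. exp_minors k z n / n) \<longlonglongrightarrow> lyap_sum k z" for z
    by (rule lyap_sum[OF k])
  fix n
  have "continuous_on UNIV (\<lambda>p :: complex \<times> (nat \<Rightarrow> real ^ 'w ^ 'w). ln (minors_sum k (tprod (snd p) (fst p) n)))"
  proof (intro continuous_on_ln continuous_on_minors_sum continuous_on_tprod_entry ballI)
    show "minors_sum k (tprod (snd p) (fst p) n) \<noteq> 0" for p :: "complex \<times> (nat \<Rightarrow> real ^ 'w ^ 'w)"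
      using minors_sum_tprod_bounds(3)[OF k order_refl, of "snd p" "fst p" n] by linarith
  qed
  then have "(\<lambda>p :: complex \<times> (nat \<Rightarrow> real ^ 'w ^ 'w). ln (minors_sum k (tprod (snd p) (fst p) n))) \<in> borel_measurable borel"
    by (rule borel_measurable_continuous_onI)
  note meas = this
  have "(\<lambda>q. (fst q, pot (snd q))) \<in> ((borel :: complex measure) \<Otimes>\<^sub>M M) \<rightarrow>\<^sub>M (borel \<Otimes>\<^sub>M borel)"
    by (intro measurable_Pair measurable_fst measurable_compose[OF measurable_snd pot_meas])
  then have "(\<lambda>q. (fst q, pot (snd q))) \<in> borel_measurable ((borel :: complex measure) \<Otimes>\<^sub>M M)"
    by (simp only: borel_prod)
  from measurable_compose[OF this meas]
  have "(\<lambda>q. ln (minors_sum k (tprod (pot (snd q)) (fst q) n))) \<in> borel_measurable (borel \<Otimes>\<^sub>M M)"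
    by simp
  then have "(\<lambda>(z, \<omega>). ln (minors_sum k (tprod (pot \<omega>) z n))) \<in> borel_measurable (borel \<Otimes>\<^sub>M M)"
    by (simp add: case_prod_beta')
  then have "(\<lambda>z. exp_minors k z n) \<in> borel_measurable borel"
    unfolding exp_minors_def by (rule borel_measurable_lebesgue_integral)
  then show "(\<lambda>z. exp_minors k z n / n) \<in> borel_measurable borel"
    by measurable
qed

end

lemma birkhoff_le_affine:
  assumes "prob_space M" "birkhoff_le M T f \<omega>" "integrable M f" "d \<ge> 0"
  shows "birkhoff_le M T (\<lambda>\<omega>. c + d * f \<omega>) \<omega>"
  unfolding birkhoff_le_def
proof (intro allI impI)
  interpret prob_space M by fact
  fix \<delta> :: real assume \<delta>: "\<delta> > 0"
  have int: "integral\<^sup>L M (\<lambda>\<omega>. c + d * f \<omega>) = c + d * integral\<^sup>L M f"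
    using assms(3) by (simp add: prob_space)
  \<comment> \<open>Dividing by \<open>d + 1\<close> instead of \<open>d\<close> also covers
    \<open>d = 0\<close>.\<close>
  have "\<forall>\<^sub>F n in sequentially. (\<Sum>j<n. f ((T ^^ j) \<omega>)) \<le> real n * (integral\<^sup>L M f + \<delta> / (d + 1))"
    using assms(2,4) \<delta> unfolding birkhoff_le_def by auto
  then show "\<forall>\<^sub>F n in sequentially. (\<Sum>j<n. c + d * f ((T ^^ j) \<omega>)) \<le> real n * (integral\<^sup>L M (\<lambda>\<omega>. c + d * f \<omega>) + \<delta>)"
  proof eventually_elim
    case (elim n)
    have "(\<Sum>j<n. c + d * f ((T ^^ j) \<omega>)) = real n * c + d * (\<Sum>j<n. f ((T ^^ j) \<omega>))"
      by (simp add: sum.distrib sum_distrib_left)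
    also have "\<dots> \<le> real n * c + d * (real n * (integral\<^sup>L M f + \<delta> / (d + 1)))"
      using elim assms(4) by (intro add_left_mono mult_left_mono)
    also have "\<dots> = real n * (c + d * integral\<^sup>L M f + d / (d + 1) * \<delta>)"
      by (simp add: algebra_simps)
    also have "\<dots> \<le> real n * (c + d * integral\<^sup>L M f + 1 * \<delta>)"
      using assms(4) \<delta> by (intro mult_left_mono add_left_mono mult_right_mono) auto
    finally show ?case
      by (simp add: int)
  qed
qed

section \<open>Dirichlet determinants\<close>

definition ddet :: "(nat \<Rightarrow> real ^ 'w::finite ^ 'w) \<Rightarrow> complex \<Rightarrow> nat \<Rightarrow> real" where
  "ddet V z n = cmod (det (top_left (tprod V z n)))"

text \<open>The reciprocal of the constant in \<open>det_top_left_tprod_lower\<close>, a lower bound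
  at height \<open>e\<close> uniform in the potential and the length; the type argument carries the
  dimension.\<close>

definition ddet_min :: "'w::finite itself \<Rightarrow> real \<Rightarrow> real" where
  "ddet_min _ e = 1 / (fact CARD('w) * (1 / e) ^ CARD('w))"

lemma ddet_min_pos: "e > 0 \<Longrightarrow> ddet_min TYPE('w::finite) e > 0"
  by (simp add: ddet_min_def)

lemma ddet_ge:
  fixes V :: "nat \<Rightarrow> real ^ 'w::finite ^ 'w"
  assumes "\<And>i. transpose (V i) = V i" "Im z > 0" "n \<ge> 1"
  shows "ddet_min TYPE('w) (Im z) \<le> ddet V z n" "ddet V z n > 0"
proof -
  have "1 \<le> fact CARD('w) * (1 / Im z) ^ CARD('w) * ddet V z n"
    unfolding ddet_def by (rule det_top_left_tprod_lower) (use assms in auto)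
  then show "ddet_min TYPE('w) (Im z) \<le> ddet V z n"
    using assms(2) by (simp add: ddet_min_def field_simps)
  then show "ddet V z n > 0"
    using ddet_min_pos[OF assms(2), where 'w = 'w] by linarith
qed

lemma ddet_polynomial:
  fixes V :: "nat \<Rightarrow> real ^ 'w::finite ^ 'w"
  obtains p where "degree p \<le> n * CARD('w)" "\<And>z. det (top_left (tprod V z n)) = poly p z"
proof -
  have "polynomial_matrix n (\<lambda>z. top_left (tprod V z n))"
    unfolding top_left_def by (intro polynomial_matrix_submatrix polynomial_matrix_tprod)
  from polynomial_matrix_det[OF this] show ?thesis
    using that by blast
qed

lemma ln_ddet_lipschitz:
  fixes V :: "nat \<Rightarrow> real ^ 'w::finite ^ 'w"
  assumes sym: "\<And>i. transpose (V i) = V i" and z: "Im z > 0" "Im w > 0" and n: "n \<ge> 1"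
  shows "ln (ddet V z n) \<le> ln (ddet V w n) + real n * (real CARD('w) * (cmod (z - w) / Im w))"
proof -
  obtain p where p: "degree p \<le> n * CARD('w)" "\<And>z. det (top_left (tprod V z n)) = poly p z"
    using ddet_polynomial[of n V] by blast
  have d: "ddet V z n = cmod (poly p z)" for z
    by (simp add: ddet_def p)
  have "poly p u \<noteq> 0" if "Im u > 0" for u
    using ddet_ge(2)[of V, OF sym that n] by (simp add: d)
  from poly_norm_lipschitz[OF this z(2), of z]
  have "ddet V z n \<le> ddet V w n * exp (real (degree p) * (cmod (z - w) / Im w))"
    by (simp add: d)
  then have "ln (ddet V z n) \<le> ln (ddet V w n * exp (real (degree p) * (cmod (z - w) / Im w)))"
    by (intro ln_mono ddet_ge(2)[of V, OF sym z(1) n])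
  also have "\<dots> = ln (ddet V w n) + real (degree p) * (cmod (z - w) / Im w)"
    using ddet_ge(2)[of V, OF sym z(2) n] by (subst ln_mult_pos) auto
  also have "\<dots> \<le> ln (ddet V w n) + real (n * CARD('w)) * (cmod (z - w) / Im w)"
    using p(1) z by (intro add_left_mono mult_right_mono) (auto simp del: of_nat_mult)
  finally show ?thesis
    by (simp add: mult_ac)
qed

lemma minors_sum_le_ddet:
  assumes "e > 0"
  shows "\<exists>C>0. \<forall>(V :: nat \<Rightarrow> real ^ 'w::finite ^ 'w) z n. (\<forall>i. transpose (V i) = V i) \<longrightarrow> Im z = e \<longrightarrow> n \<ge> 1 \<longrightarrow>
    minors_sum CARD('w) (tprod V z n) \<le> C * ddet V z n"
proof -
  have "max 1 (1 / e) \<ge> 1"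
    by simp
  from minors_sum_le_det_top_left[OF this, where 'w = 'w] obtain C where C: "C > 0"
    "\<And>M :: complex ^ ('w + 'w) ^ ('w + 'w). boundary_bounded (max 1 (1 / e)) M \<Longrightarrow> minors_sum CARD('w) M \<le> C * cmod (det (top_left M))"
    by blast
  have "minors_sum CARD('w) (tprod V z n) \<le> C * ddet V z n"
    if "\<forall>i. transpose (V i) = V i" "Im z = e" "n \<ge> 1" for V :: "nat \<Rightarrow> real ^ 'w ^ 'w" and z n
    unfolding ddet_def by (intro C(2) boundary_bounded_tprod) (use that assms in auto)
  with C(1) show ?thesis
    by blast
qed

lemma rat_complex_dense:
  assumes "r > 0"
  obtains x y :: rat where "cmod (z - Complex (of_rat x) (of_rat y)) < r"
proof -
  obtain x where x: "Re z - r / 2 < of_rat x" "of_rat x < Re z + r / 2"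
    using of_rat_dense[of "Re z - r / 2" "Re z + r / 2"] assms by auto
  obtain y where y: "Im z - r / 2 < of_rat y" "of_rat y < Im z + r / 2"
    using of_rat_dense[of "Im z - r / 2" "Im z + r / 2"] assms by auto
  have "cmod (z - Complex (of_rat x) (of_rat y)) \<le> \<bar>Re z - of_rat x\<bar> + \<bar>Im z - of_rat y\<bar>"
    using cmod_le[of "z - Complex (of_rat x) (of_rat y)"] by simp
  also have "\<dots> < r / 2 + r / 2"
    using x y by (intro add_strict_mono) (simp_all only: abs_less_iff, linarith+)
  finally show ?thesis
    using that by simp
qed

section \<open>Growth bounds along good orbits\<close>

context schrodinger_cocycle
begin

text \<open>The truncation is inactive for symmetric potentials and makes the observable continuous for
  all others.\<close>

definition lower_obs :: "nat \<Rightarrow> complex \<Rightarrow> (nat \<Rightarrow> real ^ 'w ^ 'w) \<Rightarrow> real" where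
  "lower_obs m z V = - ln (max (ddet_min TYPE('w) (Im z)) (ddet V z m))"

lemma lower_obs_eq:
  assumes "\<omega> \<in> space M" "Im z > 0" "m \<ge> 1"
  shows "lower_obs m z (pot \<omega>) = - ln (ddet (pot \<omega>) z m)"
proof -
  have "ddet_min TYPE('w) (Im z) \<le> ddet (pot \<omega>) z m"
    by (rule ddet_ge(1)) (use assms pot_sym in auto)
  then show ?thesis
    by (simp add: lower_obs_def max_def)
qed

lemma observable_lower_obs:
  assumes z: "Im z > 0"
  shows "observable M T F (\<lambda>\<omega>. lower_obs m z (pot \<omega>))"
proof (rule observable_cont[where m = m and d = "real CARD('w)" and
      c = "\<bar>ln (ddet_min TYPE('w) (Im z))\<bar> + \<bar>ln (mconst CARD('w) TYPE('w))\<bar> + real CARD('w) * (real m * ln (1 + cmod z))"])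
  note pos = ddet_min_pos[OF z, where 'w = 'w]
  show "continuous_on UNIV (lower_obs m z)"
    unfolding lower_obs_def[abs_def] ddet_def top_left_def
  proof (intro continuous_on_minus continuous_on_ln continuous_on_max continuous_on_const continuous_on_norm
      continuous_on_det_entries ballI)
    show "continuous_on UNIV (\<lambda>V. (\<chi> i j. tprod V z m $ Inl i $ Inl j :: complex ^ 'w ^ 'w) $ i $ j)" for i j
      using continuous_on_tprod_entry'[of z m "Inl i" "Inl j"] by simp
    show "max (ddet_min TYPE('w) (Im z)) (cmod (det (\<chi> i j. tprod V z m $ Inl i $ Inl j :: complex ^ 'w ^ 'w))) \<noteq> 0" for V
      using less_le_trans[OF pos max.cobounded1] by (rule less_imp_neq[symmetric])
  qed
  fix \<omega>
  let ?V = "pot \<omega>"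
  let ?S = "real CARD('w) * (\<Sum>t<m. ln (1 + cmod z) + ln (vbound ?V t))"
  have P: "pbound (cmod z) ?V m \<ge> 1"
    by (rule pbound_ge_1) simp
  have c1: "mconst CARD('w) TYPE('w) \<ge> 1"
    by (rule minors_const_ge_1) auto
  have S: "?S \<ge> 0"
    using vbound_ge_1[of ?V] by (intro mult_nonneg_nonneg sum_nonneg add_nonneg_nonneg ln_ge_zero) auto
  have "ddet ?V z m \<le> minors_sum CARD('w) (tprod ?V z m)"
    unfolding ddet_def top_left_def by (rule det_submatrix_le_minors_sum)
  also have "\<dots> \<le> mconst CARD('w) TYPE('w) * pbound (cmod z) ?V m ^ CARD('w)"
    by (rule minors_sum_tprod_bounds(1)) auto
  finally have le: "ddet ?V z m \<le> mconst CARD('w) TYPE('w) * pbound (cmod z) ?V m ^ CARD('w)" .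
  have lncP: "ln (mconst CARD('w) TYPE('w) * pbound (cmod z) ?V m ^ CARD('w)) = ln (mconst CARD('w) TYPE('w)) + ?S"
    using c1 P by (subst ln_mult_pos) (auto simp: ln_realpow ln_pbound)
  have "\<bar>lower_obs m z ?V\<bar> \<le> \<bar>ln (ddet_min TYPE('w) (Im z))\<bar> + \<bar>ln (mconst CARD('w) TYPE('w))\<bar> + ?S"
  proof (cases "ddet_min TYPE('w) (Im z) \<le> ddet ?V z m")
    case True
    have "ln (ddet_min TYPE('w) (Im z)) \<le> ln (ddet ?V z m)"
      using True pos by (intro ln_mono) auto
    moreover have "ln (ddet ?V z m) \<le> ln (mconst CARD('w) TYPE('w)) + ?S"
      unfolding lncP[symmetric] using True pos le by (intro ln_mono) auto
    ultimately have "\<bar>- ln (ddet ?V z m)\<bar> \<le> \<bar>ln (ddet_min TYPE('w) (Im z))\<bar> + \<bar>ln (mconst CARD('w) TYPE('w))\<bar> + ?S"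
      using S by linarith
    then show ?thesis
      using True by (simp add: lower_obs_def max_def)
  next
    case False
    then show ?thesis
      using S by (simp add: lower_obs_def max_def)
  qed
  then show "\<bar>lower_obs m z (pot \<omega>)\<bar> \<le> \<bar>ln (ddet_min TYPE('w) (Im z))\<bar> + \<bar>ln (mconst CARD('w) TYPE('w))\<bar> +
      real CARD('w) * (real m * ln (1 + cmod z)) + real CARD('w) * (\<Sum>t<m. logb ((T ^^ t) \<omega>))"
    by (simp add: logb_iter sum.distrib distrib_left)
qed

text \<open>In the second family \<open>l\<close> sets the perturbation radius and \<open>R\<close>
  the disc in which the perturbation bound holds. In the third, \<open>y > 0\<close> keeps the
  Dirichlet determinants of symmetric potentials away from 0.\<close>

definition observables :: "('a \<Rightarrow> real) set" where
  "observables = {logb, \<lambda>\<omega>. - logb \<omega>} \<union>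
    (\<lambda>(k, m, x, y, l, R). \<lambda>\<omega>. upper_obs k m (Complex (of_rat x) (of_rat y)) (1 / real (Suc l)) (real R) (pot \<omega>)) `
      {(k, m, x :: rat, y :: rat, l, R :: nat). k \<le> CARD('w) + CARD('w) \<and> cmod (Complex (of_rat x) (of_rat y)) \<le> real R} \<union>
    (\<lambda>(m, x, y). \<lambda>\<omega>. lower_obs m (Complex (of_rat x) (of_rat y)) (pot \<omega>)) ` {(m, x :: rat, y :: rat). y > 0}"

definition good :: "'a \<Rightarrow> bool" where
  "good \<omega> \<longleftrightarrow> \<omega> \<in> space M \<and> (\<forall>f\<in>observables. birkhoff_le M T f \<omega>)"

lemma almost_star_surely_good: "almost_star_surely M T F good"
proof (rule almost_star_surely_mono)
  show "almost_star_surely M T F (\<lambda>\<omega>. \<forall>f\<in>observables. birkhoff_le M T f \<omega>)"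
  proof (rule almost_star_surely_birkhoff_le[OF prob_space_axioms erg])
    show "countable observables"
      unfolding observables_def by (intro countable_Un countable_image) auto
    show "observable M T F f" if "f \<in> observables" for f
      using that unfolding observables_def
      by (auto intro!: observable_logb observable_uminus_logb observable_upper_obs observable_lower_obs)
  qed
qed (simp add: good_def)

lemma good_logb:
  assumes "good \<omega>" "d \<ge> 0"
  shows "birkhoff_le M T (\<lambda>\<omega>. c + d * logb \<omega>) \<omega>" "birkhoff_le M T (\<lambda>\<omega>. - (c + d * logb \<omega>)) \<omega>"
proof -
  have b: "birkhoff_le M T logb \<omega>" "birkhoff_le M T (\<lambda>\<omega>. - logb \<omega>) \<omega>"
    using assms(1) by (auto simp: good_def observables_def)
  show "birkhoff_le M T (\<lambda>\<omega>. c + d * logb \<omega>) \<omega>"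
    by (rule birkhoff_le_affine[OF prob_space_axioms b(1) integrable_logb assms(2)])
  have "birkhoff_le M T (\<lambda>\<omega>. - c + d * (- logb \<omega>)) \<omega>"
    using integrable_logb by (intro birkhoff_le_affine[OF prob_space_axioms b(2) _ assms(2)]) simp
  then show "birkhoff_le M T (\<lambda>\<omega>. - (c + d * logb \<omega>)) \<omega>"
    by simp
qed

text \<open>At a rational point \<open>w\<close> within \<open>s\<close> of \<open>z\<close>, the
  observable of radius \<open>s\<close> dominates the logarithm at \<open>z\<close> and is dominated
  by the observable at \<open>z\<close> of radius \<open>s + s\<close>, whose mean tends to the
  unperturbed one as \<open>s\<close> tends to 0. So \<open>good\<close> controls all
  \<open>z\<close> without mentioning them.\<close>

lemma good_upper:
  assumes good: "good \<omega>" and k: "k \<le> CARD('w) + CARD('w)" and \<delta>: "\<delta> > 0"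
  shows "\<forall>\<^sub>F n in sequentially. ln (minors_sum k (tprod (pot \<omega>) z n)) \<le> real n * (lyap_sum k z + \<delta>)"
proof -
  have \<omega>: "\<omega> \<in> space M"
    using good by (simp add: good_def)
  have "\<forall>\<^sub>F n in sequentially. exp_minors k z n / n < lyap_sum k z + \<delta> / 3"
    using \<delta> by (intro order_tendstoD(2)[OF lyap_sum(1)[OF k]]) auto
  then have "\<forall>\<^sub>F n in sequentially. n \<ge> 1 \<and> exp_minors k z n / n < lyap_sum k z + \<delta> / 3"
    using eventually_ge_at_top[of 1] by eventually_elim simp
  \<comment> \<open>A block length at which the expectation per site is within
    \<open>\<delta> / 3\<close> of its limit.\<close>
  then obtain m where m: "m \<ge> 1" "exp_minors k z m / m < lyap_sum k z + \<delta> / 3"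
    by (auto simp: eventually_sequentially)
  obtain R :: nat where R: "real R > cmod z + 1"
    using reals_Archimedean2 by blast
  then have zR: "cmod z \<le> real R" and R0: "real R \<ge> 0"
    by auto
  \<comment> \<open>As the perturbation radius tends to 0 the mean of the observable tends to that
    of the unperturbed logarithm; the radius \<open>2 / Suc l\<close> leaves room for two moves of
    size \<open>1 / Suc l\<close>.\<close>
  have lim: "(\<lambda>l. \<integral>\<omega>. upper_obs k m z (2 / real (Suc l)) R (pot \<omega>) \<partial>M) \<longlonglongrightarrow> (\<integral>\<omega>. upper_obs k m z 0 R (pot \<omega>) \<partial>M)"
  proof (rule integral_dominated_convergence)
    show "integrable M (\<lambda>\<omega>. ln (mconst k TYPE('w) + 2 * perturb_const k m) + real (Suc k) * (\<Sum>t<m. ln (1 + real R) + logb ((T ^^ t) \<omega>)))"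
      by (intro Bochner_Integration.integrable_add integrable_mult_right Bochner_Integration.integrable_sum)
        (simp_all add: iter_integral integrable_logb)
    show "AE \<omega> in M. norm (upper_obs k m z (2 / real (Suc l)) R (pot \<omega>)) \<le>
        ln (mconst k TYPE('w) + 2 * perturb_const k m) + real (Suc k) * (\<Sum>t<m. ln (1 + real R) + logb ((T ^^ t) \<omega>))" for l
    proof (rule AE_I2)
      show "norm (upper_obs k m z (2 / real (Suc l)) R (pot \<omega>)) \<le>
        ln (mconst k TYPE('w) + 2 * perturb_const k m) + real (Suc k) * (\<Sum>t<m. ln (1 + real R) + logb ((T ^^ t) \<omega>))" for \<omega>
        using abs_upper_obs_le[OF k zR, of "2 / real (Suc l)" 2 m "pot \<omega>"] by (simp add: logb_iter divide_le_eq)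
    qed
    show "AE \<omega> in M. (\<lambda>l. upper_obs k m z (2 / real (Suc l)) R (pot \<omega>)) \<longlonglongrightarrow> upper_obs k m z 0 R (pot \<omega>)"
    proof (rule AE_I2)
      fix \<omega>
      have "(\<lambda>l. 2 / real (Suc l)) \<longlonglongrightarrow> 0"
        by (rule LIMSEQ_Suc[OF lim_const_over_n])
      then show "(\<lambda>l. upper_obs k m z (2 / real (Suc l)) R (pot \<omega>)) \<longlonglongrightarrow> upper_obs k m z 0 R (pot \<omega>)"
        unfolding upper_obs_def using minors_sum_tprod_bounds(3)[OF k zR, of "pot \<omega>" m]
        by (intro tendsto_ln tendsto_add tendsto_const tendsto_mult) auto
    qed
    have meas: "(\<lambda>\<omega>. upper_obs k m z s R (pot \<omega>)) \<in> borel_measurable M" if "s \<ge> 0" for s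
      using observable_upper_obs[OF k zR that, of m] by (auto simp: observable_def)
    show "(\<lambda>\<omega>. upper_obs k m z 0 R (pot \<omega>)) \<in> borel_measurable M"
      "(\<lambda>\<omega>. upper_obs k m z (2 / real (Suc l)) R (pot \<omega>)) \<in> borel_measurable M" for l
      by (rule meas, simp)+
  qed
  have "\<forall>\<^sub>F l in sequentially. (\<integral>\<omega>. upper_obs k m z (2 / real (Suc l)) R (pot \<omega>) \<partial>M) < exp_minors k z m + real m * (\<delta> / 3)"
    using \<delta> m(1) by (intro order_tendstoD(2)[OF lim]) (simp add: upper_obs_zero exp_minors_def)
  then obtain l where l: "(\<integral>\<omega>. upper_obs k m z (2 / real (Suc l)) R (pot \<omega>) \<partial>M) < exp_minors k z m + real m * (\<delta> / 3)"
    by (auto simp: eventually_sequentially)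
  define s where "s = 1 / real (Suc l)"
  have s: "s > 0" "s \<le> 1" "s + s = 2 / real (Suc l)"
    by (simp_all add: s_def)
  obtain x y :: rat where xy: "cmod (z - Complex (of_rat x) (of_rat y)) < s"
    using rat_complex_dense[OF s(1)] by blast
  define w where "w = Complex (of_rat x) (of_rat y)"
  have zw: "cmod (z - w) \<le> s" "cmod (w - z) \<le> s"
    using xy by (simp_all add: w_def norm_minus_commute)
  have wR: "cmod w \<le> real R"
    using zw(2) norm_triangle_ineq[of z "w - z"] s(2) R by simp
  define g where "g \<omega> = upper_obs k m w s (real R) (pot \<omega>)" for \<omega>
  have gO: "g \<in> observables"
    unfolding observables_def g_def[abs_def] w_def s_def using k wR
    by (intro UnI1 UnI2 image_eqI[where x = "(k, m, x, y, l, R)"]) (auto simp: w_def)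
  have bg: "birkhoff_le M T g \<omega>"
    using good gO by (simp add: good_def)
  have gl: "integral\<^sup>L M g \<le> (\<integral>\<omega>. upper_obs k m z (2 / real (Suc l)) R (pot \<omega>) \<partial>M)"
  proof (rule integral_mono)
    show "integrable M g"
      using observable_upper_obs[OF k wR, of s m] s(1) by (simp add: observable_def g_def[abs_def])
    show "integrable M (\<lambda>\<omega>. upper_obs k m z (2 / real (Suc l)) R (pot \<omega>))"
      using observable_upper_obs[OF k zR, of "2 / real (Suc l)" m] by (simp add: observable_def)
    show "g \<omega> \<le> upper_obs k m z (2 / real (Suc l)) R (pot \<omega>)" for \<omega>
      using minors_sum_le_upper_obs[OF k wR zR zw(2), of s m "pot \<omega>"] s by (simp add: g_def)
  qed
  have gi: "integral\<^sup>L M g / m \<le> lyap_sum k z + \<delta> / 3 + \<delta> / 3"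
  proof -
    have "integral\<^sup>L M g / m \<le> (exp_minors k z m + real m * (\<delta> / 3)) / m"
      using gl l by (intro divide_right_mono) auto
    also have "\<dots> = exp_minors k z m / m + \<delta> / 3"
      using m(1) by (simp add: add_divide_distrib)
    finally show ?thesis
      using m(2) by simp
  qed
  \<comment> \<open>A majorant per site that is affine in \<open>logb\<close>, so that
    \<open>good\<close> bounds its averages from both sides.\<close>
  let ?\<beta> = "\<lambda>\<omega>. (ln (mconst k TYPE('w)) + real k * ln (1 + cmod z)) + real k * logb \<omega>"
  have lnc: "ln (mconst k TYPE('w)) \<ge> 0"
    by (intro ln_ge_zero minors_const_ge_1) auto
  have "\<forall>\<^sub>F n in sequentially. ln (minors_sum k (tprod (pot \<omega>) z n)) \<le> real n * (integral\<^sup>L M g / m + \<delta> / 3)"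
  proof (rule subadditive_birkhoff[where \<beta> = ?\<beta>])
    show "ln (minors_sum k (tprod (pot ((T ^^ i) \<omega>)) z (n + m))) \<le>
        ln (minors_sum k (tprod (pot ((T ^^ i) \<omega>)) z n)) + ln (minors_sum k (tprod (pot ((T ^^ (i + n)) \<omega>)) z m))" for n m i
      using ln_minors_sum_subadd[OF k, of "(T ^^ i) \<omega>" z n m] by (simp add: funpow_add_apply add.commute)
    show "ln (minors_sum k (tprod (pot ((T ^^ i) \<omega>)) z n)) \<le> (\<Sum>t<n. ?\<beta> ((T ^^ (i + t)) \<omega>))" if "n \<ge> 1" for n i
    proof -
      have "ln (minors_sum k (tprod (pot ((T ^^ i) \<omega>)) z n)) \<le>
          ln (mconst k TYPE('w)) + real k * (\<Sum>t<n. ln (1 + cmod z) + ln (vbound (pot ((T ^^ i) \<omega>)) t))"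
        using abs_ln_minors_sum_tprod_le[OF k order_refl, of "pot ((T ^^ i) \<omega>)" z n] by linarith
      also have "\<dots> \<le> real n * ln (mconst k TYPE('w)) + real k * (\<Sum>t<n. ln (1 + cmod z) + ln (vbound (pot ((T ^^ i) \<omega>)) t))"
        using that mult_right_mono[of 1 "real n", OF _ lnc] by simp
      also have "\<dots> = (\<Sum>t<n. ?\<beta> ((T ^^ (i + t)) \<omega>))"
        unfolding logb_iter pot_shift by (simp add: sum.distrib sum_distrib_left algebra_simps vbound_def)
      finally show ?thesis .
    qed
    show "?\<beta> \<omega> \<ge> 0" for \<omega>
      using logb_nonneg by (intro add_nonneg_nonneg[OF add_nonneg_nonneg[OF lnc]] mult_nonneg_nonneg ln_ge_zero) auto
    show "ln (minors_sum k (tprod (pot ((T ^^ i) \<omega>)) z m)) \<le> g ((T ^^ i) \<omega>)" for i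
      using minors_sum_le_upper_obs[OF k zR wR zw(1), of 0 m "pot ((T ^^ i) \<omega>)"] by (simp add: g_def upper_obs_zero)
    show "birkhoff_le M T ?\<beta> \<omega>" "birkhoff_le M T (\<lambda>\<omega>. - ?\<beta> \<omega>) \<omega>"
      by (rule good_logb[OF good], simp)+
  qed (use m(1) \<delta> bg in auto)
  then show ?thesis
  proof eventually_elim
    case (elim n)
    also have "real n * (integral\<^sup>L M g / m + \<delta> / 3) \<le> real n * (lyap_sum k z + \<delta>)"
      using gi by (intro mult_left_mono) auto
    finally show ?case .
  qed
qed

text \<open>By almost superadditivity \<open>c - ln (ddet ...)\<close> is subadditive, so an upper
  ergodic bound for it is a lower bound for \<open>ddet\<close>. Its mean is estimated through the
  hypothesis that compares \<open>ddet\<close> at \<open>z\<close> with the minors at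
  \<open>t\<close>. In the applications \<open>t\<close> is \<open>z\<close> itself or its real
  part.\<close>

lemma good_lower:
  assumes good: "good \<omega>" and z: "Im z > 0" and C: "C > 0"
    and le: "\<And>(V :: nat \<Rightarrow> real ^ 'w ^ 'w) n. \<forall>i. transpose (V i) = V i \<Longrightarrow> n \<ge> 1 \<Longrightarrow>
      minors_sum CARD('w) (tprod V t n) \<le> C * ddet V z n"
    and \<delta>: "\<delta> > 0"
  shows "\<forall>\<^sub>F n in sequentially. real n * (lyap_sum CARD('w) t - \<delta>) \<le> ln (ddet (pot \<omega>) z n)"
proof -
  let ?W = "real CARD('w)"
  have \<omega>: "\<omega> \<in> space M"
    using good by (simp add: good_def)
  have W: "?W > 0"
    by simp
  \<comment> \<open>The first term gives \<open>Im w \<ge> Im z / 2\<close>, the second makes the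
    Lipschitz error between \<open>z\<close> and \<open>w\<close> at most
    \<open>\<delta> / 4\<close> per site in either direction.\<close>
  define r where "r = min (Im z / 2) (\<delta> * Im z / (8 * ?W))"
  have r: "r > 0"
    using z \<delta> by (simp add: r_def)
  obtain x y :: rat where xy: "cmod (z - Complex (of_rat x) (of_rat y)) < r"
    using rat_complex_dense[OF r] by blast
  define w where "w = Complex (of_rat x) (of_rat y)"
  have zw: "cmod (z - w) \<le> r" "cmod (w - z) \<le> r"
    using xy by (simp_all add: w_def norm_minus_commute)
  have "\<bar>Im z - Im w\<bar> \<le> Im z / 2"
    using abs_Im_le_cmod[of "z - w"] zw(1) unfolding r_def minus_complex.sel by linarith
  then have w: "Im w \<ge> Im z / 2" "Im w > 0"
    using z unfolding abs_le_iff by linarith+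
  have y: "y > 0"
    using w(2) by (simp add: w_def)
  have Wr: "?W * (cmod (z - w) / Im w) \<le> \<delta> / 4" "?W * (cmod (w - z) / Im z) \<le> \<delta> / 4"
  proof -
    have "?W * (cmod (z - w) / Im w) \<le> ?W * ((\<delta> * Im z / (8 * ?W)) / (Im z / 2))"
      using zw(1) w z \<delta> unfolding r_def by (intro mult_left_mono frac_le) auto
    also have "\<dots> = \<delta> / 4"
      using z W by (simp add: field_simps)
    finally show "?W * (cmod (z - w) / Im w) \<le> \<delta> / 4" .
    have "?W * (cmod (w - z) / Im z) \<le> ?W * ((\<delta> * Im z / (8 * ?W)) / Im z)"
      using zw(2) z \<delta> unfolding r_def by (intro mult_left_mono divide_right_mono) auto
    also have "\<dots> \<le> \<delta> / 4"
      using z W \<delta> by (simp add: field_simps)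
    finally show "?W * (cmod (w - z) / Im z) \<le> \<delta> / 4" .
  qed
  \<comment> \<open>The logarithm of the constant in \<open>det_top_left_superadditive\<close> at
    height \<open>Im w\<close>.\<close>
  define c where "c = ln (fact CARD('w) * (1 + 1 / (Im w)\<^sup>2) ^ CARD('w))"
  have c1: "fact CARD('w) * (1 + 1 / (Im w)\<^sup>2) ^ CARD('w) \<ge> (1 :: real)"
    using mult_mono[of 1 "fact CARD('w) :: real" 1 "(1 + 1 / (Im w)\<^sup>2) ^ CARD('w)"] by (simp add: one_le_power)
  have c: "c \<ge> 0"
    unfolding c_def using c1 by (rule ln_ge_zero)
  \<comment> \<open>A block length for which the constants incurred once per block amount to at most
    \<open>\<delta> / 8\<close> per site.\<close>
  obtain m0 :: nat where m0: "real m0 > (c + \<bar>ln C\<bar>) / (\<delta> / 8)"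
    using reals_Archimedean2 by blast
  define m where "m = Suc m0"
  have m: "m \<ge> 1" "(c + \<bar>ln C\<bar>) / m \<le> \<delta> / 8"
    using m0 \<delta> by (auto simp: m_def field_simps)
  note pos = ddet_ge(2)[of "pot _", OF pot_sym w(2)]
  define g where "g \<omega> = c + 1 * lower_obs m w (pot \<omega>)" for \<omega>
  have lowO: "(\<lambda>\<omega>. lower_obs m w (pot \<omega>)) \<in> observables"
    unfolding observables_def w_def using y by (intro UnI2 image_eqI[where x = "(m, x, y)"]) auto
  have int_low: "integrable M (\<lambda>\<omega>. lower_obs m w (pot \<omega>))"
    using observable_lower_obs[OF w(2)] by (simp add: observable_def)
  have bg: "birkhoff_le M T g \<omega>"
    unfolding g_def[abs_def] using good lowO by (intro birkhoff_le_affine prob_space_axioms int_low) (auto simp: good_def)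
  \<comment> \<open>\<open>ddet\<close> is bounded below independently of the length, so a constant
    majorant suffices here.\<close>
  define \<beta> where "\<beta> = c + \<bar>ln (ddet_min TYPE('w) (Im w))\<bar>"
  have b0: "birkhoff_le M T (\<lambda>\<omega>. \<beta>) \<omega>" "birkhoff_le M T (\<lambda>\<omega>. - \<beta>) \<omega>"
    using good_logb[OF good, of 0 \<beta>] by simp_all
  have ev: "\<forall>\<^sub>F n in sequentially. (\<lambda>n \<omega>. c - ln (ddet (pot \<omega>) w n)) n \<omega> \<le> real n * (integral\<^sup>L M g / m + \<delta> / 8)"
  proof (rule subadditive_birkhoff[where \<beta> = "\<lambda>_. \<beta>"])
    fix n k i :: nat assume n: "n \<ge> 1" "k \<ge> 1"
    let ?o = "(T ^^ i) \<omega>"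
    have o: "?o \<in> space M"
      by (rule T_iter_space[OF \<omega>])
    have e: "(T ^^ (i + n)) \<omega> = (T ^^ n) ?o"
      by (simp add: funpow_add_apply add.commute)
    have o': "(T ^^ n) ?o \<in> space M"
      by (rule T_iter_space[OF o])
    have "ddet (pot ?o) w n * ddet (pot ((T ^^ n) ?o)) w k \<le>
        fact CARD('w) * (1 + 1 / (Im w)\<^sup>2) ^ CARD('w) * ddet (pot ?o) w (n + k)"
      unfolding ddet_def pot_shift[of n] by (rule det_top_left_superadditive) (use w n pot_sym[OF o] in auto)
    then have "ln (ddet (pot ?o) w n * ddet (pot ((T ^^ n) ?o)) w k) \<le>
        ln (fact CARD('w) * (1 + 1 / (Im w)\<^sup>2) ^ CARD('w) * ddet (pot ?o) w (n + k))"
      using pos[OF o n(1)] pos[OF o' n(2)] by (intro ln_mono) auto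
    moreover have "ln (ddet (pot ?o) w n * ddet (pot ((T ^^ n) ?o)) w k) = ln (ddet (pot ?o) w n) + ln (ddet (pot ((T ^^ n) ?o)) w k)"
      by (intro ln_mult_pos pos o o' n)
    moreover have "ln (fact CARD('w) * (1 + 1 / (Im w)\<^sup>2) ^ CARD('w) * ddet (pot ?o) w (n + k)) = c + ln (ddet (pot ?o) w (n + k))"
      unfolding c_def using c1 n by (intro ln_mult_pos pos o) auto
    ultimately show "c - ln (ddet (pot ((T ^^ i) \<omega>)) w (n + k)) \<le>
        (c - ln (ddet (pot ((T ^^ i) \<omega>)) w n)) + (c - ln (ddet (pot ((T ^^ (i + n)) \<omega>)) w k))"
      unfolding e by linarith
  next
    fix n i :: nat assume n: "n \<ge> 1"
    let ?o = "(T ^^ i) \<omega>"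
    have o: "?o \<in> space M"
      by (rule T_iter_space[OF \<omega>])
    have "ln (ddet_min TYPE('w) (Im w)) \<le> ln (ddet (pot ?o) w n)"
      using ddet_ge(1)[of "pot ?o", OF pot_sym[OF o] w(2) n] ddet_min_pos[OF w(2), where 'w = 'w] by (intro ln_mono) auto
    then have "c - ln (ddet (pot ?o) w n) \<le> 1 * \<beta>"
      using abs_ge_minus_self[of "ln (ddet_min TYPE('w) (Im w))"] unfolding \<beta>_def mult_1 by linarith
    also have "\<dots> \<le> real n * \<beta>"
      using n c by (intro mult_right_mono) (auto simp: \<beta>_def)
    finally show "c - ln (ddet (pot ((T ^^ i) \<omega>)) w n) \<le> (\<Sum>t<n. \<beta>)"
      by simp
  next
    show "c - ln (ddet (pot ((T ^^ i) \<omega>)) w m) \<le> g ((T ^^ i) \<omega>)" for i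
      using lower_obs_eq[OF T_iter_space[OF \<omega>] w(2) m(1), of i] by (simp add: g_def)
  qed (use b0 bg m(1) \<delta> c in \<open>auto simp: \<beta>_def\<close>)
  have gi: "integral\<^sup>L M g \<le> c + (\<bar>ln C\<bar> + real m * (\<delta> / 4)) - exp_minors CARD('w) t m"
  proof -
    have "integral\<^sup>L M g = (\<integral>\<omega>. c + lower_obs m w (pot \<omega>) \<partial>M)"
      by (simp add: g_def[abs_def])
    also have "\<dots> \<le> (\<integral>\<omega>. (c + (\<bar>ln C\<bar> + real m * (\<delta> / 4))) - ln (minors_sum CARD('w) (tprod (pot \<omega>) t m)) \<partial>M)"
    proof (rule integral_mono)
      show "integrable M (\<lambda>\<omega>. c + lower_obs m w (pot \<omega>))"
        using int_low by simp
      show "integrable M (\<lambda>\<omega>. (c + (\<bar>ln C\<bar> + real m * (\<delta> / 4))) - ln (minors_sum CARD('w) (tprod (pot \<omega>) t m)))"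
        using integrable_minors[of "CARD('w)" t m] by simp
      fix \<omega> assume o: "\<omega> \<in> space M"
      have "ln (minors_sum CARD('w) (tprod (pot \<omega>) t m)) \<le> ln (C * ddet (pot \<omega>) z m)"
        using le[of "pot \<omega>" m] pot_sym[OF o] m(1) minors_sum_tprod_bounds(3)[of "CARD('w)" t "cmod t" "pot \<omega>" m]
        by (intro ln_mono) auto
      also have "\<dots> = ln C + ln (ddet (pot \<omega>) z m)"
        by (intro ln_mult_pos C ddet_ge(2) pot_sym o z m)
      also have "ln (ddet (pot \<omega>) z m) \<le> ln (ddet (pot \<omega>) w m) + real m * (?W * (cmod (z - w) / Im w))"
        by (intro ln_ddet_lipschitz pot_sym o z w m)
      also have "\<dots> \<le> ln (ddet (pot \<omega>) w m) + real m * (\<delta> / 4)"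
        using Wr(1) by (intro add_left_mono mult_left_mono) auto
      finally have "ln (minors_sum CARD('w) (tprod (pot \<omega>) t m)) \<le> ln C + (ln (ddet (pot \<omega>) w m) + real m * (\<delta> / 4))"
        by simp
      then show "c + lower_obs m w (pot \<omega>) \<le> (c + (\<bar>ln C\<bar> + real m * (\<delta> / 4))) - ln (minors_sum CARD('w) (tprod (pot \<omega>) t m))"
        using lower_obs_eq[OF o w(2) m(1)] abs_ge_self[of "ln C"] by linarith
    qed
    also have "\<dots> = c + (\<bar>ln C\<bar> + real m * (\<delta> / 4)) - exp_minors CARD('w) t m"
      using integrable_minors[of "CARD('w)" t m]
      by (subst Bochner_Integration.integral_diff) (auto simp: exp_minors_def prob_space)
    finally show ?thesis .
  qed
  have gim: "integral\<^sup>L M g / m \<le> \<delta> / 8 + \<delta> / 4 - lyap_sum CARD('w) t"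
  proof -
    have "integral\<^sup>L M g / m \<le> (c + (\<bar>ln C\<bar> + real m * (\<delta> / 4)) - exp_minors CARD('w) t m) / m"
      using gi by (intro divide_right_mono) auto
    also have "\<dots> = (c + \<bar>ln C\<bar>) / m + \<delta> / 4 - exp_minors CARD('w) t m / m"
      using m(1) by (simp add: field_simps)
    also have "\<dots> \<le> \<delta> / 8 + \<delta> / 4 - lyap_sum CARD('w) t"
      using m(2) lyap_sum(2)[of "CARD('w)" m t, OF _ m(1)] by linarith
    finally show ?thesis .
  qed
  show ?thesis
    using ev eventually_ge_at_top[of 1]
  proof eventually_elim
    case (elim n)
    have "ln (ddet (pot \<omega>) w n) \<le> ln (ddet (pot \<omega>) z n) + real n * (?W * (cmod (w - z) / Im z))"
      by (intro ln_ddet_lipschitz pot_sym \<omega> z w elim)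
    also have "\<dots> \<le> ln (ddet (pot \<omega>) z n) + real n * (\<delta> / 4)"
      using Wr(2) by (intro add_left_mono mult_left_mono) auto
    finally have 1: "ln (ddet (pot \<omega>) w n) \<le> ln (ddet (pot \<omega>) z n) + real n * (\<delta> / 4)" .
    have "c - ln (ddet (pot \<omega>) w n) \<le> real n * (integral\<^sup>L M g / m + \<delta> / 8)"
      using elim by simp
    also have "\<dots> \<le> real n * (\<delta> / 2 - lyap_sum CARD('w) t)"
      using gim by (intro mult_left_mono) auto
    finally have "- ln (ddet (pot \<omega>) w n) \<le> real n * (\<delta> / 2 - lyap_sum CARD('w) t)"
      using c by linarith
    with 1 have "- ln (ddet (pot \<omega>) z n) \<le> real n * (\<delta> / 2 - lyap_sum CARD('w) t) + real n * (\<delta> / 4)"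
      by linarith
    also have "\<dots> \<le> - (real n * (lyap_sum CARD('w) t - \<delta>))"
      using \<delta> by (simp add: algebra_simps)
    finally show ?case
      by linarith
  qed
qed

end

section \<open>Lagrangian frames\<close>

lemma complexification_subspace:
  assumes "subspace L"
  shows "vec.subspace (complexification L)"
proof (rule vec.subspaceI)
  show "0 \<in> complexification L"
    using subspace_0[OF assms] by (simp add: complexification_def zero_vec_def)
  show "x + y \<in> complexification L" if "x \<in> complexification L" "y \<in> complexification L" for x y
    using subspace_add[OF assms, of "\<chi> i. Re (x $ i)" "\<chi> i. Re (y $ i)"]
      subspace_add[OF assms, of "\<chi> i. Im (x $ i)" "\<chi> i. Im (y $ i)"] that
    by (simp add: complexification_def plus_vec_def)
  show "c *s x \<in> complexification L" if "x \<in> complexification L" for c x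
  proof -
    have L: "(\<chi> i. Re (x $ i)) \<in> L" "(\<chi> i. Im (x $ i)) \<in> L"
      using that by (simp_all add: complexification_def)
    have "(\<chi> i. Re ((c *s x) $ i)) = Re c *\<^sub>R (\<chi> i. Re (x $ i)) - Im c *\<^sub>R (\<chi> i. Im (x $ i))"
      "(\<chi> i. Im ((c *s x) $ i)) = Re c *\<^sub>R (\<chi> i. Im (x $ i)) + Im c *\<^sub>R (\<chi> i. Re (x $ i))"
      by (simp_all add: vec_eq_iff)
    then show ?thesis
      unfolding complexification_def mem_Collect_eq
      by (simp only: subspace_add[OF assms] subspace_diff[OF assms] subspace_scale[OF assms] L)
  qed
qed

definition complex_matrix :: "real ^ 'n ^ 'm \<Rightarrow> complex ^ 'n ^ 'm" where
  "complex_matrix B = (\<chi> i j. of_real (B $ i $ j))"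

lemma complex_matrix_vector:
  "(\<chi> i. Re ((complex_matrix B *v c) $ i)) = B *v (\<chi> j. Re (c $ j))"
  "(\<chi> i. Im ((complex_matrix B *v c) $ i)) = B *v (\<chi> j. Im (c $ j))"
  by (simp_all add: vec_eq_iff complex_matrix_def matrix_vector_mult_def)

text \<open>Hence the Wronskian vanishes on the whole complexification of a real subspace that is
  isotropic for \<open>symplectic_J\<close>; this is how the Lagrangian condition enters the
  estimates.\<close>

lemma wronskian_symplectic:
  fixes x :: "complex ^ ('w::finite + 'w)"
  shows "wronskian x = (\<chi> i. Re (x $ i)) \<bullet> (symplectic_J *v (\<chi> i. Im (x $ i)))"
proof -
  have J: "symplectic_J *v v = pair_vec (- bot_part v) (top_part v)" for v :: "real ^ ('w + 'w)"
    by (simp add: vec_eq_iff symplectic_J_def pair_vec_def top_part_def bot_part_def matrix_vector_mult_def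
        block_matrix_def sum_UNIV_Plus mat_def if_distrib[of "\<lambda>x. x * _"] sum_negf split: sum.split cong: if_cong)
  show ?thesis
    unfolding J inner_vec_def
    by (simp add: wronskian_def cinner_def sum_UNIV_Plus top_part_def bot_part_def pair_vec_def
        sum.distrib[symmetric] sum_subtractf[symmetric] sum_negf[symmetric] algebra_simps)
qed

text \<open>A real orthonormal basis of \<open>L\<close>, enumerated by the index type and read as a
  complex matrix. That its entries are real is recorded for the conjugation symmetry between the two
  half-planes.\<close>

lemma lagrangian_frame:
  fixes L :: "(real ^ ('w::finite + 'w)) set"
  assumes "lagrangian L"
  obtains B :: "complex ^ 'w ^ ('w + 'w)" where
    "\<And>j. column j B \<in> complexification L" "\<And>j. norm (column j B) = 1"
    "\<And>c. norm (B *v c) = norm c" "\<And>c. wronskian (B *v c) = 0"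
    "vec.dim (complexification L) = CARD('w)" "\<And>i j. B $ i $ j \<in> \<real>"
proof -
  have L: "subspace L" "dim L = CARD('w)" and orth: "L = orthogonal_comp ((\<lambda>x. symplectic_J *v x) ` L)"
    using assms by (simp_all add: lagrangian_def)
  have iso: "x \<bullet> (symplectic_J *v y) = 0" if "x \<in> L" "y \<in> L" for x y
    using that orth by (auto simp: orthogonal_comp_def orthogonal_def inner_commute)
  obtain S where S: "S \<subseteq> L" "pairwise orthogonal S" "\<And>x. x \<in> S \<Longrightarrow> norm x = 1" "independent S"
    "card S = dim L" "span S = L"
    using orthonormal_basis_subspace[OF L(1)] by metis
  have "finite S"
    using S(4) by (rule independent_imp_finite)
  then obtain f where f: "bij_betw f (UNIV :: 'w set) S"
    using S(5) L(2) finite_same_card_bij[of "UNIV :: 'w set" S] by auto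
  define R :: "real ^ 'w ^ ('w + 'w)" where "R = (\<chi> i j. f j $ i)"
  define B where "B = complex_matrix R"
  have colR: "column j R = f j" for j
    by (simp add: R_def column_def vec_eq_iff)
  have fS: "f j \<in> S" for j
    using f by (auto simp: bij_betw_def)
  have ff: "f i \<bullet> f j = of_bool (i = j)" for i j
  proof (cases "i = j")
    case True
    then show ?thesis
      using S(3)[OF fS[of j]] by (simp add: dot_square_norm)
  next
    case False
    then have "f i \<noteq> f j"
      using f by (auto simp: bij_betw_def inj_on_def)
    then show ?thesis
      using S(2) fS False by (auto simp: pairwise_def orthogonal_def)
  qed
  have RL: "R *v u \<in> L" for u
  proof -
    have "R *v u = (\<Sum>j\<in>UNIV. u $ j *\<^sub>R f j)"
      by (simp add: vec_eq_iff R_def matrix_vector_mult_def mult.commute)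
    then show ?thesis
      using S(1) fS L(1) by (auto intro!: subspace_sum subspace_scale)
  qed
  have LR: "\<exists>u. x = R *v u" if "x \<in> L" for x
  proof -
    have "x \<in> span S"
      using that S(6) by simp
    then obtain g where "x = (\<Sum>v\<in>S. g v *\<^sub>R v)"
      using span_finite[OF \<open>finite S\<close>] by auto
    also have "\<dots> = (\<Sum>j\<in>UNIV. g (f j) *\<^sub>R f j)"
      by (rule sum.reindex_bij_betw[OF f, symmetric])
    also have "\<dots> = R *v (\<chi> j. g (f j))"
      by (simp add: vec_eq_iff R_def matrix_vector_mult_def mult.commute)
    finally show ?thesis
      by blast
  qed
  have colB: "column j B = (\<chi> i. of_real (f j $ i))" for j
    by (simp add: B_def complex_matrix_def column_def vec_eq_iff R_def)
  have BL: "B *v c \<in> complexification L" for c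
    unfolding complexification_def B_def by (simp add: complex_matrix_vector RL)
  have on: "cinner (column i B) (column j B) = of_bool (i = j)" for i j
    unfolding colB cinner_def using ff[of i j] by (simp add: inner_vec_def flip: of_real_mult of_real_sum)
  have BB: "conj_transpose B ** B = mat 1"
    by (auto simp: vec_eq_iff conj_transpose_mult_entry on mat_def)
  show thesis
  proof (rule that)
    show "column j B \<in> complexification L" for j
      using BL[of "axis j 1"] by (simp add: matrix_vector_mult_axis)
    have "(norm (column j B))\<^sup>2 = 1" for j
      using on[of j j] unfolding cinner_self by (simp flip: of_real_power)
    then show "norm (column j B) = 1" for j
      using power2_eq_imp_eq[of "norm (column j B)" 1] by simp
    have "cinner (B *v c) (B *v c) = cinner c c" for c
      by (simp add: cinner_mult_right matrix_vector_mul_assoc BB)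
    then have "(norm (B *v c))\<^sup>2 = (norm c)\<^sup>2" for c
      unfolding cinner_self of_real_eq_iff .
    then show "norm (B *v c) = norm c" for c
      by (simp add: power2_eq_iff_nonneg)
    show "wronskian (B *v c) = 0" for c
      unfolding wronskian_symplectic B_def complex_matrix_vector by (intro iso RL)
    show "B $ i $ j \<in> \<real>" for i j
      by (simp add: B_def complex_matrix_def)
    obtain e where e: "bij_betw e {..<CARD('w)} (UNIV :: 'w set)"
      using finite_same_card_bij[of "{..<CARD('w)}" "UNIV :: 'w set"] by auto
    have "orthonormal_on {..<CARD('w)} (\<lambda>i. column (e i) B)"
      unfolding orthonormal_on_def on using e by (auto simp: bij_betw_def inj_on_def)
    moreover have "complexification L = vec.span ((\<lambda>i. column (e i) B) ` {..<CARD('w)})"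
    proof (intro equalityI subsetI)
      fix x assume "x \<in> complexification L"
      then obtain u v where uv: "(\<chi> i. Re (x $ i)) = R *v u" "(\<chi> i. Im (x $ i)) = R *v v"
        using LR unfolding complexification_def by blast
      have "x = B *v (\<chi> j. Complex (u $ j) (v $ j))"
      proof -
        have "Re (x $ i) = Re ((B *v (\<chi> j. Complex (u $ j) (v $ j))) $ i)"
          "Im (x $ i) = Im ((B *v (\<chi> j. Complex (u $ j) (v $ j))) $ i)" for i
          using arg_cong[OF uv(1), of "\<lambda>v. v $ i"] arg_cong[OF uv(2), of "\<lambda>v. v $ i"]
          by (simp_all add: B_def complex_matrix_def matrix_vector_mult_def)
        then show ?thesis
          by (simp add: vec_eq_iff complex_eq_iff)
      qed
      also have "\<dots> = (\<Sum>j\<in>UNIV. Complex (u $ j) (v $ j) *s column j B)"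
        by (simp add: vec_eq_iff matrix_vector_mult_def column_def mult.commute)
      also have "\<dots> \<in> vec.span ((\<lambda>i. column (e i) B) ` {..<CARD('w)})"
      proof (intro vec.span_sum vec.span_scale vec.span_base)
        fix j
        show "column j B \<in> (\<lambda>i. column (e i) B) ` {..<CARD('w)}"
          using e unfolding bij_betw_def image_image[symmetric, of "\<lambda>j. column j B" e] by simp
      qed
      finally show "x \<in> vec.span ((\<lambda>i. column (e i) B) ` {..<CARD('w)})" .
    next
      fix x assume "x \<in> vec.span ((\<lambda>i. column (e i) B) ` {..<CARD('w)})"
      moreover have "(\<lambda>i. column (e i) B) ` {..<CARD('w)} \<subseteq> complexification L"
        using BL by (auto simp: matrix_vector_mult_axis[symmetric])
      ultimately show "x \<in> complexification L"
        using vec.span_minimal[OF _ complexification_subspace[OF L(1)]] by blast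
    qed
    ultimately show "vec.dim (complexification L) = CARD('w)"
      using dim_span_orthonormal by fastforce
  qed
qed

text \<open>Up to a constant the determinant is at most the product of all \<open>CARD('w)\<close>
  singular values of the restriction. All but the smallest are absorbed by the minors of order
  \<open>CARD('w) - 1\<close> of the unrestricted \<open>A\<close>.\<close>

lemma ln_sv_on_ge:
  fixes U :: "(complex ^ ('w::finite + 'w)) set" and B :: "complex ^ 'w ^ ('w + 'w)"
  assumes U: "vec.subspace U" "vec.dim U = CARD('w)" and B: "\<And>j. column j B \<in> U" "\<And>j. norm (column j B) = 1"
  shows "\<exists>c. \<forall>A :: complex ^ ('w + 'w) ^ ('w + 'w). (\<forall>x. A *v x = 0 \<longrightarrow> x = 0) \<longrightarrow>
    det (\<chi> i j. (A ** B) $ Inl i $ j) \<noteq> 0 \<longrightarrow>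
    ln (cmod (det (\<chi> i j. (A ** B) $ Inl i $ j))) - ln (minors_sum (CARD('w) - 1) A) - c \<le> ln (sv_on U CARD('w) A)"
proof -
  let ?W = "CARD('w)"
  let ?m = "CARD('w) + CARD('w)"
  define c1 where "c1 = minors_const ?W ?m ?W * minors_const ?W ?W ?W * minors_const ?W ?W ?W"
  define c2 where "c2 = minors_const (?W - 1) ?W ?m * minors_const (?W - 1) ?m ?W"
  have c: "c1 > 0" "c2 > 0"
    unfolding c1_def c2_def by (intro mult_pos_pos minors_const_pos; simp)+
  have "ln (cmod (det (\<chi> i j. (A ** B) $ Inl i $ j))) - ln (minors_sum (?W - 1) A) - ln (c1 * c2) \<le> ln (sv_on U ?W A)"
    if inj: "\<forall>x. A *v x = 0 \<longrightarrow> x = 0" and nz: "det (\<chi> i j. (A ** B) $ Inl i $ j) \<noteq> 0" for A :: "complex ^ ('w + 'w) ^ ('w + 'w)"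
  proof -
    let ?Q = "cmod (det (\<chi> i j. (A ** B) $ Inl i $ j))" and ?N = "minors_sum (?W - 1) A" and ?s = "sv_on U ?W A"
    let ?P = "\<lambda>k. \<Prod>i<k. sv_on U (Suc i) A"
    obtain V Y and e :: "nat \<Rightarrow> 'w" and s where "singular_frame U A V Y e s"
      using singular_frame_exists[OF U, of A] inj by blast
    then interpret singular_frame U A V Y e s .
    have s: "?s > 0"
      by (rule sv_on_pos) (simp_all add: Suc_leI)
    have P: "?P ?W = ?P (?W - 1) * ?s"
      using prod.lessThan_Suc[of "\<lambda>i. sv_on U (Suc i) A" "?W - 1"] by (simp del: prod.lessThan_Suc)
    have Ppos: "?P (?W - 1) > 0"
      by (intro prod_pos sv_on_pos) auto
    have PN: "?P (?W - 1) \<le> c2 * ?N"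
      using prod_sv_le_minors_sum[of "?W - 1"] by (simp add: c2_def mult_ac)
    then have N: "?N > 0"
      using less_le_trans[OF Ppos PN] c(2) by (simp add: zero_less_mult_iff)
    have "?Q \<le> minors_sum ?W (A ** B)"
      using det_submatrix_le_minors_sum[of "A ** B" Inl "\<lambda>j. j"] by simp
    also have "\<dots> \<le> c1 * ?P ?W"
      using minors_sum_le_prod_sv[of ?W B] B by (simp add: c1_def mult_ac)
    also have "\<dots> \<le> c1 * (c2 * ?N * ?s)"
      unfolding P using c s PN by (intro mult_left_mono mult_right_mono) auto
    also have "\<dots> = (c1 * c2) * (?N * ?s)"
      by simp
    finally have "ln ?Q \<le> ln ((c1 * c2) * (?N * ?s))"
      using nz by (intro ln_mono) auto
    also have "\<dots> = ln (c1 * c2) + ln (?N * ?s)"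
      using c N s by (intro ln_mult_pos) auto
    also have "ln (?N * ?s) = ln ?N + ln ?s"
      using N s by (intro ln_mult_pos) auto
    finally show ?thesis
      by linarith
  qed
  then show ?thesis
    by blast
qed

text \<open>Up to constants both logarithms of minors are sums of logarithms of leading singular
  values, and their difference telescopes to the \<open>j\<close>-th.\<close>

lemma abs_ln_sv_minors_le:
  assumes j: "1 \<le> j" "j \<le> CARD('n)"
  shows "\<exists>c. \<forall>A :: complex ^ 'n::finite ^ 'n. (\<forall>x. A *v x = 0 \<longrightarrow> x = 0) \<longrightarrow>
    \<bar>ln (sv j A) - (ln (minors_sum j A) - ln (minors_sum (j - 1) A))\<bar> \<le> c"
proof -
  let ?n = "CARD('n)"
  define c1 where "c1 k = minors_const k ?n ?n * minors_const k ?n ?n" for k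
  define c2 where "c2 k = minors_const k ?n ?n * minors_const k ?n ?n * minors_const k ?n ?n" for k
  have c: "c1 k > 0" "c2 k > 0" for k
    unfolding c1_def c2_def by (intro mult_pos_pos minors_const_pos; simp)+
  have "\<bar>ln (sv j A) - (ln (minors_sum j A) - ln (minors_sum (j - 1) A))\<bar> \<le>
      (\<bar>ln (c1 j)\<bar> + \<bar>ln (c2 j)\<bar>) + (\<bar>ln (c1 (j - 1))\<bar> + \<bar>ln (c2 (j - 1))\<bar>)"
    if inj: "\<forall>x. A *v x = 0 \<longrightarrow> x = 0" for A :: "complex ^ 'n ^ 'n"
  proof -
    let ?P = "\<lambda>k. \<Prod>i<k. sv (Suc i) A"
    obtain V Y and e :: "nat \<Rightarrow> 'n" and s where "singular_frame UNIV A V Y e s"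
      using singular_frame_exists[of UNIV A, where 'd = 'n] inj by (auto simp: card_cart_basis)
    then interpret singular_frame UNIV A V Y e s .
    have Ppos: "?P k > 0" if "k \<le> ?n" for k
      using that by (intro prod_pos sv_on_pos) auto
    have 1: "\<bar>ln (?P k) - ln (minors_sum k A)\<bar> \<le> \<bar>ln (c1 k)\<bar> + \<bar>ln (c2 k)\<bar>" if k: "k \<le> ?n" for k
    proof -
      have PN: "?P k \<le> c1 k * minors_sum k A"
        using prod_sv_le_minors_sum[OF k] by (simp add: c1_def)
      then have N: "minors_sum k A > 0"
        using less_le_trans[OF Ppos[OF k] PN] c(1)[of k] by (simp add: zero_less_mult_iff)
      have "norm (column i (mat 1 :: complex ^ 'n ^ 'n)) \<le> 1" for i
      proof -
        have "norm (column i (mat 1 :: complex ^ 'n ^ 'n)) \<le> (\<Sum>k\<in>UNIV. cmod (column i (mat 1 :: complex ^ 'n ^ 'n) $ k))"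
          unfolding norm_vec_def by (rule L2_set_le_sum) auto
        then show ?thesis
          by (simp add: column_def mat_def if_distrib cong: if_cong)
      qed
      then have NP: "minors_sum k A \<le> c2 k * ?P k"
        using minors_sum_le_prod_sv[OF k, of "mat 1"] by (simp add: c2_def)
      have "ln (?P k) \<le> ln (c1 k * minors_sum k A)"
        using PN Ppos[OF k] by (intro ln_mono) auto
      moreover have "ln (c1 k * minors_sum k A) = ln (c1 k) + ln (minors_sum k A)"
        using c N by (intro ln_mult_pos) auto
      moreover have "ln (minors_sum k A) \<le> ln (c2 k * ?P k)"
        using NP N by (intro ln_mono) auto
      moreover have "ln (c2 k * ?P k) = ln (c2 k) + ln (?P k)"
        using c Ppos[OF k] by (intro ln_mult_pos) auto
      ultimately show ?thesis
        by linarith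
    qed
    have "?P j = ?P (j - 1) * sv j A"
      using prod.lessThan_Suc[of "\<lambda>i. sv (Suc i) A" "j - 1"] j(1) by (simp del: prod.lessThan_Suc)
    moreover have "ln (?P (j - 1) * sv j A) = ln (?P (j - 1)) + ln (sv j A)"
      using j by (intro ln_mult_pos Ppos sv_on_pos) auto
    ultimately have "ln (?P j) = ln (?P (j - 1)) + ln (sv j A)"
      by (simp only:)
    then show ?thesis
      using 1[of j] 1[of "j - 1"] j(2) by linarith
  qed
  then show ?thesis
    by blast
qed

section \<open>Conjugation symmetry and Lyapunov exponents\<close>

lemma minors_sum_cnj: "minors_sum k (\<chi> i j. cnj (A $ i $ j)) = minors_sum k A"
proof -
  have "minor k (\<chi> i j. cnj (A $ i $ j)) f g = cnj (minor k A f g)" for f g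
    by (simp add: minor_def)
  then show ?thesis
    by (simp add: minors_sum_def)
qed

lemma tprod_cnj: "tprod V (cnj z) n = (\<chi> i j. cnj (tprod V z n $ i $ j))"
proof (induction n)
  case 0
  then show ?case
    by (simp add: vec_eq_iff mat_def)
next
  case (Suc n)
  have "tmat (V n) (cnj z) = (\<chi> i j. cnj (tmat (V n) z $ i $ j))"
    by (simp add: vec_eq_iff tmat_def block_matrix_def mat_def split: sum.split)
  then show ?case
    by (simp add: Suc) (simp add: vec_eq_iff matrix_matrix_mult_def)
qed

lemma tprod_injective: "tprod V z n *v x = 0 \<Longrightarrow> x = 0"
  using tprod_inverse[OF order_refl, of V z n]
  by (metis matrix_vector_mul_assoc matrix_vector_mul_lid matrix_vector_mult_0_right)

context schrodinger_cocycle
begin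

text \<open>The bounded discrepancy between singular values and minors disappears after division by
  \<open>n\<close>. For \<open>j = 1\<close> the subtracted term is 0, since the only 0-minor is
  1.\<close>

lemma lyapunov_exponent_eq:
  assumes j: "1 \<le> j" "j \<le> CARD('w) + CARD('w)"
  shows "lyapunov_exponent M T F j z = lyap_sum j z - lyap_sum (j - 1) z"
proof -
  have j': "j \<le> CARD('w + 'w)"
    using j by simp
  obtain c where c: "\<And>A :: complex ^ ('w + 'w) ^ ('w + 'w). (\<forall>x. A *v x = 0 \<longrightarrow> x = 0) \<Longrightarrow>
      \<bar>ln (sv j A) - (ln (minors_sum j A) - ln (minors_sum (j - 1) A))\<bar> \<le> c"
    using abs_ln_sv_minors_le[OF j(1) j'] by blast
  define s where "s n \<omega> = ln (sv j (tprod (pot \<omega>) z n))" for n \<omega>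
  define N where "N k n \<omega> = ln (minors_sum k (tprod (pot \<omega>) z n))" for k n \<omega>
  have N: "integrable M (N j n)" "integrable M (N (j - 1) n)" for n
    unfolding N_def[abs_def] using j by (auto intro!: integrable_minors)
  have bd: "\<bar>s n \<omega> - (N j n \<omega> - N (j - 1) n \<omega>)\<bar> \<le> c" for n \<omega>
    unfolding s_def N_def by (intro c allI impI) (rule tprod_injective)
  have s_meas: "s n \<in> borel_measurable M" for n
  proof -
    have 1: "continuous_on UNIV (\<lambda>V :: nat \<Rightarrow> real ^ 'w ^ 'w. \<chi> i k. tprod V z n $ i $ k)"
      by (intro continuous_on_vec_lambda continuous_on_tprod_entry')
    have "continuous_on UNIV (sv j :: complex ^ ('w + 'w) ^ ('w + 'w) \<Rightarrow> real)"
      using j by (intro continuous_on_sv_on) (simp_all add: card_cart_basis)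
    from continuous_on_compose2[OF this 1] have "continuous_on UNIV (\<lambda>V :: nat \<Rightarrow> real ^ 'w ^ 'w. sv j (tprod V z n))"
      by simp
    from continuous_pot_comp_meas[OF this] show ?thesis
      unfolding s_def[abs_def] by measurable
  qed
  have s_int: "integrable M (s n)" for n
  proof (rule Bochner_Integration.integrable_bound)
    show "integrable M (\<lambda>\<omega>. \<bar>c\<bar> + (\<bar>N j n \<omega>\<bar> + \<bar>N (j - 1) n \<omega>\<bar>))"
      using N by (intro Bochner_Integration.integrable_add integrable_abs) auto
    show "AE \<omega> in M. norm (s n \<omega>) \<le> norm (\<bar>c\<bar> + (\<bar>N j n \<omega>\<bar> + \<bar>N (j - 1) n \<omega>\<bar>))"
    proof (rule AE_I2)
      show "norm (s n \<omega>) \<le> norm (\<bar>c\<bar> + (\<bar>N j n \<omega>\<bar> + \<bar>N (j - 1) n \<omega>\<bar>))" for \<omega>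
        using bd[of n \<omega>] unfolding real_norm_def by linarith
    qed
  qed (rule s_meas)
  have le: "\<bar>integral\<^sup>L M (s n) - (exp_minors j z n - exp_minors (j - 1) z n)\<bar> \<le> c" for n
  proof -
    have e: "exp_minors j z n - exp_minors (j - 1) z n = (\<integral>\<omega>. N j n \<omega> - N (j - 1) n \<omega> \<partial>M)"
      unfolding exp_minors_def N_def[symmetric] using N by simp
    have "integral\<^sup>L M (s n) \<le> (\<integral>\<omega>. (N j n \<omega> - N (j - 1) n \<omega>) + c \<partial>M)"
      using bd[of n] by (intro integral_mono Bochner_Integration.integrable_add Bochner_Integration.integrable_diff N s_int)
        (auto simp: abs_le_iff algebra_simps)
    moreover have "(\<integral>\<omega>. (N j n \<omega> - N (j - 1) n \<omega>) - c \<partial>M) \<le> integral\<^sup>L M (s n)"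
      using bd[of n] by (intro integral_mono Bochner_Integration.integrable_diff N s_int)
        (auto simp: abs_le_iff algebra_simps)
    ultimately show ?thesis
      unfolding e using N by (simp add: prob_space abs_le_iff)
  qed
  have lim: "(\<lambda>n. exp_minors j z n / n - exp_minors (j - 1) z n / n) \<longlonglongrightarrow> lyap_sum j z - lyap_sum (j - 1) z"
    using j by (intro tendsto_diff lyap_sum(1)) auto
  have "(\<lambda>n. integral\<^sup>L M (s n) / n - (exp_minors j z n / n - exp_minors (j - 1) z n / n)) \<longlonglongrightarrow> 0"
  proof (rule Lim_null_comparison)
    show "\<forall>\<^sub>F n in sequentially. norm (integral\<^sup>L M (s n) / n - (exp_minors j z n / n - exp_minors (j - 1) z n / n)) \<le> c / n"
    proof (intro always_eventually allI)
      fix n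
      show "norm (integral\<^sup>L M (s n) / n - (exp_minors j z n / n - exp_minors (j - 1) z n / n)) \<le> c / n"
        using divide_right_mono[OF le[of n], of "real n"]
        by (simp add: diff_divide_distrib[symmetric])
    qed
    show "(\<lambda>n. c / real n) \<longlonglongrightarrow> 0"
      by (rule lim_const_over_n)
  qed
  from tendsto_add[OF this lim] have "(\<lambda>n. integral\<^sup>L M (s n) / n) \<longlonglongrightarrow> lyap_sum j z - lyap_sum (j - 1) z"
    by simp
  then show ?thesis
    unfolding lyapunov_exponent_def cocycle_eq by (intro limI) (simp add: s_def[abs_def])
qed

lemma lyap_sum_cnj:
  assumes "k \<le> CARD('w) + CARD('w)"
  shows "lyap_sum k (cnj z) = lyap_sum k z"
proof -
  have "exp_minors k (cnj z) = exp_minors k z"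
    unfolding exp_minors_def by (simp add: tprod_cnj minors_sum_cnj)
  then show ?thesis
    using LIMSEQ_unique[OF lyap_sum(1)[OF assms, of "cnj z"]] lyap_sum(1)[OF assms, of z] by simp
qed

section \<open>The determinant of the restricted cocycle at a good point\<close>

context
  fixes \<omega> :: 'a and B :: "complex ^ 'w ^ ('w + 'w)"
  assumes good: "good \<omega>" and iso: "\<And>c. wronskian (B *v c) = 0" and norm_B: "\<And>c. norm (B *v c) = norm c"
    and real_B: "\<And>i j. B $ i $ j \<in> \<real>"
begin

definition frame_det :: "nat \<Rightarrow> complex \<Rightarrow> complex" where
  "frame_det n z = det (\<chi> i j. (tprod (pot \<omega>) z n ** B) $ Inl i $ j)"

lemma ddet_le_frame_det:
  assumes e: "e > 0"
  obtains C where "C > 0" "\<And>z n. Im z = e \<Longrightarrow> cmod z \<le> r \<Longrightarrow> n \<ge> 2 \<Longrightarrow> ddet (pot \<omega>) z n \<le> C * cmod (frame_det n z)"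
proof -
  \<comment> \<open>\<open>R - 1\<close> bounds the entry sum of \<open>z\<close> minus the first
    potential on the whole disc, so one constant serves all \<open>z\<close> of height
    \<open>e\<close> in it.\<close>
  define R where "R = 1 + real CARD('w) * \<bar>r\<bar> + (\<Sum>i\<in>UNIV. \<Sum>j\<in>UNIV. \<bar>pot \<omega> 0 $ i $ j\<bar>)"
  have R: "R \<ge> 1"
    unfolding R_def by (simp add: sum_nonneg)
  define C where "C = fact CARD('w) * (1 + 2 * R / e + 2 * R\<^sup>2 / e) ^ CARD('w)"
  have "C > 0"
    unfolding C_def using R e by (intro mult_pos_pos zero_less_power add_pos_nonneg) auto
  moreover have "ddet (pot \<omega>) z n \<le> C * cmod (frame_det n z)" if "Im z = e" "cmod z \<le> r" "n \<ge> 2" for z n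
    unfolding ddet_def frame_det_def C_def
  proof (rule det_frame_lower)
    show "transpose (pot \<omega> i) = pot \<omega> i" for i
      using good by (intro pot_sym) (simp add: good_def)
    have "real CARD('w) * cmod z \<le> real CARD('w) * \<bar>r\<bar>"
      using that by (intro mult_left_mono) auto
    then show "entry_sum (mat z - (\<chi> i j. complex_of_real (pot \<omega> 0 $ i $ j)) :: complex ^ 'w ^ 'w) \<le> R - 1"
      using entry_sum_potential[of z "pot \<omega> 0"] unfolding R_def by linarith
  qed (use that e R iso norm_B in auto)
  ultimately show thesis
    by (rule that)
qed

lemma frame_det_nonzero:
  assumes z: "Im z > 0" and n: "n \<ge> 2"
  shows "frame_det n z \<noteq> 0"
proof -
  obtain C where C: "C > 0" "\<And>w n. Im w = Im z \<Longrightarrow> cmod w \<le> cmod z \<Longrightarrow> n \<ge> 2 \<Longrightarrow> ddet (pot \<omega>) w n \<le> C * cmod (frame_det n w)"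
    using ddet_le_frame_det[OF z] by metis
  have "0 < ddet (pot \<omega>) z n"
    using good z n by (intro ddet_ge(2) pot_sym) (auto simp: good_def)
  then show ?thesis
    using C(2)[of z n] n by auto
qed

lemma ln_frame_det_lower_uniform:
  assumes e: "e > 0"
  shows "\<exists>c. \<forall>n\<ge>2. \<forall>z. Im z = e \<longrightarrow> cmod z \<le> r \<longrightarrow> - c \<le> ln (cmod (frame_det n z)) / n"
proof -
  obtain C where C: "C > 0" "\<And>z n. Im z = e \<Longrightarrow> cmod z \<le> r \<Longrightarrow> n \<ge> 2 \<Longrightarrow> ddet (pot \<omega>) z n \<le> C * cmod (frame_det n z)"
    using ddet_le_frame_det[OF e] by metis
  define q where "q = ddet_min TYPE('w) e / C"
  have q: "q > 0"
    using ddet_min_pos[OF e, where 'w = 'w] C(1) by (simp add: q_def)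
  have "- \<bar>ln q\<bar> \<le> ln (cmod (frame_det n z)) / n" if n: "n \<ge> 2" and z: "Im z = e" "cmod z \<le> r" for n z
  proof -
    have "ddet_min TYPE('w) e \<le> ddet (pot \<omega>) z n"
      using ddet_ge(1)[of "pot \<omega>" z n] good z n e pot_sym by (auto simp: good_def)
    also have "\<dots> \<le> C * cmod (frame_det n z)"
      by (rule C(2)[OF z n])
    finally have "q \<le> cmod (frame_det n z)"
      using C(1) by (simp add: q_def field_simps)
    then have "ln q \<le> ln (cmod (frame_det n z))"
      using q by (intro ln_mono) auto
    then have "- \<bar>ln q\<bar> / n \<le> ln (cmod (frame_det n z)) / n"
      by (intro divide_right_mono) auto
    moreover have "\<bar>ln q\<bar> / n \<le> \<bar>ln q\<bar>"
      using n by (simp add: divide_le_eq mult_le_cancel_left1)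
    ultimately show ?thesis
      by simp
  qed
  then show ?thesis
    by blast
qed

lemma ln_frame_det_lower:
  assumes z: "Im z > 0" and C: "C > 0"
    and le: "\<And>(V :: nat \<Rightarrow> real ^ 'w ^ 'w) n. \<forall>i. transpose (V i) = V i \<Longrightarrow> n \<ge> 1 \<Longrightarrow>
      minors_sum CARD('w) (tprod V t n) \<le> C * ddet V z n"
    and \<delta>: "\<delta> > 0"
  shows "\<forall>\<^sub>F n in sequentially. lyap_sum CARD('w) t - \<delta> \<le> ln (cmod (frame_det n z)) / n"
proof -
  obtain D where D: "D > 0" "\<And>w n. Im w = Im z \<Longrightarrow> cmod w \<le> cmod z \<Longrightarrow> n \<ge> 2 \<Longrightarrow> ddet (pot \<omega>) w n \<le> D * cmod (frame_det n w)"
    using ddet_le_frame_det[OF z] by metis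
  have "\<forall>\<^sub>F n in sequentially. real n * (lyap_sum CARD('w) t - \<delta> / 2) \<le> ln (ddet (pot \<omega>) z n)"
    using \<delta> by (intro good_lower[OF good z C le]) auto
  moreover have "\<forall>\<^sub>F n in sequentially. ln D / real n < \<delta> / 2"
    using \<delta> by (intro order_tendstoD(2)[OF lim_const_over_n]) auto
  ultimately show ?thesis
    using eventually_ge_at_top[of 2]
  proof eventually_elim
    case (elim n)
    have "ddet (pot \<omega>) z n > 0"
      using good z elim by (intro ddet_ge(2) pot_sym) (auto simp: good_def)
    then have "ln (ddet (pot \<omega>) z n) \<le> ln (D * cmod (frame_det n z))"
      using D(2)[of z n] elim by (intro ln_mono) auto
    also have "\<dots> = ln D + ln (cmod (frame_det n z))"
      using frame_det_nonzero[OF z elim(3)] D(1) by (intro ln_mult_pos) auto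
    finally have "(real n * (lyap_sum CARD('w) t - \<delta> / 2)) / n \<le> (ln D + ln (cmod (frame_det n z))) / n"
      using elim by (intro divide_right_mono) auto
    then have "lyap_sum CARD('w) t - \<delta> / 2 \<le> ln D / n + ln (cmod (frame_det n z)) / n"
      using elim(3) by (simp add: add_divide_distrib)
    then show ?case
      using elim(2) by linarith
  qed
qed

text \<open>The upper half-plane is the case \<open>t = z\<close> of the preceding bound.
  Conjugating the parameter conjugates \<open>frame_det\<close>, because potential and frame are
  real, and this covers the lower one.\<close>

lemma ln_frame_det_lower_nonreal:
  assumes z: "Im z \<noteq> 0" and \<delta>: "\<delta> > 0"
  shows "\<forall>\<^sub>F n in sequentially. frame_det n z \<noteq> 0 \<and> lyap_sum CARD('w) z - \<delta> \<le> ln (cmod (frame_det n z)) / n"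
proof -
  have *: "\<forall>\<^sub>F n in sequentially. frame_det n z \<noteq> 0 \<and> lyap_sum CARD('w) z - \<delta> \<le> ln (cmod (frame_det n z)) / n"
    if z: "Im z > 0" for z
  proof -
    obtain C where C: "C > 0" "\<And>(V :: nat \<Rightarrow> real ^ 'w ^ 'w) n. (\<forall>i. transpose (V i) = V i) \<Longrightarrow> n \<ge> 1 \<Longrightarrow>
        minors_sum CARD('w) (tprod V z n) \<le> C * ddet V z n"
      using minors_sum_le_ddet[OF z, where 'w = 'w] by blast
    have "\<forall>\<^sub>F n in sequentially. lyap_sum CARD('w) z - \<delta> \<le> ln (cmod (frame_det n z)) / n"
      by (rule ln_frame_det_lower[OF z C(1) _ \<delta>]) (rule C(2))
    then show ?thesis
      using eventually_ge_at_top[of 2] by eventually_elim (simp add: frame_det_nonzero z)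
  qed
  show ?thesis
  proof (cases "Im z > 0")
    case False
    have "frame_det n (cnj z) = cnj (frame_det n z)" for n
    proof -
      have "(tprod (pot \<omega>) (cnj z) n ** B) $ i $ j = cnj ((tprod (pot \<omega>) z n ** B) $ i $ j)" for i j
        using real_B by (simp add: tprod_cnj matrix_matrix_mult_def Reals_cnj_iff)
      then show ?thesis
        by (simp add: frame_det_def det_def)
    qed
    then show ?thesis
      using *[of "cnj z"] False z by (simp add: lyap_sum_cnj)
  qed (rule *)
qed

lemma frame_det_polynomial:
  "\<exists>p. degree p \<le> n * CARD('w) \<and> (\<forall>z. frame_det n z = poly p z)"
proof -
  have "polynomial_matrix (n + 0) (\<lambda>z. tprod (pot \<omega>) z n ** B)"
    by (intro polynomial_matrix_mult polynomial_matrix_tprod polynomial_matrix_const)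
  then have "polynomial_matrix n (\<lambda>z. tprod (pot \<omega>) z n ** B)"
    by simp
  from polynomial_matrix_det[OF polynomial_matrix_submatrix[OF this, of Inl "\<lambda>j. j"]] show ?thesis
    unfolding frame_det_def .
qed

text \<open>The real points at which the upper growth rate of \<open>frame_det\<close> is strictly
  below \<open>lyap_sum\<close>. Indices with vanishing determinant satisfy the implication, as they
  should for the value \<open>-\<infinity>\<close> in place of the default
  \<open>ln 0 = 0\<close>.\<close>

definition exceptional :: "complex set" where
  "exceptional = {x. Im x = 0 \<and> (\<exists>\<delta>>0. \<forall>\<^sub>F n in sequentially. frame_det n x \<noteq> 0 \<longrightarrow>
    ln (cmod (frame_det n x)) / n \<le> lyap_sum CARD('w) x - \<delta>)}"

lemma log_capacity_exceptional: "log_capacity exceptional = 0"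
proof -
  obtain p where p: "\<And>n. degree (p n) \<le> n * CARD('w)" "\<And>n z. frame_det n z = poly (p n) z"
    using frame_det_polynomial by metis
  show ?thesis
  proof (rule log_capacity_exceptional_set[of p "CARD('w)" 2 _ "lyap_sum CARD('w)"])
    show "p n \<noteq> 0" if "n \<ge> 2" for n
      using frame_det_nonzero[of \<i> n] that by (auto simp: p(2))
    show "\<exists>c. \<forall>n\<ge>2. \<forall>x. Im x = 0 \<longrightarrow> cmod x \<le> R \<longrightarrow> - c \<le> ln (cmod (poly (p n) (x + \<i> * complex_of_real e))) / n"
      if e: "e > 0" for e R
    proof -
      obtain c where c: "\<And>n z. n \<ge> 2 \<Longrightarrow> Im z = e \<Longrightarrow> cmod z \<le> R + e \<Longrightarrow> - c \<le> ln (cmod (frame_det n z)) / n"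
        using ln_frame_det_lower_uniform[OF e, of "R + e"] by blast
      have "cmod (x + \<i> * complex_of_real e) \<le> R + e" if "cmod x \<le> R" for x
        using norm_triangle_ineq[of x "\<i> * complex_of_real e"] that e by (simp add: norm_mult)
      then have "- c \<le> ln (cmod (poly (p n) (x + \<i> * complex_of_real e))) / n" if "n \<ge> 2" "Im x = 0" "cmod x \<le> R" for n x
        unfolding p(2)[symmetric] using that by (intro c) auto
      then show ?thesis
        by blast
    qed
    show "\<forall>\<^sub>F n in sequentially. lyap_sum CARD('w) x - \<delta> \<le> ln (cmod (poly (p n) (x + \<i> * complex_of_real e))) / n"
      if x: "Im x = 0" and e: "e > 0" and \<delta>: "\<delta> > 0" for x e \<delta>
    proof -
      have xe: "x = of_real (Re x)" "x + \<i> * complex_of_real e = Complex (Re x) e"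
        using x by (simp_all add: complex_eq_iff)
      \<comment> \<open>The Cayley comparison brings in the exponent at the real point
        \<open>x\<close> itself, although the determinant is evaluated at height \<open>e\<close>
        above it.\<close>
      obtain C1 where C1: "C1 > 0" "\<And>(V :: nat \<Rightarrow> real ^ 'w ^ 'w) n. (\<forall>i. transpose (V i) = V i) \<Longrightarrow>
          minors_sum CARD('w) (tprod V (of_real (Re x)) n) \<le> C1 * minors_sum CARD('w) (tprod V (Complex (Re x) e) n)"
        using minors_sum_real_le_complex[where 'w = 'w] e by (metis less_imp_le)
      obtain C2 where C2: "C2 > 0" "\<And>(V :: nat \<Rightarrow> real ^ 'w ^ 'w) n. (\<forall>i. transpose (V i) = V i) \<Longrightarrow> n \<ge> 1 \<Longrightarrow>
          minors_sum CARD('w) (tprod V (Complex (Re x) e) n) \<le> C2 * ddet V (Complex (Re x) e) n"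
        using minors_sum_le_ddet[OF e, where 'w = 'w] by (metis complex.sel(2))
      have le: "minors_sum CARD('w) (tprod V x n) \<le> (C1 * C2) * ddet V (Complex (Re x) e) n"
        if V: "\<forall>i. transpose (V i) = V i" "n \<ge> 1" for V :: "nat \<Rightarrow> real ^ 'w ^ 'w" and n
      proof -
        have "minors_sum CARD('w) (tprod V x n) \<le> C1 * minors_sum CARD('w) (tprod V (Complex (Re x) e) n)"
          using C1(2)[OF V(1), of n] unfolding xe(1)[symmetric] .
        also have "\<dots> \<le> C1 * (C2 * ddet V (Complex (Re x) e) n)"
          using C1(1) by (intro mult_left_mono C2(2) V) auto
        finally show ?thesis
          by (simp add: mult.assoc)
      qed
      show ?thesis
        unfolding p(2)[symmetric] xe(2)
        by (rule ln_frame_det_lower[OF _ _ _ \<delta>, where C = "C1 * C2"]) (use C1(1) C2(1) e le in auto)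
    qed
    show "\<exists>C. \<forall>z. cmod z \<le> R \<longrightarrow> \<bar>lyap_sum CARD('w) z\<bar> \<le> C" for R
      by (rule lyap_sum_bounded) simp
    show "lyap_sum CARD('w) \<in> borel_measurable borel"
      by (rule lyap_sum_measurable) simp
  qed (use p in \<open>auto simp: exceptional_def\<close>)
qed

text \<open>The determinant is large for infinitely many \<open>n\<close>, whereas the upper bound
  for the minors of order \<open>CARD('w) - 1\<close> and the smallness of the constant hold for all
  large \<open>n\<close>. On the common indices the three errors \<open>\<delta>\<close> add up to
  \<open>\<epsilon>\<close>.\<close>

lemma limsup_sv_on:
  assumes U: "vec.subspace U" "vec.dim U = CARD('w)" and B: "\<And>j. column j B \<in> U" "\<And>j. norm (column j B) = 1"
    and z: "z \<notin> exceptional"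
  shows "ereal (lyapunov_exponent M T F CARD('w) z) \<le>
    limsup (\<lambda>n. ereal ((1 / real n) * ln (sv_on U CARD('w) (cocycle T F z n \<omega>))))"
proof (rule ereal_le_epsilon2)
  fix \<epsilon> :: real assume \<epsilon>: "\<epsilon> > 0"
  define \<delta> where "\<delta> = \<epsilon> / 3"
  have \<delta>: "\<delta> > 0"
    using \<epsilon> by (simp add: \<delta>_def)
  let ?W = "CARD('w)"
  let ?s = "\<lambda>n. (1 / real n) * ln (sv_on U CARD('w) (cocycle T F z n \<omega>))"
  obtain c where c: "\<And>A :: complex ^ ('w + 'w) ^ ('w + 'w). (\<forall>x. A *v x = 0 \<longrightarrow> x = 0) \<Longrightarrow>
    det (\<chi> i j. (A ** B) $ Inl i $ j) \<noteq> 0 \<Longrightarrow>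
    ln (cmod (det (\<chi> i j. (A ** B) $ Inl i $ j))) - ln (minors_sum (?W - 1) A) - c \<le> ln (sv_on U ?W A)"
    using ln_sv_on_ge[OF U B] by blast
  have fr: "\<exists>\<^sub>F n in sequentially. frame_det n z \<noteq> 0 \<and> lyap_sum ?W z - \<delta> \<le> ln (cmod (frame_det n z)) / n"
  proof (cases "Im z = 0")
    case True
    have "\<not> (\<forall>\<^sub>F n in sequentially. frame_det n z \<noteq> 0 \<longrightarrow> ln (cmod (frame_det n z)) / n \<le> lyap_sum ?W z - \<delta>)"
      using z True \<delta> unfolding exceptional_def by blast
    then have "\<exists>\<^sub>F n in sequentially. \<not> (frame_det n z \<noteq> 0 \<longrightarrow> ln (cmod (frame_det n z)) / n \<le> lyap_sum ?W z - \<delta>)"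
      by (simp add: not_eventually)
    then show ?thesis
      by (rule frequently_elim1) auto
  next
    case False
    then show ?thesis
      by (intro eventually_frequently ln_frame_det_lower_nonreal \<delta>) auto
  qed
  have "\<forall>\<^sub>F n in sequentially. ln (minors_sum (?W - 1) (tprod (pot \<omega>) z n)) \<le> real n * (lyap_sum (?W - 1) z + \<delta>)"
    by (rule good_upper[OF good _ \<delta>]) simp
  moreover have "\<forall>\<^sub>F n in sequentially. c / real n < \<delta>"
    using \<delta> by (intro order_tendstoD(2)[OF lim_const_over_n]) auto
  ultimately have "\<forall>\<^sub>F n in sequentially. frame_det n z \<noteq> 0 \<and> lyap_sum ?W z - \<delta> \<le> ln (cmod (frame_det n z)) / n \<longrightarrow>
      lyapunov_exponent M T F ?W z - \<epsilon> \<le> ?s n"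
    using eventually_ge_at_top[of 1]
  proof (eventually_elim, intro impI)
    fix n assume n: "ln (minors_sum (?W - 1) (tprod (pot \<omega>) z n)) \<le> real n * (lyap_sum (?W - 1) z + \<delta>)"
      "c / real n < \<delta>" "1 \<le> n" "frame_det n z \<noteq> 0 \<and> lyap_sum ?W z - \<delta> \<le> ln (cmod (frame_det n z)) / n"
    let ?A = "tprod (pot \<omega>) z n"
    have "ln (cmod (frame_det n z)) - ln (minors_sum (?W - 1) ?A) - c \<le> ln (sv_on U ?W ?A)"
      unfolding frame_det_def by (rule c) (use n tprod_injective in \<open>auto simp: frame_det_def\<close>)
    then have "(ln (cmod (frame_det n z)) - ln (minors_sum (?W - 1) ?A) - c) / n \<le> ln (sv_on U ?W ?A) / n"
      by (rule divide_right_mono) simp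
    then have "ln (cmod (frame_det n z)) / n - ln (minors_sum (?W - 1) ?A) / n - c / n \<le> ln (sv_on U ?W ?A) / n"
      by (simp add: diff_divide_distrib)
    moreover have "ln (minors_sum (?W - 1) ?A) / n \<le> lyap_sum (?W - 1) z + \<delta>"
      using n by (simp add: divide_le_eq mult.commute)
    moreover have "lyapunov_exponent M T F ?W z = lyap_sum ?W z - lyap_sum (?W - 1) z"
      by (rule lyapunov_exponent_eq) (simp_all add: Suc_leI)
    moreover have "3 * \<delta> = \<epsilon>"
      by (simp add: \<delta>_def)
    ultimately have "lyapunov_exponent M T F ?W z - \<epsilon> \<le> ln (sv_on U ?W ?A) / n"
      using n(2) conjunct2[OF n(4)] by linarith
    then show "lyapunov_exponent M T F ?W z - \<epsilon> \<le> ?s n"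
      by (simp add: cocycle_eq)
  qed
  from frequently_rev_mp[OF fr this]
  have fr': "\<exists>\<^sub>F n in sequentially. ereal (lyapunov_exponent M T F ?W z - \<epsilon>) \<le> ereal (?s n)"
    by simp
  have "ereal (lyapunov_exponent M T F ?W z - \<epsilon>) \<le> limsup (\<lambda>n. ereal (?s n))"
  proof (rule ccontr)
    assume "\<not> ?thesis"
    then have "limsup (\<lambda>n. ereal (?s n)) < ereal (lyapunov_exponent M T F ?W z - \<epsilon>)"
      by simp
    from Limsup_lessD[OF this] show False
      using fr' by (simp add: frequently_def not_le)
  qed
  then show "ereal (lyapunov_exponent M T F ?W z) \<le> limsup (\<lambda>n. ereal (?s n)) + ereal \<epsilon>"
    using add_right_mono[of "ereal (lyapunov_exponent M T F ?W z - \<epsilon>)" _ "ereal \<epsilon>"] by simp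
qed

end

end

theorem theorem6:
  fixes M :: "'a measure"
    and T :: "'a \<Rightarrow> 'a"
    and F :: "'a \<Rightarrow> real ^ 'w ^ 'w"
    and L :: "(real ^ ('w::finite + 'w)) set"
  assumes "prob_space M"
    and "ergodic_map M T"
    and "F \<in> borel_measurable M"
    and "\<And>\<omega>. \<omega> \<in> space M \<Longrightarrow> transpose (F \<omega>) = F \<omega>"
    and "integrable M (\<lambda>\<omega>. log_plus (onorm (\<lambda>x. F \<omega> *v x)))"
    and "lagrangian L"
  shows "almost_star_surely M T F (\<lambda>\<omega>.
    \<exists>E. log_capacity E = 0 \<and>
      (\<forall>z. z \<notin> E \<longrightarrow>
        limsup (\<lambda>n. ereal ((1 / real n) *
            ln (sv_on (complexification L) CARD('w) (cocycle T F z n \<omega>))))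
          \<ge> ereal (lyapunov_exponent M T F CARD('w) z)))"
proof -
  interpret schrodinger_cocycle M T F
    using assms by (intro schrodinger_cocycle.intro schrodinger_cocycle_axioms.intro) auto
  obtain B :: "complex ^ 'w ^ ('w + 'w)" where B: "\<And>j. column j B \<in> complexification L" "\<And>j. norm (column j B) = 1"
    "\<And>c. norm (B *v c) = norm c" "\<And>c. wronskian (B *v c) = 0"
    "vec.dim (complexification L) = CARD('w)" "\<And>i j. B $ i $ j \<in> \<real>"
    using lagrangian_frame[OF assms(6)] by blast
  have U: "vec.subspace (complexification L)"
    using assms(6) by (intro complexification_subspace) (simp add: lagrangian_def)
  show ?thesis
  proof (rule almost_star_surely_mono[OF almost_star_surely_good])
    \<comment> \<open>\<open>good\<close> involves neither \<open>z\<close> nor \<open>L\<close>;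
      only the exceptional set depends on the frame, and it may vary with
      \<open>\<omega>\<close>.\<close>
    fix \<omega> assume good: "good \<omega>"
    show "\<exists>E. log_capacity E = 0 \<and>
      (\<forall>z. z \<notin> E \<longrightarrow>
        limsup (\<lambda>n. ereal ((1 / real n) *
            ln (sv_on (complexification L) CARD('w) (cocycle T F z n \<omega>))))
          \<ge> ereal (lyapunov_exponent M T F CARD('w) z))"
      using log_capacity_exceptional[OF good B(4,3,6)] limsup_sv_on[OF good B(4,3,6) U B(5) B(1,2)]
      by (intro exI[of _ "exceptional \<omega> B"]) blast
  qed
qed

end
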